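(* Let $d\ge 3$. For $n\in\mathbb N$ let $N=n^d$, $V_N=[0,n-1]^d\cap\mathbb Z^d$, $E=[0,1]^d\times(-\infty,+\infty]$, and let $(\psi_\alpha)_{\alpha\in\mathbb Z^d}$ be the discrete Gaussian Free Field with zero boundary conditions outside $V_N$ (its law depends on $N$), i.e. $\psi_\alpha=0$ almost surely for $\alpha\notin V_N$ and $(\psi_\alpha)_{\alpha\in V_N}$ is a centered Gaussian vector with covariance $(g_{V_N}(\alpha,\beta))_{\alpha,\beta\in V_N}$. Let $$b_N=\sqrt{g(0)}\left[\sqrt{2\log N}-\frac{\log\log N+\log(4\pi)}{2\sqrt{2\log N}}\right],\qquad a_N=\frac{g(0)}{b_N},$$ where $g(0)=g(0,0)$ is the value on the diagonal of the Green's function $g$ of the simple random walk on all of $\mathbb Z^d$. Define the point process on $E$ $$\rho_n(\cdot)=\sum_{\alpha\in V_N}\varepsilon_{\left(\frac{\alpha}{n},\,\frac{\psi_\alpha-b_N}{a_N}\right)}(\cdot).$$ Then, as $n\to+\infty$, $\rho_n$ converges in distribution on $\mathcal M_p(E)$ to $\eta$, where $\eta$ is a Poisson random measure on $E$ with intensity measure $\mathrm dt\otimes(e^{-z}\,\mathrm dz)$, with $\mathrm dt\otimes \mathrm dz$ the Lebesgue measure on $E$.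
   Context: Let $(S_m)_{m\ge0}$ under $\mathbb P_\alpha$ be the discrete-time simple (nearest-neighbour, symmetric) random walk on $\mathbb Z^d$ started at $\alpha$. Its Green's function is $g(\alpha,\beta)=\mathbb E_\alpha\left[\sum_{m\ge 0}\mathbf 1_{\{S_m=\beta\}}\right]$, finite for $d\ge3$. For finite $\Lambda\subset\mathbb Z^d$, $g_\Lambda$ is the Green's function of the discrete Laplacian $\Delta f(\alpha)=\frac1{2d}\sum_{\beta\sim\alpha}(f(\beta)-f(\alpha))$ (sum over nearest neighbours) with Dirichlet (zero) boundary conditions outside $\Lambda$; equivalently $g_\Lambda(\alpha,\beta)=\mathbb E_\alpha\left[\sum_{0\le m<\tau_\Lambda}\mathbf 1_{\{S_m=\beta\}}\right]$ with $\tau_\Lambda=\inf\{m\ge0:S_m\notin\Lambda\}$. For $x\in E$, $\varepsilon_x$ denotes the point measure giving mass one to sets containing $x$ and zero to other sets. The interval $(-\infty,+\infty]$ carries its usual topology, in which sets $[z,+\infty]$, $z\in\mathbb R$, are compact; so compact subsets of $E$ are the closed subsets contained in some $[0,1]^d\times[z,+\infty]$. $\mathcal M_p(E)$ is the set of Radon point measures on $E$ (integer-valued measures, finite on compact sets) endowed with the topology of vague convergence (convergence of integrals of nonnegative continuous compactly supported functions on $E$). The intensity measure of $\eta$ gives no mass to $[0,1]^d\times\{+\infty\}$. The quantities $b_N,a_N$ are considered for $n$ large enough that they are well defined and $b_N>0$. *)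

theory Defs
  imports "HOL-Probability.Probability"
begin

section \<open>Simple random walk and Green's functions\<close>

definition unit_steps :: "(int ^ 'd) set" where
  "unit_steps = {axis i s | i s. s = 1 \<or> s = -1}"

definition step_space :: "(nat \<Rightarrow> int ^ 'd) measure" where
  "step_space = (\<Pi>\<^sub>M k\<in>UNIV. measure_pmf (pmf_of_set unit_steps))"

text \<open>
  The law of \<open>walk \<alpha>\<close> on the canonical space \<open>step_space\<close> of i.i.d. uniform
  steps is that of the simple random walk under \<open>\<P>\<^sub>\<alpha>\<close>.
\<close>

definition walk :: "int ^ 'd \<Rightarrow> (nat \<Rightarrow> int ^ 'd) \<Rightarrow> nat \<Rightarrow> int ^ 'd" where
  "walk \<alpha> \<omega> m = \<alpha> + (\<Sum>k<m. \<omega> k)"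

text \<open>
  Expected number of visits; \<open>enn2real\<close> only matters in dimension at most \<open>2\<close>,
  where the walk is recurrent and the expectation infinite.
\<close>

definition green :: "int ^ 'd \<Rightarrow> int ^ 'd \<Rightarrow> real" where
  "green \<alpha> \<beta> = enn2real (\<integral>\<^sup>+ \<omega>. (\<Sum>m. indicator {m. walk \<alpha> \<omega> m = \<beta>} m) \<partial>step_space)"

definition exit_time :: "'a set \<Rightarrow> (nat \<Rightarrow> 'a) \<Rightarrow> enat" where
  "exit_time \<Lambda> s = (INF m\<in>{m. s m \<notin> \<Lambda>}. enat m)"

text \<open>
  Expected number of visits before leaving \<open>\<Lambda>\<close>. For finite \<open>\<Lambda>\<close> this is the inverse of
  \<open>-\<Delta>\<close> with zero boundary values, for the Laplacian
  \<open>\<Delta> f \<alpha> = (1 / (2 * CARD('d))) * (\<Sum>s\<in>unit_steps. f (\<alpha> + s) - f \<alpha>)\<close>.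
\<close>

definition green_on :: "(int ^ 'd) set \<Rightarrow> int ^ 'd \<Rightarrow> int ^ 'd \<Rightarrow> real" where
  "green_on \<Lambda> \<alpha> \<beta> = enn2real (\<integral>\<^sup>+ \<omega>.
     (\<Sum>m. indicator {m. enat m < exit_time \<Lambda> (walk \<alpha> \<omega>) \<and> walk \<alpha> \<omega> m = \<beta>} m) \<partial>step_space)"


section \<open>The discrete Gaussian free field\<close>

text \<open>Constants count as degenerate Gaussian variables.\<close>

definition gaussian_variable :: "'w measure \<Rightarrow> ('w \<Rightarrow> real) \<Rightarrow> bool" where
  "gaussian_variable M X \<longleftrightarrow> X \<in> borel_measurable M \<and>
     ((\<exists>\<mu> \<sigma>. 0 < \<sigma> \<and> distributed M lborel X (normal_density \<mu> \<sigma>)) \<or>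
      (\<exists>c. AE \<omega> in M. X \<omega> = c))"

definition gaussian_vector :: "'w measure \<Rightarrow> 'i set \<Rightarrow> ('i \<Rightarrow> 'w \<Rightarrow> real) \<Rightarrow> bool" where
  "gaussian_vector M A X \<longleftrightarrow> finite A \<and>
     (\<forall>c :: 'i \<Rightarrow> real. gaussian_variable M (\<lambda>\<omega>. \<Sum>\<alpha>\<in>A. c \<alpha> * X \<alpha> \<omega>))"

definition centered_gaussian_vector ::
    "'w measure \<Rightarrow> 'i set \<Rightarrow> ('i \<Rightarrow> 'i \<Rightarrow> real) \<Rightarrow> ('i \<Rightarrow> 'w \<Rightarrow> real) \<Rightarrow> bool" where
  "centered_gaussian_vector M A C X \<longleftrightarrow> gaussian_vector M A X \<and>
     (\<forall>\<alpha>\<in>A. (\<integral>\<omega>. X \<alpha> \<omega> \<partial>M) = 0) \<and>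
     (\<forall>\<alpha>\<in>A. \<forall>\<beta>\<in>A. (\<integral>\<omega>. X \<alpha> \<omega> * X \<beta> \<omega> \<partial>M) = C \<alpha> \<beta>)"

definition gaussian_free_field ::
    "'w measure \<Rightarrow> (int ^ 'd) set \<Rightarrow> (int ^ 'd \<Rightarrow> 'w \<Rightarrow> real) \<Rightarrow> bool" where
  "gaussian_free_field M \<Lambda> \<psi> \<longleftrightarrow> prob_space M \<and>
     (\<forall>\<alpha>. \<psi> \<alpha> \<in> borel_measurable M) \<and>
     (\<forall>\<alpha>. \<alpha> \<notin> \<Lambda> \<longrightarrow> (AE \<omega> in M. \<psi> \<alpha> \<omega> = 0)) \<and>
     centered_gaussian_vector M \<Lambda> (green_on \<Lambda>) \<psi>"


section \<open>Point measures and the vague topology\<close>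

abbreviation borel_on :: "'a::topological_space set \<Rightarrow> 'a measure" where
  "borel_on E \<equiv> restrict_space borel E"

text \<open>
  Here \<open>E\<close> is a Borel set carrying the subspace topology; for locally compact, second
  countable \<open>E\<close> the measures below are the Radon point measures on \<open>E\<close>.
\<close>

definition point_measures :: "'a::topological_space set \<Rightarrow> 'a measure set" where
  "point_measures E = {\<mu>. sets \<mu> = sets (borel_on E) \<and>
     (\<forall>A\<in>sets \<mu>. emeasure \<mu> A = \<infinity> \<or> (\<exists>k::nat. emeasure \<mu> A = of_nat k)) \<and>
     (\<forall>K. compact K \<and> K \<subseteq> E \<longrightarrow> emeasure \<mu> K < \<infinity>)}"

definition test_functions :: "'a::topological_space set \<Rightarrow> ('a \<Rightarrow> real) set" where
  "test_functions E = {f. continuous_on E f \<and> (\<forall>x\<in>E. 0 \<le> f x) \<and>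
     (\<exists>K. compact K \<and> K \<subseteq> E \<and> (\<forall>x\<in>E - K. f x = 0))}"

definition vague_topology :: "'a::topological_space set \<Rightarrow> 'a measure topology" where
  "vague_topology E = topology_generated_by
     {{\<mu> \<in> point_measures E. (\<integral>x. f x \<partial>\<mu>) \<in> U} | f U. f \<in> test_functions E \<and> open U}"

lemma topspace_vague_topology [simp]: "topspace (vague_topology E) = point_measures E"
proof -
  have "(\<lambda>_. 0) \<in> test_functions E"
    by (auto simp: test_functions_def intro!: exI[of _ "{}"])
  then show ?thesis
    unfolding vague_topology_def topology_generated_by_topspace
    by (fastforce intro!: exI[of _ UNIV])
qed

text \<open>Intended for finite index sets only.\<close>

definition sum_of_point_masses :: "'a::topological_space set \<Rightarrow> 'i set \<Rightarrow> ('i \<Rightarrow> 'a) \<Rightarrow> 'a measure" where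
  "sum_of_point_masses E I x =
     measure_of E (sets (borel_on E)) (\<lambda>A. \<Sum>i\<in>I. emeasure (return (borel_on E) (x i)) A)"

lemma sets_sum_of_point_masses [simp, measurable_cong]:
  "sets (sum_of_point_masses E I x) = sets (borel_on E)"
proof -
  have "sets (borel_on E) \<subseteq> Pow E"
    using sets.space_closed[of "borel_on E"] by (simp add: space_restrict_space)
  then have "sets (sum_of_point_masses E I x) = sigma_sets E (sets (borel_on E))"
    by (simp add: sum_of_point_masses_def)
  also have "\<dots> = sets (borel_on E)"
    using sets.sigma_sets_eq[of "borel_on E"] by (simp add: space_restrict_space)
  finally show ?thesis .
qed

lemma emeasure_sum_of_point_masses:
  assumes "A \<in> sets (borel_on E)"
  shows "emeasure (sum_of_point_masses E I x) A = (\<Sum>i\<in>I. indicator A (x i))"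
proof -
  have "emeasure (sum_of_point_masses E I x) A
      = (\<Sum>i\<in>I. emeasure (return (borel_on E) (x i)) A)"
  proof (rule emeasure_measure_of[OF sum_of_point_masses_def])
    show "sets (borel_on E) \<subseteq> Pow E"
      using sets.space_closed[of "borel_on E"] by (simp add: space_restrict_space)
    show "A \<in> sets (sum_of_point_masses E I x)" using assms by simp
    show "positive (sets (sum_of_point_masses E I x))
        (\<lambda>A. \<Sum>i\<in>I. emeasure (return (borel_on E) (x i)) A)"
      by (simp add: positive_def)
    show "countably_additive (sets (sum_of_point_masses E I x))
        (\<lambda>A. \<Sum>i\<in>I. emeasure (return (borel_on E) (x i)) A)"
    proof (rule countably_additiveI)
      fix F :: "nat \<Rightarrow> 'a set"
      assume F: "range F \<subseteq> sets (sum_of_point_masses E I x)" "disjoint_family F"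
      have "(\<Sum>k. \<Sum>i\<in>I. emeasure (return (borel_on E) (x i)) (F k))
          = (\<Sum>i\<in>I. \<Sum>k. emeasure (return (borel_on E) (x i)) (F k))"
        by (rule suminf_sum) simp
      also have "\<dots> = (\<Sum>i\<in>I. emeasure (return (borel_on E) (x i)) (\<Union>k. F k))"
        using F by (intro sum.cong refl suminf_emeasure) auto
      finally show "(\<Sum>k. \<Sum>i\<in>I. emeasure (return (borel_on E) (x i)) (F k))
          = (\<Sum>i\<in>I. emeasure (return (borel_on E) (x i)) (\<Union>k. F k))" .
    qed
  qed
  then show ?thesis using assms by simp
qed


section \<open>Random elements and Poisson random measures\<close>

definition borel_sigma :: "'a topology \<Rightarrow> 'a measure" where
  "borel_sigma T = sigma (topspace T) {U. openin T U}"

definition random_element :: "'w measure \<Rightarrow> 'a topology \<Rightarrow> ('w \<Rightarrow> 'a) \<Rightarrow> bool" where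
  "random_element M T X \<longleftrightarrow> prob_space M \<and> X \<in> measurable M (borel_sigma T)"

definition converges_in_distribution ::
    "'a topology \<Rightarrow> (nat \<Rightarrow> 'w measure) \<Rightarrow> (nat \<Rightarrow> 'w \<Rightarrow> 'a) \<Rightarrow> 'p measure \<Rightarrow> ('p \<Rightarrow> 'a) \<Rightarrow> bool" where
  "converges_in_distribution T M X P Y \<longleftrightarrow>
     (\<forall>n. random_element (M n) T (X n)) \<and> random_element P T Y \<and>
     (\<forall>h :: 'a \<Rightarrow> real. continuous_map T euclideanreal h \<and> bounded (h ` topspace T) \<longrightarrow>
        (\<lambda>n. \<integral>\<omega>. h (X n \<omega>) \<partial>M n) \<longlonglongrightarrow> (\<integral>\<omega>. h (Y \<omega>) \<partial>P))"

text \<open>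
  The Poisson probabilities are written out because \<open>poisson_pmf\<close> excludes rate \<open>0\<close>;
  here rate \<open>0\<close> gives a count that vanishes almost surely.
\<close>

definition poisson_random_measure ::
    "'a::topological_space set \<Rightarrow> 'a measure \<Rightarrow> 'p measure \<Rightarrow> ('p \<Rightarrow> 'a measure) \<Rightarrow> bool" where
  "poisson_random_measure E \<nu> P \<eta> \<longleftrightarrow> random_element P (vague_topology E) \<eta> \<and>
     (\<forall>A\<in>sets (borel_on E). emeasure \<nu> A < \<infinity> \<longrightarrow>
        (\<forall>k::nat. measure P {\<omega> \<in> space P. emeasure (\<eta> \<omega>) A = of_nat k} =
           measure \<nu> A ^ k / fact k * exp (- measure \<nu> A))) \<and>
     (\<forall>A\<in>sets (borel_on E). emeasure \<nu> A = \<infinity> \<longrightarrow> (AE \<omega> in P. emeasure (\<eta> \<omega>) A = \<infinity>)) \<and>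
     (\<forall>(A :: nat \<Rightarrow> 'a set) k. (\<forall>i<k. A i \<in> sets (borel_on E)) \<and> disjoint_family_on A {..<k} \<longrightarrow>
        prob_space.indep_vars P (\<lambda>_. borel) (\<lambda>i \<omega>. emeasure (\<eta> \<omega>) (A i)) {..<k})"


section \<open>The rescaled process of extremes\<close>

definition unit_cube :: "(real ^ 'd) set" where
  "unit_cube = {t. \<forall>i. 0 \<le> t $ i \<and> t $ i \<le> 1}"

definition state_space :: "((real ^ 'd) \<times> ereal) set" where
  "state_space = unit_cube \<times> {-\<infinity><..}"

definition lattice_box :: "nat \<Rightarrow> (int ^ 'd) set" where
  "lattice_box n = {\<alpha>. \<forall>i. 0 \<le> \<alpha> $ i \<and> \<alpha> $ i \<le> int n - 1}"

definition centering :: "real \<Rightarrow> real \<Rightarrow> real" where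
  "centering g N =
     sqrt g * (sqrt (2 * ln N) - (ln (ln N) + ln (4 * pi)) / (2 * sqrt (2 * ln N)))"

definition scaling :: "real \<Rightarrow> real \<Rightarrow> real" where
  "scaling g N = g / centering g N"

definition extremal_process :: "nat \<Rightarrow> (int ^ 'd \<Rightarrow> real) \<Rightarrow> ((real ^ 'd) \<times> ereal) measure" where
  "extremal_process n \<phi> =
     (let N = real (n ^ CARD('d)); g = green (0 :: int ^ 'd) 0 in
      sum_of_point_masses state_space (lattice_box n)
        (\<lambda>\<alpha>. (\<chi> i. real_of_int (\<alpha> $ i) / real n,
               ereal ((\<phi> \<alpha> - centering g N) / scaling g N))))"

text \<open>
  The measure \<open>dt \<otimes> exp (- z) dz\<close>; as an image under \<open>ereal\<close> it gives no mass to the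
  points with second coordinate \<open>\<infinity>\<close>.
\<close>

definition intensity :: "((real ^ 'd) \<times> ereal) measure" where
  "intensity =
     distr (restrict_space lborel unit_cube \<Otimes>\<^sub>M density lborel (\<lambda>z. ennreal (exp (- z))))
       (borel_on state_space) (\<lambda>(t, z). (t, ereal z))"

end

theory Submission
  imports Defs "HOL-Real_Asymp.Real_Asymp"
begin

text \<open>
  The field varies so little in correlation that its extremes behave like those of independent
  centered Gaussian variables with variance \<open>g(0)\<close>. Three ideas make this precise.

  \<^bold>\<open>Green's functions.\<close> In dimension at least three the function
  \<open>(|x|\<^sup>2 + K) powr (-1/4)\<close> is superharmonic on the lattice and strictly so at
  the origin, hence a multiple of it dominates the Green's function (\<open>green_decay\<close>). By
  the maximum principle the variance of the field far inside the box is then polynomially close to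
  \<open>g(0)\<close> (\<open>green_minus_green_on_le\<close>), while two values of the field are
  never close to perfectly correlated (\<open>gff_covariance_gap\<close>).

  \<^bold>\<open>Decoupling.\<close> Consider a product over the sites of functions of single field
  values. To split off the site \<open>k\<close>, resample \<open>X k\<close>: replace the component
  of every other coordinate along \<open>X k\<close> by that of an independent copy. The resampled
  coordinates are independent of the old \<open>X k\<close> and have the old law, so the covariance
  is the expected effect of resampling on the other factors, weighted by the deviation of the factor
  at \<open>k\<close> from one (\<open>decoupling\<close>). For step functions that equal one below
  a level exceeded with probability of order \<open>1/N\<close>, the effect is small in two ways:
  nearby sites rarely exceed the level jointly, because their correlation stays away from one, and
  at distant sites resampling moves the field so little that it rarely crosses a jump. Summed over
  all pairs the error vanishes (\<open>gff_decoupling\<close>). What remains is a product of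
  one-point quantities, governed by the Gaussian tail at the level \<open>b + a * z\<close>
  (\<open>one_point_sums\<close>), and its limit is the joint generating function of independent
  Poisson counts (\<open>cell_counts_limit\<close>).

  \<^bold>\<open>Vague convergence from counts.\<close> Partition the state space, in the
  coordinates \<open>(t, exp (- z))\<close>, into dyadic cells of level \<open>j\<close>. Measures
  that have the same cell counts as \<open>\<mu>\<close> at the levels \<open>j = 0, 1, 2,
  \<dots>\<close> converge vaguely to \<open>\<mu>\<close>. Therefore a continuous \<open>h\<close>
  is the pointwise limit of the functionals \<open>\<mu> \<mapsto> inf {h \<nu> | \<nu> has the
  level j counts of \<mu>}\<close>, which lie below \<open>h\<close> and depend on finitely many
  integers. Convergence of the joint law of these integers thus yields \<open>liminf E
  h(\<rho>\<^sub>n) \<ge> E h(\<eta>)\<close> for bounded continuous \<open>h \<ge> 0\<close>, and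
  the theorem follows by applying this to \<open>B + h\<close> and \<open>B - h\<close>
  (\<open>convergence_from_cell_counts\<close>).
\<close>

section \<open>Green's functions of the simple random walk\<close>

definition step_mean :: "(int ^ 'd \<Rightarrow> real) \<Rightarrow> int ^ 'd \<Rightarrow> real" where
  "step_mean f \<alpha> = (\<Sum>s\<in>unit_steps. f (\<alpha> + s)) / card (unit_steps :: (int ^ 'd) set)"

text \<open>
  The probability that the walk started at \<open>\<alpha>\<close> is at \<open>\<beta>\<close> at
  time \<open>m\<close> and has stayed in \<open>\<Lambda>\<close>, in the form of its first-step
  recursion. The choice \<open>\<Lambda> = UNIV\<close> is the free walk.
\<close>

primrec killed :: "(int ^ 'd) set \<Rightarrow> nat \<Rightarrow> int ^ 'd \<Rightarrow> int ^ 'd \<Rightarrow> real" where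
  "killed \<Lambda> 0 \<alpha> \<beta> = (if \<alpha> \<in> \<Lambda> \<and> \<alpha> = \<beta> then 1 else 0)"
| "killed \<Lambda> (Suc m) \<alpha> \<beta> = (if \<alpha> \<in> \<Lambda> then step_mean (\<lambda>\<gamma>. killed \<Lambda> m \<gamma> \<beta>) \<alpha> else 0)"

lemma unit_steps_eq:
  "(unit_steps :: (int ^ 'd) set) = (\<lambda>(i, s). axis i s) ` (UNIV \<times> {1, -1})"
  by (auto simp: unit_steps_def)

lemma finite_unit_steps [simp]: "finite (unit_steps :: (int ^ 'd) set)"
  by (simp add: unit_steps_eq)

lemma unit_steps_nonempty [simp]: "(unit_steps :: (int ^ 'd) set) \<noteq> {}"
  by (simp add: unit_steps_eq)

lemma sum_unit_steps:
  fixes f :: "int ^ 'd \<Rightarrow> 'b::comm_monoid_add"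
  shows "(\<Sum>s\<in>unit_steps. f s) = (\<Sum>i\<in>UNIV. f (axis i 1) + f (axis i (-1)))"
proof -
  have inj: "inj_on (\<lambda>(i :: 'd, s :: int). axis i s) (UNIV \<times> {1, -1})"
    by (auto simp: inj_on_def axis_eq_axis)
  have "(\<Sum>s\<in>unit_steps. f s) = (\<Sum>(i, s)\<in>UNIV \<times> {1, -1}. f (axis i s))"
    unfolding unit_steps_eq by (subst sum.reindex[OF inj]) (auto intro!: sum.cong)
  also have "\<dots> = (\<Sum>i\<in>UNIV. \<Sum>s\<in>{1, -1}. f (axis i s))"
    by (rule sum.cartesian_product[symmetric])
  finally show ?thesis by simp
qed

lemma card_unit_steps: "card (unit_steps :: (int ^ 'd) set) = 2 * CARD('d)"
  using sum_unit_steps[of "\<lambda>_::int^'d. 1 :: nat"] by simp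

lemma card_unit_steps_pos [simp]: "0 < card (unit_steps :: (int ^ 'd) set)"
  by (simp add: card_gt_0_iff)

lemma step_mean_mono:
  assumes "\<And>s. s \<in> unit_steps \<Longrightarrow> f (\<alpha> + s) \<le> g (\<alpha> + s)"
  shows "step_mean f \<alpha> \<le> step_mean g \<alpha>"
  unfolding step_mean_def by (intro divide_right_mono sum_mono assms) auto

lemma step_mean_const [simp]: "step_mean (\<lambda>_. c) (\<alpha> :: int ^ 'd) = c"
  using card_unit_steps_pos[where 'd='d] by (simp add: step_mean_def)

lemma step_mean_add: "step_mean (\<lambda>\<gamma>. f \<gamma> + g \<gamma>) \<alpha> = step_mean f \<alpha> + step_mean g \<alpha>"
  by (simp add: step_mean_def sum.distrib add_divide_distrib)

lemma step_mean_cmult: "step_mean (\<lambda>\<gamma>. c * f \<gamma>) \<alpha> = c * step_mean f \<alpha>"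
  by (simp add: step_mean_def sum_distrib_left)

lemma step_mean_sum: "step_mean (\<lambda>\<gamma>. \<Sum>i\<in>I. f i \<gamma>) \<alpha> = (\<Sum>i\<in>I. step_mean (f i) \<alpha>)"
  unfolding step_mean_def by (subst sum.swap) (simp add: sum_divide_distrib)

lemma killed_nonneg: "0 \<le> killed \<Lambda> m \<alpha> \<beta>"
proof (induction m arbitrary: \<alpha>)
  case (Suc m)
  then show ?case by (auto simp: step_mean_def intro!: divide_nonneg_nonneg sum_nonneg)
qed simp

lemma killed_outside: "\<alpha> \<notin> \<Lambda> \<Longrightarrow> killed \<Lambda> m \<alpha> \<beta> = 0"
  by (cases m) auto

lemma killed_le_free: "killed \<Lambda> m \<alpha> \<beta> \<le> killed UNIV m \<alpha> \<beta>"
proof (induction m arbitrary: \<alpha>)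
  case (Suc m)
  show ?case
    using step_mean_mono[where f="\<lambda>\<gamma>. killed \<Lambda> m \<gamma> \<beta>" and g="\<lambda>\<gamma>. killed UNIV m \<gamma> \<beta>" and \<alpha>=\<alpha>] Suc
      killed_nonneg[of UNIV "Suc m" \<alpha> \<beta>] by auto
qed simp

lemma killed_translate: "killed UNIV m (\<alpha> + \<gamma>) (\<beta> + \<gamma>) = killed UNIV m \<alpha> \<beta>"
proof (induction m arbitrary: \<alpha>)
  case (Suc m)
  have "killed UNIV m (\<alpha> + \<gamma> + s) (\<beta> + \<gamma>) = killed UNIV m (\<alpha> + s) \<beta>" for s
    using Suc[of "\<alpha> + s"] by (simp add: add_ac)
  then show ?case by (simp add: step_mean_def)
qed simp

text \<open>
  Truncating the Green's function at a time horizon turns the discrete Poisson equation into a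
  recursion in the horizon. The comparison arguments below are inductions along it.
\<close>

lemma killed_partial_sum_Suc:
  assumes "\<alpha> \<in> \<Lambda>"
  shows "(\<Sum>m<Suc M. killed \<Lambda> m \<alpha> \<beta>) =
    (if \<alpha> = \<beta> then 1 else 0) + step_mean (\<lambda>\<gamma>. \<Sum>m<M. killed \<Lambda> m \<gamma> \<beta>) \<alpha>"
  using assms by (subst sum.lessThan_Suc_shift) (simp add: step_mean_sum)

subsection \<open>Path counts and the canonical walk\<close>

abbreviation step_pmf :: "(int ^ 'd) pmf" where
  "step_pmf \<equiv> pmf_of_set unit_steps"

interpretation steps: sequence_space "measure_pmf (step_pmf :: (int ^ 'd) pmf)"
  by unfold_locales

interpretation step_space: prob_space "step_space :: (nat \<Rightarrow> int ^ 'd) measure"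
  unfolding step_space_def by (rule prob_space_PiM) (rule prob_space_measure_pmf)

lemma walk_measurable [measurable]:
  "(\<lambda>\<omega>. walk \<alpha> \<omega> m) \<in> measurable step_space (count_space UNIV)"
proof (induction m)
  case 0
  then show ?case by (simp add: walk_def)
next
  case (Suc m)
  have comp: "(\<lambda>\<omega>. \<omega> m) \<in> measurable step_space (measure_pmf (step_pmf :: (int ^ 'd) pmf))"
    unfolding step_space_def by (rule measurable_component_singleton) simp
  have "(\<lambda>\<omega>. i + \<omega> m) \<in> measurable step_space (count_space UNIV)" for i :: "int ^ 'd"
    using measurable_compose[OF comp, of "\<lambda>s. i + s" "count_space UNIV"] by simp
  then have "(\<lambda>\<omega>. walk \<alpha> \<omega> m + \<omega> m) \<in> measurable step_space (count_space UNIV)"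
    by (rule measurable_compose_countable) (rule Suc)
  then show ?case by (simp add: walk_def add.assoc)
qed

lemma walk_first_step: "walk \<alpha> (case_nat s \<omega>) (Suc m) = walk (\<alpha> + s) \<omega> m"
  unfolding walk_def by (subst sum.lessThan_Suc_shift) (simp add: add.assoc)

text \<open>
  First-step analysis: the first step is independent of the later ones, which again form a sequence
  with law \<open>step_space\<close>.
\<close>

lemma nn_integral_step_space:
  assumes "f \<in> borel_measurable (step_space :: (nat \<Rightarrow> int ^ 'd) measure)"
  shows "(\<integral>\<^sup>+\<omega>. f \<omega> \<partial>step_space) =
    (\<integral>\<^sup>+s. (\<integral>\<^sup>+\<omega>. f (case_nat s \<omega>) \<partial>step_space) \<partial>step_pmf)"
proof -
  note f [measurable] = assms[unfolded step_space_def]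
  have "(\<integral>\<^sup>+\<omega>. f \<omega> \<partial>steps.S) = (\<integral>\<^sup>+\<omega>. f \<omega> \<partial>distr (measure_pmf step_pmf \<Otimes>\<^sub>M steps.S) steps.S (\<lambda>(s, \<omega>). case_nat s \<omega>))"
    by (simp add: steps.PiM_iter)
  also have "\<dots> = (\<integral>\<^sup>+x. f (case_nat (fst x) (snd x)) \<partial>(measure_pmf step_pmf \<Otimes>\<^sub>M steps.S))"
    by (subst nn_integral_distr) (auto simp: split_beta)
  also have "\<dots> = (\<integral>\<^sup>+s. (\<integral>\<^sup>+\<omega>. f (case_nat s \<omega>) \<partial>steps.S) \<partial>step_pmf)"
    by (subst steps.P.nn_integral_fst[symmetric]) auto
  finally show ?thesis by (simp add: step_space_def)
qed

text \<open>
  Splitting off the first step of the walk reproduces the recursion of \<open>killed\<close>. From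
  here on Green's functions are series of real numbers.
\<close>

lemma emeasure_walk_killed:
  "(\<integral>\<^sup>+\<omega>. indicator {\<omega>. (\<forall>k\<le>m. walk \<alpha> \<omega> k \<in> \<Lambda>) \<and> walk \<alpha> \<omega> m = \<beta>} \<omega> \<partial>step_space)
     = ennreal (killed \<Lambda> m \<alpha> \<beta>)"
proof (induction m arbitrary: \<alpha>)
  case 0
  show ?case
    by (simp add: walk_def step_space.emeasure_space_1 split: split_indicator)
       (auto simp: step_space.emeasure_space_1)
next
  case (Suc m)
  let ?I = "\<lambda>m \<alpha>. {\<omega>. (\<forall>k\<le>m. walk \<alpha> \<omega> k \<in> \<Lambda>) \<and> walk \<alpha> \<omega> m = \<beta>}"
  have split: "(\<forall>k\<le>Suc m. walk \<alpha> (case_nat s \<omega>) k \<in> \<Lambda>) \<longleftrightarrow>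
      \<alpha> \<in> \<Lambda> \<and> (\<forall>k\<le>m. walk (\<alpha> + s) \<omega> k \<in> \<Lambda>)" for s \<omega>
  proof -
    have "(\<forall>k\<le>Suc m. Q k) \<longleftrightarrow> Q 0 \<and> (\<forall>k\<le>m. Q (Suc k))" for Q :: "nat \<Rightarrow> bool"
      by (metis Suc_le_mono le0 not0_implies_Suc)
    from this[of "\<lambda>k. walk \<alpha> (case_nat s \<omega>) k \<in> \<Lambda>"] show ?thesis
      by (simp add: walk_first_step) (simp add: walk_def)
  qed
  have "(\<integral>\<^sup>+\<omega>. indicator (?I (Suc m) \<alpha>) \<omega> \<partial>step_space)
      = (\<integral>\<^sup>+s. (\<integral>\<^sup>+\<omega>. indicator (?I (Suc m) \<alpha>) (case_nat s \<omega>) \<partial>step_space) \<partial>step_pmf)"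
    by (rule nn_integral_step_space) measurable
  also have "\<dots> = (\<integral>\<^sup>+s. indicator \<Lambda> \<alpha> * (\<integral>\<^sup>+\<omega>. indicator (?I m (\<alpha> + s)) \<omega> \<partial>step_space) \<partial>step_pmf)"
    by (intro nn_integral_cong, subst nn_integral_cmult[symmetric])
       (auto intro!: nn_integral_cong simp: split walk_first_step split: split_indicator)
  also have "\<dots> = indicator \<Lambda> \<alpha> * (\<integral>\<^sup>+s. ennreal (killed \<Lambda> m (\<alpha> + s) \<beta>) \<partial>step_pmf)"
    by (simp add: Suc nn_integral_cmult)
  also have "\<dots> = ennreal (killed \<Lambda> (Suc m) \<alpha> \<beta>)"
    by (subst nn_integral_pmf_of_set)
       (auto simp: step_mean_def sum_nonneg killed_nonneg sum_ennreal divide_ennreal ennreal_of_nat_eq_real_of_nat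
         split: split_indicator)
  finally show ?case .
qed

lemma less_exit_time_iff: "enat m < exit_time \<Lambda> s \<longleftrightarrow> (\<forall>k\<le>m. s k \<in> \<Lambda>)"
proof
  assume "enat m < exit_time \<Lambda> s"
  then show "\<forall>k\<le>m. s k \<in> \<Lambda>"
    unfolding exit_time_def using less_INF_D by fastforce
next
  assume *: "\<forall>k\<le>m. s k \<in> \<Lambda>"
  have "enat (Suc m) \<le> exit_time \<Lambda> s"
    unfolding exit_time_def using * by (intro INF_greatest) (auto simp: not_less_eq_eq)
  then show "enat m < exit_time \<Lambda> s"
    by (metis enat_ord_simps(2) lessI less_le_trans)
qed

lemma green_on_suminf: "green_on \<Lambda> \<alpha> \<beta> = enn2real (\<Sum>m. ennreal (killed \<Lambda> m \<alpha> \<beta>))"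
proof -
  have "(\<integral>\<^sup>+\<omega>. (\<Sum>m. indicator {m. enat m < exit_time \<Lambda> (walk \<alpha> \<omega>) \<and> walk \<alpha> \<omega> m = \<beta>} m) \<partial>step_space)
     = (\<integral>\<^sup>+\<omega>. (\<Sum>m. indicator {\<omega>. (\<forall>k\<le>m. walk \<alpha> \<omega> k \<in> \<Lambda>) \<and> walk \<alpha> \<omega> m = \<beta>} \<omega>) \<partial>step_space)"
    unfolding less_exit_time_iff by (intro nn_integral_cong suminf_cong) (auto split: split_indicator)
  also have "\<dots> = (\<Sum>m. \<integral>\<^sup>+\<omega>. indicator {\<omega>. (\<forall>k\<le>m. walk \<alpha> \<omega> k \<in> \<Lambda>) \<and> walk \<alpha> \<omega> m = \<beta>} \<omega> \<partial>step_space)"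
    by (intro nn_integral_suminf) measurable
  finally show ?thesis by (simp add: green_on_def emeasure_walk_killed)
qed

lemma green_eq_green_on: "(green :: int ^ 'd \<Rightarrow> int ^ 'd \<Rightarrow> real) = green_on UNIV"
proof -
  have "exit_time UNIV s = \<infinity>" for s :: "nat \<Rightarrow> int ^ 'd"
    by (simp add: exit_time_def top_enat_def)
  then show ?thesis by (simp add: green_def green_on_def fun_eq_iff)
qed

subsection \<open>Decay of the free Green's function\<close>

definition shifted_norm2 :: "int ^ 'd \<Rightarrow> real" where
  "shifted_norm2 x = 100000 + (\<Sum>i\<in>UNIV. (real_of_int (x $ i))\<^sup>2)"

text \<open>
  The exponent is positive, to give decay, and below \<open>1/2\<close>, the threshold for
  superharmonicity in dimension three. The shift by \<open>100000\<close> makes the relative change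
  of \<open>shifted_norm2\<close> in one step at most \<open>1/120\<close>, the range in which
  \<open>powr_minus_quarter_le\<close> holds.
\<close>

definition barrier :: "int ^ 'd \<Rightarrow> real" where
  "barrier x = shifted_norm2 x powr (-1/4)"

lemma shifted_norm2_ge: "100000 \<le> shifted_norm2 x"
  by (simp add: shifted_norm2_def sum_nonneg)

text \<open>
  The coefficient \<open>17/100\<close> has to exceed the Taylor coefficient \<open>5/32\<close>, so
  as to absorb the higher order terms, and to stay below \<open>3/16\<close>, so that in dimension
  three the quadratic terms, which carry a factor \<open>4/3\<close>, do not outweigh the drift
  \<open>1/4\<close>.
\<close>

lemma powr_minus_quarter_le:
  fixes y :: real
  assumes y: "\<bar>y\<bar> \<le> 1/120"
  shows "(1 + y) powr (-1/4) \<le> 1 - y/4 + 17/100 * y\<^sup>2"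
proof -
  define q where "q = 1 - y/4 + 17/100 * y\<^sup>2"
  have y2: "0 \<le> y\<^sup>2" by simp
  have q_pos: "q > 0" using y y2 unfolding q_def by linarith
  \<comment> \<open>It suffices that \<open>(1 + y) * q ^ 4 \<ge> 1\<close>; the fourth power is bounded by squaring twice.\<close>
  have q2: "1 - y/2 + 39/100 * y\<^sup>2 \<le> q\<^sup>2"
  proof -
    have "q\<^sup>2 - (1 - y/2 + 39/100 * y\<^sup>2) = y\<^sup>2 * (1/80 - 17/200 * y + 289/10000 * y\<^sup>2)"
      unfolding q_def by (simp add: power2_eq_square field_simps)
    moreover have "0 \<le> 1/80 - 17/200 * y + 289/10000 * y\<^sup>2" using y y2 by linarith
    ultimately show ?thesis by (metis diff_ge_0_iff_ge mult_nonneg_nonneg y2)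
  qed
  have "(1 - y/2 + 39/100 * y\<^sup>2)\<^sup>2 \<le> (q\<^sup>2)\<^sup>2"
    using q2 y y2 by (intro power_mono) auto
  moreover have "1 - y + 101/100 * y\<^sup>2 \<le> (1 - y/2 + 39/100 * y\<^sup>2)\<^sup>2"
  proof -
    have "(1 - y/2 + 39/100 * y\<^sup>2)\<^sup>2 - (1 - y + 101/100 * y\<^sup>2)
        = y\<^sup>2 * (1/50 - 39/100 * y + (39/100 * y)\<^sup>2)"
      by (simp add: power2_eq_square field_simps)
    moreover have "0 \<le> 1/50 - 39/100 * y + (39/100 * y)\<^sup>2" using y zero_le_power2[of "39/100 * y"] by linarith
    ultimately show ?thesis by (metis diff_ge_0_iff_ge mult_nonneg_nonneg y2)
  qed
  ultimately have q4: "1 - y + 101/100 * y\<^sup>2 \<le> q ^ 4" by (simp flip: power_mult)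
  have "1 \<le> (1 + y) * (1 - y + 101/100 * y\<^sup>2)"
  proof -
    have "(1 + y) * (1 - y + 101/100 * y\<^sup>2) - 1 = y\<^sup>2 * (1/100 + 101/100 * y)"
      by (simp add: power2_eq_square field_simps)
    moreover have "0 \<le> 1/100 + 101/100 * y" using y by linarith
    ultimately show ?thesis by (metis diff_ge_0_iff_ge mult_nonneg_nonneg y2)
  qed
  also have "\<dots> \<le> (1 + y) * q ^ 4" using q4 y by (intro mult_left_mono) auto
  finally have "q powr (-4) \<le> 1 + y"
    using q_pos by (simp add: powr_minus divide_simps powr_numeral)
  then have "(1 + y) powr (-1/4) \<le> (q powr (-4)) powr (-1/4)"
    using q_pos by (intro powr_mono2') auto
  also have "\<dots> = q" using q_pos by (simp add: powr_powr)
  finally show ?thesis by (simp add: q_def)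
qed

lemma shifted_norm2_step:
  "shifted_norm2 (x + axis i s) = shifted_norm2 x + 2 * real_of_int (x $ i) * real_of_int s + (real_of_int s)\<^sup>2"
proof -
  have "(\<Sum>j\<in>UNIV. (real_of_int ((x + axis i s) $ j))\<^sup>2)
      = (\<Sum>j\<in>UNIV. (real_of_int (x $ j))\<^sup>2 + (if j = i then 2 * real_of_int (x $ i) * real_of_int s + (real_of_int s)\<^sup>2 else 0))"
    by (intro sum.cong) (auto simp: axis_def power2_eq_square algebra_simps)
  then show ?thesis by (simp add: shifted_norm2_def sum.distrib)
qed

lemma barrier_step_le:
  fixes x :: "int ^ 'd" and i :: 'd
  assumes s: "s \<in> {1, -1}"
  defines "r \<equiv> shifted_norm2 x"
  defines "y \<equiv> (1 + 2 * real_of_int (x $ i) * real_of_int s) / r"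
  shows "barrier (x + axis i s) \<le> barrier x * (1 - y/4 + 17/100 * y\<^sup>2)"
proof -
  have r: "r \<ge> 100000" using shifted_norm2_ge by (simp add: r_def)
  have "(real_of_int (x $ i))\<^sup>2 \<le> (\<Sum>i\<in>UNIV. (real_of_int (x $ i))\<^sup>2)"
    by (rule member_le_sum) auto
  then have "(real_of_int (x $ i))\<^sup>2 \<le> r" by (simp add: r_def shifted_norm2_def)
  then have xi: "\<bar>real_of_int (x $ i)\<bar> \<le> sqrt r"
    using real_le_rsqrt[of "\<bar>real_of_int (x $ i)\<bar>" r] by simp
  have sr: "300 \<le> sqrt r" by (rule real_le_rsqrt) (use r in simp)
  have "\<bar>1 + 2 * real_of_int (x $ i) * real_of_int s\<bar> \<le> 1 + 2 * sqrt r"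
    using s xi by auto
  also have "\<dots> \<le> r / 120"
  proof -
    have "1 + 2 * sqrt r \<le> (1/300 + 2) * sqrt r" using sr by simp
    also have "\<dots> \<le> (300/120) * sqrt r" using sr r by (intro mult_right_mono) auto
    also have "\<dots> \<le> (sqrt r/120) * sqrt r" using sr r by (intro mult_right_mono) auto
    finally show ?thesis using r by simp
  qed
  finally have y: "\<bar>y\<bar> \<le> 1/120" using r by (simp add: y_def abs_divide field_simps)
  have "shifted_norm2 (x + axis i s) = r * (1 + y)"
    using s r unfolding y_def by (auto simp: shifted_norm2_step r_def field_simps)
  then have "barrier (x + axis i s) = barrier x * (1 + y) powr (-1/4)"
    using r y by (simp add: barrier_def powr_mult r_def)
  also have "\<dots> \<le> barrier x * (1 - y/4 + 17/100 * y\<^sup>2)"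
    by (intro mult_left_mono powr_minus_quarter_le y) (simp add: barrier_def)
  finally show ?thesis .
qed

text \<open>
  The increments of \<open>shifted_norm2\<close> along opposite steps cancel up to a constant, which
  leaves a negative drift \<open>1 / (4 * r)\<close>. The quadratic terms contribute about \<open>(4
  / d) * (17/100) / r\<close>, which is smaller as soon as \<open>d \<ge> 3\<close>.
\<close>

lemma barrier_superharmonic:
  fixes x :: "int ^ 'd"
  assumes d: "CARD('d) \<ge> 3"
  shows "step_mean barrier x \<le> barrier x"
proof -
  define r where "r = shifted_norm2 x"
  define d where "d = real CARD('d)"
  have r: "r \<ge> 100000" using shifted_norm2_ge by (simp add: r_def)
  have d3: "d \<ge> 3" using d by (simp add: d_def)
  let ?x = "\<lambda>i. real_of_int (x $ i)"
  let ?y = "\<lambda>i s. (1 + 2 * ?x i * s) / r"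
  let ?q = "\<lambda>i s. 1 - ?y i s/4 + 17/100 * (?y i s)\<^sup>2"
  have "(\<Sum>s\<in>unit_steps. barrier (x + s)) = (\<Sum>i\<in>UNIV. barrier (x + axis i 1) + barrier (x + axis i (-1)))"
    by (rule sum_unit_steps)
  also have "\<dots> \<le> (\<Sum>i\<in>UNIV. barrier x * (?q i 1) + barrier x * (?q i (-1)))"
    using barrier_step_le[of 1 x] barrier_step_le[of "-1" x]
    by (intro sum_mono add_mono) (auto simp: r_def)
  also have "\<dots> = (\<Sum>i\<in>UNIV. barrier x * (2 - 1/(2*r) + 34/100 / r\<^sup>2 + 136/100 / r\<^sup>2 * (?x i)\<^sup>2))"
    using r by (intro sum.cong) (auto simp: power2_eq_square field_simps)
  also have "\<dots> = barrier x * (d * (2 - 1/(2*r) + 34/100 / r\<^sup>2) + 136/100 / r\<^sup>2 * (\<Sum>i\<in>UNIV. (?x i)\<^sup>2))"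
    by (simp add: sum.distrib d_def flip: sum_distrib_left)
       (simp add: sum_distrib_left sum_divide_distrib)
  also have "\<dots> \<le> barrier x * (2 * d)"
  proof (intro mult_left_mono)
    have "136/100 / r\<^sup>2 * (\<Sum>i\<in>UNIV. (?x i)\<^sup>2) \<le> 136/100 / r\<^sup>2 * r"
      by (intro mult_left_mono) (auto simp: r_def shifted_norm2_def)
    also have "\<dots> = 136/100 / r" using r by (simp add: power2_eq_square)
    also have "\<dots> \<le> d * (136/300 / r)" using d3 r by (simp add: field_simps)
    finally have "d * (2 - 1/(2*r) + 34/100 / r\<^sup>2) + 136/100 / r\<^sup>2 * (\<Sum>i\<in>UNIV. (?x i)\<^sup>2)
        \<le> d * (2 - 1/(2*r) + 34/100 / r\<^sup>2 + 136/300/r)" by (simp add: algebra_simps)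
    also have "\<dots> \<le> d * 2"
    proof (intro mult_left_mono)
      have "34/100 / r\<^sup>2 \<le> (1/1000) / r" using r by (simp add: power2_eq_square field_simps)
      moreover have "1/(2*r) = (1/2)/r" "136/300/r = (136/300)/r" by simp_all
      moreover have "(1/1000)/r + (136/300)/r \<le> (1/2)/r"
        using r by (simp add: field_simps)
      ultimately show "2 - 1/(2*r) + 34/100 / r\<^sup>2 + 136/300/r \<le> 2" by linarith
    qed (use d3 in simp)
    finally show "d * (2 - 1/(2*r) + 34/100 / r\<^sup>2) + 136/100 / r\<^sup>2 * (\<Sum>i\<in>UNIV. (?x i)\<^sup>2) \<le> 2 * d"
      by simp
  qed (simp add: barrier_def)
  finally show ?thesis using d3
    by (simp add: step_mean_def card_unit_steps d_def field_simps)
qed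

definition barrier_defect :: real where
  "barrier_defect = 100000 powr (-1/4) - 100001 powr (-1/4)"

lemma barrier_defect_pos: "barrier_defect > 0"
  by (simp add: barrier_defect_def powr_less_mono2_neg)

lemma barrier_defect_at_0: "barrier (0 :: int ^ 'd) - step_mean barrier (0 :: int ^ 'd) = barrier_defect"
proof -
  have "barrier s = 100001 powr (-1/4)" if "s \<in> unit_steps" for s :: "int ^ 'd"
  proof -
    have "shifted_norm2 s = 100001"
      using that shifted_norm2_step[where x="0 :: int ^ 'd" and s=1] shifted_norm2_step[where x="0 :: int ^ 'd" and s="-1"]
      by (auto simp: unit_steps_def) (auto simp: shifted_norm2_def)
    then show ?thesis by (simp add: barrier_def)
  qed
  then show ?thesis using card_unit_steps_pos[where 'd='d]
    by (simp add: step_mean_def barrier_defect_def barrier_def shifted_norm2_def)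
qed

text \<open>
  The barrier exceeds its mean over the neighbours by \<open>barrier_defect\<close> at the origin
  and by a non-negative amount elsewhere, so it dominates the potential generated by that excess.
  This gives transience and the rate of decay at once.
\<close>

lemma killed_partial_sum_le_barrier:
  fixes \<alpha> \<beta> :: "int ^ 'd"
  assumes d: "CARD('d) \<ge> 3"
  shows "barrier_defect * (\<Sum>m<M. killed UNIV m \<alpha> \<beta>) \<le> barrier (\<alpha> - \<beta>)"
proof (induction M arbitrary: \<alpha>)
  case 0
  then show ?case by (simp add: barrier_def)
next
  case (Suc M)
  let ?G = "\<lambda>\<gamma>. \<Sum>m<M. killed UNIV m \<gamma> \<beta>"
  have "barrier_defect * step_mean ?G \<alpha> = step_mean (\<lambda>\<gamma>. barrier_defect * ?G \<gamma>) \<alpha>"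
    by (simp add: step_mean_cmult)
  also have "\<dots> \<le> step_mean (\<lambda>\<gamma>. barrier (\<gamma> - \<beta>)) \<alpha>"
    by (rule step_mean_mono) (rule Suc)
  also have "\<dots> = step_mean barrier (\<alpha> - \<beta>)"
    by (simp add: step_mean_def algebra_simps)
  finally have *: "barrier_defect * step_mean ?G \<alpha> \<le> step_mean barrier (\<alpha> - \<beta>)" .
  show ?case
    using * barrier_defect_at_0[where 'd='d] barrier_superharmonic[OF d, of "\<alpha> - \<beta>"]
    by (subst killed_partial_sum_Suc) (auto simp: algebra_simps)
qed

lemma sums_green_on:
  fixes \<alpha> \<beta> :: "int ^ 'd"
  assumes d: "CARD('d) \<ge> 3"
  shows "(\<lambda>m. killed \<Lambda> m \<alpha> \<beta>) sums green_on \<Lambda> \<alpha> \<beta>"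
proof -
  have free: "summable (\<lambda>m. killed UNIV m \<alpha> \<beta>)"
  proof (rule summableI_nonneg_bounded)
    show "(\<Sum>m<M. killed UNIV m \<alpha> \<beta>) \<le> barrier (\<alpha> - \<beta>) / barrier_defect" for M
      using killed_partial_sum_le_barrier[OF d, where M=M and \<alpha>=\<alpha> and \<beta>=\<beta>] barrier_defect_pos
      by (simp add: field_simps)
  qed (rule killed_nonneg)
  have summ: "summable (\<lambda>m. killed \<Lambda> m \<alpha> \<beta>)"
    by (rule summable_comparison_test'[OF free, of 0]) (simp add: killed_nonneg killed_le_free)
  have "(\<Sum>m. ennreal (killed \<Lambda> m \<alpha> \<beta>)) = ennreal (\<Sum>m. killed \<Lambda> m \<alpha> \<beta>)"
    by (rule suminf_ennreal2[OF killed_nonneg summ])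
  then have "green_on \<Lambda> \<alpha> \<beta> = (\<Sum>m. killed \<Lambda> m \<alpha> \<beta>)"
    by (simp add: green_on_suminf suminf_nonneg summ killed_nonneg)
  then show ?thesis using summ by (simp add: summable_sums)
qed

lemma green_le_barrier:
  fixes \<alpha> \<beta> :: "int ^ 'd"
  assumes d: "CARD('d) \<ge> 3"
  shows "green \<alpha> \<beta> \<le> barrier (\<alpha> - \<beta>) / barrier_defect"
proof (rule LIMSEQ_le_const2)
  show "(\<lambda>M. \<Sum>m<M. killed UNIV m \<alpha> \<beta>) \<longlonglongrightarrow> green \<alpha> \<beta>"
    using sums_green_on[OF d, of UNIV \<alpha> \<beta>] by (simp add: sums_def green_eq_green_on)
  show "\<exists>N. \<forall>n\<ge>N. (\<Sum>m<n. killed UNIV m \<alpha> \<beta>) \<le> barrier (\<alpha> - \<beta>) / barrier_defect"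
    using killed_partial_sum_le_barrier[OF d, where \<alpha>=\<alpha> and \<beta>=\<beta>] barrier_defect_pos
    by (simp add: field_simps)
qed

lemma green_decay:
  fixes \<alpha> \<beta> :: "int ^ 'd"
  assumes d: "CARD('d) \<ge> 3" and R: "0 < R" "R \<le> \<bar>real_of_int (\<alpha> $ i - \<beta> $ i)\<bar>"
  shows "green \<alpha> \<beta> \<le> R powr (-1/2) / barrier_defect"
proof -
  have "R\<^sup>2 \<le> (real_of_int ((\<alpha> - \<beta>) $ i))\<^sup>2"
    using R power_mono[of R "\<bar>real_of_int (\<alpha> $ i - \<beta> $ i)\<bar>" 2] by simp
  also have "\<dots> \<le> (\<Sum>i\<in>UNIV. (real_of_int ((\<alpha> - \<beta>) $ i))\<^sup>2)"
    by (rule member_le_sum) auto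
  finally have "R\<^sup>2 \<le> shifted_norm2 (\<alpha> - \<beta>)" by (simp add: shifted_norm2_def)
  then have "barrier (\<alpha> - \<beta>) \<le> (R\<^sup>2) powr (-1/4)"
    unfolding barrier_def using R by (intro powr_mono2') auto
  also have "R\<^sup>2 = R powr 2" using R by (simp add: powr_numeral)
  also have "(R powr 2) powr (-1/4) = R powr (-1/2)" by (simp add: powr_powr)
  finally have "barrier (\<alpha> - \<beta>) / barrier_defect \<le> R powr (-1/2) / barrier_defect"
    using barrier_defect_pos by (simp add: divide_right_mono)
  then show ?thesis using green_le_barrier[OF d, of \<alpha> \<beta>] by linarith
qed

subsection \<open>The Green's function with zero boundary values\<close>

lemma green_on_nonneg: "0 \<le> green_on \<Lambda> \<alpha> \<beta>"
  by (simp add: green_on_def)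

lemma green_on_outside: "\<alpha> \<notin> \<Lambda> \<Longrightarrow> green_on \<Lambda> \<alpha> \<beta> = 0"
  by (simp add: green_on_suminf killed_outside)

lemma green_diag: "green \<alpha> (\<alpha> :: int ^ 'd) = green (0 :: int ^ 'd) (0 :: int ^ 'd)"
  using killed_translate[of _ 0 \<alpha> 0]
  by (simp add: green_eq_green_on green_on_suminf)

context
  assumes d: "CARD('d::finite) \<ge> 3"
begin

lemma green_on_le_green:
  fixes \<alpha> :: "int ^ 'd"
  shows "green_on \<Lambda> \<alpha> \<beta> \<le> green \<alpha> \<beta>"
  unfolding green_eq_green_on
  by (rule sums_le[OF killed_le_free sums_green_on[OF d] sums_green_on[OF d]])

lemma green_on_step:
  fixes \<alpha> :: "int ^ 'd"
  assumes "\<alpha> \<in> \<Lambda>"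
  shows "green_on \<Lambda> \<alpha> \<beta> = (if \<alpha> = \<beta> then 1 else 0) + step_mean (\<lambda>\<gamma>. green_on \<Lambda> \<gamma> \<beta>) \<alpha>"
proof (rule LIMSEQ_unique)
  show "(\<lambda>M. \<Sum>m<Suc M. killed \<Lambda> m \<alpha> \<beta>) \<longlonglongrightarrow> green_on \<Lambda> \<alpha> \<beta>"
    using LIMSEQ_Suc[OF sums_green_on[OF d, unfolded sums_def]] .
  show "(\<lambda>M. \<Sum>m<Suc M. killed \<Lambda> m \<alpha> \<beta>) \<longlonglongrightarrow>
      (if \<alpha> = \<beta> then 1 else 0) + step_mean (\<lambda>\<gamma>. green_on \<Lambda> \<gamma> \<beta>) \<alpha>"
    unfolding killed_partial_sum_Suc[OF assms] step_mean_def
    by (intro tendsto_intros sums_green_on[OF d, unfolded sums_def]) simp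
qed

lemma green_on_diag_ge_1:
  fixes \<alpha> :: "int ^ 'd"
  assumes "\<alpha> \<in> \<Lambda>"
  shows "1 \<le> green_on \<Lambda> \<alpha> \<alpha>"
  unfolding green_on_step[OF assms]
  by (simp add: step_mean_def sum_nonneg green_on_nonneg)

lemma green_0_ge_1: "1 \<le> green (0 :: int ^ 'd) 0"
  using green_on_diag_ge_1[of "0 :: int ^ 'd" UNIV] by (simp add: green_eq_green_on)

text \<open>
  The difference is harmonic on \<open>\<Lambda>\<close>, hence bounded by its values outside. The
  induction on the time horizon is the proof of this maximum principle for truncated sums.
\<close>

lemma green_minus_green_on_le:
  fixes \<alpha> :: "int ^ 'd"
  assumes B: "0 \<le> B" "\<And>\<gamma>. \<gamma> \<notin> \<Lambda> \<Longrightarrow> green \<gamma> \<beta> \<le> B"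
  shows "green \<alpha> \<beta> - green_on \<Lambda> \<alpha> \<beta> \<le> B"
proof -
  have partial: "(\<Sum>m<M. killed UNIV m \<alpha> \<beta>) \<le> (\<Sum>m<M. killed \<Lambda> m \<alpha> \<beta>) + B" for M
  proof (induction M arbitrary: \<alpha>)
    case (Suc M)
    show ?case
    proof (cases "\<alpha> \<in> \<Lambda>")
      case True
      have "step_mean (\<lambda>\<gamma>. \<Sum>m<M. killed UNIV m \<gamma> \<beta>) \<alpha>
          \<le> step_mean (\<lambda>\<gamma>. (\<Sum>m<M. killed \<Lambda> m \<gamma> \<beta>) + B) \<alpha>"
        by (rule step_mean_mono) (rule Suc)
      then show ?thesis
        by (simp only: killed_partial_sum_Suc[OF True] killed_partial_sum_Suc[OF UNIV_I]
            step_mean_add step_mean_const)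
    next
      case False
      have "(\<Sum>m<Suc M. killed UNIV m \<alpha> \<beta>) \<le> green \<alpha> \<beta>"
        using sum_le_suminf[of "\<lambda>m. killed UNIV m \<alpha> \<beta>" "{..<Suc M}"]
          sums_green_on[OF d, of UNIV \<alpha> \<beta>]
        by (simp add: sums_iff green_eq_green_on killed_nonneg del: sum.lessThan_Suc)
      with B(2)[OF False] show ?thesis
        using sum_nonneg[of "{..<Suc M}" "\<lambda>m. killed \<Lambda> m \<alpha> \<beta>"] killed_nonneg
        by (smt (verit))
    qed
  qed (use B in simp)
  have "green \<alpha> \<beta> \<le> green_on \<Lambda> \<alpha> \<beta> + B"
  proof (rule LIMSEQ_le)
    show "(\<lambda>M. \<Sum>m<M. killed UNIV m \<alpha> \<beta>) \<longlonglongrightarrow> green \<alpha> \<beta>"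
      using sums_green_on[OF d, of UNIV \<alpha> \<beta>] by (simp add: sums_def green_eq_green_on)
    show "(\<lambda>M. (\<Sum>m<M. killed \<Lambda> m \<alpha> \<beta>) + B) \<longlonglongrightarrow> green_on \<Lambda> \<alpha> \<beta> + B"
      using sums_green_on[OF d, of \<Lambda> \<alpha> \<beta>] by (intro tendsto_intros) (simp add: sums_def)
  qed (use partial in blast)
  then show ?thesis by simp
qed

end

section \<open>Centered Gaussian vectors\<close>

context prob_space
begin

lemma bounded_integrable:
  fixes f :: "'a \<Rightarrow> real"
  assumes "f \<in> borel_measurable M" "\<And>\<omega>. \<bar>f \<omega>\<bar> \<le> B"
  shows "integrable M f"
  by (rule integrable_const_bound[of _ B]) (use assms in auto)

lemma gaussian_variable_measurable: "gaussian_variable M Z \<Longrightarrow> Z \<in> borel_measurable M"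
  by (simp add: gaussian_variable_def)

lemma gaussian_variable_square_integrable:
  assumes "gaussian_variable M Z"
  shows "integrable M (\<lambda>\<omega>. (Z \<omega>)\<^sup>2)"
proof -
  note [measurable] = gaussian_variable_measurable[OF assms]
  from assms consider \<mu> \<sigma> where "0 < \<sigma>" "distributed M lborel Z (normal_density \<mu> \<sigma>)"
    | c where "AE \<omega> in M. Z \<omega> = c" by (auto simp: gaussian_variable_def)
  then show ?thesis
  proof cases
    case (1 \<mu> \<sigma>)
    have "integrable lborel (\<lambda>x. normal_density \<mu> \<sigma> x * (x - \<mu>)\<^sup>2
        + 2 * \<mu> * (normal_density \<mu> \<sigma> x * x) - \<mu>\<^sup>2 * normal_density \<mu> \<sigma> x)"
      using 1(1) by (intro Bochner_Integration.integrable_add Bochner_Integration.integrable_diff Bochner_Integration.integrable_mult_right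
          integrable_normal_moment integrable_normal_moment_nz_1 integrable_normal_density)
    moreover have "(\<lambda>x. normal_density \<mu> \<sigma> x * (x - \<mu>)\<^sup>2
        + 2 * \<mu> * (normal_density \<mu> \<sigma> x * x) - \<mu>\<^sup>2 * normal_density \<mu> \<sigma> x)
      = (\<lambda>x. normal_density \<mu> \<sigma> x * x\<^sup>2)"
      by (auto simp: fun_eq_iff power2_eq_square algebra_simps)
    ultimately have "integrable lborel (\<lambda>x. normal_density \<mu> \<sigma> x * x\<^sup>2)" by simp
    then show ?thesis
      by (subst distributed_integrable[OF 1(2), symmetric]) auto
  next
    case (2 c)
    have "integrable M (\<lambda>\<omega>. c\<^sup>2)" by simp
    then show ?thesis
      by (rule integrable_cong_AE_imp) (use 2 in auto)
  qed
qed

lemma gaussian_variable_integrable: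
  "gaussian_variable M Z \<Longrightarrow> integrable M Z"
  by (rule square_integrable_imp_integrable)
     (auto intro: gaussian_variable_measurable gaussian_variable_square_integrable)

lemma gaussian_variable_mult_integrable:
  assumes "gaussian_variable M Y" "gaussian_variable M Z"
  shows "integrable M (\<lambda>\<omega>. Y \<omega> * Z \<omega>)"
proof (rule Bochner_Integration.integrable_bound)
  show "integrable M (\<lambda>\<omega>. (Y \<omega>)\<^sup>2 + (Z \<omega>)\<^sup>2)"
    using assms by (intro Bochner_Integration.integrable_add gaussian_variable_square_integrable)
  note [measurable] = assms[THEN gaussian_variable_measurable]
  show "(\<lambda>\<omega>. Y \<omega> * Z \<omega>) \<in> borel_measurable M" by measurable
  have "\<bar>y * z\<bar> \<le> y\<^sup>2 + z\<^sup>2" for y z :: real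
  proof -
    have "0 \<le> (\<bar>y\<bar> - \<bar>z\<bar>)\<^sup>2" by simp
    then have "2 * (\<bar>y\<bar> * \<bar>z\<bar>) \<le> y\<^sup>2 + z\<^sup>2" by (simp add: power2_eq_square algebra_simps)
    moreover have "0 \<le> \<bar>y\<bar> * \<bar>z\<bar>" by simp
    ultimately show ?thesis unfolding abs_mult by linarith
  qed
  then show "AE \<omega> in M. norm (Y \<omega> * Z \<omega>) \<le> norm ((Y \<omega>)\<^sup>2 + (Z \<omega>)\<^sup>2)"
    by (intro AE_I2) (smt (verit) real_norm_def zero_le_power2)
qed

lemma centered_gaussian_distributed:
  assumes Z: "gaussian_variable M Z" "expectation Z = 0" and v: "0 < expectation (\<lambda>\<omega>. (Z \<omega>)\<^sup>2)"
  shows "distributed M lborel Z (normal_density 0 (sqrt (expectation (\<lambda>\<omega>. (Z \<omega>)\<^sup>2))))"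
proof -
  note [measurable] = gaussian_variable_measurable[OF Z(1)]
  from Z(1) consider \<mu> \<sigma> where "0 < \<sigma>" "distributed M lborel Z (normal_density \<mu> \<sigma>)"
    | c where "AE \<omega> in M. Z \<omega> = c" by (auto simp: gaussian_variable_def)
  then show ?thesis
  proof cases
    case (1 \<mu> \<sigma>)
    have "\<mu> = 0" using normal_distributed_expectation[OF 1] Z by simp
    moreover have "expectation (\<lambda>\<omega>. (Z \<omega>)\<^sup>2) = \<sigma>\<^sup>2"
      using normal_distributed_variance[OF 1] Z by simp
    ultimately show ?thesis using 1 by simp
  next
    case (2 c)
    have "expectation Z = expectation (\<lambda>_. c)" by (rule integral_cong_AE) (use 2 in auto)
    moreover have "expectation (\<lambda>\<omega>. (Z \<omega>)\<^sup>2) = expectation (\<lambda>_. c\<^sup>2)"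
      by (rule integral_cong_AE) (use 2 in auto)
    ultimately show ?thesis using Z v by (simp add: prob_space)
  qed
qed

lemma centered_gaussian_AE_0:
  assumes Z: "gaussian_variable M Z" and v: "expectation (\<lambda>\<omega>. (Z \<omega>)\<^sup>2) = 0"
  shows "AE \<omega> in M. Z \<omega> = 0"
  using integral_nonneg_eq_0_iff_AE[OF gaussian_variable_square_integrable[OF Z]] v by simp

text \<open>
  Characteristic functions are handled through their real and imaginary parts, because the
  uniqueness argument below works with real weights.
\<close>

lemma centered_gaussian_cos_sin:
  assumes Z: "gaussian_variable M Z" "expectation Z = 0"
  shows "expectation (\<lambda>\<omega>. cos (Z \<omega>)) = exp (- expectation (\<lambda>\<omega>. (Z \<omega>)\<^sup>2) / 2)"
    and "expectation (\<lambda>\<omega>. sin (Z \<omega>)) = 0"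
proof -
  note [measurable] = gaussian_variable_measurable[OF Z(1)]
  let ?v = "expectation (\<lambda>\<omega>. (Z \<omega>)\<^sup>2)"
  have "expectation (\<lambda>\<omega>. cos (Z \<omega>)) = exp (- ?v / 2) \<and> expectation (\<lambda>\<omega>. sin (Z \<omega>)) = 0"
  proof (cases "?v = 0")
    case True
    have AE: "AE \<omega> in M. Z \<omega> = 0" by (rule centered_gaussian_AE_0[OF Z(1) True])
    have "expectation (\<lambda>\<omega>. cos (Z \<omega>)) = expectation (\<lambda>\<omega>. 1)"
      by (rule integral_cong_AE) (use AE in auto)
    moreover have "expectation (\<lambda>\<omega>. sin (Z \<omega>)) = expectation (\<lambda>\<omega>. 0)"
      by (rule integral_cong_AE) (use AE in auto)
    ultimately show ?thesis using True by (simp add: prob_space)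
  next
    case False
    moreover have "0 \<le> ?v" by simp
    ultimately have v: "0 < ?v" by linarith
    define \<sigma> where "\<sigma> = sqrt ?v"
    have \<sigma>: "0 < \<sigma>" "\<sigma>\<^sup>2 = ?v" using v by (auto simp: \<sigma>_def)
    have "distributed M lborel (\<lambda>\<omega>. (Z \<omega> - 0) / \<sigma>) std_normal_density"
      using centered_gaussian_distributed[OF Z v] normal_standard_normal_convert[OF \<sigma>(1)]
      by (simp add: \<sigma>_def)
    then have d: "distr M lborel (\<lambda>\<omega>. Z \<omega> / \<sigma>) = std_normal_distribution"
      by (simp add: distributed_distr_eq_density)
    have "distr M borel (\<lambda>\<omega>. Z \<omega> / \<sigma>) = distr M lborel (\<lambda>\<omega>. Z \<omega> / \<sigma>)"
      by (rule distr_cong) auto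
    then have "char (distr M borel (\<lambda>\<omega>. Z \<omega> / \<sigma>)) \<sigma> = of_real (exp (- (\<sigma>\<^sup>2) / 2))"
      by (simp add: d char_std_normal_distribution)
    moreover have "char (distr M borel (\<lambda>\<omega>. Z \<omega> / \<sigma>)) \<sigma> = (CLINT \<omega>|M. iexp (Z \<omega>))"
      unfolding char_def by (subst integral_distr) (use \<sigma> in auto)
    ultimately have *: "(CLINT \<omega>|M. iexp (Z \<omega>)) = of_real (exp (- ?v / 2))" by (simp add: \<sigma>)
    have int: "complex_integrable M (\<lambda>\<omega>. iexp (Z \<omega>))"
      by (rule integrable_const_bound[of _ 1]) auto
    have "Re (CLINT \<omega>|M. iexp (Z \<omega>)) = expectation (\<lambda>\<omega>. cos (Z \<omega>))"
      using integral_Re[OF int] by (simp add: Re_exp)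
    moreover have "Im (CLINT \<omega>|M. iexp (Z \<omega>)) = expectation (\<lambda>\<omega>. sin (Z \<omega>))"
      using integral_Im[OF int] by (simp add: Im_exp)
    ultimately show ?thesis using * by simp
  qed
  then show "expectation (\<lambda>\<omega>. cos (Z \<omega>)) = exp (- ?v / 2)" "expectation (\<lambda>\<omega>. sin (Z \<omega>)) = 0"
    by auto
qed

end

locale centered_gaussian = prob_space M for M :: "'w measure" +
  fixes A :: "'i set" and C :: "'i \<Rightarrow> 'i \<Rightarrow> real" and X :: "'i \<Rightarrow> 'w \<Rightarrow> real"
  assumes vector: "centered_gaussian_vector M A C X"
begin

lemma finite_index: "finite A"
  using vector by (simp add: centered_gaussian_vector_def gaussian_vector_def)

lemma gaussian_combination: "gaussian_variable M (\<lambda>\<omega>. \<Sum>\<alpha>\<in>A. c \<alpha> * X \<alpha> \<omega>)"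
  using vector by (simp add: centered_gaussian_vector_def gaussian_vector_def)

lemma gaussian_combination_subset:
  assumes "B \<subseteq> A"
  shows "gaussian_variable M (\<lambda>\<omega>. \<Sum>\<alpha>\<in>B. c \<alpha> * X \<alpha> \<omega>)"
proof -
  have "(\<Sum>\<alpha>\<in>B. c \<alpha> * X \<alpha> \<omega>) = (\<Sum>\<alpha>\<in>A. (if \<alpha> \<in> B then c \<alpha> else 0) * X \<alpha> \<omega>)" for \<omega>
    using assms by (intro sum.mono_neutral_cong_left finite_index) auto
  then show ?thesis using gaussian_combination[of "\<lambda>\<alpha>. if \<alpha> \<in> B then c \<alpha> else 0"] by simp
qed

lemma gaussian_coordinate: "\<alpha> \<in> A \<Longrightarrow> gaussian_variable M (X \<alpha>)"
  using gaussian_combination_subset[of "{\<alpha>}" "\<lambda>_. 1"] by simp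

lemma coordinate_measurable [measurable (raw)]: "\<alpha> \<in> A \<Longrightarrow> X \<alpha> \<in> borel_measurable M"
  by (rule gaussian_variable_measurable[OF gaussian_coordinate])

lemma expectation_coordinate: "\<alpha> \<in> A \<Longrightarrow> expectation (X \<alpha>) = 0"
  using vector by (simp add: centered_gaussian_vector_def)

lemma covariance: "\<alpha> \<in> A \<Longrightarrow> \<beta> \<in> A \<Longrightarrow> expectation (\<lambda>\<omega>. X \<alpha> \<omega> * X \<beta> \<omega>) = C \<alpha> \<beta>"
  using vector by (simp add: centered_gaussian_vector_def)

lemma covariance_commute: "\<alpha> \<in> A \<Longrightarrow> \<beta> \<in> A \<Longrightarrow> C \<alpha> \<beta> = C \<beta> \<alpha>"
  using covariance[of \<alpha> \<beta>] covariance[of \<beta> \<alpha>] by (simp add: mult.commute)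

lemma expectation_combination:
  assumes "B \<subseteq> A"
  shows "expectation (\<lambda>\<omega>. \<Sum>\<alpha>\<in>B. c \<alpha> * X \<alpha> \<omega>) = 0"
  using assms gaussian_variable_integrable[OF gaussian_coordinate] expectation_coordinate
  by (subst Bochner_Integration.integral_sum) (auto intro!: sum.neutral)

lemma covariance_combination:
  assumes "B \<subseteq> A" "D \<subseteq> A"
  shows "expectation (\<lambda>\<omega>. (\<Sum>\<alpha>\<in>B. c \<alpha> * X \<alpha> \<omega>) * (\<Sum>\<beta>\<in>D. e \<beta> * X \<beta> \<omega>))
    = (\<Sum>\<alpha>\<in>B. \<Sum>\<beta>\<in>D. c \<alpha> * e \<beta> * C \<alpha> \<beta>)"
proof -
  have int: "integrable M (\<lambda>\<omega>. X \<alpha> \<omega> * X \<beta> \<omega>)" if "\<alpha> \<in> B" "\<beta> \<in> D" for \<alpha> \<beta>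
    using that assms by (intro gaussian_variable_mult_integrable gaussian_coordinate) auto
  have "expectation (\<lambda>\<omega>. (\<Sum>\<alpha>\<in>B. c \<alpha> * X \<alpha> \<omega>) * (\<Sum>\<beta>\<in>D. e \<beta> * X \<beta> \<omega>))
      = expectation (\<lambda>\<omega>. \<Sum>\<alpha>\<in>B. \<Sum>\<beta>\<in>D. c \<alpha> * e \<beta> * (X \<alpha> \<omega> * X \<beta> \<omega>))"
    by (intro Bochner_Integration.integral_cong) (auto simp: sum_product mult_ac)
  also have "\<dots> = (\<Sum>\<alpha>\<in>B. \<Sum>\<beta>\<in>D. c \<alpha> * e \<beta> * expectation (\<lambda>\<omega>. X \<alpha> \<omega> * X \<beta> \<omega>))"
    using int by (simp add: Bochner_Integration.integral_sum)
  also have "\<dots> = (\<Sum>\<alpha>\<in>B. \<Sum>\<beta>\<in>D. c \<alpha> * e \<beta> * C \<alpha> \<beta>)"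
    using assms by (intro sum.cong) (auto simp: covariance subset_iff)
  finally show ?thesis .
qed

definition variance_form :: "'i set \<Rightarrow> ('i \<Rightarrow> real) \<Rightarrow> real" where
  "variance_form B c = (\<Sum>\<alpha>\<in>B. \<Sum>\<beta>\<in>B. c \<alpha> * c \<beta> * C \<alpha> \<beta>)"

lemma cos_sin_combination:
  assumes "B \<subseteq> A"
  shows "expectation (\<lambda>\<omega>. cos (\<Sum>\<alpha>\<in>B. c \<alpha> * X \<alpha> \<omega>)) = exp (- variance_form B c / 2)"
    and "expectation (\<lambda>\<omega>. sin (\<Sum>\<alpha>\<in>B. c \<alpha> * X \<alpha> \<omega>)) = 0"
  using centered_gaussian_cos_sin[OF gaussian_combination_subset[OF assms, of c] expectation_combination[OF assms]]
    covariance_combination[OF assms assms, of c c]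
  by (auto simp: variance_form_def power2_eq_square)

end

subsection \<open>Laws are determined by their characteristic functions\<close>

text \<open>
  This is Levy's uniqueness theorem for the laws of \<open>Y\<close> and \<open>Y'\<close> under the
  probability measures with densities proportional to \<open>W\<close> and \<open>W'\<close>. The
  weights let random vectors be treated one coordinate at a time.
\<close>

lemma weighted_char_unique:
  fixes M :: "'a measure" and M' :: "'b measure"
  assumes "prob_space M" "prob_space M'"
  assumes meas [measurable]: "W \<in> borel_measurable M" "W' \<in> borel_measurable M'"
    "Y \<in> borel_measurable M" "Y' \<in> borel_measurable M'" "\<phi> \<in> borel_measurable borel"
  assumes W: "\<And>x. 0 \<le> W x" "\<And>x. W x \<le> B" "\<And>x. 0 \<le> W' x" "\<And>x. W' x \<le> B"
  assumes cos: "\<And>t. (\<integral>x. W x * cos (t * Y x) \<partial>M) = (\<integral>x. W' x * cos (t * Y' x) \<partial>M')"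
  assumes sin: "\<And>t. (\<integral>x. W x * sin (t * Y x) \<partial>M) = (\<integral>x. W' x * sin (t * Y' x) \<partial>M')"
  shows "(\<integral>x. W x * \<phi> (Y x) \<partial>M) = (\<integral>x. W' x * (\<phi> (Y' x) :: real) \<partial>M')"
proof -
  interpret M: prob_space M by fact
  interpret M': prob_space M' by fact
  \<comment> \<open>Both weights have the same total mass, by the cosine identity at \<open>t = 0\<close>.\<close>
  define m where "m = (\<integral>x. W x \<partial>M)"
  have m': "m = (\<integral>x. W' x \<partial>M')" using cos[of 0] by (simp add: m_def)
  have int: "integrable M W" by (rule M.bounded_integrable[of _ B]) (use W in auto)
  have int': "integrable M' W'" by (rule M'.bounded_integrable[of _ B]) (use W in auto)
  show ?thesis
  proof (cases "m = 0")
    case True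
    have "AE x in M. W x = 0" using integral_nonneg_eq_0_iff_AE[OF int] W True by (simp add: m_def)
    then have "(\<integral>x. W x * \<phi> (Y x) \<partial>M) = 0" by (intro integral_eq_zero_AE) auto
    moreover have "AE x in M'. W' x = 0" using integral_nonneg_eq_0_iff_AE[OF int'] W True by (simp add: m')
    then have "(\<integral>x. W' x * \<phi> (Y' x) \<partial>M') = 0" by (intro integral_eq_zero_AE) auto
    ultimately show ?thesis by simp
  next
    case False
    moreover have "0 \<le> m" unfolding m_def by (intro integral_nonneg_AE) (use W in auto)
    ultimately have m: "0 < m" by simp
    define D where "D = distr (density M (\<lambda>x. ennreal (W x / m))) borel Y"
    define D' where "D' = distr (density M' (\<lambda>x. ennreal (W' x / m))) borel Y'"
    have rd: "real_distribution D"
    proof -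
      have "emeasure (density M (\<lambda>x. ennreal (W x / m))) (space M) = (\<integral>\<^sup>+x. ennreal (W x / m) \<partial>M)"
        by (subst emeasure_density) (auto intro!: nn_integral_cong)
      also have "\<dots> = ennreal (\<integral>x. W x / m \<partial>M)"
        by (rule nn_integral_eq_integral) (use int W m in auto)
      also have "\<dots> = 1" using m by (simp add: m_def)
      finally have "prob_space (density M (\<lambda>x. ennreal (W x / m)))" by (intro prob_spaceI) simp
      then have "prob_space D" unfolding D_def by (rule prob_space.prob_space_distr) simp
      then show ?thesis by (simp add: real_distribution_def real_distribution_axioms_def D_def)
    qed
    have rd': "real_distribution D'"
    proof -
      have "emeasure (density M' (\<lambda>x. ennreal (W' x / m))) (space M') = (\<integral>\<^sup>+x. ennreal (W' x / m) \<partial>M')"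
        by (subst emeasure_density) (auto intro!: nn_integral_cong)
      also have "\<dots> = ennreal (\<integral>x. W' x / m \<partial>M')"
        by (rule nn_integral_eq_integral) (use int' W m in auto)
      also have "\<dots> = 1" using m by (simp add: m')
      finally have "prob_space (density M' (\<lambda>x. ennreal (W' x / m)))" by (intro prob_spaceI) simp
      then have "prob_space D'" unfolding D'_def by (rule prob_space.prob_space_distr) simp
      then show ?thesis by (simp add: real_distribution_def real_distribution_axioms_def D'_def)
    qed
    have int_D: "(\<integral>y. f y \<partial>D) = (\<integral>x. W x * f (Y x) \<partial>M) / m"
      if [measurable]: "f \<in> borel_measurable borel" for f :: "real \<Rightarrow> real"
      unfolding D_def using W m
      by (subst integral_distr, simp, simp, subst integral_density) (auto simp: field_simps)
    have int_D': "(\<integral>y. f y \<partial>D') = (\<integral>x. W' x * f (Y' x) \<partial>M') / m"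
      if [measurable]: "f \<in> borel_measurable borel" for f :: "real \<Rightarrow> real"
      unfolding D'_def using W m
      by (subst integral_distr, simp, simp, subst integral_density) (auto simp: field_simps)
    have char_eq: "char N t = Complex (\<integral>y. cos (t * y) \<partial>N) (\<integral>y. sin (t * y) \<partial>N)"
      if "real_distribution N" for N t
    proof -
      interpret N: real_distribution N by fact
      have int: "complex_integrable N (\<lambda>y. iexp (t * y))"
        by (rule N.integrable_const_bound[of _ 1]) auto
      have "Re (char N t) = (\<integral>y. cos (t * y) \<partial>N)"
        using integral_Re[OF int] by (simp add: char_def Re_exp)
      moreover have "Im (char N t) = (\<integral>y. sin (t * y) \<partial>N)"
        using integral_Im[OF int] by (simp add: char_def Im_exp)
      ultimately show ?thesis by (simp add: complex_eq_iff)
    qed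
    have "char D = char D'"
      by (rule ext) (simp add: char_eq rd rd' int_D int_D' cos sin)
    then have "D = D'" by (rule Levy_uniqueness[OF rd rd'])
    then have "(\<integral>x. W x * \<phi> (Y x) \<partial>M) / m = (\<integral>x. W' x * \<phi> (Y' x) \<partial>M') / m"
      by (simp flip: int_D int_D')
    then show ?thesis using m by simp
  qed
qed

text \<open>
  Uniqueness for random vectors from uniqueness on the line: starting from the characteristic
  function, trigonometric factors are exchanged for the functions \<open>\<phi> i\<close> one
  coordinate at a time. The trigonometric factor of the remaining coordinates acts as a weight, made
  non-negative by adding one.
\<close>

lemma product_expectation_unique:
  fixes M :: "'a measure" and M' :: "'b measure" and X :: "'i \<Rightarrow> 'a \<Rightarrow> real" and X' :: "'i \<Rightarrow> 'b \<Rightarrow> real"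
  assumes "prob_space M" "prob_space M'" and fin: "finite I"
  assumes X: "\<And>i. i \<in> I \<Longrightarrow> X i \<in> borel_measurable M" "\<And>i. i \<in> I \<Longrightarrow> X' i \<in> borel_measurable M'"
  assumes \<phi>: "\<And>i. i \<in> I \<Longrightarrow> \<phi> i \<in> borel_measurable borel" "\<And>i x. 0 \<le> \<phi> i x" "\<And>i x. \<phi> i x \<le> (1 :: real)"
  assumes cos: "\<And>c. (\<integral>x. cos (\<Sum>i\<in>I. c i * X i x) \<partial>M) = (\<integral>x. cos (\<Sum>i\<in>I. c i * X' i x) \<partial>M')"
  assumes sin: "\<And>c. (\<integral>x. sin (\<Sum>i\<in>I. c i * X i x) \<partial>M) = (\<integral>x. sin (\<Sum>i\<in>I. c i * X' i x) \<partial>M')"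
  shows "(\<integral>x. (\<Prod>i\<in>I. \<phi> i (X i x)) \<partial>M) = (\<integral>x. (\<Prod>i\<in>I. \<phi> i (X' i x)) \<partial>M')"
proof -
  interpret M: prob_space M by fact
  interpret M': prob_space M' by fact
  let ?P = "\<lambda>J x. \<Prod>i\<in>J. \<phi> i (X i x)" and ?P' = "\<lambda>J x. \<Prod>i\<in>J. \<phi> i (X' i x)"
  let ?S = "\<lambda>J c x. \<Sum>i\<in>I - J. c i * X i x" and ?S' = "\<lambda>J c x. \<Sum>i\<in>I - J. c i * X' i x"
  have P: "0 \<le> ?P J x" "?P J x \<le> 1" for J x using \<phi> by (auto intro: prod_nonneg prod_le_1)
  have P': "0 \<le> ?P' J x" "?P' J x \<le> 1" for J x using \<phi> by (auto intro: prod_nonneg prod_le_1)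
  have P_meas: "?P J \<in> borel_measurable M" "?P' J \<in> borel_measurable M'" if "J \<subseteq> I" for J
    using that X \<phi> by (auto intro!: borel_measurable_prod intro: measurable_compose[OF X(1)] measurable_compose[OF X(2)])
  have S_meas: "?S J c \<in> borel_measurable M" "?S' J c \<in> borel_measurable M'" for J c
    using X by auto
  have "J \<subseteq> I \<Longrightarrow> \<forall>c. (\<integral>x. ?P J x * cos (?S J c x) \<partial>M) = (\<integral>x. ?P' J x * cos (?S' J c x) \<partial>M') \<and>
      (\<integral>x. ?P J x * sin (?S J c x) \<partial>M) = (\<integral>x. ?P' J x * sin (?S' J c x) \<partial>M')" if "finite J" for J
    using that
  proof (induction J rule: finite_induct)
    case empty
    then show ?case using cos sin by simp
  next
    case (insert k J)
    then have k: "k \<in> I" "k \<notin> J" and J: "J \<subseteq> I" "finite J" by auto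
    have IH_cos: "(\<integral>x. ?P J x * cos (?S J c x) \<partial>M) = (\<integral>x. ?P' J x * cos (?S' J c x) \<partial>M')"
      and IH_sin: "(\<integral>x. ?P J x * sin (?S J c x) \<partial>M) = (\<integral>x. ?P' J x * sin (?S' J c x) \<partial>M')" for c
      using insert.IH J by auto
    note [measurable] = P_meas[OF J(1)] S_meas X(1)[OF k(1)] X(2)[OF k(1)] \<phi>(1)[OF k(1)]
    let ?Q = "?S (insert k J)" and ?Q' = "?S' (insert k J)"
    have split: "?S J (c(k := t)) x = ?Q c x + t * X k x" "?S' J (c(k := t)) y = ?Q' c y + t * X' k y" for c t x y
    proof -
      have rm: "(\<Sum>i\<in>I - J. (c(k := t)) i * f i) = (\<Sum>i\<in>I - insert k J. c i * f i) + t * f k" for f :: "'i \<Rightarrow> real"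
      proof -
        have "(\<Sum>i\<in>I - J. (c(k := t)) i * f i) = (c(k := t)) k * f k + (\<Sum>i\<in>I - J - {k}. (c(k := t)) i * f i)"
          using k fin by (intro sum.remove) auto
        also have "(\<Sum>i\<in>I - J - {k}. (c(k := t)) i * f i) = (\<Sum>i\<in>I - insert k J. c i * f i)"
          by (rule sum.cong) auto
        finally show ?thesis by simp
      qed
      show "?S J (c(k := t)) x = ?Q c x + t * X k x" "?S' J (c(k := t)) y = ?Q' c y + t * X' k y"
        by (rule rm)+
    qed
    have int: "integrable M (\<lambda>x. ?P J x * f x)" if [measurable]: "f \<in> borel_measurable M" and "\<And>x. \<bar>f x\<bar> \<le> 1" for f
      by (rule M.bounded_integrable[of _ 1]) (auto simp: abs_mult P intro!: mult_le_one that)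
    have int': "integrable M' (\<lambda>x. ?P' J x * f x)" if [measurable]: "f \<in> borel_measurable M'" and "\<And>x. \<bar>f x\<bar> \<le> 1" for f
      by (rule M'.bounded_integrable[of _ 1]) (auto simp: abs_mult P' intro!: mult_le_one that)
    have cc: "(\<integral>x. ?P J x * (cos (?Q c x) * cos (t * X k x)) \<partial>M) = (\<integral>x. ?P' J x * (cos (?Q' c x) * cos (t * X' k x)) \<partial>M')"
      and cs: "(\<integral>x. ?P J x * (cos (?Q c x) * sin (t * X k x)) \<partial>M) = (\<integral>x. ?P' J x * (cos (?Q' c x) * sin (t * X' k x)) \<partial>M')"
      and sc: "(\<integral>x. ?P J x * (sin (?Q c x) * cos (t * X k x)) \<partial>M) = (\<integral>x. ?P' J x * (sin (?Q' c x) * cos (t * X' k x)) \<partial>M')"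
      and ss: "(\<integral>x. ?P J x * (sin (?Q c x) * sin (t * X k x)) \<partial>M) = (\<integral>x. ?P' J x * (sin (?Q' c x) * sin (t * X' k x)) \<partial>M')" for c t
    proof -
      note IHc = IH_cos[of "c(k := t)", unfolded split] IH_cos[of "c(k := -t)", unfolded split]
      note IHs = IH_sin[of "c(k := t)", unfolded split] IH_sin[of "c(k := -t)", unfolded split]
      have c: "(\<integral>x. ?P J x * cos (?Q c x + s * X k x) \<partial>M) =
          (\<integral>x. ?P J x * (cos (?Q c x) * cos (s * X k x)) \<partial>M) - (\<integral>x. ?P J x * (sin (?Q c x) * sin (s * X k x)) \<partial>M)"
        and s: "(\<integral>x. ?P J x * sin (?Q c x + s * X k x) \<partial>M) =
          (\<integral>x. ?P J x * (sin (?Q c x) * cos (s * X k x)) \<partial>M) + (\<integral>x. ?P J x * (cos (?Q c x) * sin (s * X k x)) \<partial>M)" for s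
        unfolding cos_add sin_add right_diff_distrib distrib_left
        by (intro Bochner_Integration.integral_diff Bochner_Integration.integral_add int;
            auto intro!: mult_le_one simp: abs_mult)+
      have c': "(\<integral>x. ?P' J x * cos (?Q' c x + s * X' k x) \<partial>M') =
          (\<integral>x. ?P' J x * (cos (?Q' c x) * cos (s * X' k x)) \<partial>M') - (\<integral>x. ?P' J x * (sin (?Q' c x) * sin (s * X' k x)) \<partial>M')"
        and s': "(\<integral>x. ?P' J x * sin (?Q' c x + s * X' k x) \<partial>M') =
          (\<integral>x. ?P' J x * (sin (?Q' c x) * cos (s * X' k x)) \<partial>M') + (\<integral>x. ?P' J x * (cos (?Q' c x) * sin (s * X' k x)) \<partial>M')" for s
        unfolding cos_add sin_add right_diff_distrib distrib_left
        by (intro Bochner_Integration.integral_diff Bochner_Integration.integral_add int';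
            auto intro!: mult_le_one simp: abs_mult)+
      show "(\<integral>x. ?P J x * (cos (?Q c x) * cos (t * X k x)) \<partial>M) = (\<integral>x. ?P' J x * (cos (?Q' c x) * cos (t * X' k x)) \<partial>M')"
        "(\<integral>x. ?P J x * (cos (?Q c x) * sin (t * X k x)) \<partial>M) = (\<integral>x. ?P' J x * (cos (?Q' c x) * sin (t * X' k x)) \<partial>M')"
        "(\<integral>x. ?P J x * (sin (?Q c x) * cos (t * X k x)) \<partial>M) = (\<integral>x. ?P' J x * (sin (?Q' c x) * cos (t * X' k x)) \<partial>M')"
        "(\<integral>x. ?P J x * (sin (?Q c x) * sin (t * X k x)) \<partial>M) = (\<integral>x. ?P' J x * (sin (?Q' c x) * sin (t * X' k x)) \<partial>M')"
        using IHc IHs unfolding c s c' s' by simp_all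
    qed
    have base_c: "(\<integral>x. ?P J x * cos (t * X k x) \<partial>M) = (\<integral>x. ?P' J x * cos (t * X' k x) \<partial>M')"
      and base_s: "(\<integral>x. ?P J x * sin (t * X k x) \<partial>M) = (\<integral>x. ?P' J x * sin (t * X' k x) \<partial>M')" for t
      using cc[of "\<lambda>_. 0" t] cs[of "\<lambda>_. 0" t] by simp_all
    have base: "(\<integral>x. ?P J x * \<phi> k (X k x) \<partial>M) = (\<integral>x. ?P' J x * \<phi> k (X' k x) \<partial>M')"
      by (rule weighted_char_unique[where B=1 and W="?P J" and Y="X k" and \<phi>="\<phi> k" and W'="?P' J" and Y'="X' k", OF \<open>prob_space M\<close> \<open>prob_space M'\<close>])
         (auto simp: P P' base_c base_s)
    have trig: "(\<integral>x. ?P J x * f (?Q c x) * \<phi> k (X k x) \<partial>M) = (\<integral>x. ?P' J x * f (?Q' c x) * \<phi> k (X' k x) \<partial>M')"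
      if f [measurable]: "f \<in> borel_measurable borel" "\<And>y. \<bar>f y\<bar> \<le> 1"
        and fc: "\<And>t. (\<integral>x. ?P J x * (f (?Q c x) * cos (t * X k x)) \<partial>M) = (\<integral>x. ?P' J x * (f (?Q' c x) * cos (t * X' k x)) \<partial>M')"
        and fs: "\<And>t. (\<integral>x. ?P J x * (f (?Q c x) * sin (t * X k x)) \<partial>M) = (\<integral>x. ?P' J x * (f (?Q' c x) * sin (t * X' k x)) \<partial>M')"
      for f :: "real \<Rightarrow> real" and c
    proof -
      have f1: "0 \<le> 1 + f y" "1 + f y \<le> 2" for y using f(2)[of y] by linarith+
      have le2: "p * (1 + f y) \<le> 2" if "0 \<le> p" "p \<le> 1" for p y
        using mult_mono[OF that(2) f1(2)[of y] _ f1(1)[of y]] by simp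
      have "(\<integral>x. ?P J x * (1 + f (?Q c x)) * \<phi> k (X k x) \<partial>M) = (\<integral>x. ?P' J x * (1 + f (?Q' c x)) * \<phi> k (X' k x) \<partial>M')"
      proof (rule weighted_char_unique[where B=2 and W="\<lambda>x. ?P J x * (1 + f (?Q c x))" and Y="X k" and \<phi>="\<phi> k"
            and W'="\<lambda>x. ?P' J x * (1 + f (?Q' c x))" and Y'="X' k", OF \<open>prob_space M\<close> \<open>prob_space M'\<close>])
        show "(\<integral>x. ?P J x * (1 + f (?Q c x)) * cos (t * X k x) \<partial>M) = (\<integral>x. ?P' J x * (1 + f (?Q' c x)) * cos (t * X' k x) \<partial>M')"
          "(\<integral>x. ?P J x * (1 + f (?Q c x)) * sin (t * X k x) \<partial>M) = (\<integral>x. ?P' J x * (1 + f (?Q' c x)) * sin (t * X' k x) \<partial>M')" for t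
          using base_c[of t] base_s[of t] fc[of t] fs[of t]
          by (simp_all add: distrib_left distrib_right mult.assoc int int' abs_mult mult_le_one f)
      qed (use P P' f1 le2 in \<open>auto intro: mult_nonneg_nonneg\<close>)
      then show ?thesis
        using base \<phi>(2,3)[of k]
        by (simp add: distrib_left distrib_right mult.assoc int int' abs_mult mult_le_one f)
    qed
    have prod: "?P (insert k J) x = ?P J x * \<phi> k (X k x)" "?P' (insert k J) y = ?P' J y * \<phi> k (X' k y)" for x y
      using k J by (simp_all add: mult.commute)
    show ?case
      using trig[of cos] trig[of sin] cc cs sc ss unfolding prod by (simp add: mult_ac)
  qed
  from this[OF fin subset_refl] show ?thesis by simp
qed

subsection \<open>Decoupling the coordinates of a Gaussian vector\<close>

lemma pair_expectation_mult:
  fixes f :: "'a \<Rightarrow> real" and g :: "'b \<Rightarrow> real"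
  assumes "prob_space M" "prob_space N"
  assumes meas [measurable]: "f \<in> borel_measurable M" "g \<in> borel_measurable N"
  assumes bound: "\<And>x. \<bar>f x\<bar> \<le> 1" "\<And>y. \<bar>g y\<bar> \<le> 1"
  shows "(\<integral>x. f (fst x) * g (snd x) \<partial>(M \<Otimes>\<^sub>M N)) = (\<integral>x. f x \<partial>M) * (\<integral>y. g y \<partial>N)"
proof -
  interpret M: prob_space M by fact
  interpret N: prob_space N by fact
  interpret pair_prob_space M N ..
  have int: "integrable (M \<Otimes>\<^sub>M N) (\<lambda>x. f (fst x) * g (snd x))"
    by (rule P.bounded_integrable[of _ 1]) (auto simp: abs_mult intro!: mult_le_one bound)
  have "(\<integral>x. f (fst x) * g (snd x) \<partial>(M \<Otimes>\<^sub>M N)) = (\<integral>x. (\<integral>y. f x * g y \<partial>N) \<partial>M)"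
    using integral_fst'[OF int] by simp
  then show ?thesis by simp
qed

lemma abs_prod_diff_le:
  fixes a b :: "'i \<Rightarrow> real"
  assumes "\<And>i. i \<in> I \<Longrightarrow> 0 \<le> a i \<and> a i \<le> 1" "\<And>i. i \<in> I \<Longrightarrow> 0 \<le> b i \<and> b i \<le> 1"
  shows "\<bar>(\<Prod>i\<in>I. a i) - (\<Prod>i\<in>I. b i)\<bar> \<le> (\<Sum>i\<in>I. \<bar>a i - b i\<bar>)"
  using norm_prod_diff[of I a b] assms by simp

context centered_gaussian
begin

abbreviation "pairs \<equiv> M \<Otimes>\<^sub>M M"

text \<open>
  The quotient is the regression coefficient of \<open>X i\<close> on \<open>X k\<close>; the
  component of \<open>X i\<close> along \<open>X k\<close> is taken from the second copy of the
  probability space.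
\<close>

definition resampled :: "'i \<Rightarrow> 'i \<Rightarrow> 'w \<times> 'w \<Rightarrow> real" where
  "resampled k i x = X i (fst x) + C i k / C k k * (X k (snd x) - X k (fst x))"

lemma prob_space_pairs: "prob_space pairs"
proof -
  interpret pair_prob_space M M ..
  show ?thesis by (rule P.prob_space_axioms)
qed

lemma resampled_measurable [measurable (raw)]:
  assumes [measurable (raw)]: "i \<in> A" "k \<in> A"
  shows "resampled k i \<in> borel_measurable pairs"
  unfolding resampled_def
  using measurable_compose[OF measurable_fst coordinate_measurable[OF assms(1)], of M]
    measurable_compose[OF measurable_fst coordinate_measurable[OF assms(2)], of M]
    measurable_compose[OF measurable_snd coordinate_measurable[OF assms(2)], of M]
  by (intro borel_measurable_add borel_measurable_times borel_measurable_diff borel_measurable_const) auto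

lemma expectation_fst:
  fixes f :: "'w \<Rightarrow> real"
  assumes f: "f \<in> borel_measurable M" "\<And>\<omega>. \<bar>f \<omega>\<bar> \<le> 1"
  shows "(\<integral>x. f (fst x) \<partial>pairs) = expectation f"
  using pair_expectation_mult[OF prob_space_axioms prob_space_axioms f(1), of "\<lambda>_. 1"] f
  by (simp add: prob_space)

lemma cos_sin_pair:
  assumes B: "B \<subseteq> A"
  shows "(\<integral>x. cos ((\<Sum>i\<in>B. p i * X i (fst x)) + (\<Sum>i\<in>B. q i * X i (snd x))) \<partial>pairs)
      = exp (- (variance_form B p + variance_form B q) / 2)"
    and "(\<integral>x. sin ((\<Sum>i\<in>B. p i * X i (fst x)) + (\<Sum>i\<in>B. q i * X i (snd x))) \<partial>pairs) = 0"
proof -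
  interpret P: prob_space pairs by (rule prob_space_pairs)
  have [measurable]: "(\<lambda>\<omega>. \<Sum>i\<in>B. c i * X i \<omega>) \<in> borel_measurable M" for c
    using gaussian_combination_subset[OF B] by (rule gaussian_variable_measurable)
  define S where "S c \<omega> = (\<Sum>i\<in>B. c i * X i \<omega>)" for c \<omega>
  have [measurable]: "S c \<in> borel_measurable M" for c unfolding S_def by measurable
  note mult = pair_expectation_mult[OF prob_space_axioms prob_space_axioms]
  have int: "integrable pairs (\<lambda>x. f (S p (fst x)) * g (S q (snd x)))"
    if [measurable]: "f \<in> borel_measurable borel" "g \<in> borel_measurable borel"
      and "\<And>x. \<bar>f x\<bar> \<le> 1" "\<And>x. \<bar>g x\<bar> \<le> 1" for f g :: "real \<Rightarrow> real"
    by (rule P.bounded_integrable[of _ 1]) (auto simp: abs_mult intro!: mult_le_one that)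
  have "(\<integral>x. cos (S p (fst x) + S q (snd x)) \<partial>pairs)
      = (\<integral>x. cos (S p (fst x)) * cos (S q (snd x)) \<partial>pairs) - (\<integral>x. sin (S p (fst x)) * sin (S q (snd x)) \<partial>pairs)"
    unfolding cos_add by (intro Bochner_Integration.integral_diff int) auto
  also have "\<dots> = expectation (\<lambda>\<omega>. cos (S p \<omega>)) * expectation (\<lambda>\<omega>. cos (S q \<omega>))
      - expectation (\<lambda>\<omega>. sin (S p \<omega>)) * expectation (\<lambda>\<omega>. sin (S q \<omega>))"
    by (subst (1 2) mult) auto
  also have "\<dots> = exp (- (variance_form B p + variance_form B q) / 2)"
    unfolding S_def by (simp add: cos_sin_combination[OF B] diff_divide_distrib flip: exp_add)
  finally show "(\<integral>x. cos ((\<Sum>i\<in>B. p i * X i (fst x)) + (\<Sum>i\<in>B. q i * X i (snd x))) \<partial>pairs)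
      = exp (- (variance_form B p + variance_form B q) / 2)" by (simp add: S_def)
  have "(\<integral>x. sin (S p (fst x) + S q (snd x)) \<partial>pairs)
      = (\<integral>x. sin (S p (fst x)) * cos (S q (snd x)) \<partial>pairs) + (\<integral>x. cos (S p (fst x)) * sin (S q (snd x)) \<partial>pairs)"
    unfolding sin_add by (intro Bochner_Integration.integral_add int) auto
  also have "\<dots> = expectation (\<lambda>\<omega>. sin (S p \<omega>)) * expectation (\<lambda>\<omega>. cos (S q \<omega>))
      + expectation (\<lambda>\<omega>. cos (S p \<omega>)) * expectation (\<lambda>\<omega>. sin (S q \<omega>))"
    by (subst (1 2) mult) auto
  also have "\<dots> = 0"
    unfolding S_def by (simp add: cos_sin_combination[OF B])
  finally show "(\<integral>x. sin ((\<Sum>i\<in>B. p i * X i (fst x)) + (\<Sum>i\<in>B. q i * X i (snd x))) \<partial>pairs) = 0"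
    by (simp add: S_def)
qed

lemma variance_form_insert:
  assumes "B \<subseteq> A" "k \<in> A" "k \<notin> B"
  shows "variance_form (insert k B) c =
    variance_form B c + 2 * c k * (\<Sum>i\<in>B. c i * C i k) + (c k)\<^sup>2 * C k k"
proof -
  have fin: "finite B" using assms finite_index finite_subset by blast
  have "(\<Sum>i\<in>B. c k * c i * C k i) = (\<Sum>i\<in>B. c k * c i * C i k)"
    using assms by (intro sum.cong refl) (metis covariance_commute subsetD)
  then show ?thesis using assms fin
    by (simp add: variance_form_def sum.distrib sum_distrib_left power2_eq_square algebra_simps)
qed

text \<open>
  The regression residuals are uncorrelated with \<open>X k\<close>. Hence the resampled coordinates
  together with \<open>X k\<close> of the first copy have the same characteristic function as the
  coordinates of the second copy together with \<open>X k\<close> of the first.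
\<close>

lemma resampled_independent:
  assumes B: "B \<subseteq> A" and k: "k \<in> A" "k \<notin> B" "0 < C k k"
  assumes \<phi>: "\<And>i. \<phi> i \<in> borel_measurable borel" "\<And>i x. 0 \<le> \<phi> i x" "\<And>i x. \<phi> i x \<le> (1 :: real)"
  shows "(\<integral>x. (\<Prod>i\<in>B. \<phi> i (resampled k i x)) * \<phi> k (X k (fst x)) \<partial>pairs)
    = expectation (\<lambda>\<omega>. \<Prod>i\<in>B. \<phi> i (X i \<omega>)) * expectation (\<lambda>\<omega>. \<phi> k (X k \<omega>))"
proof -
  have fin: "finite B" using B finite_index finite_subset by blast
  let ?I = "insert k B"
  have I: "?I \<subseteq> A" using B k by auto
  have fstX: "(\<lambda>x. X i (fst x)) \<in> borel_measurable pairs" and sndX: "(\<lambda>x. X i (snd x)) \<in> borel_measurable pairs"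
    if "i \<in> A" for i
    using measurable_compose[OF measurable_fst coordinate_measurable[OF that], of M]
      measurable_compose[OF measurable_snd coordinate_measurable[OF that], of M] by auto
  let ?U = "\<lambda>i x. if i = k then X k (fst x) else resampled k i x"
  let ?V = "\<lambda>i x. if i = k then X k (fst x) else X i (snd x)"
  have U: "(\<Sum>i\<in>?I. c i * ?U i x) = (\<Sum>i\<in>?I. (c(k := c k - (\<Sum>i\<in>B. c i * (C i k / C k k)))) i * X i (fst x))
        + (\<Sum>i\<in>?I. ((\<lambda>_. 0)(k := (\<Sum>i\<in>B. c i * (C i k / C k k)))) i * X i (snd x))" for c x
  proof -
    have *: "(\<Sum>i\<in>B. f i * (if i = k then a else g i)) = (\<Sum>i\<in>B. f i * g i)"
      "(\<Sum>i\<in>B. (if i = k then a else g i) * f i) = (\<Sum>i\<in>B. g i * f i)" for f g a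
      using k by (auto intro!: sum.cong)
    have "(\<Sum>i\<in>B. c i * resampled k i x) = (\<Sum>i\<in>B. c i * X i (fst x))
        + (\<Sum>i\<in>B. c i * (C i k / C k k)) * (X k (snd x) - X k (fst x))"
      by (simp add: resampled_def distrib_left sum.distrib sum_distrib_right mult.assoc)
    then show ?thesis using k fin by (simp add: * algebra_simps)
  qed
  have V: "(\<Sum>i\<in>?I. c i * ?V i x) = (\<Sum>i\<in>?I. ((\<lambda>_. 0)(k := c k)) i * X i (fst x))
        + (\<Sum>i\<in>?I. (c(k := 0)) i * X i (snd x))" for c x
  proof -
    have *: "(\<Sum>i\<in>B. f i * (if i = k then a else g i)) = (\<Sum>i\<in>B. f i * g i)"
      "(\<Sum>i\<in>B. (if i = k then a else g i) * f i) = (\<Sum>i\<in>B. g i * f i)" for f g a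
      using k by (auto intro!: sum.cong)
    show ?thesis using k fin by (simp add: *)
  qed
  have var: "variance_form ?I (c(k := c k - (\<Sum>i\<in>B. c i * (C i k / C k k)))) + variance_form ?I ((\<lambda>_. 0)(k := (\<Sum>i\<in>B. c i * (C i k / C k k))))
      = variance_form ?I ((\<lambda>_. 0)(k := c k)) + variance_form ?I (c(k := 0))" for c
  proof -
    define \<kappa> where "\<kappa> = (\<Sum>i\<in>B. c i * (C i k / C k k))"
    have \<kappa>: "(\<Sum>i\<in>B. c i * C i k) = \<kappa> * C k k"
      using k(3) by (simp add: \<kappa>_def sum_distrib_right)
    have vf: "variance_form B (c(k := t)) = variance_form B c" "variance_form B ((\<lambda>_. 0)(k := t)) = 0" for t
      using k by (auto simp: variance_form_def intro!: sum.cong sum.neutral)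
    have s: "(\<Sum>i\<in>B. (c(k := t)) i * C i k) = \<kappa> * C k k" "(\<Sum>i\<in>B. ((\<lambda>_. 0)(k := t)) i * C i k) = 0" for t
      using k by (auto simp flip: \<kappa> intro!: sum.cong sum.neutral)
    show ?thesis
      unfolding \<kappa>_def[symmetric] variance_form_insert[OF B k(1,2)] vf s
      by (simp add: power2_eq_square algebra_simps)
  qed
  have "(\<integral>x. (\<Prod>i\<in>?I. \<phi> i (?U i x)) \<partial>pairs) = (\<integral>x. (\<Prod>i\<in>?I. \<phi> i (?V i x)) \<partial>pairs)"
  proof (rule product_expectation_unique[where I="?I" and X="?U" and X'="?V" and \<phi>=\<phi>, OF prob_space_pairs prob_space_pairs])
    show "finite ?I" using fin by simp
    show "?U i \<in> borel_measurable pairs" "?V i \<in> borel_measurable pairs" if "i \<in> ?I" for i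
      using fstX sndX k that B by (cases "i = k"; force simp: subset_iff intro: resampled_measurable)+
    show "(\<integral>x. cos (\<Sum>i\<in>?I. c i * ?U i x) \<partial>pairs) = (\<integral>x. cos (\<Sum>i\<in>?I. c i * ?V i x) \<partial>pairs)"
      "(\<integral>x. sin (\<Sum>i\<in>?I. c i * ?U i x) \<partial>pairs) = (\<integral>x. sin (\<Sum>i\<in>?I. c i * ?V i x) \<partial>pairs)" for c
      unfolding U V cos_sin_pair[OF I] var by (rule refl)+
  qed (use \<phi> in auto)
  also have "(\<lambda>x. \<Prod>i\<in>?I. \<phi> i (?U i x)) = (\<lambda>x. (\<Prod>i\<in>B. \<phi> i (resampled k i x)) * \<phi> k (X k (fst x)))"
    using k fin by (auto simp: fun_eq_iff mult.commute intro!: prod.cong)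
  also have "(\<lambda>x. \<Prod>i\<in>?I. \<phi> i (?V i x)) = (\<lambda>x. \<phi> k (X k (fst x)) * (\<Prod>i\<in>B. \<phi> i (X i (snd x))))"
    using k fin by (auto simp: fun_eq_iff intro!: prod.cong)
  also have "(\<integral>x. \<phi> k (X k (fst x)) * (\<Prod>i\<in>B. \<phi> i (X i (snd x))) \<partial>pairs)
      = expectation (\<lambda>\<omega>. \<phi> k (X k \<omega>)) * expectation (\<lambda>\<omega>. \<Prod>i\<in>B. \<phi> i (X i \<omega>))"
  proof (rule pair_expectation_mult[OF prob_space_axioms prob_space_axioms])
    show "(\<lambda>\<omega>. \<phi> k (X k \<omega>)) \<in> borel_measurable M"
      using measurable_compose[OF coordinate_measurable[OF k(1)] \<phi>(1)] .
    show "(\<lambda>\<omega>. \<Prod>i\<in>B. \<phi> i (X i \<omega>)) \<in> borel_measurable M"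
      using B by (intro borel_measurable_prod measurable_compose[OF coordinate_measurable \<phi>(1)]) auto
  qed (use \<phi> in \<open>auto simp: prod_nonneg abs_of_nonneg intro!: prod_le_1\<close>)
  finally show ?thesis by (simp add: mult.commute)
qed

definition coupling_error :: "('i \<Rightarrow> real \<Rightarrow> real) \<Rightarrow> 'i \<Rightarrow> 'i \<Rightarrow> real" where
  "coupling_error \<phi> i k =
    (\<integral>x. \<bar>\<phi> i (X i (fst x)) - \<phi> i (resampled k i x)\<bar> * (1 - \<phi> k (X k (fst x))) \<partial>pairs)"

text \<open>
  Coordinates are adjoined one at a time. The covariance of the product so far with \<open>\<phi>
  k\<close> is, up to sign, its covariance with \<open>1 - \<phi> k\<close>; by
  \<open>resampled_independent\<close> the latter is the expected change of the product under
  resampling, times \<open>1 - \<phi> k\<close>, and a product with factors in the unit interval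
  changes by at most the sum of the changes of its factors. The passage to \<open>1 - \<phi>
  k\<close> pays off when \<open>\<phi> k\<close> equals one outside a rare event.
\<close>

theorem decoupling:
  assumes pos: "\<And>k. k \<in> A \<Longrightarrow> 0 < C k k"
  assumes \<phi>: "\<And>i. \<phi> i \<in> borel_measurable borel" "\<And>i x. 0 \<le> \<phi> i x" "\<And>i x. \<phi> i x \<le> (1 :: real)"
  shows "\<bar>expectation (\<lambda>\<omega>. \<Prod>i\<in>A. \<phi> i (X i \<omega>)) - (\<Prod>i\<in>A. expectation (\<lambda>\<omega>. \<phi> i (X i \<omega>)))\<bar>
    \<le> (\<Sum>k\<in>A. \<Sum>i\<in>A - {k}. coupling_error \<phi> i k)"
proof -
  interpret P: prob_space pairs by (rule prob_space_pairs)
  have err_nonneg: "0 \<le> coupling_error \<phi> i k" for i k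
    unfolding coupling_error_def using \<phi> by (intro integral_nonneg_AE) auto
  have \<phi>X: "(\<lambda>\<omega>. \<phi> i (X i \<omega>)) \<in> borel_measurable M" if "i \<in> A" for i
    using measurable_compose[OF coordinate_measurable[OF that] \<phi>(1)] .
  have PX: "(\<lambda>\<omega>. \<Prod>i\<in>B. \<phi> i (X i \<omega>)) \<in> borel_measurable M" if "B \<subseteq> A" for B
    using that by (intro borel_measurable_prod \<phi>X) auto
  have \<phi>1: "0 \<le> 1 - \<phi> i y" "1 - \<phi> i y \<le> 1" for i y using \<phi>(2,3)[of i y] by auto
  have prod01: "0 \<le> (\<Prod>i\<in>B. \<phi> i (f i))" "(\<Prod>i\<in>B. \<phi> i (f i)) \<le> 1" for B f
    using \<phi> by (auto intro: prod_nonneg prod_le_1)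
  have E01: "0 \<le> expectation (\<lambda>\<omega>. \<phi> i (X i \<omega>)) \<and> expectation (\<lambda>\<omega>. \<phi> i (X i \<omega>)) \<le> 1" if "i \<in> A" for i
  proof
    show "0 \<le> expectation (\<lambda>\<omega>. \<phi> i (X i \<omega>))" using \<phi> by (intro integral_nonneg_AE) auto
    show "expectation (\<lambda>\<omega>. \<phi> i (X i \<omega>)) \<le> 1"
      by (rule integral_le_const) (use \<phi> \<phi>X[OF that] in \<open>auto intro!: bounded_integrable[of _ 1]\<close>)
  qed
  have step: "\<bar>expectation (\<lambda>\<omega>. (\<Prod>i\<in>B. \<phi> i (X i \<omega>)) * \<phi> k (X k \<omega>))
      - expectation (\<lambda>\<omega>. \<Prod>i\<in>B. \<phi> i (X i \<omega>)) * expectation (\<lambda>\<omega>. \<phi> k (X k \<omega>))\<bar>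
      \<le> (\<Sum>i\<in>B. coupling_error \<phi> i k)" if B: "B \<subseteq> A" and k: "k \<in> A" "k \<notin> B" for B k
  proof -
    let ?G = "\<lambda>\<omega>. \<Prod>i\<in>B. \<phi> i (X i \<omega>)" and ?h = "\<lambda>\<omega>. 1 - \<phi> k (X k \<omega>)"
    have fin: "finite B" using B finite_index finite_subset by blast
    note [measurable] = PX[OF B] \<phi>X[OF k(1)]
    have intG: "integrable M ?G" "integrable M (\<lambda>\<omega>. \<phi> k (X k \<omega>))"
      "integrable M (\<lambda>\<omega>. ?G \<omega> * \<phi> k (X k \<omega>))"
      using \<phi> prod01 by (auto intro!: bounded_integrable[of _ 1] mult_le_one simp: abs_mult)
    have "expectation (\<lambda>\<omega>. ?G \<omega> * \<phi> k (X k \<omega>)) - expectation ?G * expectation (\<lambda>\<omega>. \<phi> k (X k \<omega>))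
        = expectation ?G * expectation ?h - expectation (\<lambda>\<omega>. ?G \<omega> * ?h \<omega>)"
      using intG by (simp add: right_diff_distrib prob_space)
    also have "expectation ?G * expectation ?h
        = (\<integral>x. (\<Prod>i\<in>B. \<phi> i (resampled k i x)) * ?h (fst x) \<partial>pairs)"
    proof -
      let ?\<phi> = "\<phi>(k := \<lambda>y. 1 - \<phi> k y)"
      have \<phi>B: "(\<Prod>i\<in>B. ?\<phi> i (f i)) = (\<Prod>i\<in>B. \<phi> i (f i))" for f
        using k by (auto intro!: prod.cong)
      have "(\<integral>x. (\<Prod>i\<in>B. ?\<phi> i (resampled k i x)) * ?\<phi> k (X k (fst x)) \<partial>pairs)
          = expectation (\<lambda>\<omega>. \<Prod>i\<in>B. ?\<phi> i (X i \<omega>)) * expectation (\<lambda>\<omega>. ?\<phi> k (X k \<omega>))"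
        by (rule resampled_independent[OF B k pos[OF k(1)]]) (use \<phi> \<phi>1 in auto)
      then show ?thesis unfolding \<phi>B by simp
    qed
    also have "expectation (\<lambda>\<omega>. ?G \<omega> * ?h \<omega>) = (\<integral>x. ?G (fst x) * ?h (fst x) \<partial>pairs)"
      by (rule expectation_fst[symmetric]) (use prod01 \<phi>1 in \<open>auto simp: abs_mult intro!: mult_le_one\<close>)
    finally have eq: "expectation (\<lambda>\<omega>. ?G \<omega> * \<phi> k (X k \<omega>)) - expectation ?G * expectation (\<lambda>\<omega>. \<phi> k (X k \<omega>))
        = (\<integral>x. (\<Prod>i\<in>B. \<phi> i (resampled k i x)) * ?h (fst x) \<partial>pairs) - (\<integral>x. ?G (fst x) * ?h (fst x) \<partial>pairs)" .
    have res: "(\<lambda>x. \<phi> i (resampled k i x)) \<in> borel_measurable pairs" if "i \<in> B" for i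
      by (rule measurable_compose[OF resampled_measurable \<phi>(1)]) (use that B k in auto)
    have fstX: "(\<lambda>x. \<phi> i (X i (fst x))) \<in> borel_measurable pairs" if "i \<in> B" for i
      by (rule measurable_compose[OF measurable_fst \<phi>X]) (use that B in auto)
    have [measurable]: "(\<lambda>x. \<Prod>i\<in>B. \<phi> i (resampled k i x)) \<in> borel_measurable pairs"
      using res by (rule borel_measurable_prod)
    have [measurable]: "(\<lambda>x. ?h (fst x)) \<in> borel_measurable pairs" by measurable
    have int1: "integrable pairs (\<lambda>x. (\<Prod>i\<in>B. \<phi> i (resampled k i x)) * ?h (fst x))"
      "integrable pairs (\<lambda>x. ?G (fst x) * ?h (fst x))"
      by (rule P.bounded_integrable[of _ 1]; use prod01 \<phi>1 in \<open>auto simp: abs_mult intro!: mult_le_one\<close>)+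
    have int2: "integrable pairs (\<lambda>x. \<bar>\<phi> i (X i (fst x)) - \<phi> i (resampled k i x)\<bar> * ?h (fst x))" if "i \<in> B" for i
    proof (rule P.bounded_integrable[of _ 1])
      note [measurable] = res[OF that] fstX[OF that]
      show "(\<lambda>x. \<bar>\<phi> i (X i (fst x)) - \<phi> i (resampled k i x)\<bar> * ?h (fst x)) \<in> borel_measurable pairs"
        by measurable
      have "\<bar>\<phi> i y - \<phi> i z\<bar> \<le> 1" for y z using \<phi>(2,3)[of i y] \<phi>(2,3)[of i z] by linarith
      then show "\<bar>\<bar>\<phi> i (X i (fst x)) - \<phi> i (resampled k i x)\<bar> * ?h (fst x)\<bar> \<le> 1" for x
        using \<phi>1 by (auto simp: abs_mult intro!: mult_le_one)
    qed
    have "\<bar>(\<integral>x. (\<Prod>i\<in>B. \<phi> i (resampled k i x)) * ?h (fst x) \<partial>pairs) - (\<integral>x. ?G (fst x) * ?h (fst x) \<partial>pairs)\<bar>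
        = \<bar>\<integral>x. ((\<Prod>i\<in>B. \<phi> i (resampled k i x)) - ?G (fst x)) * ?h (fst x) \<partial>pairs\<bar>"
      using int1 by (simp add: left_diff_distrib)
    also have "\<dots> \<le> (\<integral>x. \<bar>((\<Prod>i\<in>B. \<phi> i (resampled k i x)) - ?G (fst x)) * ?h (fst x)\<bar> \<partial>pairs)"
      by (rule integral_abs_bound)
    also have "\<dots> \<le> (\<integral>x. (\<Sum>i\<in>B. \<bar>\<phi> i (X i (fst x)) - \<phi> i (resampled k i x)\<bar> * ?h (fst x)) \<partial>pairs)"
    proof (rule integral_mono)
      show "integrable pairs (\<lambda>x. \<bar>((\<Prod>i\<in>B. \<phi> i (resampled k i x)) - ?G (fst x)) * ?h (fst x)\<bar>)"
        using int1 by (simp add: left_diff_distrib)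
      show "integrable pairs (\<lambda>x. \<Sum>i\<in>B. \<bar>\<phi> i (X i (fst x)) - \<phi> i (resampled k i x)\<bar> * ?h (fst x))"
        using int2 by (rule Bochner_Integration.integrable_sum)
      show "\<bar>((\<Prod>i\<in>B. \<phi> i (resampled k i x)) - ?G (fst x)) * ?h (fst x)\<bar>
          \<le> (\<Sum>i\<in>B. \<bar>\<phi> i (X i (fst x)) - \<phi> i (resampled k i x)\<bar> * ?h (fst x))" for x
        unfolding sum_distrib_right[symmetric] abs_mult
        using abs_prod_diff_le[of B "\<lambda>i. \<phi> i (resampled k i x)" "\<lambda>i. \<phi> i (X i (fst x))"] \<phi> \<phi>1
        by (auto intro!: mult_mono simp: abs_minus_commute sum_nonneg)
    qed
    also have "\<dots> = (\<Sum>i\<in>B. coupling_error \<phi> i k)"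
      unfolding coupling_error_def using int2 by (rule Bochner_Integration.integral_sum)
    finally show ?thesis unfolding eq .
  qed
  have "B \<subseteq> A \<Longrightarrow> \<bar>expectation (\<lambda>\<omega>. \<Prod>i\<in>B. \<phi> i (X i \<omega>)) - (\<Prod>i\<in>B. expectation (\<lambda>\<omega>. \<phi> i (X i \<omega>)))\<bar>
    \<le> (\<Sum>k\<in>B. \<Sum>i\<in>B - {k}. coupling_error \<phi> i k)" if "finite B" for B
    using that
  proof (induction B rule: finite_induct)
    case empty
    then show ?case by (simp add: prob_space)
  next
    case (insert k B)
    then have B: "B \<subseteq> A" "finite B" and k: "k \<in> A" "k \<notin> B" by auto
    let ?E = "\<lambda>i. expectation (\<lambda>\<omega>. \<phi> i (X i \<omega>))" and ?G = "expectation (\<lambda>\<omega>. \<Prod>i\<in>B. \<phi> i (X i \<omega>))"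
    have split: "expectation (\<lambda>\<omega>. \<Prod>i\<in>insert k B. \<phi> i (X i \<omega>)) - (\<Prod>i\<in>insert k B. ?E i)
        = (expectation (\<lambda>\<omega>. (\<Prod>i\<in>B. \<phi> i (X i \<omega>)) * \<phi> k (X k \<omega>)) - ?G * ?E k) + (?G - (\<Prod>i\<in>B. ?E i)) * ?E k"
      using k B by (simp add: algebra_simps)
    have "\<bar>expectation (\<lambda>\<omega>. \<Prod>i\<in>insert k B. \<phi> i (X i \<omega>)) - (\<Prod>i\<in>insert k B. ?E i)\<bar>
        \<le> (\<Sum>i\<in>B. coupling_error \<phi> i k) + \<bar>?G - (\<Prod>i\<in>B. ?E i)\<bar> * \<bar>?E k\<bar>"
      unfolding split using step[OF B(1) k] by (simp flip: abs_mult)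
    also have "\<dots> \<le> (\<Sum>i\<in>B. coupling_error \<phi> i k) + \<bar>?G - (\<Prod>i\<in>B. ?E i)\<bar>"
    proof (intro add_left_mono mult_left_le)
      show "\<bar>?E k\<bar> \<le> 1" using E01[OF k(1)] by linarith
    qed (rule abs_ge_zero)
    also have "\<dots> \<le> (\<Sum>i\<in>B. coupling_error \<phi> i k) + (\<Sum>k\<in>B. \<Sum>i\<in>B - {k}. coupling_error \<phi> i k)"
      using insert.IH[OF B(1)] by simp
    also have "\<dots> \<le> (\<Sum>k'\<in>insert k B. \<Sum>i\<in>insert k B - {k'}. coupling_error \<phi> i k')"
    proof -
      have "(\<Sum>k'\<in>B. \<Sum>i\<in>B - {k'}. coupling_error \<phi> i k') \<le> (\<Sum>k'\<in>B. \<Sum>i\<in>insert k B - {k'}. coupling_error \<phi> i k')"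
        using B by (intro sum_mono sum_mono2) (auto simp: err_nonneg)
      then show ?thesis using k B by simp
    qed
    finally show ?case .
  qed
  from this[OF finite_index subset_refl] show ?thesis .
qed

end

subsection \<open>Gaussian tail estimates and the coupling error\<close>

text \<open>
  The lower bound on the variance controls the prefactor and the upper bound the exponent, so the
  estimate is uniform over all sites of the field.
\<close>

lemma normal_density_le_exp:
  assumes "1 \<le> v" "v \<le> G"
  shows "normal_density 0 (sqrt v) x \<le> exp (- x\<^sup>2 / (2 * G))"
proof -
  have "1 \<le> 2 * pi * v" using assms pi_ge_two mult_mono[of 1 "2 * pi" 1 v] by simp
  then have "1 / sqrt (2 * pi * v) \<le> 1" by simp
  moreover have "x\<^sup>2 / (2 * G) \<le> x\<^sup>2 / (2 * v)" using assms by (intro divide_left_mono) auto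
  then have "exp (- x\<^sup>2 / (2 * v)) \<le> exp (- x\<^sup>2 / (2 * G))" by simp
  ultimately have "1 / sqrt (2 * pi * v) * exp (- x\<^sup>2 / (2 * v)) \<le> 1 * exp (- x\<^sup>2 / (2 * G))"
    by (intro mult_mono) auto
  then show ?thesis using assms by (simp add: normal_density_def)
qed

context prob_space
begin

lemma expectation_indicator_compose:
  "expectation (\<lambda>\<omega>. indicator S (f \<omega>)) = prob {\<omega> \<in> space M. f \<omega> \<in> S}"
proof -
  have "(\<lambda>\<omega>. indicator S (f \<omega>) :: real) = indicator (f -` S)"
    by (auto simp: indicator_def fun_eq_iff)
  moreover have "f -` S \<inter> space M = {\<omega> \<in> space M. f \<omega> \<in> S}" by auto
  ultimately show ?thesis by simp
qed

text \<open>
  The exponent is bounded by its tangent at \<open>u\<close>.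
\<close>

lemma gaussian_upper_tail:
  assumes Z: "distributed M lborel Z (normal_density 0 (sqrt v))" and v: "1 \<le> v" "v \<le> G" and u: "0 < u"
  shows "prob {\<omega> \<in> space M. u \<le> Z \<omega>} \<le> G / u * exp (- u\<^sup>2 / (2 * G))"
proof -
  let ?f = "\<lambda>x. exp (- u\<^sup>2 / (2 * G) - u / G * (x - u))"
  let ?F = "\<lambda>x. - (G / u) * ?f x"
  have G: "0 < G" using v by linarith
  have "emeasure M {\<omega> \<in> space M. u \<le> Z \<omega>} = emeasure M (Z -` {u..} \<inter> space M)"
    by (intro arg_cong2[where f=emeasure]) auto
  also have "\<dots> = (\<integral>\<^sup>+x. ennreal (normal_density 0 (sqrt v) x) * indicator {u..} x \<partial>lborel)"
    by (rule distributed_emeasure[OF Z]) auto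
  also have "\<dots> \<le> (\<integral>\<^sup>+x. ennreal (?f x) * indicator {u..} x \<partial>lborel)"
  proof (intro nn_integral_mono mult_right_mono ennreal_leI)
    fix x
    have "0 \<le> (x - u)\<^sup>2 / (2 * G)" using G by simp
    also have "\<dots> = (- u\<^sup>2 / (2 * G) - u / G * (x - u)) - (- x\<^sup>2 / (2 * G))"
      using G by (simp add: power2_eq_square field_simps)
    finally have "- x\<^sup>2 / (2 * G) \<le> - u\<^sup>2 / (2 * G) - u / G * (x - u)" by simp
    then show "normal_density 0 (sqrt v) x \<le> ?f x"
      using normal_density_le_exp[OF v, of x] by (smt (verit) exp_le_cancel_iff)
  qed simp
  also have "\<dots> = ennreal (0 - ?F u)"
  proof (rule nn_integral_FTC_atLeast[where f="?f" and F="?F" and T=0])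
    show "DERIV ?F x :> ?f x" for x
      using G u by (auto intro!: derivative_eq_intros)
    show "(?F \<longlongrightarrow> 0) at_top" using G u by real_asymp
  qed auto
  finally have "emeasure M {\<omega> \<in> space M. u \<le> Z \<omega>} \<le> ennreal (G / u * exp (- u\<^sup>2 / (2 * G)))" by simp
  then show ?thesis using G u by (simp add: emeasure_eq_measure)
qed

lemma gaussian_window:
  assumes Z: "distributed M lborel Z (normal_density 0 (sqrt v))" and v: "1 \<le> v" "v \<le> G"
    and w: "0 \<le> \<delta>" "\<delta> \<le> w"
  shows "prob {\<omega> \<in> space M. \<bar>Z \<omega> - w\<bar> \<le> \<delta>} \<le> 2 * \<delta> * exp (- (w - \<delta>)\<^sup>2 / (2 * G))"
proof -
  have G: "0 < G" using v by linarith
  have "emeasure M {\<omega> \<in> space M. \<bar>Z \<omega> - w\<bar> \<le> \<delta>} = emeasure M (Z -` {w - \<delta>..w + \<delta>} \<inter> space M)"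
    by (intro arg_cong2[where f=emeasure]) auto
  also have "\<dots> = (\<integral>\<^sup>+x. ennreal (normal_density 0 (sqrt v) x) * indicator {w - \<delta>..w + \<delta>} x \<partial>lborel)"
    by (rule distributed_emeasure[OF Z]) auto
  also have "\<dots> \<le> (\<integral>\<^sup>+x. ennreal (exp (- (w - \<delta>)\<^sup>2 / (2 * G))) * indicator {w - \<delta>..w + \<delta>} x \<partial>lborel)"
  proof (intro nn_integral_mono)
    fix x
    show "ennreal (normal_density 0 (sqrt v) x) * indicator {w - \<delta>..w + \<delta>} x
        \<le> ennreal (exp (- (w - \<delta>)\<^sup>2 / (2 * G))) * indicator {w - \<delta>..w + \<delta>} x"
    proof (cases "x \<in> {w - \<delta>..w + \<delta>}")
      case True
      then have "(w - \<delta>)\<^sup>2 \<le> x\<^sup>2" using w by (intro power_mono) auto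
      then have "exp (- x\<^sup>2 / (2 * G)) \<le> exp (- (w - \<delta>)\<^sup>2 / (2 * G))" using G by (simp add: divide_right_mono)
      from order_trans[OF normal_density_le_exp[OF v, of x] this] show ?thesis
        by (intro mult_right_mono ennreal_leI) auto
    qed simp
  qed
  also have "\<dots> = ennreal (exp (- (w - \<delta>)\<^sup>2 / (2 * G))) * ennreal (2 * \<delta>)"
    using w by (subst nn_integral_cmult_indicator) auto
  also have "\<dots> = ennreal (2 * \<delta> * exp (- (w - \<delta>)\<^sup>2 / (2 * G)))"
    using w by (subst ennreal_mult[symmetric]) (auto simp: mult_ac)
  finally show ?thesis using w by (simp add: emeasure_eq_measure)
qed

end

context centered_gaussian
begin

lemma upper_tail_combination:
  assumes "B \<subseteq> A" "1 \<le> variance_form B c" "variance_form B c \<le> G" "0 < u"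
  shows "prob {\<omega> \<in> space M. u \<le> (\<Sum>\<alpha>\<in>B. c \<alpha> * X \<alpha> \<omega>)} \<le> G / u * exp (- u\<^sup>2 / (2 * G))"
proof (rule gaussian_upper_tail)
  have "expectation (\<lambda>\<omega>. (\<Sum>\<alpha>\<in>B. c \<alpha> * X \<alpha> \<omega>)\<^sup>2) = variance_form B c"
    using covariance_combination[OF assms(1) assms(1), of c c] by (simp add: variance_form_def power2_eq_square)
  then show "distributed M lborel (\<lambda>\<omega>. \<Sum>\<alpha>\<in>B. c \<alpha> * X \<alpha> \<omega>) (normal_density 0 (sqrt (variance_form B c)))"
    using centered_gaussian_distributed[OF gaussian_combination_subset[OF assms(1), of c] expectation_combination[OF assms(1)]] assms
    by simp
qed (use assms in auto)

lemma coordinate_distributed: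
  assumes "k \<in> A" "1 \<le> C k k"
  shows "distributed M lborel (X k) (normal_density 0 (sqrt (C k k)))"
  using centered_gaussian_distributed[OF gaussian_coordinate[OF assms(1)] expectation_coordinate[OF assms(1)]]
    covariance[of k k] assms
  by (simp add: power2_eq_square)

lemma upper_tail_coordinate:
  assumes k: "k \<in> A" "1 \<le> C k k" "C k k \<le> g" and "0 < u"
  shows "prob {\<omega> \<in> space M. u \<le> X k \<omega>} \<le> g / u * exp (- u\<^sup>2 / (2 * g))"
  by (rule gaussian_upper_tail[OF coordinate_distributed]) (use assms in auto)

lemma two_sided_tail_coordinate:
  assumes k: "k \<in> A" "1 \<le> C k k" "C k k \<le> g" and H: "0 < H"
  shows "prob {\<omega> \<in> space M. H \<le> \<bar>X k \<omega>\<bar>} \<le> 2 * (g / H * exp (- H\<^sup>2 / (2 * g)))"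
proof -
  note [measurable] = coordinate_measurable[OF k(1)]
  have "prob {\<omega> \<in> space M. H \<le> \<bar>X k \<omega>\<bar>}
      \<le> prob ({\<omega> \<in> space M. H \<le> X k \<omega>} \<union> {\<omega> \<in> space M. H \<le> - X k \<omega>})"
    by (intro finite_measure_mono) auto
  also have "\<dots> \<le> prob {\<omega> \<in> space M. H \<le> X k \<omega>} + prob {\<omega> \<in> space M. H \<le> - X k \<omega>}"
    by (rule measure_Un_le) measurable
  also have "\<dots> \<le> g / H * exp (- H\<^sup>2 / (2 * g)) + g / H * exp (- H\<^sup>2 / (2 * g))"
    using upper_tail_coordinate[OF k H] upper_tail_combination[of "{k}" "\<lambda>_. -1" g H] k H
    by (intro add_mono) (simp_all add: variance_form_def)
  finally show ?thesis by simp
qed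

lemma pair_variance:
  assumes "i \<in> A" "k \<in> A" "i \<noteq> k"
  shows "variance_form {i, k} c = (c i)\<^sup>2 * C i i + 2 * c i * c k * C i k + (c k)\<^sup>2 * C k k"
  using assms covariance_commute[of i k] by (simp add: variance_form_def power2_eq_square algebra_simps)

lemma joint_upper_tail:
  assumes ik: "i \<in> A" "k \<in> A" "i \<noteq> k" and v: "1 \<le> C i i + C k k + 2 * C i k" "C i i + C k k + 2 * C i k \<le> G"
    and u: "0 < u"
  shows "prob {\<omega> \<in> space M. u \<le> X i \<omega> \<and> u \<le> X k \<omega>} \<le> G / (2 * u) * exp (- (2 * u)\<^sup>2 / (2 * G))"
proof -
  note [measurable] = coordinate_measurable[OF ik(1)] coordinate_measurable[OF ik(2)]
  have "prob {\<omega> \<in> space M. u \<le> X i \<omega> \<and> u \<le> X k \<omega>}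
      \<le> prob {\<omega> \<in> space M. 2 * u \<le> (\<Sum>\<alpha>\<in>{i, k}. 1 * X \<alpha> \<omega>)}"
    using ik by (intro finite_measure_mono) auto
  also have "\<dots> \<le> G / (2 * u) * exp (- (2 * u)\<^sup>2 / (2 * G))"
    using pair_variance[OF ik, of "\<lambda>_. 1"] ik v u by (intro upper_tail_combination) auto
  finally show ?thesis .
qed

lemma resampled_pair:
  assumes ik: "i \<in> A" "k \<in> A" "i \<noteq> k" "0 < C k k" and S: "S \<in> sets borel"
  shows "(\<integral>x. indicator S (resampled k i x) * indicator {u..} (X k (fst x)) \<partial>pairs)
    = prob {\<omega> \<in> space M. X i \<omega> \<in> S} * prob {\<omega> \<in> space M. u \<le> X k \<omega>}"
proof -
  let ?\<phi> = "\<lambda>j. if j = k then indicator {u..} else indicator S :: real \<Rightarrow> real"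
  have "(\<integral>x. (\<Prod>i\<in>{i}. ?\<phi> i (resampled k i x)) * ?\<phi> k (X k (fst x)) \<partial>pairs)
    = expectation (\<lambda>\<omega>. \<Prod>i\<in>{i}. ?\<phi> i (X i \<omega>)) * expectation (\<lambda>\<omega>. ?\<phi> k (X k \<omega>))"
    by (rule resampled_independent) (use ik S in \<open>auto split: split_indicator\<close>)
  then show ?thesis using ik by (simp add: expectation_indicator_compose)
qed

lemma expectation_snd:
  fixes f :: "'w \<Rightarrow> real"
  assumes f: "f \<in> borel_measurable M" "\<And>\<omega>. \<bar>f \<omega>\<bar> \<le> 1"
  shows "(\<integral>x. f (snd x) \<partial>pairs) = expectation f"
  using pair_expectation_mult[OF prob_space_axioms prob_space_axioms, of "\<lambda>_. 1" f] f
  by (simp add: prob_space)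

text \<open>
  Both \<open>1 - \<phi> i\<close> and \<open>1 - \<phi> k\<close> vanish below \<open>u\<close>, so
  an error requires \<open>X k\<close> and one of the two versions of \<open>X i\<close> to exceed
  \<open>u\<close>; the resampled version is independent of \<open>X k\<close>.
\<close>

lemma coupling_error_near:
  assumes ik: "i \<in> A" "k \<in> A" "i \<noteq> k" "0 < C k k"
  assumes \<phi>: "\<And>i x. 0 \<le> \<phi> i x" "\<And>i x. \<phi> i x \<le> (1 :: real)"
    and above: "\<And>j x. \<phi> j x < 1 \<Longrightarrow> u \<le> x"
  shows "coupling_error \<phi> i k \<le> prob {\<omega> \<in> space M. u \<le> X i \<omega> \<and> u \<le> X k \<omega>}
    + prob {\<omega> \<in> space M. u \<le> X i \<omega>} * prob {\<omega> \<in> space M. u \<le> X k \<omega>}"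
proof -
  interpret P: prob_space pairs by (rule prob_space_pairs)
  note [measurable] = coordinate_measurable[OF ik(1)] coordinate_measurable[OF ik(2)] resampled_measurable[OF ik(1,2)]
  let ?I = "indicator {u..} :: real \<Rightarrow> real"
  have int1: "integrable pairs (\<lambda>x. ?I (X i (fst x)) * ?I (X k (fst x)))"
    and int2: "integrable pairs (\<lambda>x. ?I (resampled k i x) * ?I (X k (fst x)))"
    by (rule P.bounded_integrable[of _ 1]; auto split: split_indicator)+
  have "coupling_error \<phi> i k \<le> (\<integral>x. ?I (X i (fst x)) * ?I (X k (fst x)) + ?I (resampled k i x) * ?I (X k (fst x)) \<partial>pairs)"
    unfolding coupling_error_def
  proof (rule integral_mono')
    show "integrable pairs (\<lambda>x. ?I (X i (fst x)) * ?I (X k (fst x)) + ?I (resampled k i x) * ?I (X k (fst x)))"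
      using int1 int2 by (rule Bochner_Integration.integrable_add)
    fix x
    have le: "\<bar>\<phi> i y - \<phi> i z\<bar> \<le> ?I y + ?I z" for y z
      using above[of i y] above[of i z] \<phi>[of i y] \<phi>[of i z]
      by (cases "\<phi> i y < 1"; cases "\<phi> i z < 1") (auto split: split_indicator)
    have le': "1 - \<phi> k y \<le> ?I y" for y
      using above[of k y] \<phi>[of k y] by (cases "\<phi> k y < 1") (auto split: split_indicator)
    show "\<bar>\<phi> i (X i (fst x)) - \<phi> i (resampled k i x)\<bar> * (1 - \<phi> k (X k (fst x)))
        \<le> ?I (X i (fst x)) * ?I (X k (fst x)) + ?I (resampled k i x) * ?I (X k (fst x))"
      unfolding distrib_right[symmetric] using \<phi> by (intro mult_mono le le') (auto simp: add_nonneg_nonneg)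
    show "0 \<le> ?I (X i (fst x)) * ?I (X k (fst x)) + ?I (resampled k i x) * ?I (X k (fst x))"
      by (simp add: add_nonneg_nonneg)
  qed
  also have "\<dots> = (\<integral>x. ?I (X i (fst x)) * ?I (X k (fst x)) \<partial>pairs) + (\<integral>x. ?I (resampled k i x) * ?I (X k (fst x)) \<partial>pairs)"
    using int1 int2 by (rule Bochner_Integration.integral_add)
  also have "(\<integral>x. ?I (X i (fst x)) * ?I (X k (fst x)) \<partial>pairs) = expectation (\<lambda>\<omega>. ?I (X i \<omega>) * ?I (X k \<omega>))"
    by (rule expectation_fst) (auto split: split_indicator)
  also have "\<dots> = expectation (\<lambda>\<omega>. indicator ({u..} \<times> {u..}) (X i \<omega>, X k \<omega>))"
    by (intro Bochner_Integration.integral_cong) (auto simp: indicator_def)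
  finally show ?thesis
    unfolding expectation_indicator_compose resampled_pair[OF ik, OF borel_closed[OF closed_atLeast]] by simp
qed

text \<open>
  As long as both copies of \<open>X k\<close> are below \<open>H\<close> in absolute value,
  resampling moves \<open>X i\<close> by at most \<open>\<delta>\<close>, and \<open>\<phi>
  i\<close> changes only if the resampled coordinate lies within \<open>\<delta>\<close> of a
  threshold. By independence this event and the exceedance of \<open>u\<close> by \<open>X k\<close>
  contribute a product of two small probabilities.
\<close>

lemma coupling_error_far:
  assumes ik: "i \<in> A" "k \<in> A" "i \<noteq> k" "0 < C k k"
  assumes \<phi>: "\<And>i x. 0 \<le> \<phi> i x" "\<And>i x. \<phi> i x \<le> (1 :: real)"
    and above: "\<And>j x. \<phi> j x < 1 \<Longrightarrow> u \<le> x"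
    and T: "finite T" "\<And>j x y. \<phi> j x \<noteq> \<phi> j y \<Longrightarrow> \<exists>v\<in>T. min x y \<le> v \<and> v \<le> max x y"
    and H: "\<bar>C i k / C k k\<bar> * (2 * H) \<le> \<delta>"
  shows "coupling_error \<phi> i k \<le> (\<Sum>v\<in>T. prob {\<omega> \<in> space M. \<bar>X i \<omega> - v\<bar> \<le> \<delta>}) * prob {\<omega> \<in> space M. u \<le> X k \<omega>}
    + 2 * prob {\<omega> \<in> space M. H \<le> \<bar>X k \<omega>\<bar>}"
proof -
  interpret P: prob_space pairs by (rule prob_space_pairs)
  note [measurable] = coordinate_measurable[OF ik(1)] coordinate_measurable[OF ik(2)] resampled_measurable[OF ik(1,2)]
  let ?I = "indicator {u..} :: real \<Rightarrow> real" and ?J = "indicator {y. H \<le> \<bar>y\<bar>} :: real \<Rightarrow> real"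
  let ?K = "\<lambda>v. indicator {y. \<bar>y - v\<bar> \<le> \<delta>} :: real \<Rightarrow> real"
  have [measurable]: "{y. H \<le> \<bar>y\<bar>} \<in> sets borel" "{y. \<bar>y - v\<bar> \<le> \<delta>} \<in> sets borel" for v :: real
    by measurable
  let ?S = "\<lambda>x. \<Sum>v\<in>T. ?K v (resampled k i x) * ?I (X k (fst x))"
  have int1: "integrable pairs (\<lambda>x. ?J (X k (fst x)))" and int2: "integrable pairs (\<lambda>x. ?J (X k (snd x)))"
    and int3: "integrable pairs (\<lambda>x. ?K v (resampled k i x) * ?I (X k (fst x)))" for v
    by (rule P.bounded_integrable[of _ 1]; auto split: split_indicator)+
  have S_nonneg: "0 \<le> ?S x" for x by (intro sum_nonneg) auto
  have "coupling_error \<phi> i k \<le> (\<integral>x. ?S x + (?J (X k (fst x)) + ?J (X k (snd x))) \<partial>pairs)"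
    unfolding coupling_error_def
  proof (rule integral_mono')
    show "integrable pairs (\<lambda>x. ?S x + (?J (X k (fst x)) + ?J (X k (snd x))))"
      by (intro Bochner_Integration.integrable_add Bochner_Integration.integrable_sum int1 int2 int3)
    fix x
    show "0 \<le> ?S x + (?J (X k (fst x)) + ?J (X k (snd x)))"
      using S_nonneg[of x] by (simp add: add_nonneg_nonneg)
    let ?a = "X i (fst x)" and ?r = "resampled k i x" and ?D = "\<bar>\<phi> i (X i (fst x)) - \<phi> i (resampled k i x)\<bar> * (1 - \<phi> k (X k (fst x)))"
    have D1: "?D \<le> 1"
      using \<phi>[of i ?a] \<phi>[of i ?r] \<phi>[of k "X k (fst x)"] by (intro mult_le_one) auto
    show "?D \<le> ?S x + (?J (X k (fst x)) + ?J (X k (snd x)))"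
    proof (cases "H \<le> \<bar>X k (fst x)\<bar> \<or> H \<le> \<bar>X k (snd x)\<bar>")
      case True
      then have "1 \<le> ?J (X k (fst x)) + ?J (X k (snd x))" by (auto split: split_indicator)
      then show ?thesis using D1 S_nonneg[of x] by linarith
    next
      case False
      show ?thesis
      proof (cases "?D = 0")
        case True
        show ?thesis unfolding True by (intro add_nonneg_nonneg S_nonneg) auto
      next
        case D: False
        then have "\<phi> i ?a \<noteq> \<phi> i ?r" and "\<phi> k (X k (fst x)) < 1"
          using \<phi>(2)[of k "X k (fst x)"] by auto
        then obtain v where v: "v \<in> T" "min ?a ?r \<le> v" "v \<le> max ?a ?r" and u: "u \<le> X k (fst x)"
          using T(2) above by blast
        have "\<bar>?r - ?a\<bar> = \<bar>C i k / C k k\<bar> * \<bar>X k (snd x) - X k (fst x)\<bar>"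
          by (simp add: resampled_def abs_mult)
        also have "\<dots> \<le> \<bar>C i k / C k k\<bar> * (2 * H)"
          using False by (intro mult_left_mono) auto
        also note H
        finally have "\<bar>?r - v\<bar> \<le> \<delta>" using v by (auto simp: min_def max_def split: if_splits)
        then have "1 \<le> ?K v ?r * ?I (X k (fst x))" using u by simp
        also have "\<dots> \<le> ?S x" using v T by (intro member_le_sum) auto
        finally show ?thesis using D1
          by (smt (verit) indicator_pos_le)
      qed
    qed
  qed
  also have "\<dots> = (\<Sum>v\<in>T. \<integral>x. ?K v (resampled k i x) * ?I (X k (fst x)) \<partial>pairs)
      + ((\<integral>x. ?J (X k (fst x)) \<partial>pairs) + (\<integral>x. ?J (X k (snd x)) \<partial>pairs))"
    using int1 int2 int3
    by (simp add: Bochner_Integration.integral_add Bochner_Integration.integral_sum Bochner_Integration.integrable_sum)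
  also have "(\<integral>x. ?J (X k (fst x)) \<partial>pairs) = prob {\<omega> \<in> space M. H \<le> \<bar>X k \<omega>\<bar>}"
    by (subst expectation_fst) (auto simp: expectation_indicator_compose split: split_indicator)
  also have "(\<integral>x. ?J (X k (snd x)) \<partial>pairs) = prob {\<omega> \<in> space M. H \<le> \<bar>X k \<omega>\<bar>}"
    by (subst expectation_snd) (auto simp: expectation_indicator_compose split: split_indicator)
  finally show ?thesis
    by (simp add: resampled_pair[OF ik] sum_distrib_right)
qed

end

subsection \<open>The exponential limit of rescaled Gaussian tails\<close>

text \<open>
  The density of \<open>(X - b) / (g / b)\<close> for a centered Gaussian variable \<open>X\<close>
  with variance \<open>s\<close>.
\<close>

definition rescaled_density :: "real \<Rightarrow> real \<Rightarrow> real \<Rightarrow> real \<Rightarrow> real" where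
  "rescaled_density g b s y = (g / b) / sqrt (2 * pi * s) * exp (- (b + g / b * y)\<^sup>2 / (2 * s))"

lemma rescaled_density_measurable [measurable]: "rescaled_density g b s \<in> borel_measurable borel"
  unfolding rescaled_density_def by measurable

lemma (in prob_space) rescaled_gaussian_prob:
  assumes X: "distributed M lborel X (normal_density 0 (sqrt s))" and pos: "0 < s" "0 < b" "0 < g"
    and J [measurable]: "J \<in> sets borel"
  shows "prob {\<omega> \<in> space M. (X \<omega> - b) / (g / b) \<in> J} = (\<integral>y. indicator J y * rescaled_density g b s y \<partial>lborel)"
proof -
  define a where "a = g / b"
  have a: "0 < a" using pos by (simp add: a_def)
  have "distributed M lborel (\<lambda>\<omega>. - b / a + 1 / a * X \<omega>) (normal_density (- b / a + 1 / a * 0) (\<bar>1 / a\<bar> * sqrt s))"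
    by (rule normal_density_affine[OF X]) (use a pos in auto)
  moreover have "(\<lambda>\<omega>. - b / a + 1 / a * X \<omega>) = (\<lambda>\<omega>. (X \<omega> - b) / a)"
    using a by (auto simp: fun_eq_iff field_simps)
  moreover have "normal_density (- b / a + 1 / a * 0) (\<bar>1 / a\<bar> * sqrt s) y = rescaled_density g b s y" for y
  proof -
    have 1: "sqrt (2 * pi * (\<bar>1 / a\<bar> * sqrt s)\<^sup>2) = sqrt (2 * pi * s) / a"
      using a pos by (simp add: power_mult_distrib power_divide real_sqrt_divide)
    have 2: "- (y - (- b / a + 1 / a * 0))\<^sup>2 / (2 * (\<bar>1 / a\<bar> * sqrt s)\<^sup>2) = - (b + a * y)\<^sup>2 / (2 * s)"
    proof -
      have "y - (- b / a + 1 / a * 0) = (b + a * y) / a" using a by (simp add: field_simps)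
      moreover have "(\<bar>1 / a\<bar> * sqrt s)\<^sup>2 = s / a\<^sup>2" using a pos by (simp add: power_mult_distrib power_divide)
      ultimately show ?thesis using a pos by (simp add: power_divide)
    qed
    show ?thesis
      unfolding normal_density_def 1 2 rescaled_density_def a_def[symmetric] by simp
  qed
  ultimately have D: "distributed M lborel (\<lambda>\<omega>. (X \<omega> - b) / a) (\<lambda>y. ennreal (rescaled_density g b s y))"
    by simp
  have "(\<integral>y. rescaled_density g b s y * indicator J y \<partial>lborel) = expectation (\<lambda>\<omega>. indicator J ((X \<omega> - b) / a))"
    by (rule distributed_integral[OF D]) (use pos in \<open>auto simp: rescaled_density_def\<close>)
  then show ?thesis by (simp add: expectation_indicator_compose a_def mult.commute)
qed

text \<open>
  The scale \<open>g / b\<close> is the one for which the linear term of the exponent is exactly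
  \<open>y\<close>.
\<close>

lemma rescaled_exponent:
  fixes g b y :: real
  assumes "0 < b" "0 < g"
  shows "(b + g / b * y)\<^sup>2 / (2 * g) = b\<^sup>2 / (2 * g) + y + (g / b)\<^sup>2 * y\<^sup>2 / (2 * g)"
  using assms by (simp add: power2_eq_square field_simps)

lemma rescaled_density_le:
  assumes s: "1 \<le> s" "s \<le> g" and b: "0 < b"
  shows "rescaled_density g b s y \<le> g / b * exp (- b\<^sup>2 / (2 * g)) * exp (- y)"
proof -
  have g: "0 < g" using s by linarith
  have "1 \<le> 2 * pi * s" using s pi_ge_two mult_mono[of 1 "2 * pi" 1 s] by simp
  then have "1 / sqrt (2 * pi * s) \<le> 1" by simp
  moreover have "b\<^sup>2 / (2 * g) + y \<le> (b + g / b * y)\<^sup>2 / (2 * g)"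
    unfolding rescaled_exponent[OF b g] using g by simp
  moreover have "(b + g / b * y)\<^sup>2 / (2 * g) \<le> (b + g / b * y)\<^sup>2 / (2 * s)"
    using s by (intro divide_left_mono) auto
  ultimately have "1 / sqrt (2 * pi * s) * exp (- (b + g / b * y)\<^sup>2 / (2 * s)) \<le> 1 * exp (- (b\<^sup>2 / (2 * g) + y))"
    by (intro mult_mono) auto
  then have "g / b * (1 / sqrt (2 * pi * s) * exp (- (b + g / b * y)\<^sup>2 / (2 * s))) \<le> g / b * (1 * exp (- (b\<^sup>2 / (2 * g) + y)))"
    by (rule mult_left_mono) (use g b in simp)
  moreover have "exp (- (b\<^sup>2 / (2 * g) + y)) = exp (- b\<^sup>2 / (2 * g)) * exp (- y)"
    by (simp flip: exp_add)
  ultimately show ?thesis by (simp add: rescaled_density_def)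
qed

lemma integrable_exp_minus_above:
  fixes J :: "real set"
  assumes [measurable]: "J \<in> sets borel" and J: "J \<subseteq> {z..}"
  shows "integrable lborel (\<lambda>y. indicator J y * exp (- y))"
proof -
  have "integrable lborel (\<lambda>y. indicator {z..} y * exp (- y))"
  proof (rule integrableI_nonneg)
    have "(\<integral>\<^sup>+y. ennreal (indicator {z..} y * exp (- y)) \<partial>lborel)
        = (\<integral>\<^sup>+y. ennreal (exp (- y)) * indicator {z..} y \<partial>lborel)"
      by (intro nn_integral_cong) (auto split: split_indicator)
    also have "\<dots> = ennreal (0 - (- exp (- z)))"
    proof (rule nn_integral_FTC_atLeast[where F="\<lambda>y. - exp (- y)" and T=0 and f="\<lambda>y. exp (- y)"])
      show "((\<lambda>y::real. - exp (- y)) \<longlongrightarrow> 0) at_top" by real_asymp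
    qed (auto intro!: derivative_eq_intros)
    finally show "(\<integral>\<^sup>+y. ennreal (indicator {z..} y * exp (- y)) \<partial>lborel) < \<infinity>" by simp
  qed auto
  then show ?thesis
    by (rule Bochner_Integration.integrable_bound) (use J in \<open>auto split: split_indicator\<close>)
qed

text \<open>
  Dominated convergence: by \<open>rescaled_density_le\<close> the densities are at most a constant
  multiple of \<open>exp (- y)\<close>, which is integrable over sets bounded below.
\<close>

lemma rescaled_gaussian_limit:
  fixes b x s :: "nat \<Rightarrow> real"
  assumes b: "filterlim b at_top sequentially"
    and x: "\<And>n. 0 \<le> x n" "(\<lambda>n. x n * (g / b n * exp (- (b n)\<^sup>2 / (2 * g)))) \<longlonglongrightarrow> sqrt (2 * pi * g)"
    and s: "\<And>n. 1 \<le> s n" "\<And>n. s n \<le> g" "(\<lambda>n. (g - s n) * (b n)\<^sup>2) \<longlonglongrightarrow> 0"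
    and J [measurable]: "J \<in> sets borel" and Jz: "J \<subseteq> {z..}"
  shows "(\<lambda>n. x n * (\<integral>y. indicator J y * rescaled_density g (b n) (s n) y \<partial>lborel))
    \<longlonglongrightarrow> (\<integral>y. indicator J y * exp (- y) \<partial>lborel)"
proof -
  have g: "1 \<le> g" using s(1,2)[of 0] by linarith
  have b_ev: "eventually (\<lambda>n. 1 \<le> b n) sequentially"
    using b by (auto simp: filterlim_at_top)
  have s_lim: "s \<longlonglongrightarrow> g"
  proof -
    have "(\<lambda>n. g - s n) \<longlonglongrightarrow> 0"
    proof (rule tendsto_sandwich[OF _ _ tendsto_const s(3)])
      show "eventually (\<lambda>n. 0 \<le> g - s n) sequentially" using s(2) by simp
      show "eventually (\<lambda>n. g - s n \<le> (g - s n) * (b n)\<^sup>2) sequentially"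
        using b_ev
      proof eventually_elim
        case (elim n)
        then show ?case
          using mult_left_mono[OF one_le_power[OF elim, of 2], of "g - s n"] s(2)[of n] by simp
      qed
    qed
    from tendsto_diff[OF tendsto_const[of g] this] show ?thesis by simp
  qed
  have a_lim: "(\<lambda>n. g / b n) \<longlonglongrightarrow> 0"
    by (rule tendsto_divide_0[OF tendsto_const filterlim_at_top_imp_at_infinity[OF b]])
  obtain B where B: "\<And>n. \<bar>x n * (g / b n * exp (- (b n)\<^sup>2 / (2 * g)))\<bar> \<le> B"
    using convergent_imp_Bseq[OF convergentI[OF x(2)]] by (auto simp: Bseq_def)
  let ?f = "\<lambda>n y. if 0 < b n then x n * (indicator J y * rescaled_density g (b n) (s n) y) else 0"
  have lim: "(\<lambda>n. ?f n y) \<longlonglongrightarrow> indicator J y * exp (- y)" for y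
  proof -
    have e: "(\<lambda>n. ((b n)\<^sup>2 * (g - s n) + 2 * g * y * (g - s n) + (g / b n)\<^sup>2 * y\<^sup>2 * (g - s n)) / (2 * s n * g)) \<longlonglongrightarrow>
        (0 + 2 * g * y * (g - g) + 0\<^sup>2 * y\<^sup>2 * (g - g)) / (2 * g * g)"
      using s(3) g by (intro tendsto_intros s_lim a_lim) (auto simp: mult.commute)
    then have e0: "(\<lambda>n. ((b n)\<^sup>2 * (g - s n) + 2 * g * y * (g - s n) + (g / b n)\<^sup>2 * y\<^sup>2 * (g - s n)) / (2 * s n * g)) \<longlonglongrightarrow> 0"
      by simp
    have "(\<lambda>n. (g / b n)\<^sup>2 * y\<^sup>2 / (2 * g)) \<longlonglongrightarrow> 0\<^sup>2 * y\<^sup>2 / (2 * g)"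
      using g by (intro tendsto_divide tendsto_mult tendsto_power a_lim tendsto_const) auto
    then have c0: "(\<lambda>n. (g / b n)\<^sup>2 * y\<^sup>2 / (2 * g)) \<longlonglongrightarrow> 0" by simp
    have q: "(\<lambda>n. sqrt (2 * pi * s n)) \<longlonglongrightarrow> sqrt (2 * pi * g)"
      by (intro tendsto_real_sqrt tendsto_mult tendsto_const s_lim)
    have "sqrt (2 * pi * g) \<noteq> 0" using g by simp
    from tendsto_mult[OF tendsto_divide[OF x(2) q this] tendsto_exp[OF tendsto_diff[OF tendsto_diff[OF tendsto_const c0] e0]], of "- y"]
    have main: "(\<lambda>n. x n * (g / b n * exp (- (b n)\<^sup>2 / (2 * g))) / sqrt (2 * pi * s n)
        * exp (- y - (g / b n)\<^sup>2 * y\<^sup>2 / (2 * g)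
          - ((b n)\<^sup>2 * (g - s n) + 2 * g * y * (g - s n) + (g / b n)\<^sup>2 * y\<^sup>2 * (g - s n)) / (2 * s n * g)))
      \<longlonglongrightarrow> exp (- y)" using g by simp
    have "eventually (\<lambda>n. indicator J y * (x n * (g / b n * exp (- (b n)\<^sup>2 / (2 * g))) / sqrt (2 * pi * s n)
        * exp (- y - (g / b n)\<^sup>2 * y\<^sup>2 / (2 * g)
          - ((b n)\<^sup>2 * (g - s n) + 2 * g * y * (g - s n) + (g / b n)\<^sup>2 * y\<^sup>2 * (g - s n)) / (2 * s n * g))) = ?f n y) sequentially"
      using b_ev
    proof eventually_elim
      case (elim n)
      have bn: "0 < b n" and sn: "0 < s n" using elim s(1)[of n] by linarith+
      have "(b n + g / b n * y)\<^sup>2 = (b n)\<^sup>2 + 2 * g * y + (g / b n)\<^sup>2 * y\<^sup>2"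
        using bn by (simp add: power2_eq_square field_simps)
      then have num: "(b n)\<^sup>2 * (g - s n) + 2 * g * y * (g - s n) + (g / b n)\<^sup>2 * y\<^sup>2 * (g - s n)
          = (b n + g / b n * y)\<^sup>2 * (g - s n)"
        by (simp only: distrib_right)
      have frac: "q / (2 * s n) = q / (2 * g) + q * (g - s n) / (2 * s n * g)" for q :: real
        using sn g by (simp add: field_simps)
      have "(b n + g / b n * y)\<^sup>2 / (2 * s n) = (b n + g / b n * y)\<^sup>2 / (2 * g)
          + ((b n)\<^sup>2 * (g - s n) + 2 * g * y * (g - s n) + (g / b n)\<^sup>2 * y\<^sup>2 * (g - s n)) / (2 * s n * g)"
        unfolding num by (rule frac)
      then have eq: "- (b n + g / b n * y)\<^sup>2 / (2 * s n) = - (b n)\<^sup>2 / (2 * g) + (- y - (g / b n)\<^sup>2 * y\<^sup>2 / (2 * g)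
          - ((b n)\<^sup>2 * (g - s n) + 2 * g * y * (g - s n) + (g / b n)\<^sup>2 * y\<^sup>2 * (g - s n)) / (2 * s n * g))"
        using rescaled_exponent[OF bn, of g y] g by simp
      show ?case using bn unfolding rescaled_density_def eq exp_add by simp
    qed
    from Lim_transform_eventually[OF tendsto_mult[OF tendsto_const main] this] show ?thesis .
  qed
  have "(\<lambda>n. \<integral>y. ?f n y \<partial>lborel) \<longlonglongrightarrow> (\<integral>y. indicator J y * exp (- y) \<partial>lborel)"
  proof (rule integral_dominated_convergence[where w="\<lambda>y. B * (indicator J y * exp (- y))"])
    show "integrable lborel (\<lambda>y. B * (indicator J y * exp (- y)))"
      using integrable_exp_minus_above[OF J Jz] by simp
    show "AE y in lborel. (\<lambda>n. ?f n y) \<longlonglongrightarrow> indicator J y * exp (- y)" using lim by simp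
    show "AE y in lborel. norm (?f n y) \<le> B * (indicator J y * exp (- y))" for n
    proof (intro AE_I2)
      fix y
      show "norm (?f n y) \<le> B * (indicator J y * exp (- y))"
      proof (cases "0 < b n \<and> y \<in> J")
        case True
        then have "norm (?f n y) = x n * rescaled_density g (b n) (s n) y"
          using x(1)[of n] s(1)[of n] g by (simp add: abs_mult rescaled_density_def)
        also have "\<dots> \<le> x n * (g / b n * exp (- (b n)\<^sup>2 / (2 * g)) * exp (- y))"
          using True by (intro mult_left_mono rescaled_density_le s x) auto
        also have "\<dots> \<le> B * exp (- y)"
          using mult_right_mono[OF order_trans[OF abs_ge_self B[of n]], of "exp (- y)"]
          by (simp only: mult.assoc) simp
        finally show ?thesis using True by simp
      next
        case False
        then show ?thesis using order_trans[OF abs_ge_zero B] by (auto split: split_indicator)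
      qed
    qed
  qed (auto intro!: borel_measurable_if)
  moreover have "eventually (\<lambda>n. (\<integral>y. ?f n y \<partial>lborel) = x n * (\<integral>y. indicator J y * rescaled_density g (b n) (s n) y \<partial>lborel)) sequentially"
    using b_ev by eventually_elim simp
  ultimately show ?thesis by (rule Lim_transform_eventually)
qed

text \<open>
  Uniformity over the variance comes from the freedom to choose the sequence in
  \<open>rescaled_gaussian_limit\<close>: choose a variance that violates the claim whenever there
  is one.
\<close>

lemma rescaled_gaussian_limit_uniform:
  fixes b x \<kappa> :: "nat \<Rightarrow> real"
  assumes b: "filterlim b at_top sequentially"
    and x: "\<And>n. 0 \<le> x n" "(\<lambda>n. x n * (g / b n * exp (- (b n)\<^sup>2 / (2 * g)))) \<longlonglongrightarrow> sqrt (2 * pi * g)"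
    and g: "1 \<le> g" and \<kappa>: "\<And>n. 0 \<le> \<kappa> n" "(\<lambda>n. \<kappa> n * (b n)\<^sup>2) \<longlonglongrightarrow> 0"
    and J: "J \<in> sets borel" "J \<subseteq> {z..}" and \<epsilon>: "0 < \<epsilon>"
  shows "eventually (\<lambda>n. \<forall>s. 1 \<le> s \<and> g - \<kappa> n \<le> s \<and> s \<le> g \<longrightarrow>
    \<bar>x n * (\<integral>y. indicator J y * rescaled_density g (b n) s y \<partial>lborel) - (\<integral>y. indicator J y * exp (- y) \<partial>lborel)\<bar> < \<epsilon>) sequentially"
proof -
  \<comment> \<open>The variance \<open>g\<close> itself serves as a default where no violating variance exists.\<close>
  define bad where "bad n s \<longleftrightarrow> (1 \<le> s \<and> g - \<kappa> n \<le> s \<and> s \<le> g) \<and>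
    \<not> \<bar>x n * (\<integral>y. indicator J y * rescaled_density g (b n) s y \<partial>lborel) - (\<integral>y. indicator J y * exp (- y) \<partial>lborel)\<bar> < \<epsilon>" for n s
  define s where "s n = (if \<exists>s. bad n s then SOME s. bad n s else g)" for n
  have bad: "bad n (s n)" if "bad n s'" for n s'
    using that someI_ex[of "bad n"] by (auto simp: s_def)
  have range: "1 \<le> s n \<and> g - \<kappa> n \<le> s n \<and> s n \<le> g" for n
  proof (cases "\<exists>s. bad n s")
    case True
    then have "bad n (s n)" using bad by blast
    then show ?thesis by (simp add: bad_def)
  next
    case False
    then show ?thesis using g \<kappa>(1)[of n] by (simp add: s_def)
  qed
  have "(\<lambda>n. (g - s n) * (b n)\<^sup>2) \<longlonglongrightarrow> 0"
  proof (rule tendsto_sandwich[OF _ _ tendsto_const \<kappa>(2)])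
    show "eventually (\<lambda>n. 0 \<le> (g - s n) * (b n)\<^sup>2) sequentially" using range by simp
    have "g - s n \<le> \<kappa> n" for n using range[of n] by linarith
    then show "eventually (\<lambda>n. (g - s n) * (b n)\<^sup>2 \<le> \<kappa> n * (b n)\<^sup>2) sequentially"
      by (intro always_eventually allI mult_right_mono) auto
  qed
  then have "(\<lambda>n. x n * (\<integral>y. indicator J y * rescaled_density g (b n) (s n) y \<partial>lborel))
      \<longlonglongrightarrow> (\<integral>y. indicator J y * exp (- y) \<partial>lborel)"
    using range by (intro rescaled_gaussian_limit[OF b x _ _ _ J]) auto
  then have "eventually (\<lambda>n. \<bar>x n * (\<integral>y. indicator J y * rescaled_density g (b n) (s n) y \<partial>lborel) - (\<integral>y. indicator J y * exp (- y) \<partial>lborel)\<bar> < \<epsilon>) sequentially"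
    using \<epsilon> by (auto simp: tendsto_iff dist_real_def)
  then show ?thesis
  proof eventually_elim
    case (elim n)
    then have "\<not> bad n s'" for s' using bad[of n s'] by (auto simp: bad_def)
    then show ?case by (auto simp: bad_def)
  qed
qed

section \<open>Asymptotics of the normalizing constants\<close>

definition unit_centering :: "real \<Rightarrow> real" where
  "unit_centering x = sqrt (2 * ln x) - (ln (ln x) + ln (4 * pi)) / (2 * sqrt (2 * ln x))"

lemma centering_eq: "centering g x = sqrt g * unit_centering x"
  by (simp add: centering_def unit_centering_def)

lemma eventually_greater:
  fixes f :: "'a \<Rightarrow> real"
  shows "filterlim f at_top F \<Longrightarrow> eventually (\<lambda>x. c < f x) F"
  by (simp add: filterlim_at_top_dense)

lemma unit_centering_at_top: "filterlim unit_centering at_top at_top"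
  unfolding unit_centering_def by real_asymp

lemma unit_centering_le: "eventually (\<lambda>x. unit_centering x \<le> sqrt (2 * ln x)) at_top"
proof -
  have "eventually (\<lambda>x::real. 0 < ln (ln x) + ln (4 * pi)) at_top" by real_asymp
  moreover have "eventually (\<lambda>x::real. 0 < ln x) at_top" by real_asymp
  ultimately show ?thesis by eventually_elim (simp add: unit_centering_def)
qed

text \<open>
  The logarithmic correction in the centering is tuned to this limit: in the square it produces the
  factor \<open>sqrt (4 * pi * ln x)\<close> that turns the Gaussian exponential into a tail
  probability of order \<open>1 / x\<close>.
\<close>

lemma unit_centering_gauss:
  "((\<lambda>x. x * exp (- (unit_centering x)\<^sup>2 / 2) / unit_centering x) \<longlongrightarrow> sqrt (2 * pi)) at_top"
proof -
  let ?c = "ln (4 * pi)"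
  have "((\<lambda>x. sqrt (4 * pi) * (sqrt (ln x) / unit_centering x) * exp (- ((ln (ln x) + ?c)\<^sup>2 / (16 * ln x))))
      \<longlongrightarrow> sqrt (4 * pi) * (1 / sqrt 2) * exp (- 0)) at_top"
  proof (intro tendsto_mult tendsto_const tendsto_exp tendsto_minus)
    show "((\<lambda>x. sqrt (ln x) / unit_centering x) \<longlongrightarrow> 1 / sqrt 2) at_top"
      unfolding unit_centering_def by (real_asymp simp: powr_half_sqrt inverse_eq_divide)
    show "((\<lambda>x. (ln (ln x) + ?c)\<^sup>2 / (16 * ln x)) \<longlongrightarrow> 0) at_top" by real_asymp
  qed
  moreover have "sqrt (4 * pi) * (1 / sqrt 2) * exp (- 0) = sqrt (2 * pi)"
  proof -
    have "sqrt (4 * pi) = sqrt 2 * sqrt (2 * pi)" by (simp flip: real_sqrt_mult)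
    then show ?thesis by simp
  qed
  moreover have "eventually (\<lambda>x. sqrt (4 * pi) * (sqrt (ln x) / unit_centering x) * exp (- ((ln (ln x) + ?c)\<^sup>2 / (16 * ln x)))
      = x * exp (- (unit_centering x)\<^sup>2 / 2) / unit_centering x) at_top"
    using eventually_gt_at_top[of 1]
  proof eventually_elim
    case (elim x)
    define l where "l = ln x"
    have l: "0 < l" using elim by (simp add: l_def)
    have "(unit_centering x)\<^sup>2 / 2 = l - (ln l + ?c) / 2 + (ln l + ?c)\<^sup>2 / (16 * l)"
    proof -
      have s: "sqrt (2 * l) * sqrt (2 * l) = 2 * l" "sqrt (2 * l) \<noteq> 0" using l by simp_all
      have "(unit_centering x)\<^sup>2 = sqrt (2 * l) * sqrt (2 * l) - (ln l + ?c) + (ln l + ?c)\<^sup>2 / (4 * (sqrt (2 * l) * sqrt (2 * l)))"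
        using s(2) unfolding unit_centering_def l_def[symmetric] power2_diff
        by (simp add: power2_eq_square power_divide)
      then show ?thesis unfolding s(1) using l by (simp add: field_simps)
    qed
    then have "exp (- (unit_centering x)\<^sup>2 / 2) = exp (- l) * exp ((ln l + ?c) / 2) * exp (- ((ln l + ?c)\<^sup>2 / (16 * l)))"
      by (simp flip: exp_add)
    also have "exp (- l) = 1 / x" using elim by (simp add: l_def exp_minus inverse_eq_divide)
    also have "exp ((ln l + ?c) / 2) = sqrt (4 * pi) * sqrt l"
    proof -
      have "(ln l + ?c) / 2 = ln (sqrt (4 * pi) * sqrt l)" using l by (simp add: ln_mult ln_sqrt)
      then show ?thesis using l by simp
    qed
    finally show ?case using elim by (simp add: l_def field_simps)
  qed
  ultimately show ?thesis using Lim_transform_eventually by fastforce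
qed

lemma centering_at_top: "0 < g \<Longrightarrow> filterlim (centering g) at_top at_top"
  unfolding centering_eq
  by (rule filterlim_tendsto_pos_mult_at_top[OF tendsto_const _ unit_centering_at_top]) simp

lemma centering_gauss:
  assumes g: "0 < g"
  shows "((\<lambda>x. x * (g / centering g x * exp (- (centering g x)\<^sup>2 / (2 * g)))) \<longlongrightarrow> sqrt (2 * pi * g)) at_top"
proof -
  have "x * (g / centering g x * exp (- (centering g x)\<^sup>2 / (2 * g)))
      = sqrt g * (x * exp (- (unit_centering x)\<^sup>2 / 2) / unit_centering x)" for x
  proof -
    have "(centering g x)\<^sup>2 / (2 * g) = (unit_centering x)\<^sup>2 / 2"
      using g by (simp add: centering_eq power_mult_distrib)
    moreover have "g / centering g x = sqrt g / unit_centering x"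
      using g by (simp add: centering_eq real_div_sqrt flip: divide_divide_eq_left)
    ultimately show ?thesis by simp
  qed
  moreover have "sqrt (2 * pi * g) = sqrt g * sqrt (2 * pi)" by (simp add: real_sqrt_mult)
  ultimately show ?thesis using tendsto_mult[OF tendsto_const[of "sqrt g"] unit_centering_gauss] by simp
qed

lemma powr_centering_tendsto_0:
  assumes "0 < e" "0 \<le> p"
  shows "((\<lambda>x. x powr (- e) * (unit_centering x) powr p) \<longlongrightarrow> 0) at_top"
proof (rule tendsto_sandwich[OF _ _ tendsto_const])
  show "eventually (\<lambda>x. 0 \<le> x powr (- e) * (unit_centering x) powr p) at_top" by simp
  show "eventually (\<lambda>x. x powr (- e) * (unit_centering x) powr p \<le> x powr (- e) * sqrt (2 * ln x) powr p) at_top"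
    using unit_centering_le eventually_greater[OF unit_centering_at_top, of 0]
    by eventually_elim (use assms in \<open>auto intro!: mult_left_mono powr_mono2\<close>)
  show "((\<lambda>x. x powr (- e) * sqrt (2 * ln x) powr p) \<longlongrightarrow> 0) at_top"
    using assms by real_asymp
qed

text \<open>
  The height that the rescaling maps to \<open>z\<close>.
\<close>

definition level :: "real \<Rightarrow> real \<Rightarrow> real \<Rightarrow> real" where
  "level g z x = centering g x + scaling g x * z"

definition tail_bound :: "real \<Rightarrow> real \<Rightarrow> real \<Rightarrow> real" where
  "tail_bound g z x = g / level g z x * exp (- (level g z x)\<^sup>2 / (2 * g))"

text \<open>
  The sum of two field values has variance at most \<open>4 * g - 1\<close>, whereas perfectly
  correlated values of variance \<open>g\<close> would give \<open>4 * g\<close>. The second summand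
  belongs to the independent, resampled pair.
\<close>

definition near_bound :: "real \<Rightarrow> real \<Rightarrow> real \<Rightarrow> real" where
  "near_bound g z x = (4 * g - 1) / (2 * level g z x) * exp (- (2 * level g z x)\<^sup>2 / (2 * (4 * g - 1)))
    + (tail_bound g z x)\<^sup>2"

text \<open>
  Here \<open>K\<close> is the number of thresholds and \<open>\<delta>\<close> the displacement
  caused by resampling; the field is cut off at height \<open>ln x\<close>.
\<close>

definition far_bound :: "real \<Rightarrow> real \<Rightarrow> real \<Rightarrow> real \<Rightarrow> real \<Rightarrow> real" where
  "far_bound K g z \<delta> x = K * (2 * \<delta> * exp (- (level g z x - \<delta>)\<^sup>2 / (2 * g))) * tail_bound g z x
    + 2 * (2 * (g / ln x * exp (- (ln x)\<^sup>2 / (2 * g))))"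

context
  fixes g z :: real
  assumes g: "0 < g"
begin

lemma level_ratio: "((\<lambda>x. level g z x / unit_centering x) \<longlongrightarrow> sqrt g) at_top"
proof -
  have "((\<lambda>x. sqrt g + sqrt g * z / (unit_centering x)\<^sup>2) \<longlongrightarrow> sqrt g + 0) at_top"
    by (intro tendsto_add tendsto_const tendsto_divide_0[OF tendsto_const] filterlim_at_top_imp_at_infinity
        filterlim_pow_at_top unit_centering_at_top) simp
  moreover have "eventually (\<lambda>x. sqrt g + sqrt g * z / (unit_centering x)\<^sup>2 = level g z x / unit_centering x) at_top"
    using eventually_greater[OF unit_centering_at_top, of 0]
  proof eventually_elim
    case (elim x)
    have "scaling g x = sqrt g / unit_centering x"
      using g elim real_sqrt_mult_self[of g] by (simp add: scaling_def centering_eq field_simps)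
    then show ?case using elim by (simp add: level_def centering_eq power2_eq_square field_simps)
  qed
  ultimately show ?thesis using Lim_transform_eventually by fastforce
qed

lemma level_at_top: "filterlim (level g z) at_top at_top"
proof -
  have "filterlim (\<lambda>x. level g z x / unit_centering x * unit_centering x) at_top at_top"
    by (rule filterlim_tendsto_pos_mult_at_top[OF level_ratio _ unit_centering_at_top]) (use g in simp)
  moreover have "eventually (\<lambda>x. level g z x / unit_centering x * unit_centering x = level g z x) at_top"
    using eventually_greater[OF unit_centering_at_top, of 0]
    by eventually_elim simp
  ultimately show ?thesis by (rule filterlim_cong[OF refl refl, THEN iffD1, rotated])
qed

lemma level_gauss:
  "((\<lambda>x. x * exp (- (level g z x)\<^sup>2 / (2 * g)) / unit_centering x) \<longlongrightarrow> sqrt (2 * pi) * exp (- z)) at_top"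
proof -
  have "((\<lambda>x. x * exp (- (unit_centering x)\<^sup>2 / 2) / unit_centering x * exp (- z - z\<^sup>2 / (2 * (unit_centering x)\<^sup>2)))
      \<longlongrightarrow> sqrt (2 * pi) * exp (- z - 0)) at_top"
    by (intro tendsto_mult unit_centering_gauss tendsto_exp tendsto_diff tendsto_const
        tendsto_divide_0[OF tendsto_const] filterlim_at_top_imp_at_infinity
        filterlim_tendsto_pos_mult_at_top[OF tendsto_const] filterlim_pow_at_top unit_centering_at_top) auto
  moreover have "eventually (\<lambda>x. x * exp (- (unit_centering x)\<^sup>2 / 2) / unit_centering x * exp (- z - z\<^sup>2 / (2 * (unit_centering x)\<^sup>2))
      = x * exp (- (level g z x)\<^sup>2 / (2 * g)) / unit_centering x) at_top"
    using eventually_greater[OF unit_centering_at_top, of 0]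
  proof eventually_elim
    case (elim x)
    have b: "0 < centering g x" using elim g by (simp add: centering_eq)
    have "(level g z x)\<^sup>2 / (2 * g) = (unit_centering x)\<^sup>2 / 2 + z + z\<^sup>2 / (2 * (unit_centering x)\<^sup>2)"
    proof -
      have "(g / centering g x)\<^sup>2 * z\<^sup>2 / (2 * g) = z\<^sup>2 / (2 * (unit_centering x)\<^sup>2)"
      proof -
        have "(centering g x)\<^sup>2 = g * (unit_centering x)\<^sup>2" using g by (simp add: centering_eq power_mult_distrib)
        then show ?thesis using g by (simp add: power_divide) (simp add: power2_eq_square)
      qed
      moreover have "(centering g x)\<^sup>2 / (2 * g) = (unit_centering x)\<^sup>2 / 2"
        using g by (simp add: centering_eq power_mult_distrib)
      ultimately show ?thesis
        using rescaled_exponent[OF b g, of z] by (simp add: level_def scaling_def)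
    qed
    then have "exp (- (level g z x)\<^sup>2 / (2 * g)) = exp (- (unit_centering x)\<^sup>2 / 2) * exp (- z - z\<^sup>2 / (2 * (unit_centering x)\<^sup>2))"
      by (simp flip: exp_add)
    then show ?case by simp
  qed
  ultimately show ?thesis using Lim_transform_eventually by fastforce
qed

lemma tail_bound_limit: "((\<lambda>x. x * tail_bound g z x) \<longlongrightarrow> g * (sqrt (2 * pi) * exp (- z)) / sqrt g) at_top"
proof -
  have "((\<lambda>x. g * (x * exp (- (level g z x)\<^sup>2 / (2 * g)) / unit_centering x) / (level g z x / unit_centering x))
      \<longlongrightarrow> g * (sqrt (2 * pi) * exp (- z)) / sqrt g) at_top"
    by (intro tendsto_divide tendsto_mult tendsto_const level_gauss level_ratio) (use g in simp)
  moreover have "eventually (\<lambda>x. g * (x * exp (- (level g z x)\<^sup>2 / (2 * g)) / unit_centering x) / (level g z x / unit_centering x)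
      = x * tail_bound g z x) at_top"
    using eventually_greater[OF unit_centering_at_top, of 0]
    by eventually_elim (simp add: tail_bound_def)
  ultimately show ?thesis by (rule Lim_transform_eventually)
qed

text \<open>
  Replacing \<open>4 * g\<close> by \<open>4 * g - 1\<close> improves the order of a joint
  exceedance from \<open>1 / x\<close> to \<open>x powr (- 1 - 1 / (4 * g - 1))\<close>, up to
  logarithms. This leaves room for \<open>x powr e\<close> neighbours of each of the
  \<open>x\<close> sites.
\<close>

lemma near_bound_limit:
  assumes g1: "1 \<le> g" and e: "0 < e" "e < 1 / (4 * g - 1)"
  shows "((\<lambda>x. x powr (1 + e) * near_bound g z x) \<longlongrightarrow> 0) at_top"
proof -
  define \<theta> where "\<theta> = 1 / (4 * g - 1)"
  have G: "0 < 4 * g - 1" "3 \<le> 4 * g - 1" using g1 by auto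
  have \<theta>: "0 < \<theta>" "e < \<theta>" "\<theta> < 1" using G e by (auto simp: \<theta>_def field_simps)
  have pos: "eventually (\<lambda>x. 0 < x \<and> 0 < unit_centering x \<and> 0 < level g z x) at_top"
    using eventually_gt_at_top[of 0] eventually_greater[OF unit_centering_at_top, of 0]
      eventually_greater[OF level_at_top, of 0]
    by eventually_elim auto
  have lim1: "((\<lambda>x. (4 * g - 1) / (2 * level g z x)
        * ((x * exp (- (level g z x)\<^sup>2 / (2 * g)) / unit_centering x) powr (1 + \<theta>) * (x powr (- (\<theta> - e)) * (unit_centering x) powr (1 + \<theta>))))
      \<longlongrightarrow> 0 * ((sqrt (2 * pi) * exp (- z)) powr (1 + \<theta>) * 0)) at_top"
    using \<theta>
    by (intro tendsto_mult tendsto_powr level_gauss tendsto_const powr_centering_tendsto_0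
        tendsto_divide_0[OF tendsto_const] filterlim_at_top_imp_at_infinity
        filterlim_tendsto_pos_mult_at_top[OF tendsto_const] level_at_top) auto
  have lim2: "((\<lambda>x. (x * tail_bound g z x)\<^sup>2 * x powr (- (1 - e))) \<longlongrightarrow> (g * (sqrt (2 * pi) * exp (- z)) / sqrt g)\<^sup>2 * 0) at_top"
  proof (intro tendsto_mult tendsto_power tail_bound_limit)
    have "0 < 1 - e" using \<theta> by simp
    then show "((\<lambda>x::real. x powr (- (1 - e))) \<longlongrightarrow> 0) at_top" by real_asymp
  qed
  have "eventually (\<lambda>x. (4 * g - 1) / (2 * level g z x)
        * ((x * exp (- (level g z x)\<^sup>2 / (2 * g)) / unit_centering x) powr (1 + \<theta>) * (x powr (- (\<theta> - e)) * (unit_centering x) powr (1 + \<theta>)))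
      + (x * tail_bound g z x)\<^sup>2 * x powr (- (1 - e))
      = x powr (1 + e) * near_bound g z x) at_top"
    using pos
  proof eventually_elim
    case (elim x)
    let ?u = "level g z x" and ?E = "exp (- (level g z x)\<^sup>2 / (2 * g))"
    have x: "0 < x" "0 < unit_centering x" using elim by auto
    have "(2 * ?u)\<^sup>2 / (2 * (4 * g - 1)) = ?u\<^sup>2 / (2 * g) * (1 + \<theta>)"
      using G g by (simp add: \<theta>_def field_simps)
    then have E: "exp (- (2 * ?u)\<^sup>2 / (2 * (4 * g - 1))) = ?E powr (1 + \<theta>)"
      by (simp add: powr_def)
    have 1: "(x * ?E / unit_centering x) powr (1 + \<theta>) * (x powr (- (\<theta> - e)) * unit_centering x powr (1 + \<theta>))
        = x powr (1 + e) * ?E powr (1 + \<theta>)"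
    proof -
      have "(x * ?E / unit_centering x) powr (1 + \<theta>) = x powr (1 + \<theta>) * ?E powr (1 + \<theta>) / unit_centering x powr (1 + \<theta>)"
        using x by (simp add: powr_mult powr_divide)
      moreover have "x powr (1 + \<theta>) * x powr (- (\<theta> - e)) = x powr (1 + e)"
        using x by (simp flip: powr_add)
      ultimately show ?thesis using x by (simp add: field_simps)
    qed
    have 2: "(x * tail_bound g z x)\<^sup>2 * x powr (- (1 - e)) = x powr (1 + e) * (tail_bound g z x)\<^sup>2"
    proof -
      have "x\<^sup>2 * x powr (- (1 - e)) = x powr (1 + e)"
        using x by (simp flip: powr_add powr_numeral)
      then show ?thesis by (simp add: power_mult_distrib mult_ac)
    qed
    show ?case unfolding near_bound_def 1 2 E by (simp add: algebra_simps)
  qed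
  from Lim_transform_eventually[OF tendsto_add[OF lim1 lim2] this] show ?thesis by simp
qed

text \<open>
  Of the order \<open>x\<^sup>2\<close> pairs each contributes two factors \<open>1 / x\<close>, up
  to logarithms, and the factor \<open>\<delta>\<close>, whose polynomial decay wins against the
  logarithms.
\<close>

lemma far_bound_limit:
  assumes D: "0 < D" and e: "0 < e"
  defines "\<delta> \<equiv> \<lambda>x. D * x powr (- e) * ln x"
  shows "((\<lambda>x. x\<^sup>2 * far_bound K g z (\<delta> x) x) \<longlongrightarrow> 0) at_top"
    and "eventually (\<lambda>x. 0 < \<delta> x \<and> \<delta> x \<le> level g z x) at_top"
proof -
  have \<delta>0: "(\<delta> \<longlongrightarrow> 0) at_top" unfolding \<delta>_def using D e by real_asymp
  have \<delta>_pos: "eventually (\<lambda>x. 0 < \<delta> x) at_top" unfolding \<delta>_def using D e by real_asymp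
  have pos: "eventually (\<lambda>x. 0 < x \<and> 0 < unit_centering x \<and> 1 < level g z x) at_top"
    using eventually_gt_at_top[of 0] eventually_greater[OF unit_centering_at_top, of 0]
      eventually_greater[OF level_at_top, of 1]
    by eventually_elim auto
  have "eventually (\<lambda>x. \<delta> x < 1) at_top" using order_tendstoD(2)[OF \<delta>0, of 1] by simp
  then show "eventually (\<lambda>x. 0 < \<delta> x \<and> \<delta> x \<le> level g z x) at_top"
    using \<delta>_pos pos by eventually_elim auto
  have \<delta>c: "((\<lambda>x. \<delta> x * unit_centering x) \<longlongrightarrow> 0) at_top"
  proof (rule tendsto_sandwich[OF _ _ tendsto_const])
    show "eventually (\<lambda>x. 0 \<le> \<delta> x * unit_centering x) at_top"
      using \<delta>_pos pos by eventually_elim auto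
    show "eventually (\<lambda>x. \<delta> x * unit_centering x \<le> \<delta> x * sqrt (2 * ln x)) at_top"
      using \<delta>_pos unit_centering_le by eventually_elim auto
    show "((\<lambda>x. \<delta> x * sqrt (2 * ln x)) \<longlongrightarrow> 0) at_top"
      unfolding \<delta>_def using D e by real_asymp
  qed
  have lim1: "((\<lambda>x. 2 * K * (x * tail_bound g z x) * (x * exp (- (level g z x)\<^sup>2 / (2 * g)) / unit_centering x)
        * (\<delta> x * unit_centering x) * exp ((level g z x / unit_centering x) * (\<delta> x * unit_centering x) / g - (\<delta> x)\<^sup>2 / (2 * g)))
      \<longlongrightarrow> 2 * K * (g * (sqrt (2 * pi) * exp (- z)) / sqrt g) * (sqrt (2 * pi) * exp (- z)) * 0
        * exp (sqrt g * 0 / g - 0\<^sup>2 / (2 * g))) at_top"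
    using g by (intro tendsto_mult tendsto_const tail_bound_limit level_gauss \<delta>c tendsto_exp tendsto_diff tendsto_divide
        level_ratio tendsto_power \<delta>0) auto
  have lim2: "((\<lambda>x::real. x\<^sup>2 * (2 * (2 * (g / ln x * exp (- (ln x)\<^sup>2 / (2 * g)))))) \<longlongrightarrow> 0) at_top"
    using g by real_asymp
  have "eventually (\<lambda>x. 2 * K * (x * tail_bound g z x) * (x * exp (- (level g z x)\<^sup>2 / (2 * g)) / unit_centering x)
        * (\<delta> x * unit_centering x) * exp ((level g z x / unit_centering x) * (\<delta> x * unit_centering x) / g - (\<delta> x)\<^sup>2 / (2 * g))
      + x\<^sup>2 * (2 * (2 * (g / ln x * exp (- (ln x)\<^sup>2 / (2 * g)))))
      = x\<^sup>2 * far_bound K g z (\<delta> x) x) at_top"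
    using pos
  proof eventually_elim
    case (elim x)
    let ?u = "level g z x"
    have "- (?u - \<delta> x)\<^sup>2 / (2 * g) = - ?u\<^sup>2 / (2 * g) + ((?u / unit_centering x) * (\<delta> x * unit_centering x) / g - (\<delta> x)\<^sup>2 / (2 * g))"
      using elim g by (simp add: power2_eq_square field_simps)
    then have "exp (- (?u - \<delta> x)\<^sup>2 / (2 * g)) = exp (- ?u\<^sup>2 / (2 * g))
        * exp ((?u / unit_centering x) * (\<delta> x * unit_centering x) / g - (\<delta> x)\<^sup>2 / (2 * g))"
      by (simp only: exp_add)
    then show ?case using elim by (simp add: far_bound_def power2_eq_square algebra_simps)
  qed
  from Lim_transform_eventually[OF tendsto_add[OF lim1 lim2] this]
  show "((\<lambda>x. x\<^sup>2 * far_bound K g z (\<delta> x) x) \<longlongrightarrow> 0) at_top" by simp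
qed

end

section \<open>Decoupling the Gaussian free field\<close>

subsection \<open>Counting lattice points\<close>

lemma bij_betw_vec_nth:
  "bij_betw vec_nth {\<alpha> :: 'a ^ 'd. \<forall>i. \<alpha> $ i \<in> S i} (PiE UNIV S)"
  by (rule bij_betwI[where g=vec_lambda]) (auto simp: PiE_iff)

lemma card_vec_product:
  assumes "\<And>i. finite (S i)"
  shows "finite {\<alpha> :: 'a ^ 'd. \<forall>i. \<alpha> $ i \<in> S i}"
    and "card {\<alpha> :: 'a ^ 'd. \<forall>i. \<alpha> $ i \<in> S i} = (\<Prod>i\<in>UNIV. card (S i))"
  using bij_betw_finite[OF bij_betw_vec_nth[of S]] bij_betw_same_card[OF bij_betw_vec_nth[of S]]
    card_PiE[of "UNIV :: 'd set" S] finite_PiE[of "UNIV :: 'd set" S] assms by auto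

lemma lattice_box_eq: "lattice_box n = {\<alpha>. \<forall>i. \<alpha> $ i \<in> {0..int n - 1}}"
  by (auto simp: lattice_box_def)

lemma finite_lattice_box [simp]: "finite (lattice_box n)"
  unfolding lattice_box_eq by (rule card_vec_product) simp

lemma card_lattice_box: "card (lattice_box n :: (int ^ 'd) set) = n ^ CARD('d)"
  unfolding lattice_box_eq by (subst card_vec_product) auto

lemma card_int_interval_le:
  assumes "0 \<le> R"
  shows "real (card {\<lceil>real_of_int k - R\<rceil>..\<lfloor>real_of_int k + R\<rfloor>}) \<le> 2 * R + 1"
proof -
  have "real_of_int (\<lfloor>real_of_int k + R\<rfloor> - \<lceil>real_of_int k - R\<rceil> + 1) \<le> 2 * R + 1" by linarith
  then show ?thesis using assms by simp
qed

lemma near_eq: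
  "{\<alpha> :: int ^ 'd. \<forall>i. \<bar>real_of_int (\<alpha> $ i - \<beta> $ i)\<bar> \<le> R}
    = {\<alpha>. \<forall>i. \<alpha> $ i \<in> {\<lceil>real_of_int (\<beta> $ i) - R\<rceil>..\<lfloor>real_of_int (\<beta> $ i) + R\<rfloor>}}"
proof -
  have "\<bar>real_of_int (a - b)\<bar> \<le> R \<longleftrightarrow> a \<in> {\<lceil>real_of_int b - R\<rceil>..\<lfloor>real_of_int b + R\<rfloor>}" for a b :: int
    by (simp only: atLeastAtMost_iff ceiling_le_iff le_floor_iff abs_le_iff of_int_diff) linarith
  then show ?thesis by simp
qed

lemma card_near_le:
  assumes R: "1 \<le> R"
  shows "real (card {\<alpha> :: int ^ 'd. \<forall>i. \<bar>real_of_int (\<alpha> $ i - \<beta> $ i)\<bar> \<le> R}) \<le> (3 * R) ^ CARD('d)"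
proof -
  have "real (card {\<alpha> :: int ^ 'd. \<forall>i. \<bar>real_of_int (\<alpha> $ i - \<beta> $ i)\<bar> \<le> R})
      = (\<Prod>i\<in>UNIV. real (card {\<lceil>real_of_int (\<beta> $ i) - R\<rceil>..\<lfloor>real_of_int (\<beta> $ i) + R\<rfloor>}))"
    unfolding near_eq by (subst card_vec_product) (auto simp: of_nat_prod)
  also have "\<dots> \<le> (\<Prod>i\<in>(UNIV :: 'd set). 3 * R)"
    using R by (intro prod_mono conjI order_trans[OF card_int_interval_le]) auto
  finally show ?thesis by simp
qed

lemma finite_near: "finite {\<alpha> :: int ^ 'd. \<forall>i. \<bar>real_of_int (\<alpha> $ i - \<beta> $ i)\<bar> \<le> R}"
  unfolding near_eq by (rule card_vec_product) simp

subsection \<open>Covariances of the field\<close>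

lemma killed_outside_right: "\<beta> \<notin> \<Lambda> \<Longrightarrow> killed \<Lambda> m \<alpha> \<beta> = 0"
  by (induction m arbitrary: \<alpha>) (auto simp: step_mean_def)

lemma green_on_outside_right: "\<beta> \<notin> \<Lambda> \<Longrightarrow> green_on \<Lambda> \<alpha> \<beta> = 0"
  by (simp add: green_on_suminf killed_outside_right)

lemma gff_centered_gaussian:
  assumes "gaussian_free_field M \<Lambda> \<psi>"
  shows "centered_gaussian M \<Lambda> (green_on \<Lambda>) \<psi>"
  using assms by (simp add: gaussian_free_field_def centered_gaussian_def centered_gaussian_axioms_def)

lemma gff_covariance:
  assumes gff: "gaussian_free_field M \<Lambda> \<psi>"
  shows "integrable M (\<lambda>\<omega>. \<psi> \<alpha> \<omega> * \<psi> \<beta> \<omega>)" "(\<integral>\<omega>. \<psi> \<alpha> \<omega> * \<psi> \<beta> \<omega> \<partial>M) = green_on \<Lambda> \<alpha> \<beta>"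
proof -
  interpret centered_gaussian M \<Lambda> "green_on \<Lambda>" \<psi> by (rule gff_centered_gaussian[OF gff])
  have meas [measurable]: "\<psi> \<gamma> \<in> borel_measurable M" for \<gamma>
    using gff by (simp add: gaussian_free_field_def)
  have zero: "AE \<omega> in M. \<psi> \<gamma> \<omega> = 0" if "\<gamma> \<notin> \<Lambda>" for \<gamma>
    using gff that by (simp add: gaussian_free_field_def)
  have "integrable M (\<lambda>\<omega>. \<psi> \<alpha> \<omega> * \<psi> \<beta> \<omega>) \<and> (\<integral>\<omega>. \<psi> \<alpha> \<omega> * \<psi> \<beta> \<omega> \<partial>M) = green_on \<Lambda> \<alpha> \<beta>"
  proof (cases "\<alpha> \<in> \<Lambda> \<and> \<beta> \<in> \<Lambda>")
    case True
    then show ?thesis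
      by (auto simp: covariance intro: gaussian_variable_mult_integrable gaussian_coordinate)
  next
    case False
    then have z: "AE \<omega> in M. \<psi> \<alpha> \<omega> * \<psi> \<beta> \<omega> = 0"
      using zero[of \<alpha>] zero[of \<beta>] by auto
    have "integrable M (\<lambda>\<omega>. \<psi> \<alpha> \<omega> * \<psi> \<beta> \<omega>)"
      by (rule integrable_cong_AE_imp[of M "\<lambda>_. 0"]) (use z in auto)
    moreover have "(\<integral>\<omega>. \<psi> \<alpha> \<omega> * \<psi> \<beta> \<omega> \<partial>M) = 0" by (rule integral_eq_zero_AE[OF z])
    ultimately show ?thesis using False by (auto simp: green_on_outside green_on_outside_right)
  qed
  then show "integrable M (\<lambda>\<omega>. \<psi> \<alpha> \<omega> * \<psi> \<beta> \<omega>)" "(\<integral>\<omega>. \<psi> \<alpha> \<omega> * \<psi> \<beta> \<omega> \<partial>M) = green_on \<Lambda> \<alpha> \<beta>"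
    by auto
qed

text \<open>
  Let \<open>m\<close> be the mean of the field over the neighbours of \<open>\<alpha>\<close>. The
  Poisson equation gives \<open>E (m * \<psi> \<gamma>) = green_on \<Lambda> \<alpha>
  \<gamma>\<close> for \<open>\<gamma> \<noteq> \<alpha>\<close> and one less for \<open>\<gamma> =
  \<alpha>\<close>, and the inequality is \<open>E (m - \<psi> \<beta>)\<^sup>2 \<ge> 0\<close>. It
  says that \<open>\<psi> \<alpha> - \<psi> \<beta>\<close> has variance at least one, whatever
  \<open>\<Lambda>\<close> is.
\<close>

lemma gff_covariance_gap:
  fixes \<psi> :: "int ^ 'd \<Rightarrow> 'w \<Rightarrow> real"
  assumes d: "CARD('d) \<ge> 3" and gff: "gaussian_free_field M \<Lambda> \<psi>"
    and \<alpha>: "\<alpha> \<in> \<Lambda>" and \<alpha>\<beta>: "\<alpha> \<noteq> \<beta>"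
  shows "2 * green_on \<Lambda> \<alpha> \<beta> \<le> green_on \<Lambda> \<alpha> \<alpha> + green_on \<Lambda> \<beta> \<beta> - 1"
proof -
  let ?G = "green_on \<Lambda>" and ?U = "unit_steps :: (int ^ 'd) set"
  define K where "K = real (card ?U)"
  have K: "0 < K" by (simp add: K_def)
  note cov = gff_covariance[OF gff]
  have sym: "?G \<gamma> \<delta> = ?G \<delta> \<gamma>" for \<gamma> \<delta>
    using cov(2)[of \<gamma> \<delta>] cov(2)[of \<delta> \<gamma>] by (simp add: mult.commute)
  have step: "(\<Sum>s\<in>?U. ?G (\<alpha> + s) \<gamma>) = K * (?G \<alpha> \<gamma> - (if \<alpha> = \<gamma> then 1 else 0))" for \<gamma>
    using green_on_step[OF d \<alpha>, of \<gamma>] K by (simp add: step_mean_def K_def)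
  have U0: "(0 :: int ^ 'd) \<notin> ?U" by (auto simp: unit_steps_def axis_def vec_eq_iff)
  have "0 \<le> (\<integral>\<omega>. ((\<Sum>s\<in>?U. \<psi> (\<alpha> + s) \<omega>) - K * \<psi> \<beta> \<omega>)\<^sup>2 \<partial>M)" by simp
  also have "\<dots> = (\<integral>\<omega>. (\<Sum>t\<in>?U. \<Sum>s\<in>?U. \<psi> (\<alpha> + s) \<omega> * \<psi> (\<alpha> + t) \<omega>)
      - 2 * K * (\<Sum>s\<in>?U. \<psi> (\<alpha> + s) \<omega> * \<psi> \<beta> \<omega>) + K\<^sup>2 * (\<psi> \<beta> \<omega> * \<psi> \<beta> \<omega>) \<partial>M)"
  proof (rule Bochner_Integration.integral_cong[OF refl])
    fix \<omega>
    have "((\<Sum>s\<in>?U. \<psi> (\<alpha> + s) \<omega>) - K * \<psi> \<beta> \<omega>)\<^sup>2 = (\<Sum>s\<in>?U. \<psi> (\<alpha> + s) \<omega>) * (\<Sum>s\<in>?U. \<psi> (\<alpha> + s) \<omega>)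
        - 2 * K * ((\<Sum>s\<in>?U. \<psi> (\<alpha> + s) \<omega>) * \<psi> \<beta> \<omega>) + K\<^sup>2 * (\<psi> \<beta> \<omega> * \<psi> \<beta> \<omega>)"
      by (simp add: power2_eq_square algebra_simps)
    then show "((\<Sum>s\<in>?U. \<psi> (\<alpha> + s) \<omega>) - K * \<psi> \<beta> \<omega>)\<^sup>2 = (\<Sum>t\<in>?U. \<Sum>s\<in>?U. \<psi> (\<alpha> + s) \<omega> * \<psi> (\<alpha> + t) \<omega>)
      - 2 * K * (\<Sum>s\<in>?U. \<psi> (\<alpha> + s) \<omega> * \<psi> \<beta> \<omega>) + K\<^sup>2 * (\<psi> \<beta> \<omega> * \<psi> \<beta> \<omega>)"
      by (simp only: sum_distrib_left sum_distrib_right)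
  qed
  also have "\<dots> = (\<Sum>t\<in>?U. \<Sum>s\<in>?U. ?G (\<alpha> + s) (\<alpha> + t)) - 2 * K * (\<Sum>s\<in>?U. ?G (\<alpha> + s) \<beta>) + K\<^sup>2 * ?G \<beta> \<beta>"
    by (simp add: cov Bochner_Integration.integral_add Bochner_Integration.integral_diff
        Bochner_Integration.integral_sum Bochner_Integration.integrable_sum)
  also have "(\<Sum>t\<in>?U. \<Sum>s\<in>?U. ?G (\<alpha> + s) (\<alpha> + t)) = (\<Sum>t\<in>?U. K * ?G (\<alpha> + t) \<alpha>)"
    unfolding step using U0 by (intro sum.cong refl) (auto simp: sym)
  also have "\<dots> = K\<^sup>2 * (?G \<alpha> \<alpha> - 1)"
    unfolding sum_distrib_left[symmetric] step by (simp add: power2_eq_square)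
  also have "K\<^sup>2 * (?G \<alpha> \<alpha> - 1) - 2 * K * (\<Sum>s\<in>?U. ?G (\<alpha> + s) \<beta>) + K\<^sup>2 * ?G \<beta> \<beta>
      = K\<^sup>2 * (?G \<alpha> \<alpha> + ?G \<beta> \<beta> - 1 - 2 * ?G \<alpha> \<beta>)"
    unfolding step using \<alpha>\<beta> by (simp add: power2_eq_square algebra_simps)
  finally show ?thesis using K by (simp add: zero_le_mult_iff)
qed

subsection \<open>The decoupling error vanishes\<close>

text \<open>
  The factor two accounts for the two copies of the coordinate in a resampling step.
\<close>

definition decay_constant :: real where
  "decay_constant = 2 / barrier_defect"

text \<open>
  Two sites are near if all their coordinates differ by at most \<open>n powr e\<close>. A site has
  at most \<open>3 ^ d * x powr e\<close> near sites; for the others the covariance is at most a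
  multiple of \<open>n powr (- e / 2)\<close>, that is of \<open>x powr (- e / (2 * d))\<close>.
\<close>

lemma gff_decoupling_bound:
  fixes \<psi> :: "int ^ 'd \<Rightarrow> 'w \<Rightarrow> real" and q :: "int ^ 'd \<Rightarrow> real \<Rightarrow> real" and e :: real
  assumes d: "CARD('d) \<ge> 3" and gff: "gaussian_free_field M (lattice_box n) \<psi>"
  assumes q: "\<And>\<alpha>. q \<alpha> \<in> borel_measurable borel" "\<And>\<alpha> y. 0 \<le> q \<alpha> y" "\<And>\<alpha> y. q \<alpha> y \<le> 1"
    and above: "\<And>\<alpha> y. q \<alpha> y < 1 \<Longrightarrow> z \<le> y"
    and T: "finite T" "\<And>v. v \<in> T \<Longrightarrow> z \<le> v"
      "\<And>\<alpha> y y'. q \<alpha> y \<noteq> q \<alpha> y' \<Longrightarrow> \<exists>v\<in>T. min y y' \<le> v \<and> v \<le> max y y'"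
  defines "x \<equiv> real (n ^ CARD('d))" and "g \<equiv> green (0 :: int ^ 'd) 0"
  defines "\<delta> \<equiv> decay_constant * x powr (- (e / (2 * CARD('d)))) * ln x"
  assumes e: "0 < e" and x: "1 < x" and b: "0 < centering g x" and \<delta>: "0 < \<delta>" "\<delta> \<le> level g z x"
  defines "F \<equiv> \<lambda>\<alpha> \<omega>. q \<alpha> ((\<psi> \<alpha> \<omega> - centering g x) / scaling g x)"
  shows "\<bar>(\<integral>\<omega>. (\<Prod>\<alpha>\<in>lattice_box n. F \<alpha> \<omega>) \<partial>M) - (\<Prod>\<alpha>\<in>lattice_box n. \<integral>\<omega>. F \<alpha> \<omega> \<partial>M)\<bar>
    \<le> 3 ^ CARD('d) * (x powr (1 + e) * near_bound g z x) + x\<^sup>2 * far_bound (card T) g z \<delta> x"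
proof -
  let ?V = "lattice_box n :: (int ^ 'd) set" and ?C = "green_on (lattice_box n :: (int ^ 'd) set)"
  let ?u = "level g z x" and ?b = "centering g x" and ?a = "scaling g x"
  interpret centered_gaussian M ?V ?C \<psi> by (rule gff_centered_gaussian[OF gff])
  have g1: "1 \<le> g"
    unfolding g_def by (rule green_0_ge_1[OF d])
  have a: "0 < ?a" using b g1 by (simp add: scaling_def)
  have u: "0 < ?u" using \<delta> by linarith
  have n: "1 \<le> n" using x by (cases n) (auto simp: x_def power_0_left split: if_splits)
  define \<phi> where "\<phi> \<alpha> y = q \<alpha> ((y - ?b) / ?a)" for \<alpha> y
  define \<tau> where "\<tau> v = ?b + ?a * v" for v
  have le_iff: "v \<le> (y - ?b) / ?a \<longleftrightarrow> \<tau> v \<le> y" "(y - ?b) / ?a \<le> v \<longleftrightarrow> y \<le> \<tau> v" for v y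
    using a by (auto simp: \<tau>_def field_simps)
  have u_eq: "?u = \<tau> z" by (simp add: level_def \<tau>_def)
  have \<phi>_meas: "\<phi> \<alpha> \<in> borel_measurable borel" for \<alpha>
    unfolding \<phi>_def by (rule measurable_compose[OF _ q(1)]) measurable
  have \<phi>01: "0 \<le> \<phi> \<alpha> y" "\<phi> \<alpha> y \<le> 1" for \<alpha> y using q by (auto simp: \<phi>_def)
  have \<phi>_above: "?u \<le> y" if "\<phi> \<alpha> y < 1" for \<alpha> y
    using above[of \<alpha> "(y - ?b) / ?a"] that by (simp add: \<phi>_def le_iff u_eq)
  have \<phi>_T: "\<exists>w\<in>\<tau> ` T. min y y' \<le> w \<and> w \<le> max y y'" if "\<phi> \<alpha> y \<noteq> \<phi> \<alpha> y'" for \<alpha> y y'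
  proof -
    from that obtain v where v: "v \<in> T" "min ((y - ?b) / ?a) ((y' - ?b) / ?a) \<le> v" "v \<le> max ((y - ?b) / ?a) ((y' - ?b) / ?a)"
      using T(3)[of \<alpha>] unfolding \<phi>_def by blast
    then have "min y y' \<le> \<tau> v \<and> \<tau> v \<le> max y y'"
      by (auto simp: min_le_iff_disj le_max_iff_disj le_iff)
    then show ?thesis using v(1) by blast
  qed
  have C_diag: "1 \<le> ?C k k" "?C k k \<le> g" if "k \<in> ?V" for k
    using green_on_diag_ge_1[OF d that] green_on_le_green[OF d, of ?V k k] green_diag[of k] by (auto simp: g_def)
  have tail: "prob {\<omega> \<in> space M. ?u \<le> \<psi> k \<omega>} \<le> tail_bound g z x" if "k \<in> ?V" for k
    unfolding tail_bound_def using C_diag[OF that] by (intro upper_tail_coordinate that u) auto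
  have tail0: "0 \<le> tail_bound g z x" using u g1 by (simp add: tail_bound_def)
  have "0 < ln x" using x by simp
  let ?near = "near_bound g z x" and ?far = "far_bound (card T) g z \<delta> x"
  have near0: "0 \<le> ?near" using u g1 by (simp add: near_bound_def)
  have far0: "0 \<le> ?far" unfolding far_bound_def using \<delta> tail0 g1 \<open>0 < ln x\<close> by (intro add_nonneg_nonneg mult_nonneg_nonneg) auto
  have near: "coupling_error \<phi> i k \<le> ?near" if ik: "i \<in> ?V" "k \<in> ?V" "i \<noteq> k" for i k
  proof -
    have "coupling_error \<phi> i k \<le> prob {\<omega> \<in> space M. ?u \<le> \<psi> i \<omega> \<and> ?u \<le> \<psi> k \<omega>}
        + prob {\<omega> \<in> space M. ?u \<le> \<psi> i \<omega>} * prob {\<omega> \<in> space M. ?u \<le> \<psi> k \<omega>}"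
      using C_diag[OF ik(2)] by (intro coupling_error_near ik \<phi>01 \<phi>_above) auto
    also have "\<dots> \<le> (4 * g - 1) / (2 * ?u) * exp (- (2 * ?u)\<^sup>2 / (2 * (4 * g - 1))) + tail_bound g z x * tail_bound g z x"
      using C_diag[OF ik(1)] C_diag[OF ik(2)] gff_covariance_gap[OF d gff ik(1,3)] green_on_nonneg[of ?V i k]
      by (intro add_mono mult_mono joint_upper_tail tail ik u tail0) auto
    finally show ?thesis by (simp add: near_bound_def power2_eq_square)
  qed
  define R where "R = real n powr e"
  have R1: "1 \<le> R" using n e by (simp add: R_def ge_one_powr_ge_zero)
  have xn: "x powr p = real n powr (real CARD('d) * p)" for p :: real
    using n by (simp add: x_def powr_powr flip: powr_realpow)
  have far: "coupling_error \<phi> i k \<le> ?far"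
    if ik: "i \<in> ?V" "k \<in> ?V" "i \<noteq> k" and far: "\<not> (\<forall>j. \<bar>real_of_int (i $ j - k $ j)\<bar> \<le> R)" for i k
  proof -
    from far obtain j where j: "R \<le> \<bar>real_of_int (i $ j - k $ j)\<bar>" by (auto simp: not_le intro: less_imp_le)
    have "?C i k \<le> R powr (-1/2) / barrier_defect"
      using green_decay[OF d _ j] R1 green_on_le_green[OF d, of ?V i k] by linarith
    also have "R powr (-1/2) = x powr (- (e / (2 * CARD('d))))"
      unfolding xn by (simp add: R_def powr_powr)
    finally have C: "?C i k \<le> x powr (- (e / (2 * CARD('d)))) / barrier_defect" .
    have "\<bar>?C i k / ?C k k\<bar> \<le> ?C i k"
      using C_diag(1)[OF ik(2)] green_on_nonneg[of ?V i k] by (simp add: divide_le_eq mult_le_cancel_left1)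
    then have c: "\<bar>?C i k / ?C k k\<bar> * (2 * ln x) \<le> \<delta>"
      using order_trans[OF _ C] mult_right_mono[of "\<bar>?C i k / ?C k k\<bar>" "x powr (- (e / (2 * CARD('d)))) / barrier_defect" "2 * ln x"] \<open>0 < ln x\<close>
      by (simp add: \<delta>_def decay_constant_def mult_ac)
    have "coupling_error \<phi> i k \<le> (\<Sum>w\<in>\<tau> ` T. prob {\<omega> \<in> space M. \<bar>\<psi> i \<omega> - w\<bar> \<le> \<delta>}) * prob {\<omega> \<in> space M. ?u \<le> \<psi> k \<omega>}
        + 2 * prob {\<omega> \<in> space M. ln x \<le> \<bar>\<psi> k \<omega>\<bar>}"
      using C_diag[OF ik(2)] T(1) by (intro coupling_error_far ik \<phi>01 \<phi>_above \<phi>_T c) auto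
    also have "\<dots> \<le> (card T * (2 * \<delta> * exp (- (?u - \<delta>)\<^sup>2 / (2 * g)))) * tail_bound g z x
        + 2 * (2 * (g / ln x * exp (- (ln x)\<^sup>2 / (2 * g))))"
    proof (intro add_mono mult_mono tail ik order_refl two_sided_tail_coordinate C_diag \<open>0 < ln x\<close>)
      have "prob {\<omega> \<in> space M. \<bar>\<psi> i \<omega> - w\<bar> \<le> \<delta>} \<le> 2 * \<delta> * exp (- (?u - \<delta>)\<^sup>2 / (2 * g))" if "w \<in> \<tau> ` T" for w
      proof -
        have w: "?u \<le> w" using that T(2) a by (auto simp: u_eq \<tau>_def)
        have "prob {\<omega> \<in> space M. \<bar>\<psi> i \<omega> - w\<bar> \<le> \<delta>} \<le> 2 * \<delta> * exp (- (w - \<delta>)\<^sup>2 / (2 * g))"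
          using w \<delta> C_diag[OF ik(1)] by (intro gaussian_window[OF coordinate_distributed[OF ik(1)]]) auto
        also have "\<dots> \<le> 2 * \<delta> * exp (- (?u - \<delta>)\<^sup>2 / (2 * g))"
          using w \<delta> g1 by (auto intro!: divide_right_mono power_mono)
        finally show ?thesis .
      qed
      then have "(\<Sum>w\<in>\<tau> ` T. prob {\<omega> \<in> space M. \<bar>\<psi> i \<omega> - w\<bar> \<le> \<delta>})
          \<le> of_nat (card (\<tau> ` T)) * (2 * \<delta> * exp (- (?u - \<delta>)\<^sup>2 / (2 * g)))"
        by (rule sum_bounded_above)
      also have "\<dots> \<le> card T * (2 * \<delta> * exp (- (?u - \<delta>)\<^sup>2 / (2 * g)))"
        using card_image_le[OF T(1), of \<tau>] \<delta> by (intro mult_right_mono) auto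
      finally show "(\<Sum>w\<in>\<tau> ` T. prob {\<omega> \<in> space M. \<bar>\<psi> i \<omega> - w\<bar> \<le> \<delta>})
          \<le> card T * (2 * \<delta> * exp (- (?u - \<delta>)\<^sup>2 / (2 * g)))" .
    qed (use \<delta> in auto)
    finally show ?thesis by (simp add: far_bound_def)
  qed
  have inner: "(\<Sum>i\<in>?V - {k}. coupling_error \<phi> i k) \<le> 3 ^ CARD('d) * x powr e * ?near + x * ?far" if k: "k \<in> ?V" for k
  proof -
    let ?N = "{i. \<forall>j. \<bar>real_of_int (i $ j - k $ j)\<bar> \<le> R}"
    have "(\<Sum>i\<in>?V - {k}. coupling_error \<phi> i k)
        = (\<Sum>i\<in>(?V - {k}) \<inter> ?N. coupling_error \<phi> i k) + (\<Sum>i\<in>(?V - {k}) - ?N. coupling_error \<phi> i k)"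
      by (rule sum.Int_Diff) simp
    also have "\<dots> \<le> of_nat (card ((?V - {k}) \<inter> ?N)) * ?near + of_nat (card ((?V - {k}) - ?N)) * ?far"
      using k by (intro add_mono sum_bounded_above near far) auto
    also have "\<dots> \<le> (3 ^ CARD('d) * x powr e) * ?near + x * ?far"
    proof (intro add_mono mult_right_mono near0 far0)
      have "real (card ((?V - {k}) \<inter> ?N)) \<le> real (card ?N)"
        using finite_near[of k R] by (intro of_nat_mono card_mono) auto
      also have "\<dots> \<le> (3 * R) ^ CARD('d)" by (rule card_near_le[OF R1])
      also have "\<dots> = 3 ^ CARD('d) * x powr e"
        using n by (simp add: power_mult_distrib xn R_def powr_powr mult.commute flip: powr_realpow)
      finally show "real (card ((?V - {k}) \<inter> ?N)) \<le> 3 ^ CARD('d) * x powr e" .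
      have "card ((?V - {k}) - ?N) \<le> card ?V" by (intro card_mono) auto
      then show "real (card ((?V - {k}) - ?N)) \<le> x" by (simp add: card_lattice_box x_def)
    qed
    finally show ?thesis .
  qed
  have "\<bar>expectation (\<lambda>\<omega>. \<Prod>\<alpha>\<in>?V. \<phi> \<alpha> (\<psi> \<alpha> \<omega>)) - (\<Prod>\<alpha>\<in>?V. expectation (\<lambda>\<omega>. \<phi> \<alpha> (\<psi> \<alpha> \<omega>)))\<bar>
      \<le> (\<Sum>k\<in>?V. \<Sum>i\<in>?V - {k}. coupling_error \<phi> i k)"
    using C_diag(1) \<phi>_meas \<phi>01 by (intro decoupling) (auto intro: less_le_trans[OF zero_less_one])
  also have "\<dots> \<le> of_nat (card ?V) * (3 ^ CARD('d) * x powr e * ?near + x * ?far)"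
    by (rule sum_bounded_above) (rule inner)
  also have "\<dots> = 3 ^ CARD('d) * (x powr (1 + e) * ?near) + x\<^sup>2 * ?far"
  proof -
    have "x powr (1 + e) = x * x powr e" using x by (simp add: powr_add)
    moreover have "real (card ?V) = x" by (simp add: card_lattice_box x_def)
    moreover have "x * (c * p * r + x * f) = c * (x * p * r) + x\<^sup>2 * f" for c p r f
      by (simp add: power2_eq_square algebra_simps)
    ultimately show ?thesis by (simp only:)
  qed
  finally show ?thesis by (simp add: \<phi>_def F_def)
qed

theorem gff_decoupling:
  fixes \<psi> :: "nat \<Rightarrow> int ^ 'd \<Rightarrow> 'w \<Rightarrow> real" and q :: "nat \<Rightarrow> int ^ 'd \<Rightarrow> real \<Rightarrow> real"
  assumes d: "CARD('d) \<ge> 3" and gff: "\<And>n. gaussian_free_field (M n) (lattice_box n) (\<psi> n)"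
  assumes q: "\<And>n \<alpha>. q n \<alpha> \<in> borel_measurable borel" "\<And>n \<alpha> y. 0 \<le> q n \<alpha> y" "\<And>n \<alpha> y. q n \<alpha> y \<le> 1"
    and above: "\<And>n \<alpha> y. q n \<alpha> y < 1 \<Longrightarrow> z \<le> y"
    and T: "finite T" "\<And>v. v \<in> T \<Longrightarrow> z \<le> v"
      "\<And>n \<alpha> y y'. q n \<alpha> y \<noteq> q n \<alpha> y' \<Longrightarrow> \<exists>v\<in>T. min y y' \<le> v \<and> v \<le> max y y'"
  defines "x \<equiv> \<lambda>n. real (n ^ CARD('d))" and "g \<equiv> green (0 :: int ^ 'd) 0"
  defines "F \<equiv> \<lambda>n \<alpha> \<omega>. q n \<alpha> ((\<psi> n \<alpha> \<omega> - centering g (x n)) / scaling g (x n))"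
  shows "(\<lambda>n. (\<integral>\<omega>. (\<Prod>\<alpha>\<in>lattice_box n. F n \<alpha> \<omega>) \<partial>M n) - (\<Prod>\<alpha>\<in>lattice_box n. \<integral>\<omega>. F n \<alpha> \<omega> \<partial>M n)) \<longlonglongrightarrow> 0"
proof -
  have g1: "1 \<le> g"
    unfolding g_def by (rule green_0_ge_1[OF d])
  then have g0: "0 < g" by linarith
  \<comment> \<open>Half of the exponent gained in \<open>near_bound_limit\<close>.\<close>
  define e where "e = 1 / (4 * g - 1) / 2"
  have e: "0 < e" "e < 1 / (4 * g - 1)" using g1 by (auto simp: e_def field_simps)
  define \<kappa> where "\<kappa> = e / (2 * CARD('d))"
  have \<kappa>: "0 < \<kappa>" using e by (simp add: \<kappa>_def)
  have D: "0 < decay_constant" using barrier_defect_pos by (simp add: decay_constant_def)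
  have x_top: "filterlim x at_top sequentially"
  proof -
    have "filterlim (\<lambda>n. real n ^ CARD('d)) at_top sequentially"
      by (intro filterlim_pow_at_top filterlim_real_sequentially) simp
    then show ?thesis by (simp add: x_def)
  qed
  let ?B = "\<lambda>x. 3 ^ CARD('d) * (x powr (1 + e) * near_bound g z x)
      + x\<^sup>2 * far_bound (card T) g z (decay_constant * x powr (- \<kappa>) * ln x) x"
  have "(?B \<longlongrightarrow> 3 ^ CARD('d) * 0 + 0) at_top"
    using g1 e \<kappa> D by (intro tendsto_add tendsto_mult tendsto_const near_bound_limit far_bound_limit) auto
  then have B: "(\<lambda>n. ?B (x n)) \<longlonglongrightarrow> 0" using filterlim_compose[OF _ x_top] by force
  have "eventually (\<lambda>x. 1 < x \<and> 0 < centering g x \<and> 0 < decay_constant * x powr (- \<kappa>) * ln x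
      \<and> decay_constant * x powr (- \<kappa>) * ln x \<le> level g z x) at_top"
    using eventually_gt_at_top[of 1] eventually_greater[OF centering_at_top[OF g0], of 0]
      far_bound_limit(2)[OF g0 D \<kappa>, where z=z]
    by eventually_elim auto
  from eventually_compose_filterlim[OF this x_top]
  have "eventually (\<lambda>n. norm ((\<integral>\<omega>. (\<Prod>\<alpha>\<in>lattice_box n. F n \<alpha> \<omega>) \<partial>M n) - (\<Prod>\<alpha>\<in>lattice_box n. \<integral>\<omega>. F n \<alpha> \<omega> \<partial>M n))
      \<le> ?B (x n)) sequentially"
  proof eventually_elim
    case (elim n)
    show ?case
      using gff_decoupling_bound[where n=n and q="q n" and z=z and T=T and e=e, OF d gff q above T e(1)] elim
      by (simp add: F_def x_def g_def \<kappa>_def)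
  qed
  then show ?thesis by (rule Lim_null_comparison[OF _ B])
qed

section \<open>Expected numbers of extremes\<close>

subsection \<open>Lattice points in boxes\<close>

lemma card_int_atLeastLessThan_ceiling:
  assumes "A \<le> B"
  shows "\<bar>real (card {\<lceil>A\<rceil>..<\<lceil>B\<rceil>}) - (B - A)\<bar> \<le> 1"
proof -
  have "\<lceil>A\<rceil> \<le> \<lceil>B\<rceil>" using assms by (rule ceiling_mono)
  then have "real (card {\<lceil>A\<rceil>..<\<lceil>B\<rceil>}) = real_of_int (\<lceil>B\<rceil> - \<lceil>A\<rceil>)" by simp
  then show ?thesis by linarith
qed

text \<open>
  The cap assigns the endpoint \<open>1\<close> to the last interval, so that all \<open>2 ^
  j\<close> intervals have the same length.
\<close>

definition dyadic_index :: "nat \<Rightarrow> real \<Rightarrow> int" where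
  "dyadic_index j t = min \<lfloor>2 ^ j * t\<rfloor> (2 ^ j - 1)"

lemma dyadic_index_count:
  assumes \<kappa>: "0 \<le> \<kappa>" "\<kappa> < 2 ^ j"
  shows "(\<lambda>n. real (card {a \<in> {0..int n - 1}. dyadic_index j (real_of_int a / real n) = \<kappa>}) / real n) \<longlonglongrightarrow> 1 / 2 ^ j"
proof (rule tendsto_sandwich)
  let ?c = "\<lambda>n. real (card {a \<in> {0..int n - 1}. dyadic_index j (real_of_int a / real n) = \<kappa>})"
  have \<kappa>1: "real_of_int \<kappa> + 1 \<le> 2 ^ j"
  proof -
    have "real_of_int (\<kappa> + 1) \<le> real_of_int (2 ^ j)" using \<kappa>(2) by (intro of_int_le_iff[THEN iffD2]) simp
    then show ?thesis by simp
  qed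
  have bound: "\<bar>?c n - real n / 2 ^ j\<bar> \<le> 1" if n: "0 < n" for n
  proof -
    let ?A = "real_of_int \<kappa> * real n / 2 ^ j" and ?B = "(real_of_int \<kappa> + 1) * real n / 2 ^ j"
    have iff: "\<lfloor>2 ^ j * (real_of_int a / real n)\<rfloor> = \<kappa> \<longleftrightarrow> a \<in> {\<lceil>?A\<rceil>..<\<lceil>?B\<rceil>}" for a
    proof -
      have "\<lfloor>2 ^ j * (real_of_int a / real n)\<rfloor> = \<kappa> \<longleftrightarrow>
          real_of_int \<kappa> \<le> 2 ^ j * (real_of_int a / real n) \<and> 2 ^ j * (real_of_int a / real n) < real_of_int \<kappa> + 1"
        by (simp add: floor_eq_iff)
      also have "\<dots> \<longleftrightarrow> ?A \<le> real_of_int a \<and> real_of_int a < ?B"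
        using n by (simp add: field_simps)
      also have "\<dots> \<longleftrightarrow> a \<in> {\<lceil>?A\<rceil>..<\<lceil>?B\<rceil>}"
        by (simp add: ceiling_le_iff less_ceiling_iff)
      finally show ?thesis .
    qed
    have "{a \<in> {0..int n - 1}. dyadic_index j (real_of_int a / real n) = \<kappa>} = {\<lceil>?A\<rceil>..<\<lceil>?B\<rceil>}"
    proof (intro set_eqI iffI)
      fix a assume a: "a \<in> {a \<in> {0..int n - 1}. dyadic_index j (real_of_int a / real n) = \<kappa>}"
      have "real_of_int a / real n < 1" using a n by (simp add: divide_less_eq)
      from mult_strict_left_mono[OF this, of "2 ^ j"] have "2 ^ j * (real_of_int a / real n) < 2 ^ j" by simp
      then have "\<lfloor>2 ^ j * (real_of_int a / real n)\<rfloor> < 2 ^ j" by (simp add: floor_less_iff)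
      then show "a \<in> {\<lceil>?A\<rceil>..<\<lceil>?B\<rceil>}" using a iff[of a] by (simp add: dyadic_index_def)
    next
      fix a assume a: "a \<in> {\<lceil>?A\<rceil>..<\<lceil>?B\<rceil>}"
      then have AB: "?A \<le> real_of_int a" "real_of_int a < ?B" by (simp_all add: ceiling_le_iff less_ceiling_iff)
      have "0 \<le> ?A" using \<kappa> by simp
      moreover have "?B \<le> 1 * real n"
        using mult_right_mono[OF \<kappa>1, of "real n"] by (simp add: divide_le_eq mult.commute)
      ultimately have "0 \<le> real_of_int a" "real_of_int a < real n" using AB by linarith+
      then have "a \<in> {0..int n - 1}" by simp
      then show "a \<in> {a \<in> {0..int n - 1}. dyadic_index j (real_of_int a / real n) = \<kappa>}"
        using a iff[of a] \<kappa> by (simp add: dyadic_index_def)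
    qed
    moreover have "?A \<le> ?B" by (intro divide_right_mono mult_right_mono) auto
    moreover have "?B - ?A = real n / 2 ^ j" by (simp add: field_simps)
    ultimately show ?thesis using card_int_atLeastLessThan_ceiling[of ?A ?B] by simp
  qed
  show "eventually (\<lambda>n. 1 / 2 ^ j - 1 / real n \<le> ?c n / real n) sequentially"
    using eventually_gt_at_top[of 0]
  proof eventually_elim
    case (elim n)
    then have "(real n / 2 ^ j - 1) / real n \<le> ?c n / real n"
      using bound[of n] by (intro divide_right_mono) auto
    then show ?case using elim by (simp add: diff_divide_distrib)
  qed
  show "eventually (\<lambda>n. ?c n / real n \<le> 1 / 2 ^ j + 1 / real n) sequentially"
    using eventually_gt_at_top[of 0]
  proof eventually_elim
    case (elim n)
    then have "?c n / real n \<le> (real n / 2 ^ j + 1) / real n"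
      using bound[of n] by (intro divide_right_mono) auto
    then show ?case using elim by (simp add: add_divide_distrib)
  qed
  show "(\<lambda>n. 1 / 2 ^ j - 1 / real n) \<longlonglongrightarrow> 1 / 2 ^ j" "(\<lambda>n. 1 / 2 ^ j + 1 / real n) \<longlonglongrightarrow> 1 / 2 ^ j"
    using tendsto_diff[OF tendsto_const lim_1_over_n, of "1 / 2 ^ j"] tendsto_add[OF tendsto_const lim_1_over_n, of "1 / 2 ^ j"]
    by simp_all
qed

definition rescale_site :: "nat \<Rightarrow> int ^ 'd \<Rightarrow> real ^ 'd" where
  "rescale_site n \<alpha> = (\<chi> i. real_of_int (\<alpha> $ i) / real n)"

definition space_index :: "nat \<Rightarrow> real ^ 'd \<Rightarrow> int ^ 'd" where
  "space_index j t = (\<chi> i. dyadic_index j (t $ i))"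

lemma space_index_count:
  fixes k :: "int ^ 'd"
  assumes k: "\<And>i. 0 \<le> k $ i \<and> k $ i < 2 ^ j"
  shows "(\<lambda>n. real (card {\<alpha> \<in> lattice_box n. space_index j (rescale_site n \<alpha>) = k}) / real (n ^ CARD('d)))
    \<longlonglongrightarrow> (1 / 2 ^ j) ^ CARD('d)"
proof -
  let ?S = "\<lambda>n i. {a \<in> {0..int n - 1}. dyadic_index j (real_of_int a / real n) = k $ i}"
  have eq: "{\<alpha> \<in> lattice_box n. space_index j (rescale_site n \<alpha>) = k} = {\<alpha>. \<forall>i. \<alpha> $ i \<in> ?S n i}" for n
    by (auto simp: lattice_box_def space_index_def rescale_site_def vec_eq_iff)
  have fin: "finite (?S n i)" for n i by (rule finite_subset[of _ "{0..int n - 1}"]) auto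
  have "real (card {\<alpha> \<in> lattice_box n. space_index j (rescale_site n \<alpha>) = k}) / real (n ^ CARD('d))
      = (\<Prod>i\<in>UNIV. real (card (?S n i)) / real n)" for n
    unfolding eq card_vec_product(2)[OF fin] by (simp add: prod_dividef)
  moreover have "(\<lambda>n. \<Prod>i\<in>(UNIV :: 'd set). real (card (?S n i)) / real n) \<longlonglongrightarrow> (\<Prod>i\<in>(UNIV :: 'd set). 1 / 2 ^ j)"
    by (intro tendsto_prod dyadic_index_count) (use k in auto)
  ultimately show ?thesis by simp
qed

text \<open>
  The margin \<open>sqrt n\<close> is wide enough for the variance in the bulk to be polynomially
  close to \<open>green 0 0\<close>, and narrow enough for the remaining sites to have density zero
  in the limit.
\<close>

definition bulk :: "nat \<Rightarrow> (int ^ 'd) set" where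
  "bulk n = {\<alpha>. \<forall>i. \<alpha> $ i \<in> {\<lceil>sqrt (real n)\<rceil>..<\<lceil>real n - sqrt (real n)\<rceil>}}"

lemma bulk_subset: "bulk n \<subseteq> lattice_box n"
proof
  fix \<alpha> :: "int ^ 'd" assume "\<alpha> \<in> bulk n"
  then have *: "sqrt (real n) \<le> real_of_int (\<alpha> $ i)" "real_of_int (\<alpha> $ i) < real n - sqrt (real n)" for i
    by (auto simp: bulk_def ceiling_le_iff less_ceiling_iff)
  have "0 \<le> sqrt (real n)" by simp
  with * have "0 \<le> real_of_int (\<alpha> $ i)" "real_of_int (\<alpha> $ i) < real n" for i
    by (meson order_trans, smt (verit))
  then have "0 \<le> \<alpha> $ i" "\<alpha> $ i < int n" for i
    by (simp, metis of_int_less_iff of_int_of_nat_eq)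
  then show "\<alpha> \<in> lattice_box n" by (auto simp: lattice_box_def)
qed

lemma bulk_distance:
  assumes "\<alpha> \<in> bulk n" "\<gamma> \<notin> lattice_box n"
  shows "\<exists>i. sqrt (real n) \<le> \<bar>real_of_int (\<gamma> $ i - \<alpha> $ i)\<bar>"
proof -
  from assms(2) obtain i where i: "\<gamma> $ i < 0 \<or> int n - 1 < \<gamma> $ i" unfolding lattice_box_def mem_Collect_eq not_all de_Morgan_conj not_le by blast
  have *: "sqrt (real n) \<le> real_of_int (\<alpha> $ i)" "real_of_int (\<alpha> $ i) < real n - sqrt (real n)"
    using assms(1) by (auto simp: bulk_def ceiling_le_iff less_ceiling_iff)
  from i have "real_of_int (\<gamma> $ i) < 0 \<or> real n \<le> real_of_int (\<gamma> $ i)" by auto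
  then have "sqrt (real n) \<le> \<bar>real_of_int (\<gamma> $ i - \<alpha> $ i)\<bar>" using * by (auto simp: abs_if)
  then show ?thesis ..
qed

lemma bulk_fraction: "(\<lambda>n. real (card (bulk n :: (int ^ 'd) set)) / real (n ^ CARD('d))) \<longlonglongrightarrow> 1"
proof -
  let ?S = "\<lambda>n. {\<lceil>sqrt (real n)\<rceil>..<\<lceil>real n - sqrt (real n)\<rceil>}"
  have "(\<lambda>n. real (card (?S n)) / real n) \<longlonglongrightarrow> 1"
  proof (rule tendsto_sandwich)
    have ev: "eventually (\<lambda>n. sqrt (real n) \<le> real n - sqrt (real n)) sequentially" by real_asymp
    have b: "\<bar>real (card (?S n)) - (real n - 2 * sqrt (real n))\<bar> \<le> 1" if "sqrt (real n) \<le> real n - sqrt (real n)" for n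
      using card_int_atLeastLessThan_ceiling[OF that] by simp
    show "eventually (\<lambda>n. (real n - 2 * sqrt (real n) - 1) / real n \<le> real (card (?S n)) / real n) sequentially"
      using ev
    proof eventually_elim
      case (elim n)
      show ?case using b[OF elim] by (intro divide_right_mono) linarith+
    qed
    show "eventually (\<lambda>n. real (card (?S n)) / real n \<le> (real n - 2 * sqrt (real n) + 1) / real n) sequentially"
      using ev
    proof eventually_elim
      case (elim n)
      show ?case using b[OF elim] by (intro divide_right_mono) linarith+
    qed
    show "(\<lambda>n. (real n - 2 * sqrt (real n) - 1) / real n) \<longlonglongrightarrow> 1" by real_asymp
    show "(\<lambda>n. (real n - 2 * sqrt (real n) + 1) / real n) \<longlonglongrightarrow> 1" by real_asymp
  qed
  from tendsto_power[OF this, of "CARD('d)"] have "(\<lambda>n. (real (card (?S n)) / real n) ^ CARD('d)) \<longlonglongrightarrow> 1" by simp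
  moreover have "real (card (bulk n :: (int ^ 'd) set)) = real (card (?S n)) ^ CARD('d)" for n
    unfolding bulk_def by (subst card_vec_product) auto
  ultimately show ?thesis by (simp add: power_divide)
qed

subsection \<open>One-point tails\<close>

lemma volume_at_top: "filterlim (\<lambda>n. real (n ^ CARD('d::finite))) at_top sequentially"
proof -
  have "filterlim (\<lambda>n. real n ^ CARD('d)) at_top sequentially"
    by (intro filterlim_pow_at_top filterlim_real_sequentially) simp
  then show ?thesis by simp
qed

text \<open>
  In the bulk the variance differs from \<open>green 0 0\<close> by at most \<open>\<kappa>
  n\<close>, which is polynomially small while the centering is logarithmic, so the tails converge
  uniformly. Near the boundary the variance may be smaller, but the tails are still at most
  \<open>tail_bound\<close>, of order \<open>1 / x\<close>, and these sites have vanishing density.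
\<close>

lemma one_point_sums:
  fixes \<psi> :: "nat \<Rightarrow> int ^ 'd \<Rightarrow> 'w \<Rightarrow> real"
  assumes d: "CARD('d) \<ge> 3" and gff: "\<And>n. gaussian_free_field (M n) (lattice_box n) (\<psi> n)"
    and J: "J \<in> sets borel" "J \<subseteq> {z..}"
    and A: "\<And>n. A n \<subseteq> lattice_box n" "(\<lambda>n. real (card (A n)) / real (n ^ CARD('d))) \<longlonglongrightarrow> w"
  defines "x \<equiv> \<lambda>n. real (n ^ CARD('d))" and "g \<equiv> green (0 :: int ^ 'd) 0"
  defines "p \<equiv> \<lambda>n \<alpha>. measure (M n) {\<omega> \<in> space (M n). (\<psi> n \<alpha> \<omega> - centering g (x n)) / scaling g (x n) \<in> J}"
  shows "(\<lambda>n. \<Sum>\<alpha>\<in>A n. p n \<alpha>) \<longlonglongrightarrow> w * (\<integral>y. indicator J y * exp (- y) \<partial>lborel)"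
    and "eventually (\<lambda>n. \<forall>\<alpha>\<in>lattice_box n. p n \<alpha> \<le> tail_bound g z (x n)) sequentially"
proof -
  define \<mu> where "\<mu> = (\<integral>y. indicator J y * exp (- y) \<partial>lborel)"
  have \<mu>: "0 \<le> \<mu>" unfolding \<mu>_def by (intro integral_nonneg_AE) auto
  have g1: "1 \<le> g"
    unfolding g_def by (rule green_0_ge_1[OF d])
  then have g0: "0 < g" by linarith
  note x_top = volume_at_top[where 'd='d, folded x_def]
  have x0: "0 \<le> x n" for n by (simp add: x_def)
  have ev: "eventually (\<lambda>n. 1 < x n \<and> 0 < centering g (x n) \<and> 0 < level g z (x n)) sequentially"
  proof (rule eventually_compose_filterlim[OF _ x_top])
    show "eventually (\<lambda>x. 1 < x \<and> 0 < centering g x \<and> 0 < level g z x) at_top"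
      using eventually_gt_at_top[of 1] eventually_greater[OF centering_at_top[OF g0], of 0]
        eventually_greater[OF level_at_top[OF g0], of 0]
      by eventually_elim auto
  qed
  have C_diag: "1 \<le> green_on (lattice_box n) \<alpha> \<alpha>" "green_on (lattice_box n) \<alpha> \<alpha> \<le> g"
    if "\<alpha> \<in> lattice_box n" for n and \<alpha> :: "int ^ 'd"
    using green_on_diag_ge_1[OF d that] green_on_le_green[OF d, of "lattice_box n" \<alpha> \<alpha>] green_diag[of \<alpha>] by (auto simp: g_def)
  have p_tail: "p n \<alpha> \<le> tail_bound g z (x n)"
    if n: "0 < centering g (x n)" "0 < level g z (x n)" and \<alpha>: "\<alpha> \<in> lattice_box n" for n \<alpha>
  proof -
    interpret centered_gaussian "M n" "lattice_box n" "green_on (lattice_box n)" "\<psi> n"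
      by (rule gff_centered_gaussian[OF gff])
    note [measurable] = coordinate_measurable[OF \<alpha>]
    have a: "0 < scaling g (x n)" using n g0 by (simp add: scaling_def)
    have "p n \<alpha> \<le> prob {\<omega> \<in> space (M n). level g z (x n) \<le> \<psi> n \<alpha> \<omega>}"
      unfolding p_def
    proof (intro finite_measure_mono subsetI)
      fix \<omega> assume "\<omega> \<in> {\<omega> \<in> space (M n). (\<psi> n \<alpha> \<omega> - centering g (x n)) / scaling g (x n) \<in> J}"
      then have "\<omega> \<in> space (M n)" "z \<le> (\<psi> n \<alpha> \<omega> - centering g (x n)) / scaling g (x n)" using J(2) by auto
      then show "\<omega> \<in> {\<omega> \<in> space (M n). level g z (x n) \<le> \<psi> n \<alpha> \<omega>}"
        using a by (simp add: level_def field_simps)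
    qed measurable
    also have "\<dots> \<le> tail_bound g z (x n)"
      unfolding tail_bound_def using C_diag[OF \<alpha>] n by (intro upper_tail_coordinate \<alpha>) auto
    finally show ?thesis .
  qed
  show "eventually (\<lambda>n. \<forall>\<alpha>\<in>lattice_box n. p n \<alpha> \<le> tail_bound g z (x n)) sequentially"
    using ev by eventually_elim (use p_tail in auto)
  define \<kappa> where "\<kappa> n = real n powr (-1/4) / barrier_defect" for n
  have \<kappa>0: "0 \<le> \<kappa> n" for n using barrier_defect_pos by (simp add: \<kappa>_def)
  have \<kappa>_lim: "(\<lambda>n. \<kappa> n * (centering g (x n))\<^sup>2) \<longlonglongrightarrow> 0"
  proof (rule tendsto_sandwich[OF _ _ tendsto_const])
    show "eventually (\<lambda>n. 0 \<le> \<kappa> n * (centering g (x n))\<^sup>2) sequentially" using \<kappa>0 by simp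
    have "eventually (\<lambda>n. unit_centering (x n) \<le> sqrt (2 * ln (x n))) sequentially"
      by (rule eventually_compose_filterlim[OF unit_centering_le x_top])
    then show "eventually (\<lambda>n. \<kappa> n * (centering g (x n))\<^sup>2 \<le> \<kappa> n * (g * (2 * (CARD('d) * ln (real n))))) sequentially"
      using ev eventually_gt_at_top[of 0]
    proof eventually_elim
      case (elim n)
      have uc: "0 < unit_centering (x n)" using elim g0 by (simp add: centering_eq zero_less_mult_iff)
      have "(unit_centering (x n))\<^sup>2 \<le> (sqrt (2 * ln (x n)))\<^sup>2" using elim uc by (intro power_mono) auto
      also have "\<dots> = 2 * (CARD('d) * ln (real n))" using elim by (simp add: x_def ln_realpow)
      finally have "(centering g (x n))\<^sup>2 \<le> g * (2 * (CARD('d) * ln (real n)))"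
        using g0 by (simp add: centering_eq power_mult_distrib)
      then show ?case by (intro mult_left_mono \<kappa>0)
    qed
    show "(\<lambda>n. \<kappa> n * (g * (2 * (CARD('d) * ln (real n))))) \<longlonglongrightarrow> 0"
      unfolding \<kappa>_def using barrier_defect_pos g0 by real_asymp
  qed
  have b_top: "filterlim (\<lambda>n. centering g (x n)) at_top sequentially"
    by (rule filterlim_compose[OF centering_at_top[OF g0] x_top])
  have gauss: "(\<lambda>n. x n * (g / centering g (x n) * exp (- (centering g (x n))\<^sup>2 / (2 * g)))) \<longlonglongrightarrow> sqrt (2 * pi * g)"
    by (rule filterlim_compose[OF centering_gauss[OF g0] x_top])
  have bulk_p: "\<bar>x n * p n \<alpha> - \<mu>\<bar> < \<epsilon>"
    if uni: "\<forall>s. 1 \<le> s \<and> g - \<kappa> n \<le> s \<and> s \<le> g \<longrightarrow>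
        \<bar>x n * (\<integral>y. indicator J y * rescaled_density g (centering g (x n)) s y \<partial>lborel) - \<mu>\<bar> < \<epsilon>"
      and n: "0 < centering g (x n)" "1 < x n" and \<alpha>: "\<alpha> \<in> bulk n" for n \<alpha> \<epsilon>
  proof -
    interpret centered_gaussian "M n" "lattice_box n" "green_on (lattice_box n)" "\<psi> n"
      by (rule gff_centered_gaussian[OF gff])
    have \<alpha>V: "\<alpha> \<in> lattice_box n" using \<alpha> bulk_subset by auto
    have npos: "0 < n" using n by (cases n) (auto simp: x_def power_0_left split: if_splits)
    have "green \<gamma> \<alpha> \<le> \<kappa> n" if "\<gamma> \<notin> lattice_box n" for \<gamma>
    proof -
      from bulk_distance[OF \<alpha> that] obtain i where i: "sqrt (real n) \<le> \<bar>real_of_int (\<gamma> $ i - \<alpha> $ i)\<bar>" ..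
      from green_decay[OF d _ i] npos have "green \<gamma> \<alpha> \<le> sqrt (real n) powr (-1/2) / barrier_defect" by simp
      also have "sqrt (real n) powr (-1/2) = real n powr (-1/4)"
        using npos by (simp add: powr_powr flip: powr_half_sqrt)
      finally show ?thesis by (simp add: \<kappa>_def)
    qed
    from green_minus_green_on_le[OF d \<kappa>0 this, where \<alpha>=\<alpha> and \<Lambda>="lattice_box n"] have "g - \<kappa> n \<le> green_on (lattice_box n) \<alpha> \<alpha>"
      using green_diag[of \<alpha>] by (simp add: g_def)
    with uni C_diag[OF \<alpha>V]
    have "\<bar>x n * (\<integral>y. indicator J y * rescaled_density g (centering g (x n)) (green_on (lattice_box n) \<alpha> \<alpha>) y \<partial>lborel) - \<mu>\<bar> < \<epsilon>"
      by blast
    moreover have "p n \<alpha> = (\<integral>y. indicator J y * rescaled_density g (centering g (x n)) (green_on (lattice_box n) \<alpha> \<alpha>) y \<partial>lborel)"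
      unfolding p_def scaling_def
      using C_diag[OF \<alpha>V] n g0 J by (intro rescaled_gaussian_prob coordinate_distributed \<alpha>V) auto
    ultimately show ?thesis by simp
  qed
  have nonbulk: "(\<lambda>n. real (card (lattice_box n - bulk n :: (int ^ 'd) set)) / x n) \<longlonglongrightarrow> 0"
  proof -
    have "(\<lambda>n. 1 - real (card (bulk n :: (int ^ 'd) set)) / x n) \<longlonglongrightarrow> 1 - 1"
      unfolding x_def by (intro tendsto_diff tendsto_const bulk_fraction)
    moreover have "eventually (\<lambda>n. 1 - real (card (bulk n :: (int ^ 'd) set)) / x n
        = real (card (lattice_box n - bulk n :: (int ^ 'd) set)) / x n) sequentially"
      using ev
    proof eventually_elim
      case (elim n)
      have "card (bulk n :: (int ^ 'd) set) \<le> card (lattice_box n :: (int ^ 'd) set)"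
        using bulk_subset by (intro card_mono) auto
      moreover have "card (lattice_box n - bulk n :: (int ^ 'd) set) = card (lattice_box n :: (int ^ 'd) set) - card (bulk n :: (int ^ 'd) set)"
        using bulk_subset finite_subset[OF bulk_subset finite_lattice_box] by (intro card_Diff_subset) auto
      ultimately have "real (card (lattice_box n - bulk n :: (int ^ 'd) set)) = x n - real (card (bulk n :: (int ^ 'd) set))"
        by (simp add: card_lattice_box x_def)
      then show ?case using elim by (simp add: diff_divide_distrib)
    qed
    ultimately show ?thesis using Lim_transform_eventually by fastforce
  qed
  have r: "(\<lambda>n. real (card (lattice_box n - bulk n :: (int ^ 'd) set)) / x n * (x n * tail_bound g z (x n) + \<mu>)) \<longlonglongrightarrow> 0"
    using tendsto_mult[OF nonbulk tendsto_add[OF filterlim_compose[OF tail_bound_limit[OF g0] x_top] tendsto_const]] by simp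
  have "(\<lambda>n. \<Sum>\<alpha>\<in>A n. (p n \<alpha> - \<mu> / x n)) \<longlonglongrightarrow> 0"
  proof (rule tendstoI)
    fix \<epsilon> :: real assume \<epsilon>: "0 < \<epsilon>"
    have uni: "eventually (\<lambda>n. \<forall>s. 1 \<le> s \<and> g - \<kappa> n \<le> s \<and> s \<le> g \<longrightarrow>
        \<bar>x n * (\<integral>y. indicator J y * rescaled_density g (centering g (x n)) s y \<partial>lborel) - \<mu>\<bar> < \<epsilon> / 2) sequentially"
      unfolding \<mu>_def by (rule rescaled_gaussian_limit_uniform[OF b_top x0 gauss g1 \<kappa>0 \<kappa>_lim J]) (use \<epsilon> in simp)
    from uni ev tendstoD[OF r half_gt_zero[OF \<epsilon>]]
    show "eventually (\<lambda>n. dist (\<Sum>\<alpha>\<in>A n. (p n \<alpha> - \<mu> / x n)) 0 < \<epsilon>) sequentially"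
    proof eventually_elim
      case (elim n)
      then have n: "0 < centering g (x n)" "1 < x n" "0 < level g z (x n)" by auto
      let ?r = "real (card (lattice_box n - bulk n :: (int ^ 'd) set)) / x n * (x n * tail_bound g z (x n) + \<mu>)"
      have finA: "finite (A n)" using A(1)[of n] finite_subset finite_lattice_box by blast
      have tb: "0 \<le> tail_bound g z (x n)" using n g0 by (simp add: tail_bound_def)
      have "\<bar>\<Sum>\<alpha>\<in>A n. (p n \<alpha> - \<mu> / x n)\<bar> \<le> (\<Sum>\<alpha>\<in>A n. \<bar>p n \<alpha> - \<mu> / x n\<bar>)" by (rule sum_abs)
      also have "\<dots> \<le> (\<Sum>\<alpha>\<in>lattice_box n. \<bar>p n \<alpha> - \<mu> / x n\<bar>)"
        using A(1)[of n] by (intro sum_mono2) auto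
      also have "\<dots> = (\<Sum>\<alpha>\<in>lattice_box n - bulk n. \<bar>p n \<alpha> - \<mu> / x n\<bar>) + (\<Sum>\<alpha>\<in>bulk n. \<bar>p n \<alpha> - \<mu> / x n\<bar>)"
        by (rule sum.subset_diff[OF bulk_subset]) simp
      also have "\<dots> \<le> of_nat (card (lattice_box n - bulk n :: (int ^ 'd) set)) * (tail_bound g z (x n) + \<mu> / x n)
          + of_nat (card (bulk n :: (int ^ 'd) set)) * (\<epsilon> / 2 / x n)"
      proof (intro add_mono sum_bounded_above)
        fix \<alpha> :: "int ^ 'd" assume \<alpha>: "\<alpha> \<in> lattice_box n - bulk n"
        have "0 \<le> p n \<alpha>" by (simp add: p_def)
        moreover have "0 \<le> \<mu> / x n" using \<mu> x0 by simp
        moreover have "p n \<alpha> \<le> tail_bound g z (x n)" using \<alpha> by (intro p_tail n) auto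
        ultimately show "\<bar>p n \<alpha> - \<mu> / x n\<bar> \<le> tail_bound g z (x n) + \<mu> / x n" by linarith
      next
        fix \<alpha> :: "int ^ 'd" assume \<alpha>: "\<alpha> \<in> bulk n"
        have "\<bar>x n * p n \<alpha> - \<mu>\<bar> < \<epsilon> / 2" using bulk_p[OF _ n(1,2) \<alpha>] elim by blast
        moreover have "p n \<alpha> - \<mu> / x n = (x n * p n \<alpha> - \<mu>) / x n" using n by (simp add: diff_divide_distrib)
        ultimately show "\<bar>p n \<alpha> - \<mu> / x n\<bar> \<le> \<epsilon> / 2 / x n"
          using n by (simp add: abs_divide divide_right_mono del: divide_divide_eq_left)
      qed
      also have "\<dots> \<le> ?r + \<epsilon> / 2"
      proof (intro add_mono)
        show "of_nat (card (lattice_box n - bulk n :: (int ^ 'd) set)) * (tail_bound g z (x n) + \<mu> / x n) \<le> ?r"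
          using n by (simp add: field_simps)
        have "real (card (bulk n :: (int ^ 'd) set)) \<le> x n"
          using card_mono[OF finite_lattice_box bulk_subset[where 'a='d], of n] by (simp add: card_lattice_box x_def)
        then show "of_nat (card (bulk n :: (int ^ 'd) set)) * (\<epsilon> / 2 / x n) \<le> \<epsilon> / 2"
          using n \<epsilon> by (simp add: field_simps)
      qed
      also have "\<dots> < \<epsilon>"
      proof -
        have "\<bar>?r\<bar> < \<epsilon> / 2" using elim(3) by (simp only: dist_real_def diff_0_right)
        then show ?thesis using abs_ge_self[of ?r] by linarith
      qed
      finally show ?case by (simp add: dist_real_def)
    qed
  qed
  from tendsto_add[OF this tendsto_mult[OF A(2) tendsto_const[of \<mu>]]]
  have "(\<lambda>n. (\<Sum>\<alpha>\<in>A n. (p n \<alpha> - \<mu> / x n)) + real (card (A n)) / real (n ^ CARD('d)) * \<mu>) \<longlonglongrightarrow> w * \<mu>" by simp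
  then show "(\<lambda>n. \<Sum>\<alpha>\<in>A n. p n \<alpha>) \<longlonglongrightarrow> w * (\<integral>y. indicator J y * exp (- y) \<partial>lborel)"
    by (simp add: sum_subtractf \<mu>_def x_def)
qed

section \<open>From generating functions to probabilities\<close>

text \<open>
  Induction on \<open>m\<close>. Once the values below \<open>m\<close> have been subtracted from
  the generating function, division by \<open>s ^ m\<close> leaves the coefficient of \<open>s ^
  m\<close> up to an error of order \<open>s\<close>, uniformly in \<open>n\<close>; now let
  \<open>s\<close> tend to zero.
\<close>

lemma generating_function_extraction:
  fixes M :: "nat \<Rightarrow> 'w measure" and k :: "nat \<Rightarrow> 'w \<Rightarrow> nat" and Z :: "nat \<Rightarrow> 'w \<Rightarrow> real" and a :: "nat \<Rightarrow> real"
  assumes M: "\<And>n. prob_space (M n)"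
    and k: "\<And>n. k n \<in> measurable (M n) (count_space UNIV)"
    and Z: "\<And>n. Z n \<in> borel_measurable (M n)" "\<And>n \<omega>. 0 \<le> Z n \<omega>" "\<And>n \<omega>. Z n \<omega> \<le> 1"
    and a: "\<And>i. 0 \<le> a i" "summable a"
    and lim: "\<And>s. 0 < s \<Longrightarrow> s < 1 \<Longrightarrow> (\<lambda>n. \<integral>\<omega>. Z n \<omega> * s ^ k n \<omega> \<partial>M n) \<longlonglongrightarrow> (\<Sum>i. a i * s ^ i)"
  shows "(\<lambda>n. \<integral>\<omega>. Z n \<omega> * of_bool (k n \<omega> = m) \<partial>M n) \<longlonglongrightarrow> a m"
proof (induction m rule: less_induct)
  case (less m)
  define A where "A = suminf a"
  have A: "0 \<le> A" using a by (simp add: A_def suminf_nonneg)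
  define e where "e n i = (\<integral>\<omega>. Z n \<omega> * of_bool (k n \<omega> = i) \<partial>M n)" for n i
  define G where "G n s = (\<integral>\<omega>. Z n \<omega> * s ^ k n \<omega> \<partial>M n)" for n s
  define L where "L s = (\<Sum>i. a i * s ^ i)" for s :: real
  have approx: "\<bar>e n m - (G n s - (\<Sum>i<m. s ^ i * e n i)) / s ^ m\<bar> \<le> s" if s: "0 < s" "s < 1" for n s
  proof -
    interpret prob_space "M n" by (rule M)
    note [measurable] = k[of n] Z(1)[of n]
    have int: "integrable (M n) (\<lambda>\<omega>. Z n \<omega> * f (k n \<omega>))" if "\<And>i. \<bar>f i\<bar> \<le> 1" for f :: "nat \<Rightarrow> real"
    proof (rule integrable_const_bound[of _ 1])
      show "AE \<omega> in M n. norm (Z n \<omega> * f (k n \<omega>)) \<le> 1"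
        using Z(2,3) that by (auto simp: abs_mult intro!: mult_le_one)
      have "(\<lambda>\<omega>. f (k n \<omega>)) \<in> borel_measurable (M n)"
        by (rule measurable_compose[OF k]) simp
      then show "(\<lambda>\<omega>. Z n \<omega> * f (k n \<omega>)) \<in> borel_measurable (M n)" by measurable
    qed
    have s1: "\<bar>s ^ i\<bar> \<le> 1" for i using s by (simp add: power_le_one)
    define rem where "rem j = s ^ j - (\<Sum>i<m. s ^ i * of_bool (j = i)) - s ^ m * of_bool (j = m)" for j
    have sum_eq: "(\<Sum>i<m. s ^ i * of_bool (j = i)) = (if j < m then s ^ j else 0)" for j
    proof -
      have "(\<Sum>i<m. s ^ i * of_bool (j = i)) = (\<Sum>i<m. if i = j then s ^ i else 0)"
        by (intro sum.cong) auto
      then show ?thesis by simp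
    qed
    have r: "0 \<le> rem j \<and> rem j \<le> s ^ Suc m" for j
      using s power_decreasing[of "Suc m" j s] unfolding rem_def sum_eq by (cases j m rule: linorder_cases) auto
    have "G n s - (\<Sum>i<m. s ^ i * e n i) - s ^ m * e n m = (\<integral>\<omega>. Z n \<omega> * rem (k n \<omega>) \<partial>M n)"
    proof -
      have "(\<integral>\<omega>. Z n \<omega> * rem (k n \<omega>) \<partial>M n) = (\<integral>\<omega>. Z n \<omega> * s ^ k n \<omega>
          - (\<Sum>i<m. s ^ i * (Z n \<omega> * of_bool (k n \<omega> = i))) - s ^ m * (Z n \<omega> * of_bool (k n \<omega> = m)) \<partial>M n)"
        by (intro Bochner_Integration.integral_cong refl)
           (simp only: rem_def right_diff_distrib sum_distrib_left mult.left_commute)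
      also have "\<dots> = G n s - (\<Sum>i<m. s ^ i * e n i) - s ^ m * e n m"
        using int[of "\<lambda>j. s ^ j"] int[of "\<lambda>j. of_bool (j = _)"] s1
        by (simp add: G_def e_def Bochner_Integration.integral_diff Bochner_Integration.integral_sum
            Bochner_Integration.integrable_sum Bochner_Integration.integrable_diff)
      finally show ?thesis by simp
    qed
    moreover have "0 \<le> (\<integral>\<omega>. Z n \<omega> * rem (k n \<omega>) \<partial>M n)"
      using Z(2) r by (intro integral_nonneg_AE) auto
    moreover have "(\<integral>\<omega>. Z n \<omega> * rem (k n \<omega>) \<partial>M n) \<le> s ^ Suc m"
    proof (rule integral_le_const)
      have "\<bar>rem j\<bar> \<le> 1" for j using r[of j] s power_le_one[of s "Suc m"] by linarith
      then show "integrable (M n) (\<lambda>\<omega>. Z n \<omega> * rem (k n \<omega>))" by (rule int)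
      show "AE \<omega> in M n. Z n \<omega> * rem (k n \<omega>) \<le> s ^ Suc m"
      proof (rule AE_I2)
        fix \<omega>
        have "Z n \<omega> * rem (k n \<omega>) \<le> 1 * rem (k n \<omega>)"
          using Z(3) r by (intro mult_right_mono) auto
        then show "Z n \<omega> * rem (k n \<omega>) \<le> s ^ Suc m" using r[of "k n \<omega>"] by linarith
      qed
    qed
    ultimately have "0 \<le> (G n s - (\<Sum>i<m. s ^ i * e n i) - s ^ m * e n m) / s ^ m"
      "(G n s - (\<Sum>i<m. s ^ i * e n i) - s ^ m * e n m) / s ^ m \<le> s"
      using s by (simp_all add: divide_le_eq)
    then show ?thesis using s by (simp add: diff_divide_distrib abs_le_iff)
  qed
  have approx': "\<bar>a m - (L s - (\<Sum>i<m. s ^ i * a i)) / s ^ m\<bar> \<le> s * A" if s: "0 < s" "s < 1" for s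
  proof -
    have summ: "summable (\<lambda>i. a i * s ^ i)"
      by (rule summable_comparison_test'[OF a(2), of 0])
         (use a s in \<open>auto simp: abs_mult power_le_one intro!: mult_left_le\<close>)
    have "L s = (\<Sum>i. a (i + Suc m) * s ^ (i + Suc m)) + (\<Sum>i<Suc m. a i * s ^ i)"
      unfolding L_def by (rule suminf_split_initial_segment[OF summ])
    then have eq: "L s - (\<Sum>i<m. s ^ i * a i) - s ^ m * a m = (\<Sum>i. a (i + Suc m) * s ^ (i + Suc m))"
      by (simp add: mult.commute)
    have summ1: "summable (\<lambda>i. a (i + Suc m) * s ^ (i + Suc m))" by (rule summable_ignore_initial_segment[OF summ])
    have summ2: "summable (\<lambda>i. a (i + Suc m))" by (rule summable_ignore_initial_segment[OF a(2)])
    have "(\<Sum>i. a (i + Suc m) * s ^ (i + Suc m)) \<le> (\<Sum>i. a (i + Suc m) * s ^ Suc m)"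
      using s a by (intro suminf_le summ1 summable_mult2 summ2 mult_left_mono power_decreasing) auto
    also have "\<dots> = (\<Sum>i. a (i + Suc m)) * s ^ Suc m" by (rule suminf_mult2[OF summ2, symmetric])
    also have "\<dots> \<le> A * s ^ Suc m"
      using suminf_split_initial_segment[OF a(2), of "Suc m"] sum_nonneg[of "{..<Suc m}" a] a s
      by (intro mult_right_mono) (auto simp: A_def)
    finally have "(\<Sum>i. a (i + Suc m) * s ^ (i + Suc m)) \<le> s * A * s ^ m" by (simp add: mult_ac)
    moreover have "0 \<le> (\<Sum>i. a (i + Suc m) * s ^ (i + Suc m))"
      using a s by (intro suminf_nonneg summ1) auto
    ultimately have "0 \<le> (L s - (\<Sum>i<m. s ^ i * a i) - s ^ m * a m) / s ^ m"
      "(L s - (\<Sum>i<m. s ^ i * a i) - s ^ m * a m) / s ^ m \<le> s * A"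
      unfolding eq using s by (simp_all add: divide_le_eq)
    then show ?thesis using s by (simp add: diff_divide_distrib abs_le_iff)
  qed
  have "(\<lambda>n. e n m) \<longlonglongrightarrow> a m"
  proof (rule tendstoI)
    fix \<epsilon> :: real assume \<epsilon>: "0 < \<epsilon>"
    \<comment> \<open>The errors of both approximations add up to at most \<open>s * (1 + A)\<close>.\<close>
    define s where "s = min (1/2) (\<epsilon> / (2 * (1 + A)))"
    have s: "0 < s" "s < 1" using \<epsilon> A by (auto simp: s_def)
    have "s * (1 + A) \<le> \<epsilon> / (2 * (1 + A)) * (1 + A)" using A by (intro mult_right_mono) (auto simp: s_def)
    also have "\<dots> = \<epsilon> / 2" using A by (simp add: field_simps)
    finally have sA: "s + s * A \<le> \<epsilon> / 2" by (simp add: distrib_left)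
    have "(\<lambda>n. (G n s - (\<Sum>i<m. s ^ i * e n i)) / s ^ m) \<longlonglongrightarrow> (L s - (\<Sum>i<m. s ^ i * a i)) / s ^ m"
      using lim[OF s] less s unfolding G_def L_def e_def
      by (intro tendsto_divide tendsto_diff tendsto_sum tendsto_mult tendsto_const) auto
    from tendstoD[OF this half_gt_zero[OF \<epsilon>]]
    have "eventually (\<lambda>n. \<bar>(G n s - (\<Sum>i<m. s ^ i * e n i)) / s ^ m - (L s - (\<Sum>i<m. s ^ i * a i)) / s ^ m\<bar> < \<epsilon> / 2) sequentially"
      by (simp only: dist_real_def)
    then show "eventually (\<lambda>n. dist (e n m) (a m) < \<epsilon>) sequentially"
    proof eventually_elim
      case (elim n)
      then show ?case using approx[OF s, of n] approx'[OF s] sA unfolding dist_real_def by linarith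
    qed
  qed
  then show ?case by (simp add: e_def)
qed

text \<open>
  The power \<open>s c ^ K n c\<close> is replaced by the event \<open>K n c = \<kappa> c\<close>
  for one index after the other, the factors of the other indices being carried along as the weight
  \<open>Z\<close>.
\<close>

lemma joint_counts_limit:
  fixes M :: "nat \<Rightarrow> 'w measure" and K :: "nat \<Rightarrow> 'c \<Rightarrow> 'w \<Rightarrow> nat" and rate :: "'c \<Rightarrow> real"
  assumes M: "\<And>n. prob_space (M n)" and C: "finite C"
    and K: "\<And>n c. c \<in> C \<Longrightarrow> K n c \<in> measurable (M n) (count_space UNIV)"
    and rate: "\<And>c. c \<in> C \<Longrightarrow> 0 \<le> rate c"
    and lim: "\<And>s. (\<And>c. 0 \<le> s c \<and> s c \<le> 1) \<Longrightarrow>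
      (\<lambda>n. \<integral>\<omega>. (\<Prod>c\<in>C. s c ^ K n c \<omega>) \<partial>M n) \<longlonglongrightarrow> exp (- (\<Sum>c\<in>C. (1 - s c) * rate c))"
  shows "(\<lambda>n. measure (M n) {\<omega> \<in> space (M n). \<forall>c\<in>C. K n c \<omega> = \<kappa> c})
    \<longlonglongrightarrow> (\<Prod>c\<in>C. rate c ^ \<kappa> c / fact (\<kappa> c) * exp (- rate c))"
proof -
  let ?p = "\<lambda>c i. rate c ^ i / fact i * exp (- rate c)"
  have "B \<subseteq> C \<Longrightarrow> \<forall>s. (\<forall>c. 0 \<le> s c \<and> s c \<le> 1) \<longrightarrow>
      (\<lambda>n. \<integral>\<omega>. (\<Prod>c\<in>B. of_bool (K n c \<omega> = \<kappa> c)) * (\<Prod>c\<in>C - B. s c ^ K n c \<omega>) \<partial>M n)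
        \<longlonglongrightarrow> (\<Prod>c\<in>B. ?p c (\<kappa> c)) * exp (- (\<Sum>c\<in>C - B. (1 - s c) * rate c))" if "finite B" for B
    using that
  proof (induction B rule: finite_induct)
    case empty
    then show ?case using lim by simp
  next
    case (insert b B)
    then have b: "b \<in> C" "b \<notin> B" and B: "B \<subseteq> C" "finite B" by auto
    show ?case
    proof (intro allI impI)
      fix s :: "'c \<Rightarrow> real" assume s: "\<forall>c. 0 \<le> s c \<and> s c \<le> 1"
      let ?R = "C - insert b B"
      define Z where "Z n \<omega> = (\<Prod>c\<in>B. of_bool (K n c \<omega> = \<kappa> c)) * (\<Prod>c\<in>?R. s c ^ K n c \<omega>)" for n \<omega>
      define \<zeta> where "\<zeta> = (\<Prod>c\<in>B. ?p c (\<kappa> c)) * exp (- (\<Sum>c\<in>?R. (1 - s c) * rate c))"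
      have \<zeta>: "0 \<le> \<zeta>" unfolding \<zeta>_def using B rate by (intro mult_nonneg_nonneg prod_nonneg) auto
      have CB: "C - B = insert b ?R" using b by auto
      have split: "(\<Prod>c\<in>C - B. f c) = f b * (\<Prod>c\<in>?R. f c)" "(\<Sum>c\<in>C - B. f c) = f b + (\<Sum>c\<in>?R. f c)" for f :: "'c \<Rightarrow> real"
        unfolding CB using C by (subst prod.insert sum.insert; simp)+
      have Z01: "0 \<le> Z n \<omega>" "Z n \<omega> \<le> 1" for n \<omega>
        unfolding Z_def using s by (auto intro!: mult_nonneg_nonneg mult_le_one prod_nonneg prod_le_1 power_le_one)
      have Z_meas: "Z n \<in> borel_measurable (M n)" for n
        unfolding Z_def using B
        by (intro borel_measurable_times borel_measurable_prod measurable_compose[OF K]) auto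
      have "(\<lambda>n. \<integral>\<omega>. Z n \<omega> * of_bool (K n b \<omega> = \<kappa> b) \<partial>M n) \<longlonglongrightarrow> \<zeta> * ?p b (\<kappa> b)"
      proof (rule generating_function_extraction[OF M K[OF b(1)] Z_meas Z01])
        show "0 \<le> \<zeta> * ?p b i" for i using \<zeta> rate[OF b(1)] by simp
        have exp_sums: "(\<lambda>i. \<zeta> * exp (- rate b) * ((rate b * t) ^ i / fact i)) sums (\<zeta> * exp (- rate b) * exp (rate b * t))" for t
          using exp_converges[of "rate b * t"] by (intro sums_mult) (simp add: field_simps)
        show "summable (\<lambda>i. \<zeta> * ?p b i)"
          using exp_sums[of 1] by (simp add: sums_iff mult_ac)
        fix t :: real assume t: "0 < t" "t < 1"
        have "(\<Sum>i. \<zeta> * ?p b i * t ^ i) = \<zeta> * exp (- rate b) * exp (rate b * t)"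
          using exp_sums[of t] by (simp add: sums_iff power_mult_distrib mult_ac)
        also have "\<dots> = (\<Prod>c\<in>B. ?p c (\<kappa> c)) * exp (- (\<Sum>c\<in>C - B. (1 - (s(b := t)) c) * rate c))"
        proof -
          have "(\<Sum>c\<in>?R. (1 - (s(b := t)) c) * rate c) = (\<Sum>c\<in>?R. (1 - s c) * rate c)"
            by (intro sum.cong) auto
          then have "exp (- (\<Sum>c\<in>C - B. (1 - (s(b := t)) c) * rate c))
              = exp (- (\<Sum>c\<in>?R. (1 - s c) * rate c)) * exp (- rate b) * exp (rate b * t)"
            unfolding split by (simp add: algebra_simps flip: exp_add)
          then show ?thesis by (simp add: \<zeta>_def mult_ac)
        qed
        finally have L: "(\<Sum>i. \<zeta> * ?p b i * t ^ i) = (\<Prod>c\<in>B. ?p c (\<kappa> c)) * exp (- (\<Sum>c\<in>C - B. (1 - (s(b := t)) c) * rate c))" .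
        have "(\<lambda>n. \<integral>\<omega>. (\<Prod>c\<in>B. of_bool (K n c \<omega> = \<kappa> c)) * (\<Prod>c\<in>C - B. (s(b := t)) c ^ K n c \<omega>) \<partial>M n)
            \<longlonglongrightarrow> (\<Prod>c\<in>B. ?p c (\<kappa> c)) * exp (- (\<Sum>c\<in>C - B. (1 - (s(b := t)) c) * rate c))"
          using insert.IH[OF B(1)] s t by simp
        moreover have "(\<Prod>c\<in>B. of_bool (K n c \<omega> = \<kappa> c)) * (\<Prod>c\<in>C - B. (s(b := t)) c ^ K n c \<omega>) = Z n \<omega> * t ^ K n b \<omega>" for n \<omega>
        proof -
          have "(\<Prod>c\<in>?R. (s(b := t)) c ^ K n c \<omega>) = (\<Prod>c\<in>?R. s c ^ K n c \<omega>)"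
            by (intro prod.cong) auto
          then show ?thesis unfolding split Z_def by (simp add: mult_ac)
        qed
        ultimately show "(\<lambda>n. \<integral>\<omega>. Z n \<omega> * t ^ K n b \<omega> \<partial>M n) \<longlonglongrightarrow> (\<Sum>i. \<zeta> * ?p b i * t ^ i)"
          unfolding L by simp
      qed
      then show "(\<lambda>n. \<integral>\<omega>. (\<Prod>c\<in>insert b B. of_bool (K n c \<omega> = \<kappa> c)) * (\<Prod>c\<in>?R. s c ^ K n c \<omega>) \<partial>M n)
          \<longlonglongrightarrow> (\<Prod>c\<in>insert b B. ?p c (\<kappa> c)) * exp (- (\<Sum>c\<in>?R. (1 - s c) * rate c))"
        using b B by (simp add: Z_def \<zeta>_def mult_ac)
    qed
  qed
  from this[OF C subset_refl, rule_format, of "\<lambda>_. 0"]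
  have "(\<lambda>n. \<integral>\<omega>. (\<Prod>c\<in>C. of_bool (K n c \<omega> = \<kappa> c)) \<partial>M n) \<longlonglongrightarrow> (\<Prod>c\<in>C. ?p c (\<kappa> c))" by simp
  moreover have "(\<integral>\<omega>. (\<Prod>c\<in>C. of_bool (K n c \<omega> = \<kappa> c)) \<partial>M n) = measure (M n) {\<omega> \<in> space (M n). \<forall>c\<in>C. K n c \<omega> = \<kappa> c}" for n
  proof -
    have "(\<Prod>c\<in>C. of_bool (K n c \<omega> = \<kappa> c)) = (indicator {\<omega>. \<forall>c\<in>C. K n c \<omega> = \<kappa> c} \<omega> :: real)" for \<omega>
      using C by (cases "\<forall>c\<in>C. K n c \<omega> = \<kappa> c") auto
    then have "(\<integral>\<omega>. (\<Prod>c\<in>C. of_bool (K n c \<omega> = \<kappa> c)) \<partial>M n) = measure (M n) ({\<omega>. \<forall>c\<in>C. K n c \<omega> = \<kappa> c} \<inter> space (M n))"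
      by simp
    also have "{\<omega>. \<forall>c\<in>C. K n c \<omega> = \<kappa> c} \<inter> space (M n) = {\<omega> \<in> space (M n). \<forall>c\<in>C. K n c \<omega> = \<kappa> c}" by auto
    finally show ?thesis .
  qed
  ultimately show ?thesis by simp
qed

section \<open>Joint limit of the cell counts\<close>

text \<open>
  This coordinate maps \<open>(- \<infinity>, \<infinity>]\<close> to \<open>[0,
  \<infinity>)\<close> and the measure \<open>exp (- z) dz\<close> to the Lebesgue measure, so that
  dyadic intervals are natural for the heights as well.
\<close>

definition tail_coordinate :: "ereal \<Rightarrow> real" where
  "tail_coordinate z = (if z = \<infinity> then 0 else exp (- real_of_ereal z))"

definition cell_index :: "nat \<Rightarrow> (real ^ 'd) \<times> ereal \<Rightarrow> (int ^ 'd) \<times> int" where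
  "cell_index j p = (space_index j (fst p), \<lfloor>2 ^ j * tail_coordinate (snd p)\<rfloor>)"

text \<open>
  The \<open>4 ^ j\<close> height bands of width \<open>1 / 2 ^ j\<close> exhaust the tail
  coordinates below \<open>2 ^ j\<close>: with growing \<open>j\<close> the cells become finer and
  cover more of the state space.
\<close>

definition cell_indices :: "nat \<Rightarrow> ((int ^ 'd) \<times> int) set" where
  "cell_indices j = {k. \<forall>i. k $ i \<in> {0..<2 ^ j}} \<times> {0..<4 ^ j}"

definition height_band :: "nat \<Rightarrow> int \<Rightarrow> real set" where
  "height_band j l = {y. \<lfloor>2 ^ j * exp (- y)\<rfloor> = l}"

definition cell_mass :: "nat \<Rightarrow> (int ^ 'd) \<times> int \<Rightarrow> real" where
  "cell_mass j c = (1 / 2 ^ j) ^ CARD('d) * (\<integral>y. indicator (height_band j (snd c)) y * exp (- y) \<partial>lborel)"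

lemma finite_cell_indices [simp]: "finite (cell_indices j)"
  unfolding cell_indices_def by (intro finite_cartesian_product card_vec_product) auto

lemma floor_exp_measurable [measurable]:
  "(\<lambda>y. \<lfloor>2 ^ j * exp (- y :: real)\<rfloor>) \<in> measurable borel (count_space UNIV)"
  by (rule measurable_compose[OF _ measurable_real_floor]) measurable

lemma height_band_borel [measurable]: "height_band j l \<in> sets borel"
proof -
  have "height_band j l = (\<lambda>y. \<lfloor>2 ^ j * exp (- y :: real)\<rfloor>) -` {l} \<inter> space borel"
    by (auto simp: height_band_def)
  then show ?thesis using measurable_sets[OF floor_exp_measurable, of "{l}" j] by simp
qed

lemma floor_exp_less:
  assumes "\<lfloor>2 ^ j * exp (- y :: real)\<rfloor> < 4 ^ j"
  shows "- real j * ln 2 \<le> y"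
proof -
  have "2 ^ j * exp (- y) < 2 ^ j * (2 ^ j :: real)"
    using assms by (simp add: floor_less_iff flip: power_mult_distrib)
  then have "exp (- y) < 2 ^ j" by simp
  also have "(2 :: real) ^ j = exp (real j * ln 2)" by (simp add: exp_of_nat_mult)
  finally show ?thesis by simp
qed

lemma height_band_above: "l < 4 ^ j \<Longrightarrow> height_band j l \<subseteq> {- real j * ln 2..}"
  using floor_exp_less by (auto simp: height_band_def)

lemma cell_mass_nonneg: "0 \<le> cell_mass j c"
  unfolding cell_mass_def by (intro mult_nonneg_nonneg integral_nonneg_AE) auto

text \<open>
  Factor by factor, \<open>1 - p\<close> and \<open>exp (- p)\<close> differ by at most
  \<open>p\<^sup>2\<close>.
\<close>

lemma prod_one_minus_exp:
  fixes p :: "'a \<Rightarrow> real"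
  assumes p: "\<And>a. a \<in> A \<Longrightarrow> 0 \<le> p a \<and> p a \<le> m \<and> p a \<le> 1"
  shows "\<bar>(\<Prod>a\<in>A. 1 - p a) - exp (- (\<Sum>a\<in>A. p a))\<bar> \<le> m * (\<Sum>a\<in>A. p a)"
proof (cases "finite A")
  case True
  have le: "\<bar>(1 - t) - exp (- t)\<bar> \<le> t * t" if "0 \<le> t" for t :: real
  proof -
    have "1 - t \<le> exp (- t)" using exp_ge_add_one_self[of "- t"] by simp
    moreover have "exp (- t) \<le> 1 - t + t * t"
    proof -
      have "exp (- t) \<le> 1 / (1 + t)"
        using exp_ge_add_one_self[of t] that by (simp add: exp_minus inverse_eq_divide divide_left_mono)
      also have "\<dots> \<le> 1 - t + t * t"
      proof -
        have "(1 - t + t * t) * (1 + t) = 1 + t * t * t" by (simp add: algebra_simps)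
        then show ?thesis using that by (simp add: divide_le_eq)
      qed
      finally show ?thesis .
    qed
    ultimately show ?thesis by simp
  qed
  have "\<bar>(\<Prod>a\<in>A. 1 - p a) - exp (- (\<Sum>a\<in>A. p a))\<bar> = \<bar>(\<Prod>a\<in>A. 1 - p a) - (\<Prod>a\<in>A. exp (- p a))\<bar>"
    using True by (simp add: sum_negf[symmetric] exp_sum)
  also have "\<dots> \<le> (\<Sum>a\<in>A. \<bar>(1 - p a) - exp (- p a)\<bar>)"
    using p by (intro abs_prod_diff_le) auto
  also have "\<dots> \<le> (\<Sum>a\<in>A. m * p a)"
    using p by (intro sum_mono order_trans[OF le] mult_right_mono) auto
  finally show ?thesis by (simp add: sum_distrib_left)
qed simp

text \<open>
  The product of these weights over the sites is the generating function of the cell counts, see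
  \<open>prod_cell_weight\<close>.
\<close>

definition cell_weight :: "nat \<Rightarrow> ((int ^ 'd) \<times> int \<Rightarrow> real) \<Rightarrow> nat \<Rightarrow> int ^ 'd \<Rightarrow> real \<Rightarrow> real" where
  "cell_weight j s n \<alpha> y = (let c = cell_index j (rescale_site n \<alpha>, ereal y) in if c \<in> cell_indices j then s c else 1)"

lemma cell_index_ereal: "cell_index j (t, ereal y) = (space_index j t, \<lfloor>2 ^ j * exp (- y)\<rfloor>)"
  by (simp add: cell_index_def tail_coordinate_def)

lemma cell_weight_measurable: "cell_weight j s n \<alpha> \<in> borel_measurable borel"
proof -
  have "(\<lambda>y. (\<lambda>l. if (space_index j (rescale_site n \<alpha>), l) \<in> cell_indices j
      then s (space_index j (rescale_site n \<alpha>), l) else 1) \<lfloor>2 ^ j * exp (- y :: real)\<rfloor>) \<in> borel_measurable borel"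
    by (rule measurable_compose[OF floor_exp_measurable]) simp
  then show ?thesis by (simp add: cell_weight_def[abs_def] cell_index_ereal Let_def)
qed

text \<open>
  The weight depends on \<open>y\<close> through \<open>\<lfloor>2 ^ j * exp (- y)\<rfloor>\<close>
  and is constant once this exceeds \<open>4 ^ j - 1\<close>, so it jumps only where \<open>2 ^ j *
  exp (- y)\<close> crosses one of the integers \<open>1, \<dots>, 4 ^ j\<close>.
\<close>

lemma cell_weight_threshold:
  assumes "cell_weight j s n \<alpha> y \<noteq> cell_weight j s n \<alpha> y'"
  shows "\<exists>v\<in>(\<lambda>l. - ln (real l / 2 ^ j)) ` {1..4 ^ j}. min y y' \<le> v \<and> v \<le> max y y'"
proof -
  have main: "\<exists>v\<in>(\<lambda>l. - ln (real l / 2 ^ j)) ` {1..4 ^ j}. y \<le> v \<and> v \<le> y'"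
    if yy: "y \<le> y'" and ne: "cell_weight j s n \<alpha> y \<noteq> cell_weight j s n \<alpha> y'" for y y'
  proof -
    let ?f = "\<lambda>y. \<lfloor>2 ^ j * exp (- y :: real)\<rfloor>"
    have ne_f: "?f y \<noteq> ?f y'" using ne by (auto simp: cell_weight_def cell_index_ereal)
    have le: "?f y' \<le> ?f y" using yy by (intro floor_mono mult_left_mono) auto
    have "?f y' < 4 ^ j"
    proof (rule ccontr)
      assume "\<not> ?f y' < 4 ^ j"
      then have "cell_weight j s n \<alpha> y = 1" "cell_weight j s n \<alpha> y' = 1"
        using le by (auto simp: cell_weight_def cell_index_ereal cell_indices_def)
      then show False using ne by simp
    qed
    \<comment> \<open>The integer next to the smaller floor lies between \<open>2 ^ j * exp (- y')\<close> and \<open>2 ^ j * exp (- y)\<close>.\<close>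
    define l where "l = nat (?f y' + 1)"
    have f0: "0 \<le> ?f y'" by simp
    then have l: "int l = ?f y' + 1" by (simp add: l_def)
    have l1: "l \<in> {1..4 ^ j}"
    proof -
      have "int l \<le> int (4 ^ j)" "1 \<le> int l" using l f0 \<open>?f y' < 4 ^ j\<close> by auto
      then show ?thesis by (simp only: of_nat_le_iff atLeastAtMost_iff) simp
    qed
    have "int l \<le> ?f y" using l le ne_f by linarith
    then have "real l \<le> 2 ^ j * exp (- y)" by (simp add: le_floor_iff)
    then have "real l / 2 ^ j \<le> exp (- y)" by (simp add: divide_le_eq mult.commute)
    then have "ln (real l / 2 ^ j) \<le> - y" using l1 ln_le_cancel_iff[of "real l / 2 ^ j" "exp (- y)"] by simp
    moreover have "2 ^ j * exp (- y') < real l" using l by linarith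
    then have "exp (- y') \<le> real l / 2 ^ j" by (simp add: le_divide_eq mult.commute)
    then have "- y' \<le> ln (real l / 2 ^ j)" using l1 ln_le_cancel_iff[of "exp (- y')" "real l / 2 ^ j"] by simp
    ultimately show ?thesis using l1 by (intro bexI[of _ "- ln (real l / 2 ^ j)"]) auto
  qed
  show ?thesis
    using main[of y y'] main[of y' y] assms by (cases "y \<le> y'") (auto simp: min_def max_def)
qed

lemma one_minus_cell_weight:
  "1 - cell_weight j s n \<alpha> y = (\<Sum>c\<in>cell_indices j. (1 - s c) *
    (if space_index j (rescale_site n \<alpha>) = fst c then indicator (height_band j (snd c)) y else 0))"
proof -
  let ?c = "cell_index j (rescale_site n \<alpha>, ereal y)"
  have "(\<Sum>c\<in>cell_indices j. (1 - s c) * (if space_index j (rescale_site n \<alpha>) = fst c then indicator (height_band j (snd c)) y else 0))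
      = (\<Sum>c\<in>cell_indices j. if c = ?c then 1 - s c else 0)"
    by (intro sum.cong refl) (auto simp: cell_index_ereal height_band_def indicator_def)
  then show ?thesis by (simp add: cell_weight_def Let_def)
qed

text \<open>
  Decoupling reduces the expectation to a product of factors \<open>1 - p n \<alpha>\<close>. The
  numbers \<open>p n \<alpha>\<close> are uniformly of order \<open>1 / x\<close> and have a
  convergent sum, so the product is asymptotically the exponential of minus that sum.
\<close>

theorem cell_weight_limit:
  fixes \<psi> :: "nat \<Rightarrow> int ^ 'd \<Rightarrow> 'w \<Rightarrow> real" and s :: "(int ^ 'd) \<times> int \<Rightarrow> real"
  assumes d: "CARD('d) \<ge> 3" and gff: "\<And>n. gaussian_free_field (M n) (lattice_box n) (\<psi> n)"
    and s: "\<And>c. 0 \<le> s c \<and> s c \<le> 1"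
  defines "x \<equiv> \<lambda>n. real (n ^ CARD('d))" and "g \<equiv> green (0 :: int ^ 'd) 0"
  shows "(\<lambda>n. \<integral>\<omega>. (\<Prod>\<alpha>\<in>lattice_box n. cell_weight j s n \<alpha> ((\<psi> n \<alpha> \<omega> - centering g (x n)) / scaling g (x n))) \<partial>M n)
    \<longlonglongrightarrow> exp (- (\<Sum>c\<in>cell_indices j. (1 - s c) * cell_mass j c))"
proof -
  define z where "z = - real j * ln 2"
  define T where "T = (\<lambda>l. - ln (real l / 2 ^ j)) ` {1..4 ^ j}"
  let ?Y = "\<lambda>n \<alpha> \<omega>. (\<psi> n \<alpha> \<omega> - centering g (x n)) / scaling g (x n)"
  have w01: "0 \<le> cell_weight j s n \<alpha> y" "cell_weight j s n \<alpha> y \<le> 1" for n \<alpha> y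
    using s by (auto simp: cell_weight_def Let_def)
  have above: "z \<le> y" if "cell_weight j s n \<alpha> y < 1" for n \<alpha> y
    using that floor_exp_less[of j y]
    by (auto simp: cell_weight_def cell_index_ereal cell_indices_def z_def Let_def split: if_splits)
  have T_above: "z \<le> v" if "v \<in> T" for v
  proof -
    from that obtain l where l: "l \<in> {1..4 ^ j}" "v = - ln (real l / 2 ^ j)" by (auto simp: T_def)
    have "real l \<le> real (4 ^ j)" using l(1) by (simp only: of_nat_le_iff atLeastAtMost_iff)
    also have "\<dots> = 2 ^ j * 2 ^ j" by (simp flip: power_mult_distrib)
    finally have "ln (real l / 2 ^ j) \<le> ln (2 ^ j)" using l(1) by (subst ln_le_cancel_iff) (auto simp: divide_le_eq)
    then show ?thesis by (simp add: z_def l(2) ln_realpow)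
  qed
  have dec: "(\<lambda>n. (\<integral>\<omega>. (\<Prod>\<alpha>\<in>lattice_box n. cell_weight j s n \<alpha> (?Y n \<alpha> \<omega>)) \<partial>M n)
      - (\<Prod>\<alpha>\<in>lattice_box n. \<integral>\<omega>. cell_weight j s n \<alpha> (?Y n \<alpha> \<omega>) \<partial>M n)) \<longlonglongrightarrow> 0"
    unfolding x_def g_def
  proof (rule gff_decoupling[OF d gff, where z=z and T=T])
    show "finite T" by (simp add: T_def)
    show "\<exists>v\<in>T. min y y' \<le> v \<and> v \<le> max y y'" if "cell_weight j s n \<alpha> y \<noteq> cell_weight j s n \<alpha> y'" for n \<alpha> y y'
      using cell_weight_threshold[OF that] by (simp add: T_def)
  qed (use cell_weight_measurable w01 above T_above in auto)
  define P where "P n l \<alpha> = measure (M n) {\<omega> \<in> space (M n). ?Y n \<alpha> \<omega> \<in> height_band j l}" for n l \<alpha>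
  define p where "p n \<alpha> = (\<Sum>c\<in>cell_indices j. (1 - s c) * (if space_index j (rescale_site n \<alpha>) = fst c then P n (snd c) \<alpha> else 0))"
    for n and \<alpha> :: "int ^ 'd"
  have E: "(\<integral>\<omega>. cell_weight j s n \<alpha> (?Y n \<alpha> \<omega>) \<partial>M n) = 1 - p n \<alpha>" for n \<alpha>
  proof -
    interpret prob_space "M n" using gff[of n] by (simp add: gaussian_free_field_def)
    have [measurable]: "\<psi> n \<alpha> \<in> borel_measurable (M n)" using gff[of n] by (simp add: gaussian_free_field_def)
    have Y [measurable]: "?Y n \<alpha> \<in> borel_measurable (M n)" by measurable
    have [measurable]: "(\<lambda>\<omega>. cell_weight j s n \<alpha> (?Y n \<alpha> \<omega>)) \<in> borel_measurable (M n)"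
      by (rule measurable_compose[OF Y cell_weight_measurable])
    have int: "integrable (M n) (\<lambda>\<omega>. cell_weight j s n \<alpha> (?Y n \<alpha> \<omega>))"
      by (rule bounded_integrable[of _ 1]) (use w01 in auto)
    have intI: "integrable (M n) (\<lambda>\<omega>. indicator (height_band j l) (?Y n \<alpha> \<omega>) :: real)" for l
      by (rule bounded_integrable[of _ 1]) (auto split: split_indicator)
    have "1 - expectation (\<lambda>\<omega>. cell_weight j s n \<alpha> (?Y n \<alpha> \<omega>)) = expectation (\<lambda>\<omega>. 1 - cell_weight j s n \<alpha> (?Y n \<alpha> \<omega>))"
      using int by (simp add: prob_space)
    also have "\<dots> = expectation (\<lambda>\<omega>. \<Sum>c\<in>cell_indices j. (1 - s c) *
        (if space_index j (rescale_site n \<alpha>) = fst c then indicator (height_band j (snd c)) (?Y n \<alpha> \<omega>) else 0))"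
      by (simp only: one_minus_cell_weight)
    also have "\<dots> = (\<Sum>c\<in>cell_indices j. expectation (\<lambda>\<omega>. (1 - s c) *
        (if space_index j (rescale_site n \<alpha>) = fst c then indicator (height_band j (snd c)) (?Y n \<alpha> \<omega>) else 0)))"
    proof (rule Bochner_Integration.integral_sum)
      fix c :: "(int ^ 'd) \<times> int"
      show "integrable (M n) (\<lambda>\<omega>. (1 - s c) *
          (if space_index j (rescale_site n \<alpha>) = fst c then indicator (height_band j (snd c)) (?Y n \<alpha> \<omega>) else 0))"
        using intI by (cases "space_index j (rescale_site n \<alpha>) = fst c") auto
    qed
    also have "\<dots> = p n \<alpha>"
      unfolding p_def
    proof (rule sum.cong[OF refl])
      fix c :: "(int ^ 'd) \<times> int"
      show "expectation (\<lambda>\<omega>. (1 - s c) *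
          (if space_index j (rescale_site n \<alpha>) = fst c then indicator (height_band j (snd c)) (?Y n \<alpha> \<omega>) else 0))
        = (1 - s c) * (if space_index j (rescale_site n \<alpha>) = fst c then P n (snd c) \<alpha> else 0)"
        using expectation_indicator_compose[of "height_band j (snd c)" "?Y n \<alpha>"] by (simp add: P_def)
    qed
    finally show ?thesis by simp
  qed
  have p01: "0 \<le> p n \<alpha>" "p n \<alpha> \<le> 1" for n \<alpha>
  proof -
    interpret prob_space "M n" using gff[of n] by (simp add: gaussian_free_field_def)
    have "0 \<le> 1 - p n \<alpha>" unfolding E[symmetric] using w01 by (intro integral_nonneg_AE) auto
    then show "p n \<alpha> \<le> 1" by simp
    show "0 \<le> p n \<alpha>" unfolding p_def P_def using s by (intro sum_nonneg mult_nonneg_nonneg) auto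
  qed
  have sum_p: "(\<lambda>n. \<Sum>\<alpha>\<in>lattice_box n. p n \<alpha>) \<longlonglongrightarrow> (\<Sum>c\<in>cell_indices j. (1 - s c) * cell_mass j c)"
  proof -
    have "(\<Sum>\<alpha>\<in>lattice_box n. p n \<alpha>) = (\<Sum>c\<in>cell_indices j. (1 - s c) *
        (\<Sum>\<alpha>\<in>{\<alpha> \<in> lattice_box n. space_index j (rescale_site n \<alpha>) = fst c}. P n (snd c) \<alpha>))" for n
      unfolding p_def by (subst sum.swap) (simp add: sum_distrib_left[symmetric] sum.inter_filter[symmetric])
    moreover have "(\<lambda>n. \<Sum>c\<in>cell_indices j. (1 - s c) *
        (\<Sum>\<alpha>\<in>{\<alpha> \<in> lattice_box n. space_index j (rescale_site n \<alpha>) = fst c}. P n (snd c) \<alpha>))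
      \<longlonglongrightarrow> (\<Sum>c\<in>cell_indices j. (1 - s c) * cell_mass j c)"
    proof (intro tendsto_sum tendsto_mult tendsto_const)
      fix c :: "(int ^ 'd) \<times> int" assume c: "c \<in> cell_indices j"
      have "(\<lambda>n. real (card {\<alpha> \<in> lattice_box n. space_index j (rescale_site n \<alpha>) = fst c}) / real (n ^ CARD('d)))
          \<longlonglongrightarrow> (1 / 2 ^ j) ^ CARD('d)"
        by (rule space_index_count) (use c in \<open>auto simp: cell_indices_def\<close>)
      from one_point_sums(1)[OF d gff height_band_borel height_band_above _ this, of "snd c"]
      show "(\<lambda>n. \<Sum>\<alpha>\<in>{\<alpha> \<in> lattice_box n. space_index j (rescale_site n \<alpha>) = fst c}. P n (snd c) \<alpha>) \<longlonglongrightarrow> cell_mass j c"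
        using c by (auto simp: P_def cell_mass_def cell_indices_def x_def g_def)
    qed
    ultimately show ?thesis by simp
  qed
  have g1: "1 \<le> g"
    unfolding g_def by (rule green_0_ge_1[OF d])
  then have g0: "0 < g" by linarith
  have x_top: "filterlim x at_top sequentially" using volume_at_top[where 'd='d] by (simp add: x_def)
  define K where "K = real (card (cell_indices j :: ((int ^ 'd) \<times> int) set))"
  have tail0: "(\<lambda>n. K * tail_bound g z (x n)) \<longlonglongrightarrow> 0"
  proof -
    have "(\<lambda>n. x n * tail_bound g z (x n) / x n) \<longlonglongrightarrow> 0"
      by (rule tendsto_divide_0[OF filterlim_compose[OF tail_bound_limit[OF g0] x_top] filterlim_at_top_imp_at_infinity[OF x_top]])
    moreover have "eventually (\<lambda>n. x n * tail_bound g z (x n) / x n = tail_bound g z (x n)) sequentially"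
      using eventually_greater[OF x_top, of 0] by eventually_elim simp
    ultimately have "(\<lambda>n. tail_bound g z (x n)) \<longlonglongrightarrow> 0" by (rule Lim_transform_eventually)
    from tendsto_mult[OF tendsto_const[of K] this] show ?thesis by simp
  qed
  have P_tail: "eventually (\<lambda>n. \<forall>c\<in>(cell_indices j :: ((int ^ 'd) \<times> int) set). \<forall>\<alpha>\<in>lattice_box n. P n (snd c) \<alpha> \<le> tail_bound g z (x n)) sequentially"
  proof (rule eventually_ball_finite[OF finite_cell_indices], rule ballI)
    fix c :: "(int ^ 'd) \<times> int" assume c: "c \<in> cell_indices j"
    have "(\<lambda>n. real (card ({} :: (int ^ 'd) set)) / real (n ^ CARD('d))) \<longlonglongrightarrow> 0" by simp
    from one_point_sums(2)[OF d gff height_band_borel height_band_above _ this, of "snd c"]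
    show "eventually (\<lambda>n. \<forall>\<alpha>\<in>lattice_box n. P n (snd c) \<alpha> \<le> tail_bound g z (x n)) sequentially"
      using c by (auto simp: P_def cell_indices_def x_def g_def z_def)
  qed
  have "(\<lambda>n. (\<Prod>\<alpha>\<in>lattice_box n. 1 - p n \<alpha>) - exp (- (\<Sum>\<alpha>\<in>lattice_box n. p n \<alpha>))) \<longlonglongrightarrow> 0"
  proof (rule Lim_null_comparison)
    show "eventually (\<lambda>n. norm ((\<Prod>\<alpha>\<in>lattice_box n. 1 - p n \<alpha>) - exp (- (\<Sum>\<alpha>\<in>lattice_box n. p n \<alpha>)))
        \<le> K * tail_bound g z (x n) * (\<Sum>\<alpha>\<in>lattice_box n. p n \<alpha>)) sequentially"
      using P_tail
    proof eventually_elim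
      case (elim n)
      have "p n \<alpha> \<le> K * tail_bound g z (x n)" if \<alpha>: "\<alpha> \<in> lattice_box n" for \<alpha>
        unfolding p_def K_def
      proof (rule sum_bounded_above)
        fix c :: "(int ^ 'd) \<times> int" assume c: "c \<in> cell_indices j"
        have P: "0 \<le> P n (snd c) \<alpha>" "P n (snd c) \<alpha> \<le> tail_bound g z (x n)"
          using elim c \<alpha> by (auto simp: P_def)
        have "(1 - s c) * (if space_index j (rescale_site n \<alpha>) = fst c then P n (snd c) \<alpha> else 0)
            \<le> 1 * P n (snd c) \<alpha>"
          using s[of c] P by (intro mult_mono) auto
        then show "(1 - s c) * (if space_index j (rescale_site n \<alpha>) = fst c then P n (snd c) \<alpha> else 0) \<le> tail_bound g z (x n)"
          using P by linarith
      qed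
      then show ?case unfolding real_norm_def using p01 by (intro prod_one_minus_exp) auto
    qed
    show "(\<lambda>n. K * tail_bound g z (x n) * (\<Sum>\<alpha>\<in>lattice_box n. p n \<alpha>)) \<longlonglongrightarrow> 0"
      using tendsto_mult[OF tail0 sum_p] by simp
  qed
  from tendsto_add[OF tendsto_add[OF dec[unfolded E] this] tendsto_exp[OF tendsto_minus[OF sum_p]]]
  show ?thesis by simp
qed

definition cell_count :: "nat \<Rightarrow> nat \<Rightarrow> (int ^ 'd \<Rightarrow> real) \<Rightarrow> (int ^ 'd) \<times> int \<Rightarrow> nat" where
  "cell_count j n y c = card {\<alpha> \<in> lattice_box n. cell_index j (rescale_site n \<alpha>, ereal (y \<alpha>)) = c}"

lemma prod_cell_weight:
  fixes s :: "(int ^ 'd) \<times> int \<Rightarrow> real" and y :: "int ^ 'd \<Rightarrow> real"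
  shows "(\<Prod>\<alpha>\<in>lattice_box n. cell_weight j s n \<alpha> (y \<alpha>)) = (\<Prod>c\<in>cell_indices j. s c ^ cell_count j n y c)"
proof -
  let ?k = "\<lambda>\<alpha> :: int ^ 'd. cell_index j (rescale_site n \<alpha>, ereal (y \<alpha>))"
  have "(\<Prod>\<alpha>\<in>lattice_box n. cell_weight j s n \<alpha> (y \<alpha>)) = (\<Prod>\<alpha>\<in>{\<alpha> \<in> lattice_box n. ?k \<alpha> \<in> cell_indices j}. s (?k \<alpha>))"
    by (subst prod.inter_filter) (auto simp: cell_weight_def Let_def)
  also have "\<dots> = (\<Prod>c\<in>cell_indices j. \<Prod>\<alpha>\<in>{\<alpha> \<in> {\<alpha> \<in> lattice_box n. ?k \<alpha> \<in> cell_indices j}. ?k \<alpha> = c}. s (?k \<alpha>))"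
    by (rule prod.group[symmetric]) auto
  also have "\<dots> = (\<Prod>c\<in>cell_indices j. s c ^ cell_count j n y c)"
  proof (rule prod.cong[OF refl])
    fix c :: "(int ^ 'd) \<times> int" assume c: "c \<in> cell_indices j"
    have "{\<alpha> \<in> {\<alpha> \<in> lattice_box n. ?k \<alpha> \<in> cell_indices j}. ?k \<alpha> = c} = {\<alpha> \<in> lattice_box n. ?k \<alpha> = c}"
      using c by auto
    then show "(\<Prod>\<alpha>\<in>{\<alpha> \<in> {\<alpha> \<in> lattice_box n. ?k \<alpha> \<in> cell_indices j}. ?k \<alpha> = c}. s (?k \<alpha>)) = s c ^ cell_count j n y c"
      by (simp add: cell_count_def)
  qed
  finally show ?thesis .
qed

theorem cell_counts_limit:
  fixes \<psi> :: "nat \<Rightarrow> int ^ 'd \<Rightarrow> 'w \<Rightarrow> real" and \<kappa> :: "(int ^ 'd) \<times> int \<Rightarrow> nat" and j :: nat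
  assumes d: "CARD('d) \<ge> 3" and gff: "\<And>n. gaussian_free_field (M n) (lattice_box n) (\<psi> n)"
  defines "x \<equiv> \<lambda>n. real (n ^ CARD('d))" and "g \<equiv> green (0 :: int ^ 'd) 0"
  defines "K \<equiv> \<lambda>n c \<omega>. cell_count j n (\<lambda>\<alpha>. (\<psi> n \<alpha> \<omega> - centering g (x n)) / scaling g (x n)) c"
  shows "(\<lambda>n. measure (M n) {\<omega> \<in> space (M n). \<forall>c\<in>cell_indices j. K n c \<omega> = \<kappa> c})
    \<longlonglongrightarrow> (\<Prod>c\<in>cell_indices j. cell_mass j c ^ \<kappa> c / fact (\<kappa> c) * exp (- cell_mass j c))"
    and "K n c \<in> measurable (M n) (count_space UNIV)"
proof -
  show meas: "K n c \<in> measurable (M n) (count_space UNIV)" for n c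
  proof -
    let ?Y = "\<lambda>\<alpha> \<omega>. (\<psi> n \<alpha> \<omega> - centering g (x n)) / scaling g (x n)"
    have [measurable]: "\<psi> n \<alpha> \<in> borel_measurable (M n)" for \<alpha>
      using gff[of n] by (simp add: gaussian_free_field_def)
    have "(\<lambda>\<omega>. \<lfloor>2 ^ j * exp (- ?Y \<alpha> \<omega>)\<rfloor>) \<in> measurable (M n) (count_space UNIV)" for \<alpha>
      by (rule measurable_compose[OF _ floor_exp_measurable]) measurable
    from measurable_compose[OF this, of "\<lambda>l. of_bool ((space_index j (rescale_site n _), l) = c) :: nat" "count_space UNIV"]
    have of_bool: "(\<lambda>\<omega>. of_bool ((space_index j (rescale_site n \<alpha>), \<lfloor>2 ^ j * exp (- ?Y \<alpha> \<omega>)\<rfloor>) = c) :: nat) \<in> measurable (M n) (count_space UNIV)" for \<alpha>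
      by simp
    have add: "(\<lambda>\<omega>. f \<omega> + h \<omega> :: nat) \<in> measurable (M n) (count_space UNIV)"
      if "f \<in> measurable (M n) (count_space UNIV)" "h \<in> measurable (M n) (count_space UNIV)" for f h
      by (rule measurable_compose_countable[where f="\<lambda>i \<omega>. i + h \<omega>" and g=f, OF measurable_compose[OF that(2)] that(1)])
        simp
    have "K n c = (\<lambda>\<omega>. \<Sum>\<alpha>\<in>lattice_box n. of_bool ((space_index j (rescale_site n \<alpha>), \<lfloor>2 ^ j * exp (- ?Y \<alpha> \<omega>)\<rfloor>) = c))"
      by (auto simp: K_def cell_count_def cell_index_ereal fun_eq_iff Collect_conj_eq)
    moreover have "(\<lambda>\<omega>. \<Sum>\<alpha>\<in>A. of_bool ((space_index j (rescale_site n \<alpha>), \<lfloor>2 ^ j * exp (- ?Y \<alpha> \<omega>)\<rfloor>) = c) :: nat)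
        \<in> measurable (M n) (count_space UNIV)" if "finite A" for A
      using that
    proof (induction A rule: finite_induct)
      case (insert \<alpha> A)
      show ?case unfolding sum.insert[OF insert.hyps] by (rule add[OF of_bool insert.IH])
    qed simp
    ultimately show ?thesis by simp
  qed
  show "(\<lambda>n. measure (M n) {\<omega> \<in> space (M n). \<forall>c\<in>cell_indices j. K n c \<omega> = \<kappa> c})
    \<longlonglongrightarrow> (\<Prod>c\<in>cell_indices j. cell_mass j c ^ \<kappa> c / fact (\<kappa> c) * exp (- cell_mass j c))"
  proof (rule joint_counts_limit[OF _ finite_cell_indices meas cell_mass_nonneg])
    show "prob_space (M n)" for n using gff[of n] by (simp add: gaussian_free_field_def)
    fix s :: "(int ^ 'd) \<times> int \<Rightarrow> real" assume "\<And>c. 0 \<le> s c \<and> s c \<le> 1"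
    from cell_weight_limit[OF d gff this, of j]
    show "(\<lambda>n. \<integral>\<omega>. (\<Prod>c\<in>cell_indices j. s c ^ K n c \<omega>) \<partial>M n)
        \<longlonglongrightarrow> exp (- (\<Sum>c\<in>cell_indices j. (1 - s c) * cell_mass j c))"
      by (simp add: prod_cell_weight K_def x_def g_def)
  qed
qed

section \<open>Vague convergence through cell counts\<close>

subsection \<open>The cells\<close>

definition cell :: "nat \<Rightarrow> (int ^ 'd) \<times> int \<Rightarrow> ((real ^ 'd) \<times> ereal) set" where
  "cell j c = {p \<in> state_space. cell_index j p = c}"

lemma tail_coordinate_nonneg: "0 \<le> tail_coordinate z"
  by (simp add: tail_coordinate_def)

lemma dyadic_index_bounds:
  assumes "0 \<le> t" "t \<le> 1"
  shows "dyadic_index j t \<in> {0..<2 ^ j}"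
    and "real_of_int (dyadic_index j t) \<le> 2 ^ j * t" "2 ^ j * t \<le> real_of_int (dyadic_index j t) + 1"
proof -
  have le: "2 ^ j * t \<le> 2 ^ j" using assms by (simp add: mult_le_cancel_left1)
  show "dyadic_index j t \<in> {0..<2 ^ j}" using assms by (auto simp: dyadic_index_def)
  have "real_of_int (dyadic_index j t) \<le> real_of_int \<lfloor>2 ^ j * t\<rfloor>" by (simp add: dyadic_index_def)
  then show "real_of_int (dyadic_index j t) \<le> 2 ^ j * t" by linarith
  show "2 ^ j * t \<le> real_of_int (dyadic_index j t) + 1"
  proof (cases "\<lfloor>2 ^ j * t\<rfloor> \<le> 2 ^ j - 1")
    case True
    then have "dyadic_index j t = \<lfloor>2 ^ j * t\<rfloor>" by (simp add: dyadic_index_def)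
    then show ?thesis by linarith
  next
    case False
    then have "dyadic_index j t = 2 ^ j - 1" by (simp add: dyadic_index_def)
    then show ?thesis using le by simp
  qed
qed

lemma cell_index_in_iff:
  assumes "p \<in> state_space" "J \<le> j"
  shows "snd (cell_index j p) < 2 ^ (j + J) \<longleftrightarrow> tail_coordinate (snd p) < 2 ^ J"
proof -
  have "snd (cell_index j p) < 2 ^ (j + J) \<longleftrightarrow> 2 ^ j * tail_coordinate (snd p) < 2 ^ j * 2 ^ J"
    by (simp add: cell_index_def floor_less_iff power_add)
  then show ?thesis by simp
qed

lemma cell_index_mem:
  assumes "p \<in> state_space"
  shows "cell_index j p \<in> cell_indices j \<longleftrightarrow> tail_coordinate (snd p) < 2 ^ j"
proof -
  have "space_index j (fst p) $ i \<in> {0..<2 ^ j}" for i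
    using assms dyadic_index_bounds(1)[of "fst p $ i" j] by (auto simp: state_space_def unit_cube_def space_index_def)
  moreover have "0 \<le> snd (cell_index j p)"
    using tail_coordinate_nonneg by (simp add: cell_index_def)
  moreover have "(4 :: int) ^ j = 2 ^ (j + j)" by (simp add: power_add flip: power_mult_distrib)
  ultimately show ?thesis
    using cell_index_in_iff[OF assms, of j j] by (auto simp: cell_indices_def mem_Times_iff cell_index_def)
qed

lemma tail_coordinate_measurable [measurable]: "tail_coordinate \<in> borel_measurable borel"
  unfolding tail_coordinate_def[abs_def] by measurable

lemma cell_index_level_set: "{p :: (real ^ 'd) \<times> ereal. cell_index j p = c} \<in> sets borel"
proof -
  have fst_meas: "(\<lambda>p :: (real ^ 'd) \<times> ereal. fst p $ i) \<in> borel_measurable borel" for i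
    by (intro borel_measurable_continuous_onI continuous_intros)
  have snd_meas: "(snd :: (real ^ 'd) \<times> ereal \<Rightarrow> ereal) \<in> borel_measurable borel"
    by (intro borel_measurable_continuous_onI continuous_intros)
  have 1: "(\<lambda>p :: (real ^ 'd) \<times> ereal. \<lfloor>2 ^ j * (fst p $ i)\<rfloor>) \<in> measurable borel (count_space UNIV)" for i
    by (rule measurable_compose[OF _ measurable_real_floor]) (intro borel_measurable_times borel_measurable_const fst_meas)
  have 2: "(\<lambda>p :: (real ^ 'd) \<times> ereal. \<lfloor>2 ^ j * tail_coordinate (snd p)\<rfloor>) \<in> measurable borel (count_space UNIV)"
    by (rule measurable_compose[OF _ measurable_real_floor])
       (intro borel_measurable_times borel_measurable_const measurable_compose[OF snd_meas tail_coordinate_measurable])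
  have "{p :: (real ^ 'd) \<times> ereal. cell_index j p = c} =
      (\<Inter>i. (\<lambda>p. \<lfloor>2 ^ j * (fst p $ i)\<rfloor>) -` {l. min l (2 ^ j - 1) = fst c $ i} \<inter> space borel)
      \<inter> ((\<lambda>p. \<lfloor>2 ^ j * tail_coordinate (snd p)\<rfloor>) -` {snd c} \<inter> space borel)"
    by (auto simp: cell_index_def space_index_def dyadic_index_def prod_eq_iff vec_eq_iff)
  also have "\<dots> \<in> sets borel"
    by (intro sets.Int sets.countable_INT'' measurable_sets[OF 1] measurable_sets[OF 2]) auto
  finally show ?thesis .
qed

lemma cell_sets [measurable]: "cell j c \<in> sets (borel_on state_space)"
proof -
  have "cell j c = state_space \<inter> {p. cell_index j p = c}" by (auto simp: cell_def)
  then show ?thesis using cell_index_level_set[of j c] by (auto simp: sets_restrict_space)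
qed

lemma compact_unit_cube: "compact (unit_cube :: (real ^ 'd) set)"
proof -
  have "(unit_cube :: (real ^ 'd) set) = cbox 0 1" by (auto simp: unit_cube_def mem_box_cart)
  then show ?thesis by (metis compact_cbox)
qed

lemma compact_slab: "compact ((unit_cube :: (real ^ 'd) set) \<times> {a :: ereal..})"
  by (intro compact_Times compact_unit_cube) (metis closed_atLeast closed_Int_compact compact_UNIV inf_top_right)

lemma low_tail_subset_compact:
  "\<exists>K. compact K \<and> K \<subseteq> state_space \<and> {p \<in> state_space :: ((real ^ 'd) \<times> ereal) set. tail_coordinate (snd p) < 2 ^ j} \<subseteq> K"
proof (intro exI conjI)
  show "compact ((unit_cube :: (real ^ 'd) set) \<times> {ereal (- real j * ln 2)..})" by (rule compact_slab)
  show "unit_cube \<times> {ereal (- real j * ln 2)..} \<subseteq> state_space" by (auto simp: state_space_def less_le_trans[rotated])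
  show "{p \<in> state_space :: ((real ^ 'd) \<times> ereal) set. tail_coordinate (snd p) < 2 ^ j} \<subseteq> unit_cube \<times> {ereal (- real j * ln 2)..}"
  proof
    fix p :: "(real ^ 'd) \<times> ereal" assume p: "p \<in> {p \<in> state_space. tail_coordinate (snd p) < 2 ^ j}"
    obtain t z where tz: "p = (t, z)" by (cases p)
    have t: "t \<in> unit_cube" "z \<noteq> - \<infinity>" "tail_coordinate z < 2 ^ j" using p by (auto simp: tz state_space_def)
    have "ereal (- real j * ln 2) \<le> z"
    proof (cases z)
      case (real y)
      have "exp (- y) < 2 ^ j" using t(3) by (simp add: real tail_coordinate_def)
      also have "(2 :: real) ^ j = exp (real j * ln 2)" by (simp add: exp_of_nat_mult)
      finally show ?thesis by (simp add: real)
    qed (use t in auto)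
    then show "p \<in> unit_cube \<times> {ereal (- real j * ln 2)..}" using t by (simp add: tz)
  qed
qed

lemma compact_subset_low_tail:
  fixes K :: "((real ^ 'd) \<times> ereal) set"
  assumes K: "compact K" "K \<subseteq> state_space"
  shows "\<exists>J. \<forall>p\<in>K. tail_coordinate (snd p) < 2 ^ J"
proof (cases "K = {}")
  case False
  have "compact (snd ` K)" by (intro compact_continuous_image continuous_intros K)
  then obtain z where z: "z \<in> snd ` K" "\<And>w. w \<in> snd ` K \<Longrightarrow> z \<le> w"
    using compact_attains_inf[of "snd ` K"] False by auto
  have "z \<noteq> - \<infinity>" using z(1) K(2) by (auto simp: state_space_def)
  obtain J where J: "tail_coordinate z < 2 ^ J" using real_arch_pow[of 2 "tail_coordinate z"] by auto
  have "tail_coordinate w \<le> tail_coordinate z" if "z \<le> w" for w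
    using that \<open>z \<noteq> - \<infinity>\<close> by (cases z; cases w) (auto simp: tail_coordinate_def)
  then show ?thesis using J z(2) by (intro exI[of _ J]) (auto intro: le_less_trans)
qed auto

lemma point_measures_cell:
  fixes \<mu> :: "((real ^ 'd) \<times> ereal) measure"
  assumes \<mu>: "\<mu> \<in> point_measures state_space" and c: "c \<in> cell_indices j"
  shows "\<exists>k::nat. emeasure \<mu> (cell j c) = of_nat k"
proof -
  have sets: "sets \<mu> = sets (borel_on state_space)" using \<mu> by (simp add: point_measures_def)
  obtain K :: "((real ^ 'd) \<times> ereal) set" where K: "compact K" "K \<subseteq> state_space" "{p \<in> state_space. tail_coordinate (snd p) < 2 ^ j} \<subseteq> K"
    using low_tail_subset_compact by blast
  have "cell j c \<subseteq> K" using K(3) c cell_index_mem[of _ j] by (auto simp: cell_def)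
  moreover have "K \<in> sets \<mu>"
  proof -
    have "K = state_space \<inter> K" using K(2) by auto
    moreover have "K \<in> sets borel" using compact_imp_closed[OF K(1)] by simp
    ultimately show ?thesis unfolding sets sets_restrict_space by auto
  qed
  ultimately have "emeasure \<mu> (cell j c) \<le> emeasure \<mu> K" by (intro emeasure_mono)
  also have "\<dots> < \<infinity>" using \<mu> K by (auto simp: point_measures_def)
  finally have "emeasure \<mu> (cell j c) \<noteq> \<infinity>" by simp
  moreover have "cell j c \<in> sets \<mu>" unfolding sets by (rule cell_sets)
  ultimately show ?thesis using \<mu> by (auto simp: point_measures_def)
qed

subsection \<open>Test functions are almost constant on cells\<close>

definition height_of_tail :: "real \<Rightarrow> ereal" where
  "height_of_tail u = (if u \<le> 0 then \<infinity> else ereal (- ln u))"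

lemma height_of_tail_inverse: "z \<noteq> - \<infinity> \<Longrightarrow> height_of_tail (tail_coordinate z) = z"
  by (cases z) (auto simp: height_of_tail_def tail_coordinate_def)

lemma continuous_height_of_tail: "continuous_on {0..} height_of_tail"
  unfolding continuous_on_def
proof
  fix x :: real assume x: "x \<in> {0..}"
  show "(height_of_tail \<longlongrightarrow> height_of_tail x) (at x within {0..})"
  proof (cases "x = 0")
    case True
    have "(height_of_tail \<longlongrightarrow> \<infinity>) (at 0 within {0..})"
      unfolding tendsto_PInfty eventually_at
    proof
      fix r :: real
      show "\<exists>d>0. \<forall>u\<in>{0..}. u \<noteq> 0 \<and> dist u 0 < d \<longrightarrow> ereal r < height_of_tail u"
      proof (intro exI[of _ "exp (- r)"] conjI ballI impI)
        fix u :: real assume u: "u \<in> {0..}" "u \<noteq> 0 \<and> dist u 0 < exp (- r)"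
        then have "ln u < ln (exp (- r))" by (subst ln_less_cancel_iff) auto
        then show "ereal r < height_of_tail u" using u by (simp add: height_of_tail_def)
      qed simp
    qed
    then show ?thesis by (simp add: True height_of_tail_def)
  next
    case False
    then have x0: "0 < x" using x by simp
    have "((\<lambda>u. ereal (- ln u)) \<longlongrightarrow> ereal (- ln x)) (at x)"
      using x0 by (intro tendsto_intros) auto
    moreover have "eventually (\<lambda>u. ereal (- ln u) = height_of_tail u) (at x)"
      using eventually_at_in_open'[of "{0<..}" x] x0
      by (auto elim!: eventually_mono simp: height_of_tail_def)
    ultimately have "(height_of_tail \<longlongrightarrow> ereal (- ln x)) (at x)" by (rule Lim_transform_eventually)
    then show ?thesis using x0 by (auto simp: height_of_tail_def intro: tendsto_within_subset)
  qed
qed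

lemma same_cell_dist:
  fixes p p' :: "(real ^ 'd) \<times> ereal"
  assumes "p \<in> state_space" "p' \<in> state_space" "cell_index j p = cell_index j p'"
  shows "dist (fst p, tail_coordinate (snd p)) (fst p', tail_coordinate (snd p')) \<le> (real CARD('d) + 1) / 2 ^ j"
proof -
  have near: "\<bar>a - b\<bar> \<le> 1 / 2 ^ j" if "\<bar>2 ^ j * a - 2 ^ j * b\<bar> \<le> 1" for a b :: real
  proof -
    have "2 ^ j * \<bar>a - b\<bar> = \<bar>2 ^ j * a - 2 ^ j * b\<bar>" by (simp add: abs_mult flip: right_diff_distrib)
    then show ?thesis using that by (simp add: le_divide_eq mult.commute)
  qed
  have "\<bar>(fst p - fst p') $ i\<bar> \<le> 1 / 2 ^ j" for i
  proof -
    have "0 \<le> fst p $ i \<and> fst p $ i \<le> 1" "0 \<le> fst p' $ i \<and> fst p' $ i \<le> 1"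
      using assms(1,2) by (auto simp: state_space_def unit_cube_def)
    moreover have "dyadic_index j (fst p $ i) = dyadic_index j (fst p' $ i)"
      using assms(3) by (simp add: cell_index_def space_index_def vec_eq_iff)
    ultimately have "\<bar>2 ^ j * (fst p $ i) - 2 ^ j * (fst p' $ i)\<bar> \<le> 1"
      using dyadic_index_bounds(2,3)[of "fst p $ i" j] dyadic_index_bounds(2,3)[of "fst p' $ i" j] by (simp add: abs_le_iff)
    then show ?thesis using near by simp
  qed
  then have "(\<Sum>i\<in>UNIV. \<bar>(fst p - fst p') $ i\<bar>) \<le> of_nat (card (UNIV :: 'd set)) * (1 / 2 ^ j)"
    by (intro sum_bounded_above)
  then have 1: "dist (fst p) (fst p') \<le> real CARD('d) * (1 / 2 ^ j)"
    using norm_le_l1_cart[of "fst p - fst p'"] by (simp add: dist_norm)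
  have "\<lfloor>2 ^ j * tail_coordinate (snd p)\<rfloor> = \<lfloor>2 ^ j * tail_coordinate (snd p')\<rfloor>"
    using assms(3) by (simp add: cell_index_def)
  then have "\<bar>2 ^ j * tail_coordinate (snd p) - 2 ^ j * tail_coordinate (snd p')\<bar> \<le> 1" by linarith
  then have 2: "dist (tail_coordinate (snd p)) (tail_coordinate (snd p')) \<le> 1 / 2 ^ j"
    unfolding dist_real_def by (rule near)
  have "dist (fst p, tail_coordinate (snd p)) (fst p', tail_coordinate (snd p'))
      \<le> dist (fst p) (fst p') + dist (tail_coordinate (snd p)) (tail_coordinate (snd p'))"
    unfolding dist_Pair_Pair by (rule sqrt_sum_squares_le_sum) auto
  also have "\<dots> \<le> (real CARD('d) + 1) / 2 ^ j" using 1 2 by (simp add: add_divide_distrib)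
  finally show ?thesis .
qed

text \<open>
  In the coordinates \<open>(t, exp (- z))\<close> the part of the state space with bounded tail
  coordinate is contained in a compact set, on which \<open>f\<close> is uniformly continuous, and
  cells have diameter of order \<open>1 / 2 ^ j\<close>.
\<close>

lemma test_function_oscillation:
  fixes f :: "(real ^ 'd) \<times> ereal \<Rightarrow> real"
  assumes f: "continuous_on state_space f" and \<epsilon>: "0 < \<epsilon>"
  shows "eventually (\<lambda>j. \<forall>p\<in>state_space. \<forall>p'\<in>state_space. cell_index j p = cell_index j p' \<and>
      tail_coordinate (snd p) < 2 ^ J \<and> tail_coordinate (snd p') < 2 ^ J \<longrightarrow> \<bar>f p - f p'\<bar> \<le> \<epsilon>) sequentially"
proof -
  let ?K = "(unit_cube :: (real ^ 'd) set) \<times> {0..2 ^ J :: real}"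
  define F where "F q = f (fst q, height_of_tail (snd q))" for q
  have "continuous_on ?K (\<lambda>q. height_of_tail (snd q))"
    by (rule continuous_on_compose2[OF continuous_height_of_tail]) (auto intro!: continuous_intros)
  then have "continuous_on ?K F" unfolding F_def
    by (intro continuous_on_compose2[OF f] continuous_intros) (auto simp: state_space_def height_of_tail_def)
  moreover have "compact ?K" by (intro compact_Times compact_unit_cube) simp
  ultimately have "uniformly_continuous_on ?K F" by (rule compact_uniformly_continuous)
  then obtain d where d: "0 < d" "\<And>q q'. q \<in> ?K \<Longrightarrow> q' \<in> ?K \<Longrightarrow> dist q' q < d \<Longrightarrow> dist (F q') (F q) < \<epsilon>"
    unfolding uniformly_continuous_on_def using \<epsilon> by metis
  have F_eq: "F (fst p, tail_coordinate (snd p)) = f p" if "p \<in> state_space" for p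
    using that height_of_tail_inverse[of "snd p"] by (auto simp: F_def state_space_def)
  have "(\<lambda>j. (real CARD('d) + 1) / 2 ^ j) \<longlonglongrightarrow> 0" by real_asymp
  then have "eventually (\<lambda>j. (real CARD('d) + 1) / 2 ^ j < d) sequentially" by (rule order_tendstoD) (rule d)
  then show ?thesis
  proof eventually_elim
    case (elim j)
    show ?case
    proof (intro ballI impI)
      fix p p' :: "(real ^ 'd) \<times> ereal"
      assume p: "p \<in> state_space" and p': "p' \<in> state_space"
        and H: "cell_index j p = cell_index j p' \<and> tail_coordinate (snd p) < 2 ^ J \<and> tail_coordinate (snd p') < 2 ^ J"
      have in_K: "(fst p, tail_coordinate (snd p)) \<in> ?K" "(fst p', tail_coordinate (snd p')) \<in> ?K"
        using p p' H tail_coordinate_nonneg by (auto simp: state_space_def)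
      have "dist (fst p, tail_coordinate (snd p)) (fst p', tail_coordinate (snd p')) < d"
        using same_cell_dist[OF p p', of j] H elim by simp
      from d(2)[OF in_K(2,1) this] show "\<bar>f p - f p'\<bar> \<le> \<epsilon>"
        using F_eq[OF p] F_eq[OF p'] by (simp add: dist_real_def)
    qed
  qed
qed

subsection \<open>Equal cell counts force vague convergence\<close>

text \<open>
  A function that is constant on cells has an integral determined by the cell counts;
  \<open>f\<close> differs from such a function by at most \<open>\<epsilon>\<close> on the region
  carrying its support.
\<close>

lemma integral_of_test_function_approx:
  fixes \<nu> \<mu> :: "((real ^ 'd) \<times> ereal) measure" and f :: "(real ^ 'd) \<times> ereal \<Rightarrow> real"
  assumes PM: "\<nu> \<in> point_measures state_space" "\<mu> \<in> point_measures state_space"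
    and eq: "\<And>c. c \<in> cell_indices j \<Longrightarrow> emeasure \<nu> (cell j c) = emeasure \<mu> (cell j c)"
    and J: "J \<le> j" and f: "continuous_on state_space f"
    and supp: "\<And>p. p \<in> state_space \<Longrightarrow> 2 ^ J \<le> tail_coordinate (snd p) \<Longrightarrow> f p = 0"
    and osc: "\<forall>p\<in>state_space. \<forall>p'\<in>state_space. cell_index j p = cell_index j p' \<and>
      tail_coordinate (snd p) < 2 ^ J \<and> tail_coordinate (snd p') < 2 ^ J \<longrightarrow> \<bar>f p - f p'\<bar> \<le> \<epsilon>"
  shows "\<bar>(\<integral>p. f p \<partial>\<nu>) - (\<integral>p. f p \<partial>\<mu>)\<bar> \<le> 2 * \<epsilon> * measure \<mu> {p \<in> state_space. tail_coordinate (snd p) < 2 ^ J}"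
proof -
  define I where "I = {c \<in> cell_indices j :: ((int ^ 'd) \<times> int) set. snd c < 2 ^ (j + J)}"
  define R where "R = {p \<in> state_space :: ((real ^ 'd) \<times> ereal) set. tail_coordinate (snd p) < 2 ^ J}"
  have fin: "finite I" by (simp add: I_def)
  have I_sub: "I \<subseteq> cell_indices j" by (auto simp: I_def)
  have R_iff: "p \<in> R \<longleftrightarrow> cell_index j p \<in> I" if "p \<in> state_space" for p
  proof -
    have "(2 :: real) ^ J \<le> 2 ^ j" using J by (intro power_increasing) auto
    then have "tail_coordinate (snd p) < 2 ^ J \<Longrightarrow> tail_coordinate (snd p) < 2 ^ j" by linarith
    then show ?thesis
      using that cell_index_mem[OF that, of j] cell_index_in_iff[OF that J] by (auto simp: R_def I_def)
  qed
  define s where "s p = (\<Sum>c\<in>I. f (SOME q. q \<in> cell j c) * indicator (cell j c) p)" for p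
  have s_eq: "s p = (if p \<in> R then f (SOME q. q \<in> cell j (cell_index j p)) else 0)" if p: "p \<in> state_space" for p
  proof -
    have "s p = (\<Sum>c\<in>I. if c = cell_index j p then f (SOME q. q \<in> cell j c) else 0)"
      unfolding s_def using p by (intro sum.cong refl) (auto simp: cell_def indicator_def)
    then show ?thesis using fin R_iff[OF p] by simp
  qed
  have close: "\<bar>f p - s p\<bar> \<le> \<epsilon> * indicator R p" if p: "p \<in> state_space" for p
  proof (cases "p \<in> R")
    case True
    let ?q = "SOME q. q \<in> cell j (cell_index j p)"
    have "p \<in> cell j (cell_index j p)" using p by (simp add: cell_def)
    then have q: "?q \<in> cell j (cell_index j p)" by (rule someI)
    then have "?q \<in> R" using R_iff[of ?q] R_iff[OF p] True by (simp add: cell_def)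
    then show ?thesis using osc[rule_format, OF p, of ?q] q True s_eq[OF p] by (simp add: cell_def R_def)
  next
    case False
    then show ?thesis using supp[OF p] s_eq[OF p] p by (simp add: R_def not_less)
  qed
  have main: "\<bar>(\<integral>p. f p \<partial>\<rho>) - (\<Sum>c\<in>I. f (SOME q. q \<in> cell j c) * measure \<rho> (cell j c))\<bar> \<le> \<epsilon> * measure \<rho> R
      \<and> measure \<rho> R = (\<Sum>c\<in>I. measure \<rho> (cell j c))"
    if \<rho>: "\<rho> \<in> point_measures state_space" for \<rho> :: "((real ^ 'd) \<times> ereal) measure"
  proof -
    have sets [measurable_cong]: "sets \<rho> = sets (borel_on state_space)" using \<rho> by (simp add: point_measures_def)
    have space: "space \<rho> = state_space" using sets_eq_imp_space_eq[OF sets] by (simp add: space_restrict_space)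
    have cs: "cell j c \<in> sets \<rho>" for c unfolding sets by (rule cell_sets)
    have cfin: "emeasure \<rho> (cell j c) < \<infinity>" if "c \<in> I" for c
    proof -
      have "\<exists>k::nat. emeasure \<rho> (cell j c) = of_nat k"
        using point_measures_cell[OF \<rho>] that I_sub by blast
      then obtain k :: nat where "emeasure \<rho> (cell j c) = of_nat k" ..
      then show ?thesis by (simp add: of_nat_less_top)
    qed
    have R_eq: "R = (\<Union>c\<in>I. cell j c)" using R_iff by (auto simp: cell_def R_def)
    have disj: "disjoint_family_on (cell j) I" by (auto simp: disjoint_family_on_def cell_def)
    have R_sets: "R \<in> sets \<rho>" unfolding R_eq using fin cs by auto
    have R_meas: "measure \<rho> R = (\<Sum>c\<in>I. measure \<rho> (cell j c))"
      unfolding R_eq using cfin cs by (intro measure_finite_Union fin disj) (auto simp: less_top)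
    have "emeasure \<rho> R = (\<Sum>c\<in>I. emeasure \<rho> (cell j c))"
      unfolding R_eq using cs by (intro sum_emeasure[symmetric] fin disj) auto
    then have R_fin: "emeasure \<rho> R < \<infinity>" using cfin fin by (simp add: sum_Pinfty less_top)
    have int_ind: "integrable \<rho> (\<lambda>p. \<epsilon> * indicator R p)"
      using R_sets R_fin by (intro integrable_mult_right integrable_real_indicator) auto
    have int_s: "integrable \<rho> s"
      unfolding s_def[abs_def] using cs cfin
      by (intro Bochner_Integration.integrable_sum integrable_mult_right integrable_real_indicator) auto
    have f_meas: "f \<in> borel_measurable \<rho>"
      using borel_measurable_continuous_on_restrict[OF f] by (simp add: measurable_cong_sets[OF sets refl])
    have int_d: "integrable \<rho> (\<lambda>p. f p - s p)"
    proof (rule Bochner_Integration.integrable_bound[OF int_ind])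
      show "(\<lambda>p. f p - s p) \<in> borel_measurable \<rho>" using f_meas int_s by measurable
      show "AE p in \<rho>. norm (f p - s p) \<le> norm (\<epsilon> * indicator R p)"
        using close by (intro AE_I2) (fastforce simp: space)
    qed
    have int_f: "integrable \<rho> f" using Bochner_Integration.integrable_add[OF int_d int_s] by simp
    have "(\<integral>p. s p \<partial>\<rho>) = (\<Sum>c\<in>I. \<integral>p. f (SOME q. q \<in> cell j c) * indicator (cell j c) p \<partial>\<rho>)"
      unfolding s_def using cs cfin
      by (intro Bochner_Integration.integral_sum integrable_mult_right integrable_real_indicator) auto
    also have "\<dots> = (\<Sum>c\<in>I. f (SOME q. q \<in> cell j c) * measure \<rho> (cell j c))"
      using sets.sets_into_space[OF cs] by (simp add: Int_absorb2)
    finally have s_int: "(\<integral>p. s p \<partial>\<rho>) = (\<Sum>c\<in>I. f (SOME q. q \<in> cell j c) * measure \<rho> (cell j c))" .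
    have "\<bar>(\<integral>p. f p \<partial>\<rho>) - (\<integral>p. s p \<partial>\<rho>)\<bar> = \<bar>\<integral>p. f p - s p \<partial>\<rho>\<bar>"
      using int_f int_s by simp
    also have "\<dots> \<le> (\<integral>p. \<bar>f p - s p\<bar> \<partial>\<rho>)" by (rule integral_abs_bound)
    also have "\<dots> \<le> (\<integral>p. \<epsilon> * indicator R p \<partial>\<rho>)"
      using int_d int_ind close by (intro integral_mono) (auto simp: space)
    also have "\<dots> = \<epsilon> * measure \<rho> R" using sets.sets_into_space[OF R_sets] by (simp add: Int_absorb2)
    finally show ?thesis using R_meas unfolding s_int by blast
  qed
  have cell_eq: "measure \<nu> (cell j c) = measure \<mu> (cell j c)" if "c \<in> I" for c
    using eq[of c] that I_sub by (auto simp: measure_def)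
  let ?S = "\<lambda>\<rho>. \<Sum>c\<in>I. f (SOME q. q \<in> cell j c) * measure \<rho> (cell j c)"
  have S_eq: "?S \<nu> = ?S \<mu>" by (rule sum.cong) (auto simp: cell_eq)
  have "(\<Sum>c\<in>I. measure \<nu> (cell j c)) = (\<Sum>c\<in>I. measure \<mu> (cell j c))"
    by (rule sum.cong) (auto simp: cell_eq)
  then have R_eq: "measure \<nu> R = measure \<mu> R" using main[OF PM(1)] main[OF PM(2)] by (elim conjE) (simp only:)
  have "\<bar>(\<integral>p. f p \<partial>\<nu>) - ?S \<mu>\<bar> \<le> \<epsilon> * measure \<mu> R" "\<bar>(\<integral>p. f p \<partial>\<mu>) - ?S \<mu>\<bar> \<le> \<epsilon> * measure \<mu> R"
    using main[OF PM(1)] main[OF PM(2)] unfolding S_eq R_eq by blast+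
  then have "\<bar>(\<integral>p. f p \<partial>\<nu>) - (\<integral>p. f p \<partial>\<mu>)\<bar> \<le> \<epsilon> * measure \<mu> R + \<epsilon> * measure \<mu> R" by linarith
  then show ?thesis by (simp add: R_def)
qed

lemma limitin_vague_cells:
  fixes \<mu> :: "((real ^ 'd) \<times> ereal) measure"
  assumes PM: "\<mu> \<in> point_measures state_space" "\<And>j. \<nu> j \<in> point_measures state_space"
    and eq: "\<And>j c. c \<in> cell_indices j \<Longrightarrow> emeasure (\<nu> j) (cell j c) = emeasure \<mu> (cell j c)"
  shows "limitin (vague_topology state_space) \<nu> \<mu> sequentially"
proof -
  have int: "(\<lambda>j. \<integral>p. f p \<partial>\<nu> j) \<longlonglongrightarrow> (\<integral>p. f p \<partial>\<mu>)" if f: "f \<in> test_functions state_space" for f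
  proof -
    from f obtain K where fc: "continuous_on state_space f"
      and K: "compact K" "K \<subseteq> state_space" "\<And>p. p \<in> state_space - K \<Longrightarrow> f p = 0"
      by (auto simp: test_functions_def)
    obtain J where J: "\<And>p. p \<in> K \<Longrightarrow> tail_coordinate (snd p) < 2 ^ J"
      using compact_subset_low_tail[OF K(1,2)] by blast
    have supp: "f p = 0" if "p \<in> state_space" "2 ^ J \<le> tail_coordinate (snd p)" for p
    proof -
      have "p \<notin> K" using J[of p] that(2) by auto
      then show ?thesis using K(3) that(1) by auto
    qed
    define m where "m = measure \<mu> {p \<in> state_space. tail_coordinate (snd p) < 2 ^ J}"
    show ?thesis
    proof (rule tendstoI)
      fix \<epsilon> :: real assume \<epsilon>: "0 < \<epsilon>"
      define e where "e = \<epsilon> / (2 * (m + 1))"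
      have m: "0 \<le> m" by (simp add: m_def)
      have e: "0 < e" using \<epsilon> m by (simp add: e_def)
      have "2 * e * m < 2 * e * (m + 1)" using e by simp
      also have "\<dots> = \<epsilon>" using m by (simp add: e_def field_simps)
      finally have em: "2 * e * m < \<epsilon>" .
      from test_function_oscillation[OF fc e, of J] eventually_ge_at_top[of J]
      show "eventually (\<lambda>j. dist (\<integral>p. f p \<partial>\<nu> j) (\<integral>p. f p \<partial>\<mu>) < \<epsilon>) sequentially"
      proof eventually_elim
        case (elim j)
        have "\<bar>(\<integral>p. f p \<partial>\<nu> j) - (\<integral>p. f p \<partial>\<mu>)\<bar> \<le> 2 * e * m"
          unfolding m_def by (rule integral_of_test_function_approx[OF PM(2,1) eq elim(2) fc supp elim(1)])
        then show ?case using em by (simp add: dist_real_def)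
      qed
    qed
  qed
  have "eventually (\<lambda>j. \<nu> j \<in> U) sequentially"
    if "generate_topology_on {{\<mu> \<in> point_measures state_space. (\<integral>x. f x \<partial>\<mu>) \<in> U} | f U. f \<in> test_functions state_space \<and> open U} U"
      and "\<mu> \<in> U" for U
    using that
  proof (induction U rule: generate_topology_on.induct)
    case (Int a b)
    then show ?case by (auto intro: eventually_conj)
  next
    case (UN K)
    then obtain k where "k \<in> K" "\<mu> \<in> k" by auto
    then have "eventually (\<lambda>j. \<nu> j \<in> k) sequentially" using UN.IH by auto
    then show ?case by eventually_elim (use \<open>k \<in> K\<close> in auto)
  next
    case (Basis s)
    then obtain f U where s: "s = {\<mu> \<in> point_measures state_space. (\<integral>x. f x \<partial>\<mu>) \<in> U}"
      "f \<in> test_functions state_space" "open U" by auto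
    have "eventually (\<lambda>j. (\<integral>x. f x \<partial>\<nu> j) \<in> U) sequentially"
      using Basis s by (intro topological_tendstoD[OF int]) auto
    then show ?case using PM(2) by (simp add: s(1))
  qed simp
  then have "eventually (\<lambda>j. \<nu> j \<in> U) sequentially" if "openin (vague_topology state_space) U" "\<mu> \<in> U" for U
    using that unfolding vague_topology_def openin_topology_generated_by_iff by blast
  then show ?thesis using PM(1) by (simp add: limitin_def)
qed

subsection \<open>A criterion for convergence in distribution\<close>

definition counts_agree :: "nat \<Rightarrow> ((int ^ 'd) \<times> int \<Rightarrow> nat) \<Rightarrow> ((real ^ 'd) \<times> ereal) measure \<Rightarrow> bool" where
  "counts_agree j \<kappa> \<mu> \<longleftrightarrow> (\<forall>c\<in>cell_indices j. emeasure \<mu> (cell j c) = of_nat (\<kappa> c))"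

text \<open>
  The best lower bound for \<open>h\<close> that can be read off from the counts
  \<open>\<kappa>\<close> at level \<open>j\<close>.
\<close>

definition infimum_over_counts :: "(((real ^ 'd) \<times> ereal) measure \<Rightarrow> real) \<Rightarrow> nat \<Rightarrow> ((int ^ 'd) \<times> int \<Rightarrow> nat) \<Rightarrow> real" where
  "infimum_over_counts h j \<kappa> = Inf (h ` {\<nu> \<in> point_measures state_space. counts_agree j \<kappa> \<nu>})"

definition counts_of :: "nat \<Rightarrow> ((real ^ 'd) \<times> ereal) measure \<Rightarrow> (int ^ 'd) \<times> int \<Rightarrow> nat" where
  "counts_of j \<mu> = restrict (\<lambda>c. nat \<lfloor>measure \<mu> (cell j c)\<rfloor>) (cell_indices j)"

lemma counts_agree_iff:
  assumes "\<mu> \<in> point_measures state_space" "\<kappa> \<in> extensional (cell_indices j)"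
  shows "counts_agree j \<kappa> \<mu> \<longleftrightarrow> counts_of j \<mu> = \<kappa>"
proof -
  have *: "emeasure \<mu> (cell j c) = of_nat (\<kappa> c) \<longleftrightarrow> nat \<lfloor>measure \<mu> (cell j c)\<rfloor> = \<kappa> c" if "c \<in> cell_indices j" for c
    using point_measures_cell[OF assms(1) that] by (auto simp: measure_def)
  then show ?thesis
    using assms(2) unfolding counts_agree_def counts_of_def
    by (auto simp: fun_eq_iff restrict_def extensional_def)
qed

lemma counts_agree_counts_of:
  "\<mu> \<in> point_measures state_space \<Longrightarrow> counts_agree j (counts_of j \<mu>) \<mu>"
  by (subst counts_agree_iff) (auto simp: counts_of_def)

lemma infimum_over_counts_bounds:
  assumes h: "\<And>\<mu>. \<mu> \<in> point_measures state_space \<Longrightarrow> 0 \<le> h \<mu>" and \<mu>: "\<mu> \<in> point_measures state_space"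
    and agree: "counts_agree j \<kappa> \<mu>"
  shows "0 \<le> infimum_over_counts h j \<kappa>" "infimum_over_counts h j \<kappa> \<le> h \<mu>"
proof -
  have bdd: "bdd_below (h ` {\<nu> \<in> point_measures state_space. counts_agree j \<kappa> \<nu>})"
    using h by (intro bdd_belowI[of _ 0]) auto
  show "infimum_over_counts h j \<kappa> \<le> h \<mu>"
    unfolding infimum_over_counts_def by (rule cInf_lower[OF _ bdd]) (use \<mu> agree in auto)
  show "0 \<le> infimum_over_counts h j \<kappa>"
    unfolding infimum_over_counts_def by (rule cInf_greatest) (use \<mu> agree h in auto)
qed

text \<open>
  Choose near-minimisers with the counts of \<open>\<mu>\<close> at every level. They converge
  vaguely to \<open>\<mu>\<close> by \<open>limitin_vague_cells\<close>, and \<open>h\<close> is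
  continuous.
\<close>

lemma infimum_over_counts_tendsto:
  assumes h: "\<And>\<mu>. \<mu> \<in> point_measures state_space \<Longrightarrow> 0 \<le> h \<mu>"
    and cont: "continuous_map (vague_topology state_space) euclideanreal h"
    and \<mu>: "\<mu> \<in> point_measures state_space"
  shows "(\<lambda>j. infimum_over_counts h j (counts_of j \<mu>)) \<longlonglongrightarrow> h \<mu>"
proof -
  let ?H = "\<lambda>j. infimum_over_counts h j (counts_of j \<mu>)"
  have "\<exists>\<nu>. \<nu> \<in> point_measures state_space \<and> counts_agree j (counts_of j \<mu>) \<nu> \<and> h \<nu> < ?H j + 1 / Suc j" for j
  proof -
    let ?A = "h ` {\<nu> \<in> point_measures state_space. counts_agree j (counts_of j \<mu>) \<nu>}"
    have "?A \<noteq> {}" using \<mu> counts_agree_counts_of[OF \<mu>] by auto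
    moreover have "Inf ?A < ?H j + 1 / Suc j" by (simp add: infimum_over_counts_def)
    ultimately have "\<exists>y\<in>?A. y < ?H j + 1 / Suc j" by (rule cInf_lessD)
    then show ?thesis by auto
  qed
  then obtain \<nu> where \<nu>: "\<And>j. \<nu> j \<in> point_measures state_space" "\<And>j. counts_agree j (counts_of j \<mu>) (\<nu> j)"
    "\<And>j. h (\<nu> j) < ?H j + 1 / Suc j" by metis
  have "emeasure (\<nu> j) (cell j c) = emeasure \<mu> (cell j c)" if "c \<in> cell_indices j" for j c
    using \<nu>(2)[of j] counts_agree_counts_of[OF \<mu>, of j] that by (simp add: counts_agree_def)
  then have "limitin (vague_topology state_space) \<nu> \<mu> sequentially"
    by (rule limitin_vague_cells[OF \<mu> \<nu>(1)])
  from continuous_map_limit[OF cont this] have "(\<lambda>j. h (\<nu> j)) \<longlonglongrightarrow> h \<mu>" by (simp add: o_def)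
  from tendsto_diff[OF this LIMSEQ_Suc[OF lim_1_over_n]]
  have lower: "(\<lambda>j. h (\<nu> j) - 1 / Suc j) \<longlonglongrightarrow> h \<mu>" by simp
  show ?thesis
  proof (rule tendsto_sandwich[OF _ _ lower tendsto_const])
    show "eventually (\<lambda>j. h (\<nu> j) - 1 / Suc j \<le> ?H j) sequentially"
      using \<nu>(3) by (intro always_eventually allI) (smt (verit))
    show "eventually (\<lambda>j. ?H j \<le> h \<mu>) sequentially"
      using infimum_over_counts_bounds(2)[of h, OF h \<mu> counts_agree_counts_of[OF \<mu>]] by simp
  qed
qed

lemma random_element_compose:
  fixes X :: "'w \<Rightarrow> ((real ^ 'd) \<times> ereal) measure"
  assumes X: "random_element M (vague_topology state_space) X"
    and cont: "continuous_map (vague_topology state_space) euclideanreal h"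
  shows "(\<lambda>\<omega>. h (X \<omega>)) \<in> borel_measurable M" "\<And>\<omega>. \<omega> \<in> space M \<Longrightarrow> X \<omega> \<in> point_measures state_space"
proof -
  let ?T = "vague_topology (state_space :: ((real ^ 'd) \<times> ereal) set)"
  have sub: "{U. openin ?T U} \<subseteq> Pow (topspace ?T)" using openin_subset by blast
  have Xm: "X \<in> measurable M (borel_sigma ?T)" using X by (simp add: random_element_def)
  have space: "space (borel_sigma ?T) = point_measures state_space"
    unfolding borel_sigma_def space_measure_of[OF sub] by (rule topspace_vague_topology)
  show "X \<omega> \<in> point_measures state_space" if "\<omega> \<in> space M" for \<omega>
    using measurable_space[OF Xm that] by (simp add: space)
  have "h \<in> borel_measurable (borel_sigma ?T)"
  proof (rule borel_measurableI)
    fix S :: "real set" assume "open S"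
    then have "openin ?T {x \<in> topspace ?T. h x \<in> S}"
      using cont by (simp add: continuous_map_def)
    moreover have "h -` S \<inter> space (borel_sigma ?T) = {x \<in> topspace ?T. h x \<in> S}" by (auto simp: space)
    ultimately show "h -` S \<inter> space (borel_sigma ?T) \<in> sets (borel_sigma ?T)"
      unfolding borel_sigma_def sets_measure_of[OF sub] by (auto intro: sigma_sets.Basic)
  qed
  from measurable_compose[OF Xm this] show "(\<lambda>\<omega>. h (X \<omega>)) \<in> borel_measurable M" .
qed

definition count_event :: "'w measure \<Rightarrow> ('w \<Rightarrow> ((real ^ 'd) \<times> ereal) measure) \<Rightarrow> nat \<Rightarrow> ((int ^ 'd) \<times> int \<Rightarrow> nat) \<Rightarrow> 'w set" where
  "count_event M X j \<kappa> = {\<omega> \<in> space M. counts_agree j \<kappa> (X \<omega>)}"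

lemma count_event_sets:
  assumes "\<And>c. c \<in> cell_indices j \<Longrightarrow> (\<lambda>\<omega>. emeasure (X \<omega>) (cell j c)) \<in> borel_measurable M"
  shows "count_event M X j \<kappa> \<in> sets M"
proof -
  have "{\<omega> \<in> space M. emeasure (X \<omega>) (cell j c) = of_nat (\<kappa> c)} \<in> sets M" if "c \<in> cell_indices j" for c
  proof -
    note [measurable] = assms[OF that]
    show ?thesis by measurable
  qed
  then have "{\<omega> \<in> space M. \<forall>c\<in>cell_indices j. emeasure (X \<omega>) (cell j c) = of_nat (\<kappa> c)} \<in> sets M"
    by (intro sets.sets_Collect_finite_All) auto
  then show ?thesis by (simp add: count_event_def counts_agree_def)
qed

text \<open>
  Extensionality makes this set finite and the count events of distinct members disjoint.
\<close>

definition bounded_counts :: "nat \<Rightarrow> nat \<Rightarrow> ((int ^ 'd) \<times> int \<Rightarrow> nat) set" where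
  "bounded_counts j m = PiE (cell_indices j) (\<lambda>_. {..m})"

lemma finite_bounded_counts: "finite (bounded_counts j m)"
  unfolding bounded_counts_def by (intro finite_PiE) auto

lemma expectation_of_infimum:
  fixes X :: "'w \<Rightarrow> ((real ^ 'd) \<times> ereal) measure" and h :: "((real ^ 'd) \<times> ereal) measure \<Rightarrow> real" and j m :: nat
  assumes M: "prob_space M" and PM: "\<And>\<omega>. \<omega> \<in> space M \<Longrightarrow> X \<omega> \<in> point_measures state_space"
    and meas: "\<And>c. c \<in> cell_indices j \<Longrightarrow> (\<lambda>\<omega>. emeasure (X \<omega>) (cell j c)) \<in> borel_measurable M"
  defines "f \<equiv> \<lambda>\<omega>. if counts_of j (X \<omega>) \<in> bounded_counts j m then infimum_over_counts h j (counts_of j (X \<omega>)) else 0"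
  shows "f \<in> borel_measurable M"
    and "(\<integral>\<omega>. f \<omega> \<partial>M) = (\<Sum>\<kappa>\<in>bounded_counts j m. infimum_over_counts h j \<kappa> * measure M (count_event M X j \<kappa>))"
proof -
  interpret prob_space M by fact
  let ?g = "\<lambda>\<omega>. \<Sum>\<kappa>\<in>bounded_counts j m. infimum_over_counts h j \<kappa> * indicator (count_event M X j \<kappa>) \<omega>"
  note ev = count_event_sets[OF meas]
  have fg: "f \<omega> = ?g \<omega>" if \<omega>: "\<omega> \<in> space M" for \<omega>
  proof -
    have "?g \<omega> = (\<Sum>\<kappa>\<in>bounded_counts j m. if \<kappa> = counts_of j (X \<omega>) then infimum_over_counts h j \<kappa> else 0)"
    proof (rule sum.cong[OF refl])
      fix \<kappa> :: "(int ^ 'd) \<times> int \<Rightarrow> nat" assume "\<kappa> \<in> bounded_counts j m"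
      then have "\<kappa> \<in> extensional (cell_indices j)" by (simp add: bounded_counts_def PiE_def)
      then show "infimum_over_counts h j \<kappa> * indicator (count_event M X j \<kappa>) \<omega>
          = (if \<kappa> = counts_of j (X \<omega>) then infimum_over_counts h j \<kappa> else 0)"
        using counts_agree_iff[OF PM[OF \<omega>], of \<kappa> j] \<omega> by (auto simp: count_event_def)
    qed
    then show ?thesis by (simp add: f_def finite_bounded_counts)
  qed
  have "?g \<in> borel_measurable M" using ev by measurable
  then show "f \<in> borel_measurable M" by (rule measurable_cong[THEN iffD2, rotated]) (rule fg)
  have "(\<integral>\<omega>. f \<omega> \<partial>M) = (\<integral>\<omega>. ?g \<omega> \<partial>M)" by (rule Bochner_Integration.integral_cong[OF refl fg])
  also have "\<dots> = (\<Sum>\<kappa>\<in>bounded_counts j m. \<integral>\<omega>. infimum_over_counts h j \<kappa> * indicator (count_event M X j \<kappa>) \<omega> \<partial>M)"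
    using ev by (intro Bochner_Integration.integral_sum integrable_mult_right integrable_real_indicator)
      (auto simp: emeasure_eq_measure)
  also have "\<dots> = (\<Sum>\<kappa>\<in>bounded_counts j m. infimum_over_counts h j \<kappa> * measure M (count_event M X j \<kappa>))"
    using sets.sets_into_space[OF ev] by (intro sum.cong refl) (simp add: Int_absorb2)
  finally show "(\<integral>\<omega>. f \<omega> \<partial>M) = (\<Sum>\<kappa>\<in>bounded_counts j m. infimum_over_counts h j \<kappa> * measure M (count_event M X j \<kappa>))" .
qed

text \<open>
  Restricted to bounded counts, the infimum functional has as its expectation a finite sum over
  count events, which converges by assumption. It bounds \<open>h\<close> from below along the
  sequence, and under the limit law it approximates \<open>h\<close> as first the bound on the
  counts and then the level tends to infinity.
\<close>

lemma expectation_lower_semicontinuous: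
  fixes X :: "nat \<Rightarrow> 'w \<Rightarrow> ((real ^ 'd) \<times> ereal) measure" and Y :: "'p \<Rightarrow> ((real ^ 'd) \<times> ereal) measure"
  assumes X: "\<And>n. random_element (M n) (vague_topology state_space) (X n)"
    and Y: "random_element P (vague_topology state_space) Y"
    and measX: "\<And>n j c. c \<in> cell_indices j \<Longrightarrow> (\<lambda>\<omega>. emeasure (X n \<omega>) (cell j c)) \<in> borel_measurable (M n)"
    and measY: "\<And>j c. c \<in> cell_indices j \<Longrightarrow> (\<lambda>\<omega>. emeasure (Y \<omega>) (cell j c)) \<in> borel_measurable P"
    and lim: "\<And>j \<kappa>. (\<lambda>n. measure (M n) (count_event (M n) (X n) j \<kappa>)) \<longlonglongrightarrow> measure P (count_event P Y j \<kappa>)"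
    and h: "\<And>\<mu>. \<mu> \<in> point_measures state_space \<Longrightarrow> 0 \<le> h \<mu> \<and> h \<mu> \<le> B"
    and cont: "continuous_map (vague_topology state_space) euclideanreal h" and \<epsilon>: "0 < \<epsilon>"
  shows "eventually (\<lambda>n. (\<integral>\<omega>. h (Y \<omega>) \<partial>P) - \<epsilon> < (\<integral>\<omega>. h (X n \<omega>) \<partial>M n)) sequentially"
proof -
  interpret P: prob_space P using Y by (simp add: random_element_def)
  have h0: "\<And>\<mu>. \<mu> \<in> point_measures state_space \<Longrightarrow> 0 \<le> h \<mu>" using h by blast
  note Y_PM = random_element_compose(2)[OF Y cont]
  note hY = random_element_compose(1)[OF Y cont]
  let ?H = "\<lambda>j \<omega>. infimum_over_counts h j (counts_of j (Y \<omega>))"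
  let ?f = "\<lambda>j m \<omega>. if counts_of j (Y \<omega>) \<in> bounded_counts j m then ?H j \<omega> else 0"
  have f_meas: "?f j m \<in> borel_measurable P" for j m
    by (rule expectation_of_infimum(1)[OF P.prob_space_axioms Y_PM measY])
  have H_bounds: "0 \<le> ?H j \<omega>" "?H j \<omega> \<le> h (Y \<omega>)" if "\<omega> \<in> space P" for j \<omega>
    using infimum_over_counts_bounds[of h, OF h0 Y_PM[OF that] counts_agree_counts_of[OF Y_PM[OF that]]] by auto
  have f_lim: "(\<lambda>m. ?f j m \<omega>) \<longlonglongrightarrow> ?H j \<omega>" for j \<omega>
  proof (rule tendsto_eventually)
    define m0 where "m0 = (\<Sum>c\<in>cell_indices j. counts_of j (Y \<omega>) c)"
    have in_bounded: "counts_of j (Y \<omega>) \<in> bounded_counts j m" if "m0 \<le> m" for m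
    proof -
      have "counts_of j (Y \<omega>) c \<le> m" if "c \<in> cell_indices j" for c
        using member_le_sum[OF that, of "counts_of j (Y \<omega>)"] \<open>m0 \<le> m\<close> by (simp add: m0_def)
      then show ?thesis by (auto simp: bounded_counts_def counts_of_def PiE_iff)
    qed
    show "eventually (\<lambda>m. ?f j m \<omega> = ?H j \<omega>) sequentially"
      using eventually_ge_at_top[of m0] by eventually_elim (simp add: in_bounded)
  qed
  have H_meas: "?H j \<in> borel_measurable P" for j
    by (rule borel_measurable_LIMSEQ_real[OF f_lim f_meas])
  have f_int: "(\<lambda>m. \<integral>\<omega>. ?f j m \<omega> \<partial>P) \<longlonglongrightarrow> (\<integral>\<omega>. ?H j \<omega> \<partial>P)" for j
  proof (rule integral_dominated_convergence[where w="\<lambda>_. \<bar>B\<bar>"])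
    show "AE \<omega> in P. norm (?f j m \<omega>) \<le> \<bar>B\<bar>" for m
    proof (rule AE_I2)
      fix \<omega> assume \<omega>: "\<omega> \<in> space P"
      show "norm (?f j m \<omega>) \<le> \<bar>B\<bar>"
        using H_bounds[OF \<omega>, of j] h[OF Y_PM[OF \<omega>]] by auto
    qed
  qed (use H_meas f_meas f_lim in auto)
  have H_int: "(\<lambda>j. \<integral>\<omega>. ?H j \<omega> \<partial>P) \<longlonglongrightarrow> (\<integral>\<omega>. h (Y \<omega>) \<partial>P)"
  proof (rule integral_dominated_convergence[where w="\<lambda>_. \<bar>B\<bar>"])
    show "AE \<omega> in P. norm (?H j \<omega>) \<le> \<bar>B\<bar>" for j
    proof (rule AE_I2)
      fix \<omega> assume \<omega>: "\<omega> \<in> space P"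
      show "norm (?H j \<omega>) \<le> \<bar>B\<bar>"
        using H_bounds[OF \<omega>, of j] h[OF Y_PM[OF \<omega>]] by auto
    qed
    show "AE \<omega> in P. (\<lambda>j. ?H j \<omega>) \<longlonglongrightarrow> h (Y \<omega>)"
      using infimum_over_counts_tendsto[OF h0 cont Y_PM] by (intro AE_I2) auto
  qed (use H_meas hY in auto)
  have "eventually (\<lambda>j. (\<integral>\<omega>. h (Y \<omega>) \<partial>P) - \<epsilon> < (\<integral>\<omega>. ?H j \<omega> \<partial>P)) sequentially"
    by (rule order_tendstoD(1)[OF H_int]) (use \<epsilon> in simp)
  then obtain j where j: "(\<integral>\<omega>. h (Y \<omega>) \<partial>P) - \<epsilon> < (\<integral>\<omega>. ?H j \<omega> \<partial>P)"
    by (meson eventually_happens' sequentially_bot)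
  have "eventually (\<lambda>m. (\<integral>\<omega>. h (Y \<omega>) \<partial>P) - \<epsilon> < (\<integral>\<omega>. ?f j m \<omega> \<partial>P)) sequentially"
    by (rule order_tendstoD(1)[OF f_int j])
  then obtain m where m: "(\<integral>\<omega>. h (Y \<omega>) \<partial>P) - \<epsilon> < (\<integral>\<omega>. ?f j m \<omega> \<partial>P)"
    by (meson eventually_happens' sequentially_bot)
  let ?S = "\<lambda>M X. \<Sum>\<kappa>\<in>bounded_counts j m. infimum_over_counts h j \<kappa> * measure M (count_event M X j \<kappa>)"
  have "(\<integral>\<omega>. ?f j m \<omega> \<partial>P) = (\<Sum>\<kappa>\<in>bounded_counts j m. infimum_over_counts h j \<kappa> * measure P (count_event P Y j \<kappa>))"
    by (rule expectation_of_infimum(2)[OF P.prob_space_axioms Y_PM measY])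
  moreover have "(\<lambda>n. \<Sum>\<kappa>\<in>bounded_counts j m. infimum_over_counts h j \<kappa> * measure (M n) (count_event (M n) (X n) j \<kappa>))
      \<longlonglongrightarrow> (\<Sum>\<kappa>\<in>bounded_counts j m. infimum_over_counts h j \<kappa> * measure P (count_event P Y j \<kappa>))"
    by (intro tendsto_sum tendsto_mult tendsto_const lim)
  ultimately have "eventually (\<lambda>n. (\<integral>\<omega>. h (Y \<omega>) \<partial>P) - \<epsilon> <
      (\<Sum>\<kappa>\<in>bounded_counts j m. infimum_over_counts h j \<kappa> * measure (M n) (count_event (M n) (X n) j \<kappa>))) sequentially"
    using m by (intro order_tendstoD(1)) auto
  then show ?thesis
  proof eventually_elim
    case (elim n)
    interpret M: prob_space "M n" using X[of n] by (simp add: random_element_def)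
    note X_PM = random_element_compose(2)[OF X cont, of _ n]
    note hX = random_element_compose(1)[OF X cont, of n]
    let ?g = "\<lambda>\<omega>. if counts_of j (X n \<omega>) \<in> bounded_counts j m then infimum_over_counts h j (counts_of j (X n \<omega>)) else 0"
    note g = expectation_of_infimum[OF M.prob_space_axioms X_PM measX, where h=h and m=m and j=j]
    have g_bounds: "0 \<le> ?g \<omega>" "?g \<omega> \<le> h (X n \<omega>)" if "\<omega> \<in> space (M n)" for \<omega>
      using infimum_over_counts_bounds[of h, OF h0 X_PM[OF that] counts_agree_counts_of[OF X_PM[OF that]]] h0[OF X_PM[OF that]]
      by auto
    have "(\<Sum>\<kappa>\<in>bounded_counts j m. infimum_over_counts h j \<kappa> * measure (M n) (count_event (M n) (X n) j \<kappa>)) = (\<integral>\<omega>. ?g \<omega> \<partial>M n)"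
      by (rule g(2)[symmetric])
    also have "\<dots> \<le> (\<integral>\<omega>. h (X n \<omega>) \<partial>M n)"
    proof (rule integral_mono_AE)
      have b: "\<bar>h (X n \<omega>)\<bar> \<le> \<bar>B\<bar>" if "\<omega> \<in> space (M n)" for \<omega> using h[OF X_PM[OF that]] by auto
      show "integrable (M n) (\<lambda>\<omega>. h (X n \<omega>))"
        by (rule M.integrable_const_bound[of _ "\<bar>B\<bar>"]) (use b hX in auto)
      show "integrable (M n) ?g"
      proof (rule M.integrable_const_bound[of _ "\<bar>B\<bar>"])
        show "AE \<omega> in M n. norm (?g \<omega>) \<le> \<bar>B\<bar>"
        proof (rule AE_I2)
          fix \<omega> assume \<omega>: "\<omega> \<in> space (M n)"
          show "norm (?g \<omega>) \<le> \<bar>B\<bar>" unfolding real_norm_def using g_bounds[OF \<omega>] b[OF \<omega>] by linarith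
        qed
      qed (rule g(1))
      show "AE \<omega> in M n. ?g \<omega> \<le> h (X n \<omega>)" using g_bounds(2) by (rule AE_I2)
    qed
    finally show ?case using elim by linarith
  qed
qed

theorem convergence_from_cell_counts:
  fixes X :: "nat \<Rightarrow> 'w \<Rightarrow> ((real ^ 'd) \<times> ereal) measure" and Y :: "'p \<Rightarrow> ((real ^ 'd) \<times> ereal) measure"
  assumes X: "\<And>n. random_element (M n) (vague_topology state_space) (X n)"
    and Y: "random_element P (vague_topology state_space) Y"
    and measX: "\<And>n j c. c \<in> cell_indices j \<Longrightarrow> (\<lambda>\<omega>. emeasure (X n \<omega>) (cell j c)) \<in> borel_measurable (M n)"
    and measY: "\<And>j c. c \<in> cell_indices j \<Longrightarrow> (\<lambda>\<omega>. emeasure (Y \<omega>) (cell j c)) \<in> borel_measurable P"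
    and lim: "\<And>j \<kappa>. (\<lambda>n. measure (M n) (count_event (M n) (X n) j \<kappa>)) \<longlonglongrightarrow> measure P (count_event P Y j \<kappa>)"
  shows "converges_in_distribution (vague_topology state_space) M X P Y"
  unfolding converges_in_distribution_def
proof (intro conjI allI impI X Y)
  fix h :: "((real ^ 'd) \<times> ereal) measure \<Rightarrow> real"
  assume "continuous_map (vague_topology state_space) euclideanreal h
    \<and> bounded (h ` topspace (vague_topology state_space))"
  then have cont: "continuous_map (vague_topology state_space) euclideanreal h"
    and bdd: "bounded (h ` point_measures state_space)" by auto
  obtain B where B: "\<And>\<mu>. \<mu> \<in> point_measures state_space \<Longrightarrow> \<bar>h \<mu>\<bar> \<le> B"
    using bdd by (auto simp: bounded_iff)
  have int: "integrable N (\<lambda>\<omega>. h (Z \<omega>))" "(\<integral>\<omega>. B + h (Z \<omega>) \<partial>N) = B + (\<integral>\<omega>. h (Z \<omega>) \<partial>N)"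
    "(\<integral>\<omega>. B - h (Z \<omega>) \<partial>N) = B - (\<integral>\<omega>. h (Z \<omega>) \<partial>N)"
    if Z: "random_element N (vague_topology state_space) Z" for N :: "'z measure" and Z
  proof -
    interpret prob_space N using Z by (simp add: random_element_def)
    show i: "integrable N (\<lambda>\<omega>. h (Z \<omega>))"
      by (rule integrable_const_bound[of _ B])
         (use B random_element_compose[OF Z cont] in auto)
    show "(\<integral>\<omega>. B + h (Z \<omega>) \<partial>N) = B + (\<integral>\<omega>. h (Z \<omega>) \<partial>N)" "(\<integral>\<omega>. B - h (Z \<omega>) \<partial>N) = B - (\<integral>\<omega>. h (Z \<omega>) \<partial>N)"
      using i by (simp_all add: prob_space)
  qed
  have "continuous_map euclideanreal euclideanreal (\<lambda>x. B + x)" "continuous_map euclideanreal euclideanreal (\<lambda>x. B - x)"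
    unfolding continuous_map_iff_continuous2 by (intro continuous_intros)+
  from this[THEN continuous_map_compose[OF cont]]
  have c1: "continuous_map (vague_topology state_space) euclideanreal (\<lambda>\<mu>. B + h \<mu>)"
    and c2: "continuous_map (vague_topology state_space) euclideanreal (\<lambda>\<mu>. B - h \<mu>)"
    by (simp_all add: o_def)
  have b1: "0 \<le> B + h \<mu> \<and> B + h \<mu> \<le> 2 * B" and b2: "0 \<le> B - h \<mu> \<and> B - h \<mu> \<le> 2 * B"
    if "\<mu> \<in> point_measures state_space" for \<mu> using B[OF that] by auto
  show "(\<lambda>n. \<integral>\<omega>. h (X n \<omega>) \<partial>M n) \<longlonglongrightarrow> (\<integral>\<omega>. h (Y \<omega>) \<partial>P)"
  proof (rule tendstoI)
    fix \<epsilon> :: real assume \<epsilon>: "0 < \<epsilon>"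
    have "eventually (\<lambda>n. (\<integral>\<omega>. B + h (Y \<omega>) \<partial>P) - \<epsilon> < (\<integral>\<omega>. B + h (X n \<omega>) \<partial>M n)) sequentially"
      by (rule expectation_lower_semicontinuous[where h="\<lambda>\<mu>. B + h \<mu>", OF X Y measX measY lim b1 c1 \<epsilon>])
    moreover have "eventually (\<lambda>n. (\<integral>\<omega>. B - h (Y \<omega>) \<partial>P) - \<epsilon> < (\<integral>\<omega>. B - h (X n \<omega>) \<partial>M n)) sequentially"
      by (rule expectation_lower_semicontinuous[where h="\<lambda>\<mu>. B - h \<mu>", OF X Y measX measY lim b2 c2 \<epsilon>])
    ultimately show "eventually (\<lambda>n. dist (\<integral>\<omega>. h (X n \<omega>) \<partial>M n) (\<integral>\<omega>. h (Y \<omega>) \<partial>P) < \<epsilon>) sequentially"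
    proof eventually_elim
      case (elim n)
      then show ?case unfolding int(2,3)[OF X] int(2,3)[OF Y] dist_real_def by linarith
    qed
  qed
qed

section \<open>The Poisson limit and the extremal process\<close>

subsection \<open>Cells under the intensity measure\<close>

text \<open>
  The set lies between an open and a closed box with the same corners.
\<close>

lemma vol_space_cell:
  fixes k :: "int ^ 'd"
  assumes k: "\<And>i. k $ i \<in> {0..<2 ^ j}"
  shows "{t \<in> unit_cube. space_index j t = k} \<in> sets borel"
    and "emeasure lborel {t \<in> unit_cube. space_index j t = k} = ennreal ((1 / 2 ^ j) ^ CARD('d))"
proof -
  let ?Q = "{t \<in> unit_cube :: (real ^ 'd) set. space_index j t = k}"
  define a b :: "real ^ 'd" where "a = (\<chi> i. real_of_int (k $ i) / 2 ^ j)" and "b = (\<chi> i. (real_of_int (k $ i) + 1) / 2 ^ j)"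
  have k1: "real_of_int (k $ i) + 1 \<le> 2 ^ j" for i
  proof -
    have "real_of_int (k $ i + 1) \<le> real_of_int (2 ^ j)" using k[of i] by (intro of_int_le_iff[THEN iffD2]) auto
    then show ?thesis by simp
  qed
  have upper: "?Q \<subseteq> cbox a b"
  proof
    fix t assume t: "t \<in> ?Q"
    have "a $ i \<le> t $ i \<and> t $ i \<le> b $ i" for i
    proof -
      have "0 \<le> t $ i" "t $ i \<le> 1" "dyadic_index j (t $ i) = k $ i"
        using t by (auto simp: unit_cube_def space_index_def vec_eq_iff)
      with dyadic_index_bounds(2,3)[of "t $ i" j]
      have "real_of_int (k $ i) \<le> 2 ^ j * (t $ i)" "2 ^ j * (t $ i) \<le> real_of_int (k $ i) + 1" by auto
      then show ?thesis by (simp add: a_def b_def divide_le_eq le_divide_eq mult.commute)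
    qed
    then show "t \<in> cbox a b" by (simp add: mem_box_cart)
  qed
  have lower: "box a b \<subseteq> ?Q"
  proof
    fix t assume "t \<in> box a b"
    then have t: "a $ i < t $ i" "t $ i < b $ i" for i by (auto simp: mem_box_cart)
    have "0 \<le> t $ i \<and> t $ i \<le> 1 \<and> dyadic_index j (t $ i) = k $ i" for i
    proof -
      have *: "real_of_int (k $ i) < 2 ^ j * (t $ i)" "2 ^ j * (t $ i) < real_of_int (k $ i) + 1"
        using t[of i] by (simp_all add: a_def b_def divide_less_eq less_divide_eq mult.commute)
      then have fl: "\<lfloor>2 ^ j * (t $ i)\<rfloor> = k $ i" by (simp add: floor_eq_iff)
      have "0 \<le> real_of_int (k $ i)" using k[of i] by simp
      then have "0 < 2 ^ j * (t $ i)" using *(1) by linarith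
      then have t0: "0 \<le> t $ i" by (simp add: zero_less_mult_iff)
      have "2 ^ j * (t $ i) \<le> 2 ^ j * 1" using *(2) k1[of i] by linarith
      then have t1: "t $ i \<le> 1" by (rule mult_left_le_imp_le) simp
      have "dyadic_index j (t $ i) = k $ i" using fl k[of i] by (simp add: dyadic_index_def)
      then show ?thesis using t0 t1 by simp
    qed
    then show "t \<in> ?Q" by (simp add: unit_cube_def space_index_def vec_eq_iff)
  qed
  have dyadic_meas: "(\<lambda>t :: real ^ 'd. dyadic_index j (t $ i)) \<in> measurable borel (count_space UNIV)" for i
  proof -
    have "(\<lambda>t :: real ^ 'd. 2 ^ j * (t $ i)) \<in> borel_measurable borel"
      by (intro borel_measurable_continuous_onI continuous_intros)
    from measurable_compose[OF this measurable_real_floor]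
    have "(\<lambda>t :: real ^ 'd. \<lfloor>2 ^ j * (t $ i)\<rfloor>) \<in> measurable borel (count_space UNIV)" .
    from measurable_compose[OF this, of "\<lambda>l. min l (2 ^ j - 1)" "count_space UNIV"]
    show ?thesis by (simp add: dyadic_index_def)
  qed
  have "?Q = unit_cube \<inter> (\<Inter>i. (\<lambda>t. dyadic_index j (t $ i)) -` {k $ i} \<inter> space borel)"
    by (auto simp: space_index_def vec_eq_iff)
  moreover have "(unit_cube :: (real ^ 'd) set) \<in> sets borel"
    using compact_imp_closed[OF compact_unit_cube] by (rule borel_closed)
  ultimately show Q: "?Q \<in> sets borel"
    using measurable_sets[OF dyadic_meas] by (auto intro!: sets.Int sets.countable_INT'')
  have ab: "a $ i \<le> b $ i" "b $ i - a $ i = 1 / 2 ^ j" for i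
    by (simp_all add: a_def b_def divide_right_mono diff_divide_distrib[symmetric])
  then have ne: "cbox a b \<noteq> {}" by (auto simp: interval_ne_empty_cart)
  have cb: "emeasure lborel (cbox a b) = ennreal ((1 / 2 ^ j) ^ CARD('d))"
  proof -
    have "emeasure lborel (cbox a b) = ennreal (measure lborel (cbox a b))"
      by (rule emeasure_eq_ennreal_measure) (use emeasure_lborel_cbox_finite[of a b] in auto)
    then show ?thesis using content_cbox_cart[OF ne] ab by simp
  qed
  have bx: "emeasure lborel (box a b) = ennreal ((1 / 2 ^ j) ^ CARD('d))"
    using cb by (simp add: emeasure_lborel_cbox_eq emeasure_lborel_box_eq)
  have "emeasure lborel ?Q \<le> emeasure lborel (cbox a b)" by (rule emeasure_mono[OF upper]) simp
  moreover have "emeasure lborel (box a b) \<le> emeasure lborel ?Q" by (rule emeasure_mono[OF lower]) (use Q in simp)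
  ultimately show "emeasure lborel ?Q = ennreal ((1 / 2 ^ j) ^ CARD('d))" using cb bx by simp
qed

lemma emeasure_intensity_cell:
  fixes c :: "(int ^ 'd) \<times> int"
  assumes c: "c \<in> cell_indices j"
  shows "emeasure intensity (cell j c) = ennreal (cell_mass j c)"
proof -
  let ?L = "restrict_space lborel unit_cube :: (real ^ 'd) measure"
  let ?D = "density lborel (\<lambda>z. ennreal (exp (- z))) :: real measure"
  let ?f = "\<lambda>(t, z). (t :: real ^ 'd, ereal z)"
  let ?Q = "{t \<in> unit_cube. space_index j t = fst c}"
  interpret D: sigma_finite_measure ?D
    by (subst sigma_finite_measure.sigma_finite_iff_density_finite[OF lborel.sigma_finite_measure_axioms]) auto
  have cube: "(unit_cube :: (real ^ 'd) set) \<in> sets borel"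
    using compact_imp_closed[OF compact_unit_cube] by (rule borel_closed)
  have k: "fst c $ i \<in> {0..<2 ^ j}" for i using c by (auto simp: cell_indices_def)
  have l: "snd c < 4 ^ j" using c by (auto simp: cell_indices_def)
  have fm: "?f \<in> measurable (?L \<Otimes>\<^sub>M ?D) (borel_on state_space)"
  proof (rule measurable_restrict_space2)
    have "(\<lambda>x. (fst x :: real ^ 'd)) \<in> measurable (?L \<Otimes>\<^sub>M ?D) borel"
      by (rule measurable_compose[OF measurable_fst]) (rule measurable_restrict_space1, simp)
    moreover have "(\<lambda>x. ereal (snd x)) \<in> measurable (?L \<Otimes>\<^sub>M ?D) borel"
      by (rule measurable_compose[OF measurable_snd]) simp
    ultimately have "(\<lambda>x. (fst x, ereal (snd x))) \<in> measurable (?L \<Otimes>\<^sub>M ?D) (borel \<Otimes>\<^sub>M borel)"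
      by (rule measurable_Pair)
    then show "?f \<in> measurable (?L \<Otimes>\<^sub>M ?D) borel" by (simp add: borel_prod case_prod_beta')
    show "?f \<in> space (?L \<Otimes>\<^sub>M ?D) \<rightarrow> state_space"
      by (auto simp: space_pair_measure space_restrict_space state_space_def)
  qed
  have pre: "?f -` cell j c \<inter> space (?L \<Otimes>\<^sub>M ?D) = ?Q \<times> height_band j (snd c)"
    by (auto simp: space_pair_measure space_restrict_space cell_def cell_index_ereal state_space_def height_band_def)
  have Q_L: "?Q \<in> sets ?L"
    using vol_space_cell(1)[OF k] cube by (subst sets_restrict_space_iff) auto
  have "emeasure ?L ?Q = emeasure lborel ?Q"
    using cube by (intro emeasure_restrict_space) auto
  also have "\<dots> = ennreal ((1 / 2 ^ j) ^ CARD('d))" by (rule vol_space_cell(2)[OF k])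
  finally have L: "emeasure ?L ?Q = ennreal ((1 / 2 ^ j) ^ CARD('d))" .
  have "emeasure ?D (height_band j (snd c)) = (\<integral>\<^sup>+y. ennreal (exp (- y)) * indicator (height_band j (snd c)) y \<partial>lborel)"
    by (rule emeasure_density) auto
  also have "\<dots> = (\<integral>\<^sup>+y. ennreal (indicator (height_band j (snd c)) y * exp (- y)) \<partial>lborel)"
    by (intro nn_integral_cong) (auto split: split_indicator)
  also have "\<dots> = ennreal (\<integral>y. indicator (height_band j (snd c)) y * exp (- y) \<partial>lborel)"
    by (rule nn_integral_eq_integral[OF integrable_exp_minus_above[OF height_band_borel height_band_above[OF l]]]) simp
  finally have D: "emeasure ?D (height_band j (snd c)) = ennreal (\<integral>y. indicator (height_band j (snd c)) y * exp (- y) \<partial>lborel)" .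
  have "emeasure intensity (cell j c) = emeasure (?L \<Otimes>\<^sub>M ?D) (?Q \<times> height_band j (snd c))"
    unfolding intensity_def by (subst emeasure_distr[OF fm cell_sets]) (simp only: pre)
  also have "\<dots> = emeasure ?L ?Q * emeasure ?D (height_band j (snd c))"
    by (rule D.emeasure_pair_measure_Times[OF Q_L]) simp
  also have "\<dots> = ennreal (cell_mass j c)"
    unfolding L D cell_mass_def by (rule ennreal_mult[symmetric]) (auto intro!: integral_nonneg_AE)
  finally show ?thesis .
qed

lemma poisson_cell_counts:
  fixes \<eta> :: "'p \<Rightarrow> ((real ^ 'd) \<times> ereal) measure"
  assumes \<eta>: "poisson_random_measure state_space intensity P \<eta>"
  shows "c \<in> cell_indices j \<Longrightarrow> (\<lambda>\<omega>. emeasure (\<eta> \<omega>) (cell j c)) \<in> borel_measurable P"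
    and "measure P (count_event P \<eta> j \<kappa>) = (\<Prod>c\<in>cell_indices j. cell_mass j c ^ \<kappa> c / fact (\<kappa> c) * exp (- cell_mass j c))"
proof -
  interpret prob_space P using \<eta> by (simp add: poisson_random_measure_def random_element_def)
  let ?C = "cell_indices j :: ((int ^ 'd) \<times> int) set"
  obtain e where e: "bij_betw e {0..<card ?C} ?C" using ex_bij_betw_nat_finite[of ?C] by auto
  then have e': "bij_betw e {..<card ?C} ?C" by (simp add: atLeast0LessThan)
  have disj: "disjoint_family_on (\<lambda>i. cell j (e i)) {..<card ?C}"
    using bij_betw_imp_inj_on[OF e'] by (auto simp: disjoint_family_on_def cell_def inj_on_def)
  have indep: "indep_vars (\<lambda>_. borel) (\<lambda>i \<omega>. emeasure (\<eta> \<omega>) (cell j (e i))) {..<card ?C}"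
  proof -
    have "\<forall>(A :: nat \<Rightarrow> ((real ^ 'd) \<times> ereal) set) k. (\<forall>i<k. A i \<in> sets (borel_on state_space)) \<and> disjoint_family_on A {..<k} \<longrightarrow>
        indep_vars (\<lambda>_. borel) (\<lambda>i \<omega>. emeasure (\<eta> \<omega>) (A i)) {..<k}"
      using \<eta> by (simp add: poisson_random_measure_def)
    from this[rule_format, of "card ?C" "\<lambda>i. cell j (e i)"] show ?thesis
      using disj cell_sets by simp
  qed
  show meas: "(\<lambda>\<omega>. emeasure (\<eta> \<omega>) (cell j c)) \<in> borel_measurable P" if c: "c \<in> ?C" for c
  proof -
    have "c \<in> e ` {..<card ?C}" using c bij_betw_imp_surj_on[OF e'] by simp
    then obtain i where "i \<in> {..<card ?C}" "e i = c" by (elim imageE) simp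
    then show ?thesis using indep by (auto simp: indep_vars_def)
  qed
  have one: "prob {\<omega> \<in> space P. emeasure (\<eta> \<omega>) (cell j c) = of_nat k} = cell_mass j c ^ k / fact k * exp (- cell_mass j c)"
    if c: "c \<in> ?C" for c k
  proof -
    have fin: "emeasure intensity (cell j c) < \<infinity>" by (simp add: emeasure_intensity_cell[OF c])
    have "measure intensity (cell j c) = cell_mass j c"
      using emeasure_intensity_cell[OF c] cell_mass_nonneg[of j c] by (simp add: measure_def)
    moreover have "\<forall>A\<in>sets (borel_on state_space). emeasure intensity A < \<infinity> \<longrightarrow>
        (\<forall>k::nat. prob {\<omega> \<in> space P. emeasure (\<eta> \<omega>) A = of_nat k} =
           measure intensity A ^ k / fact k * exp (- measure intensity A))"
      using \<eta> by (simp add: poisson_random_measure_def)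
    from this[rule_format, OF cell_sets fin] have "prob {\<omega> \<in> space P. emeasure (\<eta> \<omega>) (cell j c) = of_nat k} =
        measure intensity (cell j c) ^ k / fact k * exp (- measure intensity (cell j c))" .
    ultimately show ?thesis by simp
  qed
  have ne: "{..<card ?C} \<noteq> {}"
  proof -
    have "(0, 0) \<in> ?C" by (simp add: cell_indices_def)
    then have "0 < card ?C" by (auto simp: card_gt_0_iff)
    then show ?thesis by auto
  qed
  have "count_event P \<eta> j \<kappa> = (\<Inter>i\<in>{..<card ?C}. (\<lambda>\<omega>. emeasure (\<eta> \<omega>) (cell j (e i))) -` {of_nat (\<kappa> (e i))} \<inter> space P)"
  proof -
    have "(\<forall>c\<in>e ` {..<card ?C}. Q c) \<longleftrightarrow> (\<forall>i\<in>{..<card ?C}. Q (e i))" for Q by simp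
    note all = this[unfolded bij_betw_imp_surj_on[OF e']]
    show ?thesis unfolding count_event_def counts_agree_def all using ne by auto
  qed
  then have "prob (count_event P \<eta> j \<kappa>) = (\<Prod>i\<in>{..<card ?C}. prob ((\<lambda>\<omega>. emeasure (\<eta> \<omega>) (cell j (e i))) -` {of_nat (\<kappa> (e i))} \<inter> space P))"
    using indep_varsD[OF indep ne, of "\<lambda>i. {of_nat (\<kappa> (e i))}"] by simp
  also have "\<dots> = (\<Prod>i\<in>{..<card ?C}. cell_mass j (e i) ^ \<kappa> (e i) / fact (\<kappa> (e i)) * exp (- cell_mass j (e i)))"
  proof (rule prod.cong[OF refl])
    fix i assume "i \<in> {..<card ?C}"
    then have "e i \<in> ?C" using e' by (auto dest: bij_betwE)
    moreover have "(\<lambda>\<omega>. emeasure (\<eta> \<omega>) (cell j (e i))) -` {of_nat (\<kappa> (e i))} \<inter> space P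
        = {\<omega> \<in> space P. emeasure (\<eta> \<omega>) (cell j (e i)) = of_nat (\<kappa> (e i))}" by auto
    ultimately show "prob ((\<lambda>\<omega>. emeasure (\<eta> \<omega>) (cell j (e i))) -` {of_nat (\<kappa> (e i))} \<inter> space P)
        = cell_mass j (e i) ^ \<kappa> (e i) / fact (\<kappa> (e i)) * exp (- cell_mass j (e i))" using one by simp
  qed
  also have "\<dots> = (\<Prod>c\<in>?C. cell_mass j c ^ \<kappa> c / fact (\<kappa> c) * exp (- cell_mass j c))"
    by (rule prod.reindex_bij_betw[OF e'])
  finally show "measure P (count_event P \<eta> j \<kappa>) = (\<Prod>c\<in>?C. cell_mass j c ^ \<kappa> c / fact (\<kappa> c) * exp (- cell_mass j c))" .
qed

subsection \<open>The extremal process as a random point measure\<close>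

lemma sum_of_point_masses_eq_distr:
  assumes I: "finite I" and x: "\<And>i. i \<in> I \<Longrightarrow> x i \<in> E"
  shows "sum_of_point_masses E I x = distr (count_space I) (borel_on E) x"
proof (rule measure_eqI)
  fix A assume "A \<in> sets (sum_of_point_masses E I x)"
  then have A: "A \<in> sets (borel_on E)" by simp
  have xm: "x \<in> measurable (count_space I) (borel_on E)"
    using x by (auto simp: measurable_count_space_eq1 space_restrict_space)
  have "emeasure (distr (count_space I) (borel_on E) x) A = of_nat (card {i \<in> I. x i \<in> A})"
    using I by (subst emeasure_distr[OF xm A]) (simp add: vimage_def Int_def conj_commute)
  moreover have "(\<Sum>i\<in>I. indicator A (x i) :: ennreal) = of_nat (card {i \<in> I. x i \<in> A})"
    using I by (simp add: indicator_def Int_def)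
  ultimately show "emeasure (sum_of_point_masses E I x) A = emeasure (distr (count_space I) (borel_on E) x) A"
    by (simp add: emeasure_sum_of_point_masses[OF A])
qed simp

lemma integral_sum_of_point_masses:
  fixes f :: "'a::topological_space \<Rightarrow> real"
  assumes I: "finite I" and x: "\<And>i. i \<in> I \<Longrightarrow> x i \<in> E" and f: "f \<in> borel_measurable (borel_on E)"
  shows "(\<integral>p. f p \<partial>sum_of_point_masses E I x) = (\<Sum>i\<in>I. f (x i))"
proof -
  have xm: "x \<in> measurable (count_space I) (borel_on E)"
    using x by (auto simp: measurable_count_space_eq1 space_restrict_space)
  have eq: "sum_of_point_masses E I x = distr (count_space I) (borel_on E) x"
    by (rule sum_of_point_masses_eq_distr[OF I]) (rule x)
  show ?thesis
    unfolding eq by (subst integral_distr[OF xm f]) (rule lebesgue_integral_count_space_finite[OF I])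
qed

definition extremal_point :: "nat \<Rightarrow> (int ^ 'd \<Rightarrow> real) \<Rightarrow> int ^ 'd \<Rightarrow> (real ^ 'd) \<times> ereal" where
  "extremal_point n \<phi> \<alpha> = (rescale_site n \<alpha>,
    ereal ((\<phi> \<alpha> - centering (green (0 :: int ^ 'd) 0) (real (n ^ CARD('d)))) / scaling (green (0 :: int ^ 'd) 0) (real (n ^ CARD('d)))))"

lemma extremal_process_eq:
  "extremal_process n \<phi> = sum_of_point_masses state_space (lattice_box n) (extremal_point n \<phi>)"
  unfolding extremal_process_def extremal_point_def rescale_site_def Let_def ..

lemma extremal_point_in_state_space:
  assumes "\<alpha> \<in> lattice_box n"
  shows "extremal_point n \<phi> \<alpha> \<in> state_space"
proof -
  have "0 \<le> real_of_int (\<alpha> $ i) / real n \<and> real_of_int (\<alpha> $ i) / real n \<le> 1" for i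
  proof -
    have "0 \<le> \<alpha> $ i \<and> \<alpha> $ i \<le> int n - 1" using assms by (simp add: lattice_box_def)
    then show ?thesis by (auto simp: divide_le_eq_1)
  qed
  then show ?thesis by (simp add: extremal_point_def state_space_def unit_cube_def rescale_site_def)
qed

lemma emeasure_extremal_process:
  assumes "S \<in> sets (borel_on state_space)"
  shows "emeasure (extremal_process n \<phi>) S = of_nat (card {\<alpha> \<in> lattice_box n. extremal_point n \<phi> \<alpha> \<in> S})"
  unfolding extremal_process_eq emeasure_sum_of_point_masses[OF assms]
  by (simp add: indicator_def Int_def)

lemma extremal_process_point_measure: "extremal_process n \<phi> \<in> point_measures state_space"
proof -
  have "sets (extremal_process n \<phi>) = sets (borel_on state_space)" by (simp add: extremal_process_eq)
  moreover have "emeasure (extremal_process n \<phi>) K < \<infinity>" for K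
    using emeasure_extremal_process[of K n \<phi>] emeasure_notin_sets[of K "extremal_process n \<phi>"]
    by (cases "K \<in> sets (borel_on state_space)") (auto simp: extremal_process_eq of_nat_less_top)
  ultimately show ?thesis using emeasure_extremal_process[of _ n \<phi>] by (auto simp: point_measures_def)
qed

lemma emeasure_extremal_process_cell:
  fixes \<phi> :: "int ^ 'd \<Rightarrow> real"
  shows "emeasure (extremal_process n \<phi>) (cell j c) = of_nat (cell_count j n
    (\<lambda>\<alpha>. (\<phi> \<alpha> - centering (green (0 :: int ^ 'd) 0) (real (n ^ CARD('d)))) / scaling (green (0 :: int ^ 'd) 0) (real (n ^ CARD('d)))) c)"
proof -
  have "{\<alpha> \<in> lattice_box n. extremal_point n \<phi> \<alpha> \<in> cell j c} = {\<alpha> \<in> lattice_box n. cell_index j (extremal_point n \<phi> \<alpha>) = c}"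
    using extremal_point_in_state_space[of _ n \<phi>] by (auto simp: cell_def)
  then show ?thesis by (simp add: emeasure_extremal_process[OF cell_sets] cell_count_def extremal_point_def)
qed

lemma continuous_extremal_integral:
  fixes f :: "(real ^ 'd) \<times> ereal \<Rightarrow> real"
  assumes f: "f \<in> test_functions state_space"
  shows "continuous_on UNIV (\<lambda>\<phi>. \<integral>p. f p \<partial>extremal_process n \<phi>)"
proof -
  have fc: "continuous_on state_space f" using f by (simp add: test_functions_def)
  have "(\<integral>p. f p \<partial>extremal_process n \<phi>) = (\<Sum>\<alpha>\<in>lattice_box n. f (extremal_point n \<phi> \<alpha>))" for \<phi>
    unfolding extremal_process_eq
    by (rule integral_sum_of_point_masses) (auto intro: extremal_point_in_state_space borel_measurable_continuous_on_restrict[OF fc])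
  moreover have "continuous_on UNIV (\<lambda>\<phi>. f (extremal_point n \<phi> \<alpha>))" if \<alpha>: "\<alpha> \<in> lattice_box n" for \<alpha>
  proof (rule continuous_on_compose2[OF fc])
    have "continuous_on UNIV (\<lambda>\<phi> :: int ^ 'd \<Rightarrow> real. ereal ((\<phi> \<alpha> - u) * v))" for u v
      by (intro continuous_on_ereal continuous_on_mult continuous_on_diff continuous_on_const continuous_on_product_coordinates)
    from continuous_on_Pair[OF continuous_on_const this]
    show "continuous_on UNIV (\<lambda>\<phi>. extremal_point n \<phi> \<alpha>)"
      unfolding extremal_point_def divide_inverse .
    show "(\<lambda>\<phi>. extremal_point n \<phi> \<alpha>) ` UNIV \<subseteq> state_space"
      using extremal_point_in_state_space[OF \<alpha>] by auto
  qed
  ultimately show ?thesis by (simp add: continuous_on_sum)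
qed

text \<open>
  The process is a continuous function of the field values for the product topology on functions on
  the lattice, whose Borel sets are generated by the coordinates since the lattice is countable.
  Continuity is checked on the subbase that defines the vague topology.
\<close>

lemma random_element_extremal_process:
  fixes \<psi> :: "int ^ 'd \<Rightarrow> 'w \<Rightarrow> real"
  assumes M: "prob_space M" and \<psi>: "\<And>\<alpha>. \<psi> \<alpha> \<in> borel_measurable M"
  shows "random_element M (vague_topology state_space) (\<lambda>\<omega>. extremal_process n (\<lambda>\<alpha>. \<psi> \<alpha> \<omega>))"
proof -
  let ?E = "state_space :: ((real ^ 'd) \<times> ereal) set"
  have open_pre: "open {\<phi>. extremal_process n \<phi> \<in> U}"
    if "generate_topology_on {{\<mu> \<in> point_measures ?E. (\<integral>x. f x \<partial>\<mu>) \<in> U} | f U. f \<in> test_functions ?E \<and> open U} U" for U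
    using that
  proof (induction U rule: generate_topology_on.induct)
    case (Int a b)
    then show ?case by (simp add: open_Collect_conj)
  next
    case (UN K)
    have "{\<phi>. extremal_process n \<phi> \<in> \<Union>K} = (\<Union>k\<in>K. {\<phi>. extremal_process n \<phi> \<in> k})" by auto
    then show ?case using UN.IH by auto
  next
    case (Basis s)
    then obtain f U where s: "s = {\<mu> \<in> point_measures ?E. (\<integral>x. f x \<partial>\<mu>) \<in> U}" "f \<in> test_functions ?E" "open U"
      by auto
    have "{\<phi>. extremal_process n \<phi> \<in> s} = (\<lambda>\<phi>. \<integral>p. f p \<partial>extremal_process n \<phi>) -` U"
      by (auto simp: s(1) extremal_process_point_measure)
    then show ?case using open_vimage[OF s(3) continuous_extremal_integral[OF s(2)]] by simp
  qed simp
  have \<psi>_meas: "(\<lambda>\<omega> \<alpha>. \<psi> \<alpha> \<omega>) \<in> borel_measurable M"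
    by (rule measurable_coordinatewise_then_product) (rule \<psi>)
  have "(\<lambda>\<omega>. extremal_process n (\<lambda>\<alpha>. \<psi> \<alpha> \<omega>)) \<in> measurable M (borel_sigma (vague_topology ?E))"
    unfolding borel_sigma_def
  proof (rule measurable_measure_of)
    show "{U. openin (vague_topology ?E) U} \<subseteq> Pow (topspace (vague_topology ?E))"
      using openin_subset by blast
    show "(\<lambda>\<omega>. extremal_process n (\<lambda>\<alpha>. \<psi> \<alpha> \<omega>)) \<in> space M \<rightarrow> topspace (vague_topology ?E)"
      by (simp add: extremal_process_point_measure)
    fix U assume "U \<in> {U. openin (vague_topology ?E) U}"
    then have "open {\<phi>. extremal_process n \<phi> \<in> U}"
      by (intro open_pre) (simp add: vague_topology_def openin_topology_generated_by_iff)
    from measurable_sets[OF \<psi>_meas borel_open[OF this]]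
    show "(\<lambda>\<omega>. extremal_process n (\<lambda>\<alpha>. \<psi> \<alpha> \<omega>)) -` U \<inter> space M \<in> sets M"
      by (simp add: vimage_def)
  qed
  then show ?thesis using M by (simp add: random_element_def)
qed

theorem theorem2:
  fixes M :: "nat \<Rightarrow> 'w measure"
    and \<psi> :: "nat \<Rightarrow> int ^ 'd \<Rightarrow> 'w \<Rightarrow> real"
    and P :: "'p measure"
    and \<eta> :: "'p \<Rightarrow> ((real ^ 'd) \<times> ereal) measure"
  assumes "CARD('d) \<ge> 3"
    and "\<And>n. gaussian_free_field (M n) (lattice_box n) (\<psi> n)"
    and "poisson_random_measure state_space intensity P \<eta>"
  shows "converges_in_distribution (vague_topology state_space)
           M (\<lambda>n \<omega>. extremal_process n (\<lambda>\<alpha>. \<psi> n \<alpha> \<omega>)) P \<eta>"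
proof (rule convergence_from_cell_counts)
  show "random_element (M n) (vague_topology state_space) (\<lambda>\<omega>. extremal_process n (\<lambda>\<alpha>. \<psi> n \<alpha> \<omega>))" for n
    using assms(2)[of n] by (intro random_element_extremal_process) (auto simp: gaussian_free_field_def)
  show "random_element P (vague_topology state_space) \<eta>"
    using assms(3) by (simp add: poisson_random_measure_def)
  show "(\<lambda>\<omega>. emeasure (\<eta> \<omega>) (cell j c)) \<in> borel_measurable P" if "c \<in> cell_indices j" for j c
    by (rule poisson_cell_counts(1)[OF assms(3) that])
  show "(\<lambda>\<omega>. emeasure (extremal_process n (\<lambda>\<alpha>. \<psi> n \<alpha> \<omega>)) (cell j c)) \<in> borel_measurable (M n)" for n j c
    unfolding emeasure_extremal_process_cell
    by (rule measurable_compose[OF cell_counts_limit(2)[OF assms(1,2)]]) simp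
  show "(\<lambda>n. measure (M n) (count_event (M n) (\<lambda>\<omega>. extremal_process n (\<lambda>\<alpha>. \<psi> n \<alpha> \<omega>)) j \<kappa>))
      \<longlonglongrightarrow> measure P (count_event P \<eta> j \<kappa>)" for j \<kappa>
    unfolding poisson_cell_counts(2)[OF assms(3)]
    using cell_counts_limit(1)[OF assms(1,2), of j \<kappa>]
    by (simp add: count_event_def counts_agree_def emeasure_extremal_process_cell)
qed

end
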